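(* Fix any $T\ge1$, let $\mathbf{W}\sim\mathrm{GOE}(n)$, let $f_0\equiv\mathbf{u}_1\in\mathbb{R}^n$ be an initialization, and let $f_t:\mathbb{R}^{n\times t}\to\mathbb{R}^n$, $t=1,\ldots,T-1$, be weakly differentiable. Consider the AMP algorithm, for $t=1,\ldots,T$, $$\mathbf{z}_t=\mathbf{W}\mathbf{u}_t-\sum_{s=1}^{t-1}b_{ts}\mathbf{u}_s,\qquad\mathbf{u}_{t+1}=f_t(\mathbf{z}_1,\ldots,\mathbf{z}_t),$$ with Onsager coefficients $b_{ts}$ and state evolution covariances $\boldsymbol{\Sigma}_t$ as defined in the context. Suppose there exist constants $C,c>0$ such that $\lambda_{\min}(\boldsymbol{\Sigma}_t)>c$, $\|\boldsymbol{\Sigma}_t\|_{\mathrm{op}}<C$, and $|b_{ts}|<C$ for all $1\le s<t\le T$. If the stability assumption of the context holds, then the iterates $\mathbf{z}_{1:T}$ admit a decomposition $$[\mathbf{z}_1,\ldots,\mathbf{z}_T]=[\mathbf{Z}_1,\ldots,\mathbf{Z}_T]+[\mathbf{E}_1,\ldots,\mathbf{E}_T],$$ where $\mathbf{Z}_{1:T}\sim\mathcal{N}(0,\boldsymbol{\Sigma}_T\otimes\mathrm{Id}_n)\in\mathbb{R}^{n\times T}$ and $\|\mathbf{E}_{1:T}\|_{\mathrm{F}}\prec1$.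
   Context: All objects are $n$-indexed sequences; constants are independent of $n$. $\mathbf{z}_{1:t}=(\mathbf{z}_1,\ldots,\mathbf{z}_t)\in\mathbb{R}^{n\times t}$. $\mathcal{N}(0,\boldsymbol{\Sigma}\otimes\mathrm{Id}_n)$ is the law on $\mathbb{R}^{n\times t}$ with i.i.d. rows of law $\mathcal{N}(0,\boldsymbol{\Sigma})$. $\mathbf{W}\sim\mathrm{GOE}(n)$ means $\mathbf{W}\in\mathbb{R}^{n\times n}$ is symmetric with independent entries on and above the diagonal, $\mathbf{W}[i,j]\sim\mathcal{N}(0,1/n)$ for $i<j$ and $\mathbf{W}[i,i]\sim\mathcal{N}(0,2/n)$. The decomposition is on the probability space of $\mathbf{W}$, possibly enlarged by auxiliary randomness independent of $\mathbf{W}$. **Notation $\prec$.** For $n$-dependent random variables $X$ and $a\ge0$, $X\prec n^{-a}$ means: for any constant $D>0$ there is a constant $C\equiv C(D)>0$ with $\mathbb{P}[|X|>(\log n)^Cn^{-a}]<n^{-D}$ for all large $n$. **Onsager coefficients and state evolution.** $\boldsymbol{\Sigma}_1=\frac1n\|\mathbf{u}_1\|_2^2\in\mathbb{R}^{1\times1}$. Given $\boldsymbol{\Sigma}_t\in\mathbb{R}^{t\times t}$, let $\mathbf{Z}_{1:t}\sim\mathcal{N}(0,\boldsymbol{\Sigma}_t\otimes\mathrm{Id}_n)$ and define $\boldsymbol{\Sigma}_{t+1}[r+1,s+1]=\frac1n\mathbb{E}[f_r(\mathbf{Z}_{1:r})^\top f_s(\mathbf{Z}_{1:s})]$ for $r,s=0,\ldots,t$,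 with $f_0(\cdot)\equiv\mathbf{u}_1$. For $t\ge2$ and $s<t$, $b_{ts}=\frac1n\sum_{i=1}^n\mathbb{E}\big[\partial_{\mathbf{Z}_s[i]}f_{t-1}(\mathbf{Z}_{1:(t-1)})[i]\big]$. **Stability assumption.** With $\mathbf{Z}_{1:T}\sim\mathcal{N}(0,\boldsymbol{\Sigma}_T\otimes\mathrm{Id}_n)$, for any random matrix $\mathbf{E}_{1:T}\in\mathbb{R}^{n\times T}$ in the probability space of $\mathbf{Z}_{1:T}$ such that $\|\mathbf{E}_{1:T}\|_{\mathrm{F}}\prec1$: for all $0\le s,t\le T-1$, $$\frac1n\Big|f_t(\mathbf{Z}_{1:t}+\mathbf{E}_{1:t})^\top f_s(\mathbf{Z}_{1:s}+\mathbf{E}_{1:s})-\mathbb{E}[f_t(\mathbf{Z}_{1:t})^\top f_s(\mathbf{Z}_{1:s})]\Big|\prec\frac1{\sqrt n},$$ and for all $1\le t\le T$ and $0\le s\le T-1$, $$\frac1n\Big|(\mathbf{Z}_t+\mathbf{E}_t)^\top f_s(\mathbf{Z}_{1:s}+\mathbf{E}_{1:s})-\mathbb{E}[\mathbf{Z}_t^\top f_s(\mathbf{Z}_{1:s})]\Big|\prec\frac1{\sqrt n}.$$ *)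

theory Defs
  imports "HOL-Probability.Probability" "Jordan_Normal_Form.Char_Poly"
begin

text \<open>
  Vectors of length n are functions v with v i meaningful for i in {1..n}; n by t matrices
  are functions x with x i s the entry in row i and column s, for i in {1..n} and s in {1..t}.
  As points of the measurable space of n by t matrices they are extensional.
\<close>

type_synonym rvec = "nat \<Rightarrow> real"
type_synonym rmat = "nat \<Rightarrow> nat \<Rightarrow> real"

definition matrices :: "nat \<Rightarrow> nat \<Rightarrow> rmat measure" where
  "matrices n t = (\<Pi>\<^sub>M i\<in>{1..n}. \<Pi>\<^sub>M s\<in>{1..t}. borel)"

definition mat_lborel :: "nat \<Rightarrow> nat \<Rightarrow> rmat measure" where
  "mat_lborel n t = (\<Pi>\<^sub>M i\<in>{1..n}. \<Pi>\<^sub>M s\<in>{1..t}. lborel)"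

definition take_cols :: "nat \<Rightarrow> nat \<Rightarrow> rmat \<Rightarrow> rmat" where
  "take_cols n t x = (\<lambda>i\<in>{1..n}. \<lambda>s\<in>{1..t}. x i s)"

definition mat_add :: "rmat \<Rightarrow> rmat \<Rightarrow> rmat" where
  "mat_add x y = (\<lambda>i s. x i s + y i s)"

definition dot :: "nat \<Rightarrow> rvec \<Rightarrow> rvec \<Rightarrow> real" where
  "dot n v w = (\<Sum>i = 1..n. v i * w i)"

definition frob_norm :: "nat \<Rightarrow> nat \<Rightarrow> rmat \<Rightarrow> real" where
  "frob_norm n t x = sqrt (\<Sum>i = 1..n. \<Sum>s = 1..t. (x i s)\<^sup>2)"

definition lambda_min :: "real mat \<Rightarrow> real" where
  "lambda_min A = Min {k. eigenvalue A k}"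

definition op_norm :: "real mat \<Rightarrow> real" where
  "op_norm A = Sup {sqrt (scalar_prod (A *\<^sub>v v) (A *\<^sub>v v)) |v.
     v \<in> carrier_vec (dim_col A) \<and> scalar_prod v v = 1}"


text \<open>
  The law of A g, for g standard normal and A any matrix with A * transpose A = S: by rotation invariance
  it does not depend on the choice of A. Singular S is allowed. Entries of a real mat are
  numbered from 0, columns of an rmat from 1.
\<close>

definition gauss :: "real mat \<Rightarrow> rvec measure" where
  "gauss S = (let t = dim_row S;
       A = (SOME A. A \<in> carrier_mat t t \<and> A * transpose_mat A = S)
     in distr (\<Pi>\<^sub>M s\<in>{1..t}. density lborel std_normal_density) (\<Pi>\<^sub>M s\<in>{1..t}. borel)
          (\<lambda>g. \<lambda>s\<in>{1..t}. \<Sum>r = 1..t. A $$ (s - 1, r - 1) * g r))"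

definition gauss_rows :: "nat \<Rightarrow> real mat \<Rightarrow> rmat measure" where
  "gauss_rows n S = (\<Pi>\<^sub>M i\<in>{1..n}. gauss S)"

definition has_gauss_law :: "'w measure \<Rightarrow> nat \<Rightarrow> nat \<Rightarrow> ('w \<Rightarrow> rmat) \<Rightarrow> real mat \<Rightarrow> bool" where
  "has_gauss_law M n t Z S \<longleftrightarrow>
     Z \<in> measurable M (matrices n t) \<and> distr M (matrices n t) Z = gauss_rows n S"

definition is_GOE :: "'w measure \<Rightarrow> nat \<Rightarrow> ('w \<Rightarrow> rmat) \<Rightarrow> bool" where
  "is_GOE M n W \<longleftrightarrow>
     (\<forall>\<omega>\<in>space M. \<forall>i\<in>{1..n}. \<forall>j\<in>{1..n}. W \<omega> i j = W \<omega> j i) \<and>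
     prob_space.indep_vars M (\<lambda>_. borel) (\<lambda>(i, j) \<omega>. W \<omega> i j)
       {(i, j). 1 \<le> i \<and> i \<le> j \<and> j \<le> n} \<and>
     (\<forall>i j. 1 \<le> i \<and> i < j \<and> j \<le> n \<longrightarrow>
       distributed M lborel (\<lambda>\<omega>. W \<omega> i j) (normal_density 0 (sqrt (1 / real n)))) \<and>
     (\<forall>i\<in>{1..n}.
       distributed M lborel (\<lambda>\<omega>. W \<omega> i i) (normal_density 0 (sqrt (2 / real n))))"


text \<open>stoch_le M X a says that X is stochastically dominated by n to the power -a.\<close>

definition stoch_le :: "(nat \<Rightarrow> 'w measure) \<Rightarrow> (nat \<Rightarrow> 'w \<Rightarrow> real) \<Rightarrow> real \<Rightarrow> bool" where
  "stoch_le M X a \<longleftrightarrow>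
     (\<forall>D>0. \<exists>C>0. \<forall>\<^sub>F n in sequentially.
        measure (M n) {\<omega> \<in> space (M n). \<bar>X n \<omega>\<bar> > ln (real n) powr C * real n powr (- a)}
          < real n powr (- D))"


text \<open>
  Weak differentiability on the space of n by t matrices. Continuity is with respect to the
  product topology, which on this space is the Euclidean one.
\<close>

definition has_partial ::
    "nat \<Rightarrow> nat \<Rightarrow> nat \<Rightarrow> nat \<Rightarrow> (rmat \<Rightarrow> real) \<Rightarrow> (rmat \<Rightarrow> real) \<Rightarrow> bool" where
  "has_partial n t i s \<phi> \<phi>' \<longleftrightarrow>
     (\<forall>x\<in>space (matrices n t).
        ((\<lambda>h. \<phi> (x(i := (x i)(s := h)))) has_real_derivative \<phi>' x) (at (x i s)))"

primrec C_k :: "nat \<Rightarrow> nat \<Rightarrow> nat \<Rightarrow> (rmat \<Rightarrow> real) \<Rightarrow> bool" where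
  "C_k n t 0 \<phi> \<longleftrightarrow> continuous_on (space (matrices n t)) \<phi>"
| "C_k n t (Suc k) \<phi> \<longleftrightarrow> continuous_on (space (matrices n t)) \<phi> \<and>
     (\<forall>i\<in>{1..n}. \<forall>s\<in>{1..t}. \<exists>\<phi>'. has_partial n t i s \<phi> \<phi>' \<and> C_k n t k \<phi>')"

definition cube :: "nat \<Rightarrow> nat \<Rightarrow> real \<Rightarrow> rmat set" where
  "cube n t R = {x \<in> space (matrices n t). \<forall>i\<in>{1..n}. \<forall>s\<in>{1..t}. \<bar>x i s\<bar> \<le> R}"

definition test_function :: "nat \<Rightarrow> nat \<Rightarrow> (rmat \<Rightarrow> real) \<Rightarrow> bool" where
  "test_function n t \<phi> \<longleftrightarrow>
     (\<forall>k. C_k n t k \<phi>) \<and> (\<exists>R. \<forall>x\<in>space (matrices n t) - cube n t R. \<phi> x = 0)"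

definition loc_integrable :: "nat \<Rightarrow> nat \<Rightarrow> (rmat \<Rightarrow> real) \<Rightarrow> bool" where
  "loc_integrable n t h \<longleftrightarrow>
     h \<in> borel_measurable (matrices n t) \<and>
     (\<forall>R. set_integrable (mat_lborel n t) (cube n t R) h)"

definition is_weak_partial ::
    "nat \<Rightarrow> nat \<Rightarrow> nat \<Rightarrow> nat \<Rightarrow> (rmat \<Rightarrow> real) \<Rightarrow> (rmat \<Rightarrow> real) \<Rightarrow> bool" where
  "is_weak_partial n t i s h g \<longleftrightarrow>
     loc_integrable n t g \<and>
     (\<forall>\<phi> \<phi>'. test_function n t \<phi> \<and> has_partial n t i s \<phi> \<phi>' \<longrightarrow>
        (LINT x|mat_lborel n t. h x * \<phi>' x) = - (LINT x|mat_lborel n t. g x * \<phi> x))"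

definition weakly_differentiable :: "nat \<Rightarrow> nat \<Rightarrow> (rmat \<Rightarrow> rvec) \<Rightarrow> bool" where
  "weakly_differentiable n t f \<longleftrightarrow>
     (\<forall>j\<in>{1..n}. loc_integrable n t (\<lambda>x. f x j) \<and>
        (\<forall>i\<in>{1..n}. \<forall>s\<in>{1..t}. \<exists>g. is_weak_partial n t i s (\<lambda>x. f x j) g))"

text \<open>
  A version of the weak partial derivative in the entry (i, s). Versions agree almost
  everywhere, so expectations under a nonsingular Gaussian law do not depend on the choice.
\<close>

definition weak_partial :: "nat \<Rightarrow> nat \<Rightarrow> nat \<Rightarrow> nat \<Rightarrow> (rmat \<Rightarrow> real) \<Rightarrow> rmat \<Rightarrow> real" where
  "weak_partial n t i s h = (SOME g. is_weak_partial n t i s h g)"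


text \<open>
  Below, n is the dimension, v the initial vector and f the family of nonlinearities for this n.
  nonlin n v f t is f t, made to read only the first t columns of its argument, with f 0 the
  constant v.
\<close>

definition nonlin :: "nat \<Rightarrow> rvec \<Rightarrow> (nat \<Rightarrow> rmat \<Rightarrow> rvec) \<Rightarrow> nat \<Rightarrow> rmat \<Rightarrow> rvec" where
  "nonlin n v f t x = (if t = 0 then v else f t (take_cols n t x))"

fun se_cov :: "nat \<Rightarrow> rvec \<Rightarrow> (nat \<Rightarrow> rmat \<Rightarrow> rvec) \<Rightarrow> nat \<Rightarrow> real mat" where
  "se_cov n v f 0 = 0\<^sub>m 0 0"
| "se_cov n v f (Suc 0) = mat 1 1 (\<lambda>_. dot n v v / real n)"
| "se_cov n v f (Suc (Suc t)) =
     mat (Suc (Suc t)) (Suc (Suc t)) (\<lambda>(r, s).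
       (LINT x|gauss_rows n (se_cov n v f (Suc t)).
          dot n (nonlin n v f r x) (nonlin n v f s x)) / real n)"

definition onsager :: "nat \<Rightarrow> rvec \<Rightarrow> (nat \<Rightarrow> rmat \<Rightarrow> rvec) \<Rightarrow> nat \<Rightarrow> nat \<Rightarrow> real" where
  "onsager n v f t s =
     (\<Sum>i = 1..n. LINT x|gauss_rows n (se_cov n v f (t - 1)).
        weak_partial n (t - 1) i s (\<lambda>y. f (t - 1) y i) x) / real n"

text \<open>
  The expectations in the definitions of se_cov and onsager exist, up to horizon T. (By
  Cauchy-Schwarz, the condition on squared norms covers all entries of the covariances.)
\<close>

definition se_integrable :: "nat \<Rightarrow> nat \<Rightarrow> rvec \<Rightarrow> (nat \<Rightarrow> rmat \<Rightarrow> rvec) \<Rightarrow> bool" where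
  "se_integrable T n v f \<longleftrightarrow>
     (\<forall>t\<in>{1..<T}.
        integrable (gauss_rows n (se_cov n v f t)) (\<lambda>x. dot n (f t x) (f t x)) \<and>
        (\<forall>s\<in>{1..t}. \<forall>i\<in>{1..n}.
           integrable (gauss_rows n (se_cov n v f t))
             (weak_partial n t i s (\<lambda>x. f t x i))))"

text \<open>
  Here v and f are sequences in the dimension n. Domination depends on Z and E only through their
  joint law, so letting the underlying spaces have points in rmat \<times> rmat covers random matrices Z, E
  on arbitrary common probability spaces.
\<close>

definition amp_stable ::
    "nat \<Rightarrow> (nat \<Rightarrow> rvec) \<Rightarrow> (nat \<Rightarrow> nat \<Rightarrow> rmat \<Rightarrow> rvec) \<Rightarrow> bool" where
  "amp_stable T v f \<longleftrightarrow>
     (\<forall>(M :: nat \<Rightarrow> (rmat \<times> rmat) measure) Z E.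
        (\<forall>n\<ge>1. prob_space (M n) \<and>
           has_gauss_law (M n) n T (Z n) (se_cov n (v n) (f n) T) \<and>
           E n \<in> measurable (M n) (matrices n T)) \<longrightarrow>
        stoch_le M (\<lambda>n \<omega>. frob_norm n T (E n \<omega>)) 0 \<longrightarrow>
        (\<forall>s<T. \<forall>t<T. stoch_le M (\<lambda>n \<omega>.
           1 / real n * \<bar>dot n (nonlin n (v n) (f n) t (mat_add (Z n \<omega>) (E n \<omega>)))
                          (nonlin n (v n) (f n) s (mat_add (Z n \<omega>) (E n \<omega>)))
              - (LINT \<xi>|M n. dot n (nonlin n (v n) (f n) t (Z n \<xi>))
                              (nonlin n (v n) (f n) s (Z n \<xi>)))\<bar>) (1 / 2)) \<and>
        (\<forall>t\<in>{1..T}. \<forall>s<T. stoch_le M (\<lambda>n \<omega>.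
           1 / real n * \<bar>dot n (\<lambda>i. mat_add (Z n \<omega>) (E n \<omega>) i t)
                          (nonlin n (v n) (f n) s (mat_add (Z n \<omega>) (E n \<omega>)))
              - (LINT \<xi>|M n. dot n (\<lambda>i. Z n \<xi> i t)
                              (nonlin n (v n) (f n) s (Z n \<xi>)))\<bar>) (1 / 2)))"

text \<open>The t-th iterates are the columns t of z and u, for one realization w of the GOE.\<close>

definition is_amp_run ::
    "nat \<Rightarrow> nat \<Rightarrow> rvec \<Rightarrow> (nat \<Rightarrow> rmat \<Rightarrow> rvec) \<Rightarrow> rmat \<Rightarrow> rmat \<Rightarrow> rmat \<Rightarrow> bool" where
  "is_amp_run T n v f w z u \<longleftrightarrow>
     (\<forall>i\<in>{1..n}. u i 1 = v i) \<and>
     (\<forall>t\<in>{1..T}. \<forall>i\<in>{1..n}.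
        z i t = (\<Sum>j = 1..n. w i j * u j t) - (\<Sum>s = 1..<t. onsager n v f t s * u i s)) \<and>
     (\<forall>t\<in>{1..<T}. \<forall>i\<in>{1..n}. u i (t + 1) = f t (take_cols n t z) i)"

end

theory Submission
  imports Defs "HOL-Real_Asymp.Real_Asymp"
begin

text \<open>
  After t steps of the algorithm, W has been seen only through its images of t directions, the
  Gram-Schmidt orthonormalization of the vectors u. A GOE matrix has an exchange symmetry: if the row
  and column in a unit direction e are taken out and replaced by fresh Gaussian ones, the new matrix
  and the removed row, suitably scaled, are independent, and their joint law is that of a GOE matrix
  and a standard normal vector (exchange_law). As the exchange preserves this law for
  every e, it may be repeated along directions that depend on what has been removed before. The
  removed vectors g 1, ..., g T are therefore exactly independent standard normal vectors
  (explored_law).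

  The restriction of W to the explored span can be written in terms of these vectors and directions
  (mv_span_apply). So, as long as no Gram-Schmidt residual vanishes, the iterates are a
  deterministic function of g 1, ..., g T (amp_run_eq_gauss_amp): iterate t is the combination of
  g 1, ..., g t with the rescaled Gram-Schmidt coefficients R t s of the vectors u, plus a vector in
  the span of the directions. The Gaussian approximation is Z = L g, where L is the Cholesky
  factor of the last covariance: it has exactly the prescribed law.

  It remains to bound the difference, by induction on t (iterate_close). If the earlier
  iterates are close to Z, the stability assumption says that the Gram matrix of the
  vectors u is within 1 / sqrt n of the covariance, up to logarithms. Gram-Schmidt and Cholesky solve
  the same triangular system, whose pivots stay away from 0 because of the bound on the
  smallest eigenvalue; hence R is close to L and no residual vanishes (gram_schmidt_close). The same
  assumption gives the inner products of u t with the earlier iterates, whose limits are the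
  Onsager coefficients times the covariance by Gaussian integration by parts (stein_identity,
  cross_expectation). This is exactly what makes the Onsager term cancel the components of order
  sqrt n along the earlier directions. All other components are inner products of a g s with a
  direction independent of it, hence of logarithmic size.

  Laws are identified through characteristic functions (measure_eqI_char); the integration by parts
  uses the weak derivatives with the Gaussian density times a smooth cutoff as test function.
\<close>

section \<open>Characteristic functions determine laws on finite-dimensional spaces\<close>

text \<open>
  Normalization reduces this to the uniqueness theorem for probability laws.
\<close>

lemma finite_measure_char_eqI:
  fixes M N :: "real measure"
  assumes "finite_measure M" "finite_measure N" and sM: "sets M = sets borel" and sN: "sets N = sets borel"
    and eq: "\<And>t. (CLINT x|M. iexp (t * x)) = (CLINT x|N. iexp (t * x))"
  shows "M = N"
proof -
  interpret M: finite_measure M by fact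
  interpret N: finite_measure N by fact
  define m where "m = measure M (space M)"
  have mN: "m = measure N (space N)"
    using eq[of 0] by (simp add: m_def)
  have spM: "space M = UNIV" "space N = UNIV" using sets_eq_imp_space_eq[OF sM] sets_eq_imp_space_eq[OF sN] by simp_all
  note [measurable_cong] = sM sN
  show ?thesis
  proof (cases "m = 0")
    case True
    have "emeasure M A = emeasure N A" if "A \<in> sets M" for A
    proof -
      have "measure M A \<le> 0" using True M.finite_measure_mono[of A "space M"] that sets.sets_into_space
        by (auto simp: m_def)
      moreover have "measure N A \<le> 0"
        using True mN N.finite_measure_mono[of A "space N"] that sM sN sets.sets_into_space spM
        by auto
      ultimately have "measure M A = 0" "measure N A = 0" by (auto simp: measure_le_0_iff)
      then show ?thesis by (simp add: M.emeasure_eq_measure N.emeasure_eq_measure)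
    qed
    then show ?thesis using sM sN by (intro measure_eqI) auto
  next
    case False
    then have m: "m > 0" by (simp add: m_def zero_less_measure_iff)
    define M' where "M' = density M (\<lambda>_. ennreal (1/m))"
    define N' where "N' = density N (\<lambda>_. ennreal (1/m))"
    have M': "real_distribution M'"
      unfolding real_distribution_def real_distribution_axioms_def
    proof (intro conjI prob_spaceI)
      show "emeasure M' (space M') = 1" using m
        by (simp add: M'_def emeasure_density nn_integral_cmult M.emeasure_eq_measure m_def[symmetric]
            ennreal_mult[symmetric])
      show "sets M' = sets borel" unfolding M'_def sets_density by (rule sM)
    qed
    have N': "real_distribution N'"
      unfolding real_distribution_def real_distribution_axioms_def
    proof (intro conjI prob_spaceI)
      show "emeasure N' (space N') = 1" using m
        by (simp add: N'_def emeasure_density nn_integral_cmult N.emeasure_eq_measure mN[symmetric]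
            ennreal_mult[symmetric])
      show "sets N' = sets borel" unfolding N'_def sets_density by (rule sN)
    qed
    have "char M' = char N'"
    proof
      fix t
      have "char M' t = (CLINT x|M. (1/m) *\<^sub>R iexp (t * x))"
        unfolding char_def M'_def using m by (subst integral_density) auto
      also have "\<dots> = (CLINT x|N. (1/m) *\<^sub>R iexp (t * x))"
        by (simp only: integral_scaleR_right eq)
      also have "\<dots> = char N' t"
        unfolding char_def N'_def using m by (subst integral_density) auto
      finally show "char M' t = char N' t" .
    qed
    from Levy_uniqueness[OF M' N' this] have e: "M' = N'" .
    have "emeasure M A = emeasure N A" if A: "A \<in> sets M" for A
    proof -
      have "emeasure M' A = ennreal (1/m) * emeasure M A"
        using A by (simp add: M'_def emeasure_density nn_integral_cmult)
      moreover have "emeasure N' A = ennreal (1/m) * emeasure N A"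
        using A sM sN by (simp add: N'_def emeasure_density nn_integral_cmult)
      ultimately have "ennreal (1/m) * emeasure M A = ennreal (1/m) * emeasure N A" using e by simp
      then show ?thesis using m
        by (simp add: ennreal_mult_cancel_left)
    qed
    then show ?thesis using sM sN by (intro measure_eqI) auto
  qed
qed

lemma (in finite_measure) integrable_iexp:
  assumes [measurable]: "S \<in> borel_measurable M"
  shows "integrable M (\<lambda>x. iexp (S x))"
  by (rule integrable_const_bound[where B=1]) auto

lemma integral_combination:
  fixes f g h :: "'a \<Rightarrow> complex"
  assumes "integrable M f" "integrable M g" "integrable M h"
  shows "(CLINT x|M. f x + (g x / c + h x / d)) = integral\<^sup>L M f + (integral\<^sup>L M g / c + integral\<^sup>L M h / d)"
  using assms by simp

text \<open>
  The hypothesis says that two finite measures on the line, the images under X of the measures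
  with density w, have the same transform. A weight that depends on the other coordinates is what
  carries information about them through the one-dimensional theorem.
\<close>

lemma weighted_event_eq:
  assumes "finite_measure M" "finite_measure N" and sMN: "sets M = sets N"
    and [measurable]: "X \<in> borel_measurable M" "w \<in> borel_measurable M" "A \<in> sets borel"
    and w: "\<And>x. 0 \<le> w x" "\<And>x. w x \<le> (B::real)"
    and eq: "\<And>t. (CLINT x|M. w x *\<^sub>R iexp (t * X x)) = (CLINT x|N. w x *\<^sub>R iexp (t * X x))"
  shows "(LINT x|M. w x * indicator A (X x)) = (LINT x|N. w x * indicator A (X x))"
proof -
  interpret M: finite_measure M by fact
  interpret N: finite_measure N by fact
  have [measurable]: "X \<in> borel_measurable N" "w \<in> borel_measurable N"
    by (simp_all add: measurable_cong_sets[OF sMN[symmetric] refl])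
  have fin: "finite_measure (distr (density K w) borel X)"
    if "finite_measure K" "sets K = sets M" for K
  proof -
    interpret K: finite_measure K by fact
    have [measurable]: "X \<in> borel_measurable K" "w \<in> borel_measurable K"
      by (simp_all add: measurable_cong_sets[OF that(2) refl])
    have "integrable K w"
      by (rule K.integrable_const_bound[where B=B]) (use w in auto)
    then have "(\<integral>\<^sup>+x. ennreal (w x) \<partial>K) \<noteq> \<infinity>"
      using w by (subst nn_integral_eq_integral) auto
    then show ?thesis
      by (intro finite_measure.finite_measure_distr finite_measureI) (auto simp: emeasure_density cong: nn_integral_cong)
  qed
  have e: "distr (density M w) borel X = distr (density N w) borel X"
  proof (rule finite_measure_char_eqI)
    fix t
    have "(CLINT x|distr (density M w) borel X. iexp (t * x)) = (CLINT x|M. w x *\<^sub>R iexp (t * X x))"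
      by (subst integral_distr; (subst integral_density)?) (use w in auto)
    also have "\<dots> = (CLINT x|distr (density N w) borel X. iexp (t * x))"
      unfolding eq by (subst integral_distr; (subst integral_density)?) (use w in auto)
    finally show "(CLINT x|distr (density M w) borel X. iexp (t * x)) = (CLINT x|distr (density N w) borel X. iexp (t * x))" .
  qed (use fin assms sMN in auto)
  have "(LINT x|M. w x * indicator A (X x)) = (LINT x|distr (density M w) borel X. indicator A x)"
    by (subst integral_distr; (subst integral_density)?) (use w in auto)
  also have "\<dots> = (LINT x|N. w x * indicator A (X x))"
    unfolding e by (subst integral_distr; (subst integral_density)?) (use w in auto)
  finally show ?thesis .
qed

text \<open>
  Induction on the dimension. Restricting to the event that one coordinate lies in A keeps the
  hypothesis for the remaining ones: the weights 1, 1 + cos S and 1 + sin S are nonnegative, and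
  the transforms of the weighted laws of the chosen coordinate are combinations of joint
  characteristic functions, so the one-dimensional uniqueness theorem applies to each of them.
\<close>

lemma box_measure_eq_of_char:
  assumes "finite I" "finite_measure M" "finite_measure N" "sets M = sets N"
    and "\<And>i. i \<in> I \<Longrightarrow> X i \<in> borel_measurable M"
    and "\<And>\<theta>. (CLINT x|M. iexp (\<Sum>i\<in>I. \<theta> i * X i x)) = (CLINT x|N. iexp (\<Sum>i\<in>I. \<theta> i * X i x))"
    and "\<And>i. i \<in> I \<Longrightarrow> A i \<in> sets borel"
  shows "emeasure M {x\<in>space M. \<forall>i\<in>I. X i x \<in> A i} = emeasure N {x\<in>space N. \<forall>i\<in>I. X i x \<in> A i}"
  using assms
proof (induction I arbitrary: M N rule: finite_induct)
  case empty
  interpret M: finite_measure M by fact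
  interpret N: finite_measure N by fact
  have "measure M (space M) = measure N (space N)"
    using empty(4) empty(5)[of "\<lambda>_. 0"] by simp
  then show ?case by (simp add: M.emeasure_eq_measure N.emeasure_eq_measure)
next
  case (insert j I)
  interpret M: finite_measure M by fact
  interpret N: finite_measure N by fact
  note sMN = insert.prems(3)
  have [measurable]: "X i \<in> borel_measurable M" "X i \<in> borel_measurable N" if "i \<in> insert j I" for i
    using insert.prems(4)[OF that] by (simp_all add: measurable_cong_sets[OF sMN[symmetric] refl])
  have [measurable]: "A i \<in> sets borel" if "i \<in> insert j I" for i using insert.prems(6)[OF that] .
  have spMN: "space M = space N" using sMN by (rule sets_eq_imp_space_eq)
  have Xj[measurable]: "X j \<in> borel_measurable M" "X j \<in> borel_measurable N" "A j \<in> sets borel" by simp_all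
  have cf: "(CLINT x|M. iexp (t * X j x + c * (\<Sum>i\<in>I. \<theta> i * X i x)))
      = (CLINT x|N. iexp (t * X j x + c * (\<Sum>i\<in>I. \<theta> i * X i x)))" for t c \<theta>
  proof -
    have "t * X j x + c * (\<Sum>i\<in>I. \<theta> i * X i x) = (\<Sum>i\<in>insert j I. (if i = j then t else c * \<theta> i) * X i x)" for x
    proof -
      have "(\<Sum>i\<in>I. (if i = j then t else c * \<theta> i) * X i x) = (\<Sum>i\<in>I. c * (\<theta> i * X i x))"
        using insert.hyps by (intro sum.cong) auto
      then show ?thesis using insert.hyps by (simp add: sum_distrib_left)
    qed
    then show ?thesis using insert.prems(5)[of "\<lambda>i. if i = j then t else c * \<theta> i"] by presburger
  qed
  define B where "B = {x\<in>space M. X j x \<in> A j}"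
  have "X j -` A j \<inter> space M \<in> sets M" using Xj by (intro measurable_sets)
  then have B[measurable]: "B \<in> sets M" "B \<in> sets N" using sMN by (auto simp: B_def vimage_def Int_def conj_commute)
  have fin: "finite_measure (density K (indicator B))"
    if "finite_measure K" "sets K = sets M" for K
  proof -
    interpret K: finite_measure K by fact
    show ?thesis
    proof (intro finite_measureI)
      have "B \<in> sets K" using that(2) B by simp
      then have "emeasure (density K (indicator B)) (space K) = emeasure K (B \<inter> space K)"
        by (subst emeasure_density) (auto simp flip: indicator_inter_arith)
      then show "emeasure (density K (indicator B)) (space (density K (indicator B))) \<noteq> \<infinity>"
        by (simp add: K.emeasure_eq_measure)
    qed
  qed
  have eqI: "(CLINT x|density M (indicator B). iexp (\<Sum>i\<in>I. \<theta> i * X i x))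
      = (CLINT x|density N (indicator B). iexp (\<Sum>i\<in>I. \<theta> i * X i x))" for \<theta>
  proof -
    define S where "S x = (\<Sum>i\<in>I. \<theta> i * X i x)" for x
    have [measurable]: "S \<in> borel_measurable M" "S \<in> borel_measurable N" unfolding S_def by measurable
    have c: "(CLINT x|M. iexp (t * X j x + c * S x)) = (CLINT x|N. iexp (t * X j x + c * S x))" for t c
      unfolding S_def by (rule cf)
    have c0: "(CLINT x|M. iexp (t * X j x)) = (CLINT x|N. iexp (t * X j x))" for t
      using c[of t 0] by simp
    have iM: "integrable M (\<lambda>x. iexp (t * X j x + c * S x))" for t c by (intro M.integrable_iexp) measurable
    have iN: "integrable N (\<lambda>x. iexp (t * X j x + c * S x))" for t c by (intro N.integrable_iexp) measurable
    have iM0: "integrable M (\<lambda>x. iexp (t * X j x))" for t by (intro M.integrable_iexp) measurable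
    have iN0: "integrable N (\<lambda>x. iexp (t * X j x))" for t by (intro N.integrable_iexp) measurable
    have w1: "(LINT x|M. 1 * indicator (A j) (X j x)) = (LINT x|N. 1 * indicator (A j) (X j x) :: real)"
      by (rule weighted_event_eq[where B=1]) (use insert.prems c0 in auto)
    have w2: "(LINT x|M. (1 + cos (S x)) * indicator (A j) (X j x)) = (LINT x|N. (1 + cos (S x)) * indicator (A j) (X j x))"
    proof (rule weighted_event_eq[where B=2])
      fix t
      have *: "(1 + cos (S x)) *\<^sub>R iexp (t * X j x) = iexp (t * X j x)
          + (iexp (t * X j x + 1 * S x) / 2 + iexp (t * X j x + (-1) * S x) / 2)" for x
        by (simp add: complex_eq_iff Re_exp Im_exp cos_add sin_add cos_diff sin_diff add_divide_distrib diff_divide_distrib algebra_simps)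
      show "(CLINT x|M. (1 + cos (S x)) *\<^sub>R iexp (t * X j x)) = (CLINT x|N. (1 + cos (S x)) *\<^sub>R iexp (t * X j x))"
        unfolding * by (simp only: integral_combination[OF iM0 iM iM] integral_combination[OF iN0 iN iN] c c0)
      show "0 \<le> 1 + cos (S x)" for x using cos_ge_minus_one[of "S x"] by linarith
    qed (use insert.prems in auto)
    have w3: "(LINT x|M. (1 + sin (S x)) * indicator (A j) (X j x)) = (LINT x|N. (1 + sin (S x)) * indicator (A j) (X j x))"
    proof (rule weighted_event_eq[where B=2])
      fix t
      have *: "(1 + sin (S x)) *\<^sub>R iexp (t * X j x) = iexp (t * X j x)
          + (iexp (t * X j x + 1 * S x) / (2 * \<i>) + iexp (t * X j x + (-1) * S x) / (- (2 * \<i>)))" for x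
        by (simp add: complex_eq_iff Re_divide Im_divide Re_exp Im_exp cos_add sin_add cos_diff sin_diff add_divide_distrib diff_divide_distrib algebra_simps power2_eq_square)
      show "(CLINT x|M. (1 + sin (S x)) *\<^sub>R iexp (t * X j x)) = (CLINT x|N. (1 + sin (S x)) *\<^sub>R iexp (t * X j x))"
        unfolding * by (simp only: integral_combination[OF iM0 iM iM] integral_combination[OF iN0 iN iN] c c0)
      show "0 \<le> 1 + sin (S x)" for x using sin_ge_minus_one[of "S x"] by linarith
    qed (use insert.prems in auto)
    have key: "(CLINT x|density K (indicator B). iexp (S x)) =
        Complex ((LINT x|K. (1 + cos (S x)) * indicator (A j) (X j x)) - (LINT x|K. 1 * indicator (A j) (X j x)))
                ((LINT x|K. (1 + sin (S x)) * indicator (A j) (X j x)) - (LINT x|K. 1 * indicator (A j) (X j x)))"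
      if "finite_measure K" "sets K = sets M" for K
    proof -
      interpret K: finite_measure K by fact
      have [measurable]: "S \<in> borel_measurable K" "X j \<in> borel_measurable K" "B \<in> sets K"
        by (simp_all add: measurable_cong_sets[OF that(2) refl] that(2))
      have sp: "space K = space M" using that(2) by (rule sets_eq_imp_space_eq)
      have i: "integrable K (\<lambda>x. f x * indicator (A j) (X j x))"
        if [measurable]: "f \<in> borel_measurable K" and "\<And>x. \<bar>f x::real\<bar> \<le> 2" for f
        by (rule K.integrable_const_bound[where B=2]) (use that in \<open>auto simp: indicator_def\<close>)
      have i1: "integrable K (\<lambda>x. 1 * indicator (A j) (X j x) :: real)"
        "integrable K (\<lambda>x. (1 + cos (S x)) * indicator (A j) (X j x))"
        "integrable K (\<lambda>x. (1 + sin (S x)) * indicator (A j) (X j x))"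
      proof -
        have "\<bar>1 + cos (S x)\<bar> \<le> 2" "\<bar>1 + sin (S x)\<bar> \<le> 2" for x
          using abs_cos_le_one[of "S x"] abs_sin_le_one[of "S x"] by linarith+
        then show "integrable K (\<lambda>x. (1 + cos (S x)) * indicator (A j) (X j x))"
          "integrable K (\<lambda>x. (1 + sin (S x)) * indicator (A j) (X j x))"
          by (intro i; simp)+
        show "integrable K (\<lambda>x. 1 * indicator (A j) (X j x) :: real)" by (intro i) simp_all
      qed
      have "(CLINT x|density K (indicator B). iexp (S x)) = (CLINT x|K. indicator B x *\<^sub>R iexp (S x))"
      proof -
        have "density K (indicator B) = density K (\<lambda>x. ennreal (indicator B x))"
          by (intro density_cong) (auto simp: indicator_def)
        then show ?thesis by (simp add: integral_density)
      qed
      also have "\<dots> = (CLINT x|K. complex_of_real ((1 + cos (S x)) * indicator (A j) (X j x) - 1 * indicator (A j) (X j x))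
          + \<i> * complex_of_real ((1 + sin (S x)) * indicator (A j) (X j x) - 1 * indicator (A j) (X j x)))"
        by (intro Bochner_Integration.integral_cong refl)
           (auto simp: B_def sp indicator_def complex_eq_iff Re_exp Im_exp)
      also have "\<dots> = complex_of_real (LINT x|K. (1 + cos (S x)) * indicator (A j) (X j x) - 1 * indicator (A j) (X j x))
          + \<i> * complex_of_real (LINT x|K. (1 + sin (S x)) * indicator (A j) (X j x) - 1 * indicator (A j) (X j x))"
        by (subst Bochner_Integration.integral_add)
           (use i1 in \<open>auto intro!: integrable_of_real Bochner_Integration.integrable_diff integrable_mult_right
              simp del: of_real_diff of_real_mult mult_1\<close>)
      also have "\<dots> = Complex ((LINT x|K. (1 + cos (S x)) * indicator (A j) (X j x)) - (LINT x|K. 1 * indicator (A j) (X j x)))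
                ((LINT x|K. (1 + sin (S x)) * indicator (A j) (X j x)) - (LINT x|K. 1 * indicator (A j) (X j x)))"
        using i1 by (simp add: Bochner_Integration.integral_diff complex_eq_iff)
      finally show ?thesis .
    qed
    show ?thesis
      unfolding S_def[symmetric] by (subst key; (subst key)?) (use insert.prems w1 w2 w3 in \<open>auto simp del: mult_1\<close>)
  qed
  have IH: "emeasure (density M (indicator B)) {x\<in>space (density M (indicator B)). \<forall>i\<in>I. X i x \<in> A i}
      = emeasure (density N (indicator B)) {x\<in>space (density N (indicator B)). \<forall>i\<in>I. X i x \<in> A i}"
    by (rule insert.IH) (use fin insert.prems eqI in auto)
  have res: "emeasure (density K (indicator B)) {x\<in>space (density K (indicator B)). \<forall>i\<in>I. X i x \<in> A i}
      = emeasure K {x\<in>space K. \<forall>i\<in>insert j I. X i x \<in> A i}" if "sets K = sets M" for K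
  proof -
    have sp: "space K = space M" using that(1) by (rule sets_eq_imp_space_eq)
    have [measurable]: "X i \<in> borel_measurable K" if "i \<in> I" for i
      using that insert.prems(4) \<open>sets K = sets M\<close> by (simp add: measurable_cong_sets[OF \<open>sets K = sets M\<close> refl])
    have [measurable]: "B \<in> sets K" using that by simp
    have m: "{x\<in>space K. \<forall>i\<in>I. X i x \<in> A i} \<in> sets K" using insert.hyps by measurable
    have "emeasure (density K (indicator B)) {x\<in>space K. \<forall>i\<in>I. X i x \<in> A i}
       = (\<integral>\<^sup>+x. indicator {x\<in>space K. \<forall>i\<in>insert j I. X i x \<in> A i} x \<partial>K)"
      using m by (subst emeasure_density[OF borel_measurable_indicator[OF \<open>B \<in> sets K\<close>] m]) (auto intro!: nn_integral_cong simp: indicator_def B_def sp)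
    also have "\<dots> = emeasure K {x\<in>space K. \<forall>i\<in>insert j I. X i x \<in> A i}"
    proof (rule nn_integral_indicator)
      have "{x\<in>space K. \<forall>i\<in>insert j I. X i x \<in> A i} = {x\<in>space K. \<forall>i\<in>I. X i x \<in> A i} \<inter> B"
        by (auto simp: B_def sp)
      then show "{x\<in>space K. \<forall>i\<in>insert j I. X i x \<in> A i} \<in> sets K" using m by auto
    qed
    finally show ?thesis by simp
  qed
  show ?case using IH res[of M] res[of N] sMN by simp
qed

text \<open>
  The form used below: a space whose points are rebuilt measurably from finitely many real
  coordinates, such as a product of spaces of vectors and matrices.
\<close>

theorem measure_eqI_char:
  fixes S :: "'a measure"
  assumes fI: "finite I" and "prob_space M" "prob_space N" and sM: "sets M = sets S" and sN: "sets N = sets S"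
    and X[measurable]: "\<And>i. i \<in> I \<Longrightarrow> X i \<in> borel_measurable S"
    and r[measurable]: "r \<in> measurable (\<Pi>\<^sub>M i\<in>I. borel) S"
    and rX: "\<And>x. x \<in> space S \<Longrightarrow> r (\<lambda>i\<in>I. X i x) = x"
    and cf: "\<And>\<theta>. (CLINT x|M. iexp (\<Sum>i\<in>I. \<theta> i * X i x)) = (CLINT x|N. iexp (\<Sum>i\<in>I. \<theta> i * X i x))"
  shows "M = N"
proof -
  interpret M: prob_space M by fact
  interpret N: prob_space N by fact
  note [measurable_cong] = sM sN
  have spM: "space M = space S" and spN: "space N = space S" using sM sN by (auto dest: sets_eq_imp_space_eq)
  let ?c = "\<lambda>x. \<lambda>i\<in>I. X i x"
  have cM[measurable]: "?c \<in> measurable S (\<Pi>\<^sub>M i\<in>I. borel)" by (intro measurable_restrict X)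
  have "distr M (\<Pi>\<^sub>M i\<in>I. borel) ?c = distr N (\<Pi>\<^sub>M i\<in>I. borel) ?c" (is "?D = ?E")
  proof (rule measure_eqI_PiM_finite[OF fI, where A="\<lambda>_. \<Pi>\<^sub>E i\<in>I. UNIV"])
    fix A :: "_ \<Rightarrow> real set" assume A: "\<And>i. i \<in> I \<Longrightarrow> A i \<in> sets borel"
    have em: "emeasure (distr K (\<Pi>\<^sub>M i\<in>I. borel) ?c) (Pi\<^sub>E I A) = emeasure K {x\<in>space K. \<forall>i\<in>I. X i x \<in> A i}"
      if "sets K = sets S" for K
    proof -
      have [measurable]: "?c \<in> measurable K (\<Pi>\<^sub>M i\<in>I. borel)"
        using cM by (simp add: measurable_cong_sets[OF that refl])
      show ?thesis
        by (subst emeasure_distr) (use A fI in \<open>auto intro!: sets_PiM_I_finite arg_cong[where f="emeasure K"]\<close>)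
    qed
    show "emeasure ?D (Pi\<^sub>E I A) = emeasure ?E (Pi\<^sub>E I A)"
      unfolding em[OF sM] em[OF sN]
      by (rule box_measure_eq_of_char) (use assms A M.finite_measure_axioms N.finite_measure_axioms in auto)
  next
    show "range (\<lambda>_::nat. \<Pi>\<^sub>E i\<in>I. UNIV) \<subseteq> prod_algebra I (\<lambda>_. borel)"
      using fI by (auto intro!: prod_algebraI_finite)
    show "(\<Union>i::nat. \<Pi>\<^sub>E i\<in>I. UNIV) = space (\<Pi>\<^sub>M i\<in>I. borel)" by (simp add: space_PiM)
    interpret D: prob_space ?D by (rule M.prob_space_distr) simp
    show "emeasure ?D (\<Pi>\<^sub>E i\<in>I. UNIV) \<noteq> \<infinity>" by simp
  qed simp_all
  then have "distr ?D S r = distr ?E S r" by simp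
  moreover have "distr (distr K (\<Pi>\<^sub>M i\<in>I. borel) ?c) S r = K" if "sets K = sets S" for K
  proof -
    have sp: "space K = space S" using that by (rule sets_eq_imp_space_eq)
    have [measurable]: "?c \<in> measurable K (\<Pi>\<^sub>M i\<in>I. borel)"
      using cM by (simp add: measurable_cong_sets[OF that refl])
    have "distr (distr K (\<Pi>\<^sub>M i\<in>I. borel) ?c) S r = distr K S (\<lambda>x. x)"
      by (subst distr_distr) (auto intro!: distr_cong simp: rX sp)
    then show ?thesis using that by (simp add: distr_id2)
  qed
  ultimately show ?thesis using sM sN by metis
qed

section \<open>Gaussian laws and their characteristic functions\<close>

lemma char_std_normal: "(CLINT x|std_normal_distribution. iexp (c * x)) = complex_of_real (exp (- c\<^sup>2 / 2))"
  using fun_cong[OF char_std_normal_distribution, of c] by (simp add: char_def)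

lemma prob_space_std_normal: "prob_space std_normal_distribution"
  by (rule prob_space_normal_density) simp

lemma iexp_sum: "iexp (\<Sum>i\<in>I. f i) = (\<Prod>i\<in>I. iexp (f i))"
proof (cases "finite I")
  case True
  then show ?thesis by (simp add: exp_sum sum_distrib_left)
qed simp

lemma PiM_char:
  assumes I: "finite I" and M: "\<And>i. prob_space (M i)"
    and \<phi>: "\<And>i. i \<in> I \<Longrightarrow> \<phi> i \<in> borel_measurable (M i)"
  shows "(CLINT x|PiM I M. iexp (\<Sum>i\<in>I. \<phi> i (x i))) = (\<Prod>i\<in>I. CLINT y|M i. iexp (\<phi> i y))"
proof -
  interpret product_sigma_finite M
    using M by (auto simp: product_sigma_finite_def prob_space_imp_sigma_finite)
  have "(CLINT x|PiM I M. (\<Prod>i\<in>I. iexp (\<phi> i (x i)))) = (\<Prod>i\<in>I. CLINT y|M i. iexp (\<phi> i y))"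
    using M \<phi> I
    by (intro product_integral_prod finite_measure.integrable_iexp prob_space.finite_measure) auto
  then show ?thesis by (simp only: iexp_sum)
qed

lemma PiM_std_normal_char:
  assumes "finite I"
  shows "(CLINT x|(\<Pi>\<^sub>M i\<in>I. std_normal_distribution). iexp (\<Sum>i\<in>I. c i * x i))
    = complex_of_real (exp (- (\<Sum>i\<in>I. (c i)\<^sup>2) / 2))"
proof -
  have "(CLINT x|(\<Pi>\<^sub>M i\<in>I. std_normal_distribution). iexp (\<Sum>i\<in>I. c i * x i))
    = (\<Prod>i\<in>I. CLINT y|std_normal_distribution. iexp (c i * y))"
    using assms by (intro PiM_char prob_space_std_normal) auto
  also have "\<dots> = complex_of_real (\<Prod>i\<in>I. exp (- (c i)\<^sup>2 / 2))"
    by (simp only: char_std_normal of_real_prod)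
  also have "(\<Prod>i\<in>I. exp (- (c i)\<^sup>2 / 2)) = exp (\<Sum>i\<in>I. - (c i)\<^sup>2 / 2)"
    using assms by (simp add: exp_sum)
  also have "(\<Sum>i\<in>I. - (c i)\<^sup>2 / 2) = - (\<Sum>i\<in>I. (c i)\<^sup>2) / 2"
    by (simp add: sum_divide_distrib sum_negf)
  finally show ?thesis .
qed

lemma space_matrices: "space (matrices n t) = (\<Pi>\<^sub>E i\<in>{1..n}. \<Pi>\<^sub>E s\<in>{1..t}. UNIV)"
  by (simp add: matrices_def space_PiM)

lemma matrices_entry [measurable]:
  assumes "i \<in> {1..n}" "s \<in> {1..t}"
  shows "(\<lambda>x. x i s) \<in> borel_measurable (matrices n t)"
  unfolding matrices_def
  by (rule measurable_compose[OF measurable_component_singleton[OF assms(1)] measurable_component_singleton[OF assms(2)]])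

lemma matrices_linear_measurable [measurable]:
  "(\<lambda>x. \<Sum>i=1..n. \<Sum>s=1..t. \<theta> i s * x i s :: real) \<in> borel_measurable (matrices n t)"
  by (intro borel_measurable_sum borel_measurable_times borel_measurable_const matrices_entry) auto

lemma measurable_matricesI:
  assumes "\<And>i s. i \<in> {1..n} \<Longrightarrow> s \<in> {1..t} \<Longrightarrow> (\<lambda>\<omega>. F \<omega> i s) \<in> borel_measurable M"
  shows "(\<lambda>\<omega>. \<lambda>i\<in>{1..n}. \<lambda>s\<in>{1..t}. F \<omega> i s) \<in> measurable M (matrices n t)"
  unfolding matrices_def by (intro measurable_restrict assms)

lemma take_cols_measurable:
  assumes "\<And>i s. i \<in> {1..n} \<Longrightarrow> s \<in> {1..t} \<Longrightarrow> (\<lambda>\<omega>. F \<omega> i s) \<in> borel_measurable M"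
  shows "(\<lambda>\<omega>. take_cols n t (F \<omega>)) \<in> measurable M (matrices n t)"
  unfolding take_cols_def by (intro measurable_matricesI assms)

lemma take_cols_id: "x \<in> space (matrices n t) \<Longrightarrow> take_cols n t x = x"
  by (auto simp: take_cols_def space_matrices PiE_def extensional_def fun_eq_iff Pi_iff restrict_def)

lemma matrices_eqI_char:
  assumes "prob_space M" "prob_space N" "sets M = sets (matrices n t)" "sets N = sets (matrices n t)"
    and cf: "\<And>\<theta>. (CLINT x|M. iexp (\<Sum>i=1..n. \<Sum>s=1..t. \<theta> i s * x i s)) = (CLINT x|N. iexp (\<Sum>i=1..n. \<Sum>s=1..t. \<theta> i s * x i s))"
  shows "M = N"
proof (rule measure_eqI_char[where I="{1..n} \<times> {1..t}" and S="matrices n t" and X="\<lambda>(i,s) x. x i s"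
      and r="\<lambda>y. \<lambda>i\<in>{1..n}. \<lambda>s\<in>{1..t}. y (i,s)"])
  show "(\<lambda>y. \<lambda>i\<in>{1..n}. \<lambda>s\<in>{1..t}. y (i,s)) \<in> (\<Pi>\<^sub>M i\<in>{1..n} \<times> {1..t}. borel) \<rightarrow>\<^sub>M matrices n t"
    by (intro measurable_matricesI measurable_component_singleton) auto
  show "(\<lambda>i\<in>{1..n}. \<lambda>s\<in>{1..t}. (\<lambda>p\<in>{1..n} \<times> {1..t}. (case p of (i, s) \<Rightarrow> \<lambda>x. x i s) x) (i, s)) = x"
    if "x \<in> space (matrices n t)" for x
    using take_cols_id[OF that] by (simp add: take_cols_def cong: restrict_cong)
  show "(CLINT x|M. iexp (\<Sum>p\<in>{1..n} \<times> {1..t}. \<theta> p * (case p of (i, s) \<Rightarrow> \<lambda>x. x i s) x)) =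
        (CLINT x|N. iexp (\<Sum>p\<in>{1..n} \<times> {1..t}. \<theta> p * (case p of (i, s) \<Rightarrow> \<lambda>x. x i s) x))" for \<theta>
    using cf[of "\<lambda>i s. \<theta> (i,s)"] by (simp add: sum.cartesian_product case_prod_unfold)
qed (use assms in auto)

definition quad :: "nat \<Rightarrow> real mat \<Rightarrow> rvec \<Rightarrow> real" where
  "quad t S \<theta> = (\<Sum>r=1..t. \<Sum>s=1..t. \<theta> r * \<theta> s * S $$ (r - 1, s - 1))"

definition has_factor :: "nat \<Rightarrow> real mat \<Rightarrow> bool" where
  "has_factor t S \<longleftrightarrow> dim_row S = t \<and> (\<exists>A\<in>carrier_mat t t. A * transpose_mat A = S)"

lemma sum_shift1: "(\<Sum>r=0..<t. f r) = (\<Sum>r=1..t. f (r - 1 :: nat))"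
  by (rule sum.reindex_bij_witness[of _ "\<lambda>r. r - 1" Suc]) auto

lemma factor_entry:
  assumes "A \<in> carrier_mat t t" "A * transpose_mat A = S" "r \<in> {1..t}" "s \<in> {1..t}"
  shows "S $$ (r - 1, s - 1) = (\<Sum>k=1..t. A $$ (r - 1, k - 1) * A $$ (s - 1, k - 1))"
proof -
  have "S $$ (r - 1, s - 1) = (\<Sum>k=0..<t. A $$ (r - 1, k) * A $$ (s - 1, k))"
    using assms by (auto simp flip: assms(2) simp: scalar_prod_def intro!: sum.cong)
  then show ?thesis by (simp only: sum_shift1)
qed

lemma quad_factor:
  assumes S: "\<And>r s. r \<in> {1..t} \<Longrightarrow> s \<in> {1..t} \<Longrightarrow> S $$ (r - 1, s - 1) = (\<Sum>k\<in>K. a r k * a s k)"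
  shows "quad t S \<theta> = (\<Sum>k\<in>K. (\<Sum>r=1..t. \<theta> r * a r k)\<^sup>2)"
proof -
  have "quad t S \<theta> = (\<Sum>r=1..t. \<Sum>s=1..t. \<Sum>k\<in>K. (\<theta> r * a r k) * (\<theta> s * a s k))"
    unfolding quad_def
  proof (intro sum.cong refl)
    fix r s assume "r \<in> {1..t}" "s \<in> {1..t}"
    then show "\<theta> r * \<theta> s * S $$ (r - 1, s - 1) = (\<Sum>k\<in>K. (\<theta> r * a r k) * (\<theta> s * a s k))"
      by (subst S) (simp_all add: sum_distrib_left mult_ac)
  qed
  also have "\<dots> = (\<Sum>k\<in>K. \<Sum>r=1..t. \<Sum>s=1..t. (\<theta> r * a r k) * (\<theta> s * a s k))"
    by (subst sum.swap[where A=K]) (intro sum.cong refl sum.swap)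
  also have "\<dots> = (\<Sum>k\<in>K. (\<Sum>r=1..t. \<theta> r * a r k)\<^sup>2)"
    by (simp add: power2_eq_square sum_product)
  finally show ?thesis .
qed

lemma sets_gauss: "dim_row S = t \<Longrightarrow> sets (gauss S) = sets (\<Pi>\<^sub>M s\<in>{1..t}. borel)"
  by (simp add: gauss_def Let_def)

lemma linear_map_measurable:
  fixes A :: "nat \<Rightarrow> nat \<Rightarrow> real"
  shows
  "(\<lambda>g. \<lambda>s\<in>{1..t}. \<Sum>r=1..t. A s r * g r) \<in> (\<Pi>\<^sub>M s\<in>{1..t}. density lborel std_normal_density) \<rightarrow>\<^sub>M (\<Pi>\<^sub>M s\<in>{1..t}. borel)"
proof (intro measurable_restrict borel_measurable_sum borel_measurable_times)
  fix r :: nat assume "r \<in> {1..t}"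
  then have "(\<lambda>g. g r) \<in> (\<Pi>\<^sub>M s\<in>{1..t}. density lborel std_normal_density) \<rightarrow>\<^sub>M density lborel std_normal_density"
    by (rule measurable_component_singleton)
  then show "(\<lambda>g. g r) \<in> borel_measurable (\<Pi>\<^sub>M s\<in>{1..t}. density lborel std_normal_density)"
    by simp
qed auto

lemma prob_space_gauss: "prob_space (gauss S)"
  unfolding gauss_def Let_def
  by (intro prob_space.prob_space_distr prob_space_PiM prob_space_std_normal linear_map_measurable)

lemma gauss_char:
  assumes "has_factor t S"
  shows "(CLINT y|gauss S. iexp (\<Sum>s=1..t. \<theta> s * y s)) = complex_of_real (exp (- quad t S \<theta> / 2))"
proof -
  define A where "A = (SOME A. A \<in> carrier_mat t t \<and> A * transpose_mat A = S)"
  have t: "dim_row S = t" using assms by (simp add: has_factor_def)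
  have A: "A \<in> carrier_mat t t \<and> A * transpose_mat A = S"
    unfolding A_def by (rule someI_ex) (use assms in \<open>unfold has_factor_def, blast\<close>)
  let ?P = "\<Pi>\<^sub>M s\<in>{1..t}. density lborel std_normal_density"
  have "(CLINT y|gauss S. iexp (\<Sum>s=1..t. \<theta> s * y s))
     = (CLINT g|?P. iexp (\<Sum>s=1..t. \<theta> s * (\<Sum>r = 1..t. A $$ (s - 1, r - 1) * g r)))"
    unfolding gauss_def Let_def t A_def[symmetric]
    by (subst integral_distr[OF linear_map_measurable]) (auto intro!: Bochner_Integration.integral_cong simp: measurable_component_singleton)
  also have "\<dots> = (CLINT g|?P. iexp (\<Sum>r=1..t. (\<Sum>s = 1..t. \<theta> s * A $$ (s - 1, r - 1)) * g r))"
  proof -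
    have "(\<Sum>s=1..t. \<theta> s * (\<Sum>r = 1..t. A $$ (s - 1, r - 1) * g r)) = (\<Sum>r=1..t. (\<Sum>s = 1..t. \<theta> s * A $$ (s - 1, r - 1)) * g r)" for g :: rvec
      by (simp only: sum_distrib_left sum_distrib_right mult.assoc) (rule sum.swap)
    then show ?thesis by simp
  qed
  also have "\<dots> = complex_of_real (exp (- (\<Sum>r=1..t. (\<Sum>s = 1..t. \<theta> s * A $$ (s - 1, r - 1))\<^sup>2) / 2))"
    by (rule PiM_std_normal_char) simp
  also have "(\<Sum>r=1..t. (\<Sum>s = 1..t. \<theta> s * A $$ (s - 1, r - 1))\<^sup>2) = quad t S \<theta>"
    by (rule quad_factor[symmetric]) (rule factor_entry[OF conjunct1[OF A] conjunct2[OF A]])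
  finally show ?thesis .
qed

lemma sets_gauss_rows: "dim_row S = t \<Longrightarrow> sets (gauss_rows n S) = sets (matrices n t)"
  unfolding gauss_rows_def matrices_def by (intro sets_PiM_cong refl sets_gauss)

lemma prob_space_gauss_rows: "prob_space (gauss_rows n S)"
  unfolding gauss_rows_def by (intro prob_space_PiM prob_space_gauss)

lemma gauss_rows_char:
  assumes "has_factor t S"
  shows "(CLINT x|gauss_rows n S. iexp (\<Sum>i=1..n. \<Sum>s=1..t. \<theta> i s * x i s)) = complex_of_real (exp (- (\<Sum>i=1..n. quad t S (\<theta> i)) / 2))"
proof -
  have t: "dim_row S = t" using assms by (simp add: has_factor_def)
  have m: "(\<lambda>y. \<Sum>s=1..t. c s * y s) \<in> borel_measurable (gauss S)" for c :: rvec
    unfolding measurable_cong_sets[OF sets_gauss[OF t] refl]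
    by (intro borel_measurable_sum borel_measurable_times) (auto intro: measurable_component_singleton)
  have "(CLINT x|gauss_rows n S. iexp (\<Sum>i=1..n. \<Sum>s=1..t. \<theta> i s * x i s)) = (\<Prod>i=1..n. CLINT y|gauss S. iexp (\<Sum>s=1..t. \<theta> i s * y s))"
    unfolding gauss_rows_def by (rule PiM_char) (use m prob_space_gauss in auto)
  also have "\<dots> = complex_of_real (\<Prod>i=1..n. exp (- quad t S (\<theta> i) / 2))"
    by (simp only: gauss_char[OF assms] of_real_prod)
  also have "(\<Prod>i=1..n. exp (- quad t S (\<theta> i) / 2)) = exp (- (\<Sum>i=1..n. quad t S (\<theta> i)) / 2)"
    by (simp add: sum_divide_distrib sum_negf flip: exp_sum)
  finally show ?thesis .
qed

text \<open>
  A transform of this form determines the law, whichever factor of S the definition of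
  the Gaussian law has chosen.
\<close>

lemma has_gauss_lawI:
  assumes "prob_space M" "has_factor t S" and Z: "Z \<in> measurable M (matrices n t)"
    and cf: "\<And>\<theta>. (CLINT \<omega>|M. iexp (\<Sum>i=1..n. \<Sum>s=1..t. \<theta> i s * Z \<omega> i s)) = complex_of_real (exp (- (\<Sum>i=1..n. quad t S (\<theta> i)) / 2))"
  shows "has_gauss_law M n t Z S"
  unfolding has_gauss_law_def
proof (intro conjI Z matrices_eqI_char)
  show "prob_space (distr M (matrices n t) Z)" by (intro prob_space.prob_space_distr assms)
  show "sets (gauss_rows n S) = sets (matrices n t)" using assms by (auto intro!: sets_gauss_rows simp: has_factor_def)
  fix \<theta>
  have "(CLINT x|distr M (matrices n t) Z. iexp (\<Sum>i=1..n. \<Sum>s=1..t. \<theta> i s * x i s)) = (CLINT \<omega>|M. iexp (\<Sum>i=1..n. \<Sum>s=1..t. \<theta> i s * Z \<omega> i s))"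
    by (rule integral_distr[OF Z]) (rule measurable_compose[OF matrices_linear_measurable, of "\<lambda>y. iexp y"]; simp)
  then show "(CLINT x|distr M (matrices n t) Z. iexp (\<Sum>i=1..n. \<Sum>s=1..t. \<theta> i s * x i s)) = (CLINT x|gauss_rows n S. iexp (\<Sum>i=1..n. \<Sum>s=1..t. \<theta> i s * x i s))"
    by (simp only: cf gauss_rows_char[OF assms(2)])
qed (use prob_space_gauss_rows in auto)

text \<open>
  Independent standard normal vectors, stored by columns: X s i is entry i of the vector number s.
\<close>

definition normal_vec :: "nat \<Rightarrow> rvec measure" where
  "normal_vec n = (\<Pi>\<^sub>M i\<in>{1..n}. std_normal_distribution)"

definition normal_cols :: "nat \<Rightarrow> nat \<Rightarrow> (nat \<Rightarrow> rvec) measure" where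
  "normal_cols n T = (\<Pi>\<^sub>M s\<in>{1..T}. normal_vec n)"

lemma sets_normal_vec: "sets (normal_vec n) = sets (\<Pi>\<^sub>M i\<in>{1..n}. borel)"
  unfolding normal_vec_def by (intro sets_PiM_cong) auto

lemma prob_space_normal_vec: "prob_space (normal_vec n)"
  unfolding normal_vec_def by (intro prob_space_PiM prob_space_std_normal)

lemma prob_space_normal_cols: "prob_space (normal_cols n T)"
  unfolding normal_cols_def by (intro prob_space_PiM prob_space_normal_vec)

lemma sets_normal_cols: "sets (normal_cols n T) = sets (matrices T n)"
  unfolding normal_cols_def matrices_def by (intro sets_PiM_cong refl sets_normal_vec)

lemma normal_vec_entry [measurable]:
  "i \<in> {1..n} \<Longrightarrow> (\<lambda>x. x i) \<in> borel_measurable (normal_vec n)"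
  unfolding measurable_cong_sets[OF sets_normal_vec refl] by (rule measurable_component_singleton)

lemma normal_cols_entry [measurable]:
  "s \<in> {1..T} \<Longrightarrow> i \<in> {1..n} \<Longrightarrow> (\<lambda>X. X s i) \<in> borel_measurable (normal_cols n T)"
  unfolding measurable_cong_sets[OF sets_normal_cols refl] by (rule matrices_entry)

lemma normal_vec_char:
  "(CLINT x|normal_vec n. iexp (\<Sum>i=1..n. c i * x i)) = complex_of_real (exp (- (\<Sum>i=1..n. (c i)\<^sup>2) / 2))"
  unfolding normal_vec_def by (rule PiM_std_normal_char) simp

lemma normal_cols_char:
  "(CLINT X|normal_cols n T. iexp (\<Sum>s=1..T. \<Sum>i=1..n. c s i * X s i)) = complex_of_real (exp (- (\<Sum>s=1..T. \<Sum>i=1..n. (c s i)\<^sup>2) / 2))"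
proof -
  have "(CLINT X|normal_cols n T. iexp (\<Sum>s=1..T. \<Sum>i=1..n. c s i * X s i)) = (\<Prod>s=1..T. CLINT y|normal_vec n. iexp (\<Sum>i=1..n. c s i * y i))"
    unfolding normal_cols_def by (rule PiM_char) (use prob_space_normal_vec in auto)
  also have "\<dots> = complex_of_real (\<Prod>s=1..T. exp (- (\<Sum>i=1..n. (c s i)\<^sup>2) / 2))"
    by (simp only: normal_vec_char of_real_prod)
  also have "(\<Prod>s=1..T. exp (- (\<Sum>i=1..n. (c s i)\<^sup>2) / 2)) = exp (- (\<Sum>s=1..T. \<Sum>i=1..n. (c s i)\<^sup>2) / 2)"
    by (simp add: sum_divide_distrib sum_negf flip: exp_sum)
  finally show ?thesis .
qed

text \<open>
  Covariances add up: the k-th column contributes the square of its own coefficient, and the sum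
  over k is the quadratic form of S.
\<close>

lemma mixed_cols_law:
  assumes S: "has_factor t S"
    and L: "\<And>r s. r \<in> {1..t} \<Longrightarrow> s \<in> {1..t} \<Longrightarrow> S $$ (r - 1, s - 1) = (\<Sum>k=1..T. L r k * L s k)"
  shows "has_gauss_law (normal_cols n T) n t (\<lambda>X. \<lambda>i\<in>{1..n}. \<lambda>s\<in>{1..t}. \<Sum>k=1..T. L s k * X k i) S"
proof (rule has_gauss_lawI[OF prob_space_normal_cols S])
  show "(\<lambda>X. \<lambda>i\<in>{1..n}. \<lambda>s\<in>{1..t}. \<Sum>k=1..T. L s k * X k i) \<in> normal_cols n T \<rightarrow>\<^sub>M matrices n t"
    by (intro measurable_matricesI borel_measurable_sum borel_measurable_times normal_cols_entry) auto
  fix \<theta>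
  have "(\<Sum>i=1..n. \<Sum>s=1..t. \<theta> i s * (\<lambda>i\<in>{1..n}. \<lambda>s\<in>{1..t}. \<Sum>k=1..T. L s k * X k i) i s)
      = (\<Sum>k=1..T. \<Sum>i=1..n. (\<Sum>s=1..t. \<theta> i s * L s k) * X k i)" for X :: rmat
  proof -
    have "(\<Sum>i=1..n. \<Sum>s=1..t. \<theta> i s * (\<lambda>i\<in>{1..n}. \<lambda>s\<in>{1..t}. \<Sum>k=1..T. L s k * X k i) i s)
      = (\<Sum>i=1..n. \<Sum>s=1..t. \<Sum>k=1..T. \<theta> i s * L s k * X k i)"
      by (intro sum.cong refl) (simp add: sum_distrib_left mult.assoc)
    also have "\<dots> = (\<Sum>i=1..n. \<Sum>k=1..T. \<Sum>s=1..t. \<theta> i s * L s k * X k i)"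
      by (intro sum.cong refl sum.swap)
    also have "\<dots> = (\<Sum>k=1..T. \<Sum>i=1..n. \<Sum>s=1..t. \<theta> i s * L s k * X k i)"
      by (rule sum.swap)
    finally show ?thesis by (simp add: sum_distrib_right)
  qed
  then have "(CLINT X|normal_cols n T. iexp (\<Sum>i=1..n. \<Sum>s=1..t. \<theta> i s * (\<lambda>i\<in>{1..n}. \<lambda>s\<in>{1..t}. \<Sum>k=1..T. L s k * X k i) i s))
    = complex_of_real (exp (- (\<Sum>k=1..T. \<Sum>i=1..n. (\<Sum>s=1..t. \<theta> i s * L s k)\<^sup>2) / 2))"
    by (simp only: normal_cols_char)
  also have "(\<Sum>k=1..T. \<Sum>i=1..n. (\<Sum>s=1..t. \<theta> i s * L s k)\<^sup>2) = (\<Sum>i=1..n. quad t S (\<theta> i))"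
    by (subst sum.swap) (intro sum.cong refl quad_factor[OF L, symmetric])
  finally show "(CLINT X|normal_cols n T. iexp (\<Sum>i=1..n. \<Sum>s=1..t. \<theta> i s * (\<lambda>i\<in>{1..n}. \<lambda>s\<in>{1..t}. \<Sum>k=1..T. L s k * X k i) i s))
    = complex_of_real (exp (- (\<Sum>i=1..n. quad t S (\<theta> i)) / 2))" .
qed

section \<open>The characteristic function of the GOE\<close>

lemma (in prob_space) normal_char:
  assumes X: "distributed M lborel X (normal_density 0 \<sigma>)" and \<sigma>: "\<sigma> > 0"
  shows "(CLINT \<omega>|M. iexp (c * X \<omega>)) = complex_of_real (exp (- (c\<^sup>2 * \<sigma>\<^sup>2) / 2))"
proof -
  have d: "distributed M lborel (\<lambda>x. X x / \<sigma>) std_normal_density"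
    using X normal_standard_normal_convert[OF \<sigma>, of X 0] by simp
  then have e: "distr M lborel (\<lambda>x. X x / \<sigma>) = std_normal_distribution"
    by (simp add: distributed_def)
  have m: "(\<lambda>x. X x / \<sigma>) \<in> measurable M lborel" using d by (simp add: distributed_def)
  have "(CLINT \<omega>|M. iexp (c * X \<omega>)) = (CLINT \<omega>|M. iexp (c * \<sigma> * (X \<omega> / \<sigma>)))"
    using \<sigma> by (intro Bochner_Integration.integral_cong) auto
  also have "\<dots> = (CLINT y|distr M lborel (\<lambda>x. X x / \<sigma>). iexp (c * \<sigma> * y))"
    by (rule integral_distr[OF m, symmetric]) auto
  also have "\<dots> = complex_of_real (exp (- (c * \<sigma>)\<^sup>2 / 2))"
    unfolding e by (rule char_std_normal)
  finally show ?thesis by (simp add: power_mult_distrib)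
qed

lemma (in prob_space) indep_normal_char:
  assumes "indep_vars (\<lambda>_. borel) X I" "finite I"
    and "\<And>i. i \<in> I \<Longrightarrow> distributed M lborel (X i) (normal_density 0 (\<sigma> i))" "\<And>i. i \<in> I \<Longrightarrow> \<sigma> i > 0"
  shows "(CLINT \<omega>|M. iexp (\<Sum>i\<in>I. c i * X i \<omega>)) = complex_of_real (exp (- (\<Sum>i\<in>I. (c i)\<^sup>2 * (\<sigma> i)\<^sup>2) / 2))"
proof -
  have rv: "X i \<in> borel_measurable M" if "i \<in> I" for i
    using assms(1) that by (auto simp: indep_vars_def)
  have ind: "indep_vars (\<lambda>_. borel) (\<lambda>i \<omega>. c i * X i \<omega>) I"
    by (rule indep_vars_compose2[OF assms(1)]) auto
  have m: "(\<lambda>\<omega>. \<Sum>i\<in>I. c i * X i \<omega>) \<in> borel_measurable M"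
    using rv by (intro borel_measurable_sum borel_measurable_times) auto
  have "(CLINT \<omega>|M. iexp (\<Sum>i\<in>I. c i * X i \<omega>)) = char (distr M borel (\<lambda>\<omega>. \<Sum>i\<in>I. c i * X i \<omega>)) 1"
    unfolding char_def by (subst integral_distr[OF m]) auto
  also have "\<dots> = (\<Prod>i\<in>I. char (distr M borel (\<lambda>\<omega>. c i * X i \<omega>)) 1)"
    by (rule char_distr_sum[OF ind])
  also have "\<dots> = (\<Prod>i\<in>I. complex_of_real (exp (- ((c i)\<^sup>2 * (\<sigma> i)\<^sup>2) / 2)))"
  proof (intro prod.cong refl)
    fix i assume i: "i \<in> I"
    have "(\<lambda>\<omega>. c i * X i \<omega>) \<in> borel_measurable M" using rv[OF i] by auto
    then have "char (distr M borel (\<lambda>\<omega>. c i * X i \<omega>)) 1 = (CLINT \<omega>|M. iexp (c i * X i \<omega>))"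
      unfolding char_def by (subst integral_distr) auto
    then show "char (distr M borel (\<lambda>\<omega>. c i * X i \<omega>)) 1 = complex_of_real (exp (- ((c i)\<^sup>2 * (\<sigma> i)\<^sup>2) / 2))"
      using normal_char[OF assms(3)[OF i] assms(4)[OF i]] by simp
  qed
  also have "\<dots> = complex_of_real (exp (\<Sum>i\<in>I. - ((c i)\<^sup>2 * (\<sigma> i)\<^sup>2) / 2))"
    using \<open>finite I\<close> by (simp only: exp_sum of_real_prod)
  also have "(\<Sum>i\<in>I. - ((c i)\<^sup>2 * (\<sigma> i)\<^sup>2) / 2) = - (\<Sum>i\<in>I. (c i)\<^sup>2 * (\<sigma> i)\<^sup>2) / 2"
    by (simp add: sum_divide_distrib sum_negf)
  finally show ?thesis .
qed

lemma sum_pairs_upper: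
  fixes h :: "nat \<Rightarrow> nat \<Rightarrow> real"
  shows "(\<Sum>i=1..n. \<Sum>j=1..n. h i j) = (\<Sum>(i,j)\<in>{(i,j). 1 \<le> i \<and> i \<le> j \<and> j \<le> n}. if i = j then h i i else h i j + h j i)"
proof -
  define U where "U = {(i,j). 1 \<le> i \<and> i \<le> j \<and> j \<le> n}"
  define D where "D = {(i,j). 1 \<le> i \<and> i < j \<and> j \<le> n}"
  define E where "E = {(i,j). 1 \<le> j \<and> j < i \<and> i \<le> n}"
  have sub: "U \<subseteq> {1..n} \<times> {1..n}" "D \<subseteq> {1..n} \<times> {1..n}" "E \<subseteq> {1..n} \<times> {1..n}" by (auto simp: U_def D_def E_def)
  have fin: "finite U" "finite D" "finite E" by (rule finite_subset[OF sub(1)] finite_subset[OF sub(2)] finite_subset[OF sub(3)]; simp)+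
  have "(\<Sum>i=1..n. \<Sum>j=1..n. h i j) = (\<Sum>p\<in>{1..n} \<times> {1..n}. h (fst p) (snd p))"
    by (simp add: sum.cartesian_product case_prod_unfold)
  also have "{1..n} \<times> {1..n} = U \<union> E" by (auto simp: U_def E_def)
  also have "(\<Sum>p\<in>U \<union> E. h (fst p) (snd p)) = (\<Sum>p\<in>U. h (fst p) (snd p)) + (\<Sum>p\<in>E. h (fst p) (snd p))"
    using fin by (intro sum.union_disjoint) (auto simp: U_def E_def)
  also have "(\<Sum>p\<in>E. h (fst p) (snd p)) = (\<Sum>p\<in>D. h (snd p) (fst p))"
    by (rule sum.reindex_bij_witness[of _ prod.swap prod.swap]) (auto simp: D_def E_def)
  also have "\<dots> = (\<Sum>p\<in>U. if fst p = snd p then 0 else h (snd p) (fst p))"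
    using fin by (intro sum.mono_neutral_cong_left) (auto simp: D_def U_def)
  also have "(\<Sum>p\<in>U. h (fst p) (snd p)) + \<dots> = (\<Sum>(i,j)\<in>U. if i = j then h i i else h i j + h j i)"
    unfolding sum.distrib[symmetric] by (intro sum.cong) auto
  finally show ?thesis unfolding U_def .
qed

text \<open>
  In terms of the symmetric part of the coefficients; this form makes the orthogonal
  invariance of the GOE visible.
\<close>

definition goe_char :: "nat \<Rightarrow> rmat \<Rightarrow> complex" where
  "goe_char n \<theta> = complex_of_real (exp (- (\<Sum>i=1..n. \<Sum>j=1..n. (\<theta> i j + \<theta> j i)\<^sup>2) / (4 * real n)))"

lemma GOE_char:
  assumes "prob_space M" "is_GOE M n W" "n \<ge> 1"
  shows "(CLINT \<omega>|M. iexp (\<Sum>i=1..n. \<Sum>j=1..n. \<theta> i j * W \<omega> i j)) = goe_char n \<theta>"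
proof -
  interpret prob_space M by fact
  define U where "U = {(i,j). 1 \<le> i \<and> i \<le> j \<and> j \<le> n}"
  have finU: "finite U" by (rule finite_subset[of _ "{1..n} \<times> {1..n}"]) (auto simp: U_def)
  define c where "c = (\<lambda>(i,j). if i = j then \<theta> i i else \<theta> i j + \<theta> j i)"
  define \<sigma> :: "nat \<times> nat \<Rightarrow> real" where "\<sigma> = (\<lambda>(i,j). if i = j then sqrt (2 / real n) else sqrt (1 / real n))"
  have sym: "W \<omega> i j = W \<omega> j i" if "\<omega> \<in> space M" "i \<in> {1..n}" "j \<in> {1..n}" for \<omega> i j
    using assms(2) that by (auto simp: is_GOE_def)
  have "(\<Sum>i=1..n. \<Sum>j=1..n. \<theta> i j * W \<omega> i j) = (\<Sum>p\<in>U. c p * (case p of (i,j) \<Rightarrow> \<lambda>\<omega>. W \<omega> i j) \<omega>)" if "\<omega> \<in> space M" for \<omega>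
    unfolding sum_pairs_upper[of "\<lambda>i j. \<theta> i j * W \<omega> i j"] U_def[symmetric]
  proof (intro sum.cong refl, safe)
    fix i j assume "(i,j) \<in> U"
    then have "W \<omega> i j = W \<omega> j i" by (intro sym that) (auto simp: U_def)
    then show "(if i = j then \<theta> i i * W \<omega> i i else \<theta> i j * W \<omega> i j + \<theta> j i * W \<omega> j i) = c (i, j) * W \<omega> i j"
      by (simp add: c_def algebra_simps)
  qed
  then have "(CLINT \<omega>|M. iexp (\<Sum>i=1..n. \<Sum>j=1..n. \<theta> i j * W \<omega> i j))
     = (CLINT \<omega>|M. iexp (\<Sum>p\<in>U. c p * (case p of (i,j) \<Rightarrow> \<lambda>\<omega>. W \<omega> i j) \<omega>))"
    by (intro Bochner_Integration.integral_cong) auto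
  also have "\<dots> = complex_of_real (exp (- (\<Sum>p\<in>U. (c p)\<^sup>2 * (\<sigma> p)\<^sup>2) / 2))"
  proof (rule indep_normal_char[OF _ finU])
    show "indep_vars (\<lambda>_. borel) (\<lambda>p. case p of (i, j) \<Rightarrow> \<lambda>\<omega>. W \<omega> i j) U"
      using assms(2) by (simp add: is_GOE_def U_def case_prod_unfold)
    show "distributed M lborel (case p of (i, j) \<Rightarrow> \<lambda>\<omega>. W \<omega> i j) (normal_density 0 (\<sigma> p))" if "p \<in> U" for p
      using assms(2) that by (cases p) (auto simp: is_GOE_def U_def \<sigma>_def)
    show "\<sigma> p > 0" for p using assms(3) by (cases p) (auto simp: \<sigma>_def)
  qed
  also have "- (\<Sum>p\<in>U. (c p)\<^sup>2 * (\<sigma> p)\<^sup>2) / 2 = - (\<Sum>i=1..n. \<Sum>j=1..n. (\<theta> i j + \<theta> j i)\<^sup>2) / (4 * real n)"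
    unfolding minus_divide_left[symmetric] neg_equal_iff_equal
    unfolding sum_pairs_upper[of "\<lambda>i j. (\<theta> i j + \<theta> j i)\<^sup>2"] U_def[symmetric] sum_divide_distrib
  proof (intro sum.cong refl, safe)
    fix i j assume "(i,j) \<in> U"
    show "(c (i,j))\<^sup>2 * (\<sigma> (i,j))\<^sup>2 / 2 = (if i = j then (\<theta> i i + \<theta> i i)\<^sup>2 else (\<theta> i j + \<theta> j i)\<^sup>2 + (\<theta> j i + \<theta> i j)\<^sup>2) / (4 * real n)"
      using assms(3) by (auto simp: c_def \<sigma>_def power2_eq_square field_simps)
  qed
  finally show ?thesis by (simp add: goe_char_def)
qed

section \<open>Positive definiteness and the Cholesky factor\<close>

lemma compact_unit_sphere:
  "compact {x :: rvec. (\<forall>s. s \<notin> {1..t} \<longrightarrow> x s = 0) \<and> (\<Sum>s=1..t. (x s)\<^sup>2) = 1}" (is "compact ?K")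
proof -
  define S :: "nat \<Rightarrow> real set" where "S s = (if s \<in> {1..t} then {-1..1} else {0})" for s
  have "compactin (product_topology (\<lambda>_::nat. euclideanreal) UNIV) (PiE UNIV S)"
    unfolding compactin_PiE by (auto simp: S_def)
  then have "compact (PiE UNIV S)" by (simp add: euclidean_product_topology)
  moreover have "closed {x :: rvec. (\<Sum>s=1..t. (x s)\<^sup>2) = 1}"
    by (intro closed_Collect_eq continuous_on_sum continuous_on_power continuous_on_const continuous_on_product_coordinates)
  moreover have "?K = PiE UNIV S \<inter> {x. (\<Sum>s=1..t. (x s)\<^sup>2) = 1}"
  proof (intro equalityI subsetI)
    fix x :: rvec
    assume "x \<in> ?K"
    then have *: "\<And>s. s \<notin> {1..t} \<Longrightarrow> x s = 0" "(\<Sum>s=1..t. (x s)\<^sup>2) = 1" by auto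
    have "x s \<in> S s" for s
    proof (cases "s \<in> {1..t}")
      case True
      then have "(x s)\<^sup>2 \<le> (\<Sum>s=1..t. (x s)\<^sup>2)" by (intro member_le_sum) auto
      then have "(x s)\<^sup>2 \<le> 1" using * by simp
      then have "\<bar>x s\<bar> \<le> 1" by (simp add: abs_square_le_1)
      then show ?thesis using True by (auto simp: S_def)
    next
      case False
      then show ?thesis using *(1)[OF False] by (simp add: S_def)
    qed
    then show "x \<in> PiE UNIV S \<inter> {x. (\<Sum>s=1..t. (x s)\<^sup>2) = 1}" using * by auto
  next
    fix x :: rvec
    assume x: "x \<in> PiE UNIV S \<inter> {x. (\<Sum>s=1..t. (x s)\<^sup>2) = 1}"
    have "x s = 0" if "s \<notin> {1..t}" for s
    proof -
      have "x s \<in> S s" using x by auto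
      then show ?thesis using that by (simp add: S_def del: atLeastAtMost_iff)
    qed
    then show "x \<in> ?K" using x by auto
  qed
  ultimately show ?thesis using compact_Int_closed by simp
qed

lemma quadratic_nonneg_linear_coeff:
  fixes a b :: real
  assumes "\<And>h. 0 \<le> 2 * h * a + h\<^sup>2 * b"
  shows "a = 0"
proof (rule ccontr)
  assume a: "a \<noteq> 0"
  define k where "k = 1 / (\<bar>b\<bar> + 1)"
  have k: "k > 0" "k * \<bar>b\<bar> < 1" by (auto simp: k_def field_simps)
  have "0 \<le> 2 * (- (k * a)) * a + (- (k * a))\<^sup>2 * b" by (rule assms)
  also have "\<dots> = k * a\<^sup>2 * (k * b - 2)" by (simp add: power2_eq_square algebra_simps)
  finally have "0 \<le> k * a\<^sup>2 * (k * b - 2)" .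
  moreover have "k * a\<^sup>2 > 0" using a k by simp
  ultimately have "k * b - 2 \<ge> 0" by (simp only: zero_le_mult_iff) linarith
  moreover have "k * b \<le> k * \<bar>b\<bar>" using k by (simp add: mult_left_mono)
  ultimately show False using k by linarith
qed

lemma quad_scale: "quad t S (\<lambda>s. a * v s) = a\<^sup>2 * quad t S v"
  by (simp add: quad_def sum_distrib_left power2_eq_square mult_ac)

lemma quad_add_unit:
  assumes s: "s \<in> {1..t}" and sym: "\<And>i j. i < t \<Longrightarrow> j < t \<Longrightarrow> S $$ (i,j) = S $$ (j,i)"
  shows "quad t S (\<lambda>r. x r + (if r = s then h else 0))
     = quad t S x + 2 * h * (\<Sum>r=1..t. S $$ (s - 1, r - 1) * x r) + h\<^sup>2 * S $$ (s - 1, s - 1)"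
proof -
  define D where "D r q = S $$ (r - 1, q - 1)" for r q
  have Dsym: "D r q = D q r" if "r \<in> {1..t}" "q \<in> {1..t}" for r q
    using sym[of "r - 1" "q - 1"] that by (auto simp: D_def)
  have "quad t S (\<lambda>r. x r + (if r = s then h else 0))
     = (\<Sum>r=1..t. \<Sum>q=1..t. x r * x q * D r q) + (\<Sum>r=1..t. \<Sum>q=1..t. (if q = s then h * x r * D r s else 0))
       + (\<Sum>r=1..t. \<Sum>q=1..t. (if r = s then h * x q * D s q else 0))
       + (\<Sum>r=1..t. \<Sum>q=1..t. (if r = s then (if q = s then h\<^sup>2 * D s s else 0) else 0))"
    unfolding quad_def D_def[symmetric] sum.distrib[symmetric]
    by (intro sum.cong refl) (auto simp: algebra_simps power2_eq_square)
  also have "(\<Sum>r=1..t. \<Sum>q=1..t. (if q = s then h * x r * D r s else 0)) = h * (\<Sum>r=1..t. D s r * x r)"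
    using s by (simp add: sum_distrib_left Dsym[of _ s] mult_ac)
  also have "(\<Sum>r=1..t. \<Sum>q=1..t. (if r = s then h * x q * D s q else 0)) = h * (\<Sum>r=1..t. D s r * x r)"
    by (subst sum.swap) (use s in \<open>simp add: sum_distrib_left mult_ac\<close>)
  also have "(\<Sum>r=1..t. \<Sum>q=1..t. (if r = s then (if q = s then h\<^sup>2 * D s s else 0) else 0)) = h\<^sup>2 * D s s"
    by (subst sum.swap) (use s in simp)
  finally show ?thesis by (simp add: quad_def D_def)
qed

lemma sum_sq_add_unit:
  fixes x :: rvec
  assumes "s \<in> {1..t}"
  shows "(\<Sum>r=1..t. (x r + (if r = s then h else 0))\<^sup>2) = (\<Sum>r=1..t. (x r)\<^sup>2) + 2 * h * x s + h\<^sup>2"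
proof -
  have "(\<Sum>r=1..t. (x r + (if r = s then h else 0))\<^sup>2)
     = (\<Sum>r=1..t. (x r)\<^sup>2) + (\<Sum>r=1..t. if r = s then 2 * h * x s + h\<^sup>2 else 0)"
    unfolding sum.distrib[symmetric] by (intro sum.cong refl) (auto simp: power2_eq_square algebra_simps)
  then show ?thesis using assms by simp
qed

text \<open>
  A minimizer of the quadratic form on the unit sphere is an eigenvector, so the minimum is an
  eigenvalue.
\<close>

lemma lambda_min_quad:
  assumes S: "S \<in> carrier_mat t t" and t: "t \<ge> 1"
    and sym: "\<And>i j. i < t \<Longrightarrow> j < t \<Longrightarrow> S $$ (i,j) = S $$ (j,i)"
    and c: "lambda_min S > c"
  shows "quad t S v \<ge> c * (\<Sum>s=1..t. (v s)\<^sup>2)"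
proof -
  let ?K = "{x :: rvec. (\<forall>s. s \<notin> {1..t} \<longrightarrow> x s = 0) \<and> (\<Sum>s=1..t. (x s)\<^sup>2) = 1}"
  have ne: "(\<lambda>s. if s = 1 then 1 else 0) \<in> ?K"
    using t by (auto simp: if_distrib[of "\<lambda>x. x\<^sup>2"] cong: if_cong)
  have "continuous_on ?K (quad t S)"
    unfolding quad_def
    by (intro continuous_on_sum continuous_on_mult continuous_on_const continuous_on_subset[OF continuous_on_product_coordinates]) auto
  moreover have "?K \<noteq> {}" using ne by (metis empty_iff)
  ultimately have "\<exists>x\<in>?K. \<forall>y\<in>?K. quad t S x \<le> quad t S y"
    by (intro continuous_attains_inf compact_unit_sphere)
  then obtain x where x: "x \<in> ?K" and min': "\<forall>y\<in>?K. quad t S x \<le> quad t S y" by (rule bexE)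
  have min: "quad t S x \<le> quad t S y" if "y \<in> ?K" for y using min' that by (rule bspec)
  define \<mu> where "\<mu> = quad t S x"
  have sq1: "(\<Sum>s=1..t. (x s)\<^sup>2) = 1" using x by simp
  have quad_cong: "quad t S y = quad t S z" if "\<And>s. s \<in> {1..t} \<Longrightarrow> y s = z s" for y z
    unfolding quad_def using that by (intro sum.cong refl) auto
  have ge: "quad t S y \<ge> \<mu> * (\<Sum>s=1..t. (y s)\<^sup>2)" for y
  proof (cases "(\<Sum>s=1..t. (y s)\<^sup>2) = 0")
    case True
    then have "y s = 0" if "s \<in> {1..t}" for s using that by (simp add: sum_nonneg_eq_0_iff)
    then have "quad t S y = 0" unfolding quad_def by (simp add: sum.neutral)
    then show ?thesis using True by simp
  next
    case False
    define N where "N = (\<Sum>s=1..t. (y s)\<^sup>2)"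
    have N: "N > 0" using False sum_nonneg[of "{1..t}" "\<lambda>s. (y s)\<^sup>2"] by (simp add: N_def less_le)
    let ?z = "\<lambda>s. if s \<in> {1..t} then 1 / sqrt N * y s else 0"
    have "(\<Sum>s=1..t. (?z s)\<^sup>2) = (\<Sum>s=1..t. (y s)\<^sup>2 / N)"
      using N by (intro sum.cong refl) (auto simp: power_mult_distrib power_divide)
    also have "\<dots> = 1" using N by (simp add: N_def sum_divide_distrib[symmetric])
    finally have "?z \<in> ?K" by auto
    then have "\<mu> \<le> quad t S ?z" unfolding \<mu>_def by (rule min)
    also have "\<dots> = quad t S (\<lambda>s. 1 / sqrt N * y s)" by (rule quad_cong) simp
    also have "\<dots> = quad t S y / N" using N by (subst quad_scale) (simp add: power_divide)
    finally show ?thesis using N by (simp add: N_def field_simps)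
  qed
  have eig: "(\<Sum>r=1..t. S $$ (s - 1, r - 1) * x r) = \<mu> * x s" if s: "s \<in> {1..t}" for s
  proof -
    have q: "quad t S (\<lambda>r. x r + (if r = s then h else 0))
       = \<mu> + 2 * h * (\<Sum>r=1..t. S $$ (s - 1, r - 1) * x r) + h\<^sup>2 * S $$ (s - 1, s - 1)" for h
      unfolding \<mu>_def by (rule quad_add_unit[OF s]) (rule sym)
    have "0 \<le> 2 * h * ((\<Sum>r=1..t. S $$ (s - 1, r - 1) * x r) - \<mu> * x s) + h\<^sup>2 * (S $$ (s - 1, s - 1) - \<mu>)" for h
      using ge[of "\<lambda>r. x r + (if r = s then h else 0)"]
      unfolding q sum_sq_add_unit[OF s] sq1 by (simp add: algebra_simps)
    then have "(\<Sum>r=1..t. S $$ (s - 1, r - 1) * x r) - \<mu> * x s = 0"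
      by (rule quadratic_nonneg_linear_coeff)
    then show ?thesis by simp
  qed
  define w where "w = vec t (\<lambda>i. x (Suc i))"
  have "eigenvector S w \<mu>"
    unfolding eigenvector_def
  proof (intro conjI)
    show "w \<in> carrier_vec (dim_row S)" using S by (simp add: w_def)
    have "\<exists>s\<in>{1..t}. x s \<noteq> 0"
    proof (rule ccontr)
      assume "\<not> ?thesis"
      then have "(\<Sum>s=1..t. (x s)\<^sup>2) = 0" by (intro sum.neutral) auto
      then show False using sq1 by simp
    qed
    then obtain s where s: "s \<in> {1..t}" "x s \<noteq> 0" by blast
    then have "w $ (s - 1) \<noteq> 0" "s - 1 < t" by (auto simp: w_def)
    then show "w \<noteq> 0\<^sub>v (dim_row S)" using S by auto
    show "S *\<^sub>v w = \<mu> \<cdot>\<^sub>v w"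
    proof (rule eq_vecI)
      fix i assume "i < dim_vec (\<mu> \<cdot>\<^sub>v w)"
      then have i: "i < t" by (simp add: w_def)
      have "(S *\<^sub>v w) $ i = (\<Sum>j=0..<t. S $$ (i, j) * x (Suc j))"
        using S i by (auto simp: w_def scalar_prod_def intro!: sum.cong)
      also have "\<dots> = (\<Sum>r=1..t. S $$ (i, r - 1) * x r)"
        by (subst sum_shift1) (intro sum.cong; simp)
      also have "\<dots> = \<mu> * x (Suc i)" using eig[of "Suc i"] i by simp
      finally show "(S *\<^sub>v w) $ i = (\<mu> \<cdot>\<^sub>v w) $ i" using i by (simp add: w_def)
    qed (use S in \<open>simp add: w_def\<close>)
  qed
  then have ev: "eigenvalue S \<mu>" by (auto simp: eigenvalue_def)
  have "finite {k. eigenvalue S k}"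
  proof -
    have "char_poly S \<noteq> 0" using degree_monic_char_poly[OF S] by auto
    then show ?thesis unfolding eigenvalue_root_char_poly[OF S] by (rule poly_roots_finite)
  qed
  then have "lambda_min S \<le> \<mu>" unfolding lambda_min_def using ev by (intro Min_le) auto
  then have "c \<le> \<mu>" using c by simp
  then have "c * (\<Sum>s=1..t. (v s)\<^sup>2) \<le> \<mu> * (\<Sum>s=1..t. (v s)\<^sup>2)"
    by (intro mult_right_mono sum_nonneg) auto
  then show ?thesis using ge[of v] by linarith
qed

lemma diag_le_op_norm:
  assumes S: "S \<in> carrier_mat t t" and i: "i < t"
  shows "S $$ (i,i) \<le> op_norm S"
proof -
  let ?X = "{sqrt (scalar_prod (S *\<^sub>v v) (S *\<^sub>v v)) |v. v \<in> carrier_vec (dim_col S) \<and> scalar_prod v v = 1}"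
  have nsq: "scalar_prod w w = (\<Sum>j=0..<t. (w $ j)\<^sup>2)" if "w \<in> carrier_vec t" for w :: "real vec"
    using that by (auto simp: scalar_prod_def power2_eq_square)
  have bdd: "bdd_above ?X"
  proof (rule bdd_aboveI)
    fix y assume "y \<in> ?X"
    then obtain v where v: "v \<in> carrier_vec t" "scalar_prod v v = 1" and y: "y = sqrt (scalar_prod (S *\<^sub>v v) (S *\<^sub>v v))"
      using S by auto
    have le1: "\<bar>v $ j\<bar> \<le> 1" if "j < t" for j
    proof -
      have "(v $ j)\<^sup>2 \<le> (\<Sum>j=0..<t. (v $ j)\<^sup>2)" using that by (intro member_le_sum) auto
      then show ?thesis using v nsq[OF v(1)] by (simp add: abs_square_le_1)
    qed
    have "scalar_prod (S *\<^sub>v v) (S *\<^sub>v v) = (\<Sum>k=0..<t. ((S *\<^sub>v v) $ k)\<^sup>2)"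
      by (intro nsq mult_mat_vec_carrier[OF S v(1)])
    also have "\<dots> \<le> (\<Sum>k=0..<t. (\<Sum>j=0..<t. \<bar>S $$ (k,j)\<bar>)\<^sup>2)"
    proof (intro sum_mono)
      fix k assume k: "k \<in> {0..<t}"
      then have "(S *\<^sub>v v) $ k = (\<Sum>j=0..<t. S $$ (k,j) * v $ j)" using S v by (auto simp: scalar_prod_def)
      also have "\<bar>\<dots>\<bar> \<le> (\<Sum>j=0..<t. \<bar>S $$ (k,j)\<bar> * 1)"
        using le1 by (intro order_trans[OF sum_abs] sum_mono) (auto simp: abs_mult intro!: mult_left_le)
      finally have "\<bar>(S *\<^sub>v v) $ k\<bar> \<le> \<bar>\<Sum>j=0..<t. \<bar>S $$ (k,j)\<bar>\<bar>" by simp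
      then show "((S *\<^sub>v v) $ k)\<^sup>2 \<le> (\<Sum>j=0..<t. \<bar>S $$ (k,j)\<bar>)\<^sup>2" by (simp only: abs_le_square_iff)
    qed
    finally show "y \<le> sqrt (\<Sum>k=0..<t. (\<Sum>j=0..<t. \<bar>S $$ (k,j)\<bar>)\<^sup>2)" unfolding y by (rule real_sqrt_le_mono)
  qed
  have "unit_vec t i \<in> carrier_vec (dim_col S)" "scalar_prod (unit_vec t i) (unit_vec t i) = (1::real)" using S i by auto
  then have "sqrt (scalar_prod (S *\<^sub>v unit_vec t i) (S *\<^sub>v unit_vec t i)) \<in> ?X" by blast
  then have "sqrt (scalar_prod (S *\<^sub>v unit_vec t i) (S *\<^sub>v unit_vec t i)) \<le> op_norm S"
    unfolding op_norm_def using bdd by (rule cSup_upper)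
  moreover have "(S $$ (i,i))\<^sup>2 \<le> scalar_prod (S *\<^sub>v unit_vec t i) (S *\<^sub>v unit_vec t i)"
  proof -
    have "S *\<^sub>v unit_vec t i \<in> carrier_vec t" by (intro mult_mat_vec_carrier[OF S] unit_vec_carrier)
    then have "scalar_prod (S *\<^sub>v unit_vec t i) (S *\<^sub>v unit_vec t i) = (\<Sum>k=0..<t. ((S *\<^sub>v unit_vec t i) $ k)\<^sup>2)" by (rule nsq)
    moreover have "((S *\<^sub>v unit_vec t i) $ i)\<^sup>2 \<le> \<dots>" using i by (intro member_le_sum) auto
    moreover have "(S *\<^sub>v unit_vec t i) $ i = S $$ (i,i)" using S i by auto
    ultimately show ?thesis by simp
  qed
  ultimately show ?thesis using real_le_rsqrt by fastforce
qed

text \<open>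
  L is the Cholesky factor of the form S and N its inverse. Both are lower triangular, so their
  leading blocks belong to the leading blocks of S.
\<close>

definition cholesky :: "nat \<Rightarrow> real \<Rightarrow> (nat \<Rightarrow> nat \<Rightarrow> real) \<Rightarrow> (nat \<Rightarrow> nat \<Rightarrow> real) \<Rightarrow> (nat \<Rightarrow> nat \<Rightarrow> real) \<Rightarrow> bool" where
  "cholesky t c S L N \<longleftrightarrow>
     (\<forall>r s. r < s \<longrightarrow> L r s = 0 \<and> N r s = 0) \<and>
     (\<forall>r\<in>{1..t}. L r r \<ge> sqrt c) \<and>
     (\<forall>r\<in>{1..t}. \<forall>s\<in>{1..t}. S r s = (\<Sum>k=1..t. L r k * L s k)) \<and>
     (\<forall>r\<in>{1..t}. \<forall>s\<in>{1..t}. (\<Sum>k=1..t. L r k * N k s) = (if r = s then 1 else 0)) \<and>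
     (\<forall>r\<in>{1..t}. \<forall>s\<in>{1..t}. (\<Sum>k=1..t. N r k * L k s) = (if r = s then 1 else 0))"

lemma sum_delta_factor:
  fixes A B :: "nat \<Rightarrow> nat \<Rightarrow> real"
  assumes AB: "\<And>q. q \<in> {1..t} \<Longrightarrow> (\<Sum>r=1..t. A q r * B r k) = (if q = k then 1 else 0)" and k: "k \<in> {1..t}"
  shows "(\<Sum>r=1..t. (\<Sum>q=1..t. y q * A q r) * B r k) = y k"
proof -
  have "(\<Sum>r=1..t. (\<Sum>q=1..t. y q * A q r) * B r k) = (\<Sum>q=1..t. \<Sum>r=1..t. y q * A q r * B r k)"
    by (simp only: sum_distrib_right) (rule sum.swap)
  also have "\<dots> = (\<Sum>q=1..t. y q * (\<Sum>r=1..t. A q r * B r k))"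
    by (simp only: sum_distrib_left mult.assoc)
  also have "\<dots> = (\<Sum>q=1..t. if q = k then y k else 0)"
    by (intro sum.cong refl) (simp only: AB, simp)
  finally show ?thesis using k by simp
qed

text \<open>
  Induction on the size. The new diagonal entry squared is the value of the form at the vector
  that eliminates the earlier coordinates; since its last coordinate is 1, this value is at
  least c.
\<close>

lemma cholesky_exists:
  assumes c: "c > 0"
    and sym: "\<And>r s. r \<in> {1..t} \<Longrightarrow> s \<in> {1..t} \<Longrightarrow> S r s = S s r"
    and pos: "\<And>v. (\<Sum>r=1..t. \<Sum>s=1..t. v r * v s * S r s) \<ge> c * (\<Sum>s=1..t. (v s)\<^sup>2)"
  shows "\<exists>L N. cholesky t c S L N"
  using sym pos
proof (induction t)
  case 0
  show ?case by (intro exI[of _ "\<lambda>_ _. 0"]) (simp add: cholesky_def)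
next
  case (Suc t)
  have pos_t: "(\<Sum>r=1..t. \<Sum>s=1..t. v r * v s * S r s) \<ge> c * (\<Sum>s=1..t. (v s)\<^sup>2)" for v
  proof -
    have "(\<Sum>r=1..Suc t. \<Sum>s=1..Suc t. (v(Suc t := 0)) r * (v(Suc t := 0)) s * S r s) \<ge> c * (\<Sum>s=1..Suc t. ((v(Suc t := 0)) s)\<^sup>2)"
      by (rule Suc.prems(2))
    also have "(\<Sum>r=1..Suc t. \<Sum>s=1..Suc t. (v(Suc t := 0)) r * (v(Suc t := 0)) s * S r s) = (\<Sum>r=1..t. \<Sum>s=1..t. (v(Suc t := 0)) r * (v(Suc t := 0)) s * S r s)"
      by simp
    also have "\<dots> = (\<Sum>r=1..t. \<Sum>s=1..t. v r * v s * S r s)" by (intro sum.cong refl) auto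
    also have "(\<Sum>s=1..Suc t. ((v(Suc t := 0)) s)\<^sup>2) = (\<Sum>s=1..t. ((v(Suc t := 0)) s)\<^sup>2)" by simp
    also have "\<dots> = (\<Sum>s=1..t. (v s)\<^sup>2)" by (intro sum.cong refl) auto
    finally show ?thesis .
  qed
  obtain L N where LN: "cholesky t c S L N"
    using Suc.IH[OF _ pos_t] Suc.prems(1) by auto
  have tri: "L r s = 0" "N r s = 0" if "r < s" for r s using LN that by (auto simp: cholesky_def)
  have fac: "S r s = (\<Sum>k=1..t. L r k * L s k)" if "r \<in> {1..t}" "s \<in> {1..t}" for r s
    using LN that by (auto simp: cholesky_def)
  have LNd: "(\<Sum>k=1..t. L r k * N k s) = (if r = s then 1 else 0)" if "r \<in> {1..t}" "s \<in> {1..t}" for r s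
    using LN that by (auto simp: cholesky_def)
  have NLd: "(\<Sum>k=1..t. N r k * L k s) = (if r = s then 1 else 0)" if "r \<in> {1..t}" "s \<in> {1..t}" for r s
    using LN that by (auto simp: cholesky_def)
  define a where "a r = S (Suc t) r" for r
  define y where "y q = (\<Sum>r=1..t. a r * N q r)" for q
  define d where "d = S (Suc t) (Suc t)"
  have Ly: "(\<Sum>k=1..t. L s k * y k) = a s" if s: "s \<in> {1..t}" for s
  proof -
    have "(\<Sum>k=1..t. L s k * y k) = (\<Sum>k=1..t. (\<Sum>r=1..t. a r * N k r) * L s k)"
      by (simp add: y_def mult.commute)
    also have "\<dots> = a s"
      using sum_delta_factor[of t "\<lambda>q r. N r q" "\<lambda>r k. L k r" s a] LNd[OF s] s
      by (simp add: mult.commute eq_commute[of s])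
    finally show ?thesis .
  qed
  define v where "v r = (if r = Suc t then 1 else - (\<Sum>q=1..t. y q * N q r))" for r
  have vL: "(\<Sum>r=1..t. v r * L r k) = - y k" if k: "k \<in> {1..t}" for k
  proof -
    have "(\<Sum>r=1..t. v r * L r k) = - (\<Sum>r=1..t. (\<Sum>q=1..t. y q * N q r) * L r k)"
      by (simp add: v_def sum_negf)
    also have "\<dots> = - y k" using sum_delta_factor[of t N L k y] NLd[OF _ k] k by simp
    finally show ?thesis .
  qed
  have va: "(\<Sum>r=1..t. v r * a r) = - (\<Sum>q=1..t. (y q)\<^sup>2)"
  proof -
    have "(\<Sum>r=1..t. v r * a r) = - (\<Sum>r=1..t. \<Sum>q=1..t. y q * (a r * N q r))"
      by (simp add: v_def sum_negf sum_distrib_left mult_ac)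
    also have "\<dots> = - (\<Sum>q=1..t. y q * y q)"
      by (subst sum.swap) (simp add: y_def sum_distrib_left)
    finally show ?thesis by (simp add: power2_eq_square)
  qed
  have vv: "(\<Sum>r=1..t. \<Sum>s=1..t. v r * v s * S r s) = (\<Sum>q=1..t. (y q)\<^sup>2)"
  proof -
    have "(\<Sum>r=1..t. \<Sum>s=1..t. v r * v s * S r s) = quad t (mat t t (\<lambda>(i,j). S (Suc i) (Suc j))) v"
      unfolding quad_def by (intro sum.cong refl) auto
    also have "\<dots> = (\<Sum>k=1..t. (\<Sum>r=1..t. v r * L r k)\<^sup>2)"
      by (rule quad_factor) (auto simp: fac)
    also have "\<dots> = (\<Sum>q=1..t. (y q)\<^sup>2)" by (intro sum.cong refl) (simp only: vL power2_minus)
    finally show ?thesis .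
  qed
  have "(\<Sum>r=1..Suc t. \<Sum>s=1..Suc t. v r * v s * S r s) =
     (\<Sum>r=1..t. \<Sum>s=1..t. v r * v s * S r s) + (\<Sum>r=1..t. v r * S r (Suc t)) + ((\<Sum>r=1..t. v r * S (Suc t) r) + d)"
    by (simp add: sum.distrib d_def v_def)
  also have "(\<Sum>r=1..t. v r * S r (Suc t)) = (\<Sum>r=1..t. v r * a r)"
    using Suc.prems(1) by (intro sum.cong) (auto simp: a_def)
  also have "(\<Sum>r=1..t. v r * S (Suc t) r) = (\<Sum>r=1..t. v r * a r)" by (simp add: a_def)
  finally have "d - (\<Sum>q=1..t. (y q)\<^sup>2) \<ge> c * (\<Sum>s=1..Suc t. (v s)\<^sup>2)"
    using Suc.prems(2)[of v] unfolding vv va by simp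
  moreover have "(\<Sum>s=1..Suc t. (v s)\<^sup>2) \<ge> 1" by (simp add: v_def sum_nonneg)
  then have "c * (\<Sum>s=1..Suc t. (v s)\<^sup>2) \<ge> c * 1" using c by (intro mult_left_mono) auto
  ultimately have dge: "d - (\<Sum>q=1..t. (y q)\<^sup>2) \<ge> c" by linarith
  define l where "l = sqrt (d - (\<Sum>q=1..t. (y q)\<^sup>2))"
  have l: "l \<ge> sqrt c" unfolding l_def using dge by simp
  have l0: "l > 0" using l c by (meson less_le_trans real_sqrt_gt_zero)
  have lsq: "l * l = d - (\<Sum>q=1..t. (y q)\<^sup>2)" unfolding l_def using dge c by simp
  define L' where "L' r s = (if r = Suc t then (if s = Suc t then l else if s \<le> t then y s else 0) else L r s)" for r s
  define N' where "N' r s = (if r = Suc t then (if s = Suc t then 1 / l else if s \<le> t then - (\<Sum>q=1..t. y q * N q s) / l else 0) else N r s)" for r s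
  have S1: "S (Suc t) s = (\<Sum>k=1..Suc t. L' (Suc t) k * L' s k)" if "s \<in> {1..Suc t}" for s
  proof (cases "s = Suc t")
    case True
    have "(\<Sum>k=1..t. L' (Suc t) k * L' s k) = (\<Sum>q=1..t. (y q)\<^sup>2)"
      by (intro sum.cong refl) (auto simp: L'_def True power2_eq_square)
    then show ?thesis using True lsq by (simp add: L'_def d_def)
  next
    case False
    then have s: "s \<in> {1..t}" using that by auto
    have "(\<Sum>k=1..t. L' (Suc t) k * L' s k) = (\<Sum>k=1..t. L s k * y k)"
      using s by (intro sum.cong refl) (auto simp: L'_def)
    then show ?thesis using Ly[OF s] s by (simp add: L'_def a_def tri)
  qed
  have S2: "S r s = (\<Sum>k=1..Suc t. L' r k * L' s k)" if "r \<in> {1..Suc t}" "s \<in> {1..Suc t}" for r s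
  proof -
    consider "r = Suc t" | "s = Suc t" | "r \<in> {1..t}" "s \<in> {1..t}" using \<open>r \<in> _\<close> \<open>s \<in> _\<close> by fastforce
    then show ?thesis
    proof cases
      case 1 then show ?thesis using S1 that by simp
    next
      case 2 then show ?thesis using S1[of r] that Suc.prems(1)[of r s] by (simp add: mult.commute)
    next
      case 3
      have "(\<Sum>k=1..t. L' r k * L' s k) = (\<Sum>k=1..t. L r k * L s k)"
        using 3 by (intro sum.cong refl) (auto simp: L'_def)
      then show ?thesis using 3 fac[of r s] by (simp add: L'_def tri)
    qed
  qed
  have LN': "(\<Sum>k=1..Suc t. L' r k * N' k s) = (if r = s then 1 else 0)" if "r \<in> {1..Suc t}" "s \<in> {1..Suc t}" for r s
  proof (cases "r = Suc t")
    case True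
    have "(\<Sum>k=1..t. L' r k * N' k s) = (\<Sum>k=1..t. y k * N k s)"
      by (intro sum.cong refl) (auto simp: L'_def N'_def True)
    moreover have "(\<Sum>k=1..t. y k * N k s) = 0" if "s = Suc t"
      using that by (intro sum.neutral) (auto simp: tri)
    ultimately show ?thesis using that True l0 by (auto simp: L'_def N'_def)
  next
    case False
    then have r: "r \<in> {1..t}" using that by auto
    have "(\<Sum>k=1..t. L' r k * N' k s) = (\<Sum>k=1..t. L r k * N k s)"
      using r by (intro sum.cong refl) (auto simp: L'_def N'_def)
    moreover have "(\<Sum>k=1..t. L r k * N k s) = 0" if "s = Suc t"
      using that by (intro sum.neutral) (auto simp: tri)
    ultimately show ?thesis using that r LNd[OF r, of s] by (cases "s = Suc t") (auto simp: L'_def N'_def tri)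
  qed
  have NL': "(\<Sum>k=1..Suc t. N' r k * L' k s) = (if r = s then 1 else 0)" if "r \<in> {1..Suc t}" "s \<in> {1..Suc t}" for r s
  proof (cases "r = Suc t")
    case True
    show ?thesis
    proof (cases "s = Suc t")
      case s: True
      have "(\<Sum>k=1..t. N' r k * L' k s) = 0" using s by (intro sum.neutral) (auto simp: L'_def tri)
      then show ?thesis using True s l0 by (auto simp: L'_def N'_def)
    next
      case False
      then have s: "s \<in> {1..t}" using that by auto
      have "(\<Sum>k=1..t. N' r k * L' k s) = - (\<Sum>k=1..t. (\<Sum>q=1..t. y q * N q k) * L k s) / l"
        unfolding sum_divide_distrib sum_negf[symmetric]
        by (intro sum.cong refl) (auto simp: L'_def N'_def True)
      also have "\<dots> = - y s / l" using sum_delta_factor[of t N L s y] NLd[OF _ s] s by simp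
      finally show ?thesis using True s l0 by (auto simp: L'_def N'_def)
    qed
  next
    case False
    then have r: "r \<in> {1..t}" using that by auto
    have "(\<Sum>k=1..t. N' r k * L' k s) = (\<Sum>k=1..t. N r k * L k s)"
      using r by (intro sum.cong refl) (auto simp: L'_def N'_def)
    moreover have "(\<Sum>k=1..t. N r k * L k s) = 0" if "s = Suc t"
      using that by (intro sum.neutral) (auto simp: tri)
    ultimately show ?thesis using that r NLd[OF r, of s] by (cases "s = Suc t") (auto simp: L'_def N'_def tri)
  qed
  have diag: "L' r r \<ge> sqrt c" if "r \<in> {1..Suc t}" for r
    using that l LN by (cases "r = Suc t") (auto simp: L'_def cholesky_def)
  show ?case
  proof (intro exI)
    show "cholesky (Suc t) c S L' N'"
      unfolding cholesky_def
    proof (intro conjI allI ballI impI)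
      fix r s :: nat assume "r < s"
      then show "L' r s = 0" "N' r s = 0" by (auto simp: L'_def N'_def tri)
    qed (fact diag S2 LN' NL')+
  qed
qed

section \<open>The density of a nonsingular Gaussian law\<close>

text \<open>The s-th coordinate of N x; the sum stops at s since N is lower triangular.\<close>

definition innov :: "(nat \<Rightarrow> nat \<Rightarrow> real) \<Rightarrow> nat \<Rightarrow> rvec \<Rightarrow> real" where
  "innov N s x = (\<Sum>r=1..s. N s r * x r)"

definition row_density :: "(nat \<Rightarrow> nat \<Rightarrow> real) \<Rightarrow> (nat \<Rightarrow> nat \<Rightarrow> real) \<Rightarrow> nat \<Rightarrow> rvec \<Rightarrow> real" where
  "row_density L N t x = (\<Prod>s=1..t. std_normal_density (innov N s x) / L s s)"

lemma sum_lower_triangular: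
  fixes A :: "nat \<Rightarrow> nat \<Rightarrow> real"
  assumes "\<And>s. r < s \<Longrightarrow> A r s = 0" "r \<le> t"
  shows "(\<Sum>k=1..t. A r k * y k) = (\<Sum>k=1..r. A r k * y k)"
  by (rule sum.mono_neutral_right) (use assms in auto)

lemma cholesky_tri:
  assumes "cholesky t c S L N" "r < s"
  shows "L r s = 0" "N r s = 0"
  using assms by (auto simp: cholesky_def)

lemma cholesky_inverse:
  assumes "cholesky t c S L N" "r \<in> {1..t}" "s \<in> {1..t}"
  shows "(\<Sum>k=1..t. L r k * N k s) = (if r = s then 1 else 0)" "(\<Sum>k=1..t. N r k * L k s) = (if r = s then 1 else 0)"
  using assms by (simp_all add: cholesky_def)

lemma cholesky_diag_pos:
  assumes "cholesky t c S L N" "c > 0" "r \<in> {1..t}"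
  shows "L r r > 0"
proof -
  have "sqrt c \<le> L r r" using assms(1,3) by (simp add: cholesky_def)
  moreover have "0 < sqrt c" using assms(2) by simp
  ultimately show ?thesis by linarith
qed

lemma cholesky_Suc:
  assumes "cholesky (Suc t) c S L N"
  shows "cholesky t c S L N"
  unfolding cholesky_def
proof (intro conjI allI ballI impI)
  note tri = cholesky_tri[OF assms]
  fix r s :: nat
  show "L r s = 0" "N r s = 0" if "r < s" using tri[OF that] by auto
  show "sqrt c \<le> L r r" if "r \<in> {1..t}" using assms that by (auto simp: cholesky_def)
  assume r: "r \<in> {1..t}" and s: "s \<in> {1..t}"
  then have rs: "r \<in> {1..Suc t}" "s \<in> {1..Suc t}" by auto
  have "S r s = (\<Sum>k=1..Suc t. L r k * L s k)" using assms rs unfolding cholesky_def by blast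
  then show "S r s = (\<Sum>k=1..t. L r k * L s k)" using r tri(1)[of r "Suc t"] by simp
  have "(\<Sum>k=1..Suc t. L r k * N k s) = (if r = s then 1 else 0)" using assms rs unfolding cholesky_def by blast
  then show "(\<Sum>k=1..t. L r k * N k s) = (if r = s then 1 else 0)" using r tri(1)[of r "Suc t"] by simp
  have "(\<Sum>k=1..Suc t. N r k * L k s) = (if r = s then 1 else 0)" using assms rs unfolding cholesky_def by blast
  then show "(\<Sum>k=1..t. N r k * L k s) = (if r = s then 1 else 0)" using r tri(2)[of r "Suc t"] by simp
qed

lemma cholesky_leading:
  assumes "cholesky T c S L N" "t \<le> T"
  shows "cholesky t c S L N"
  using assms(2,1) by (induction t rule: inc_induct) (auto intro: cholesky_Suc)

lemma innov_full:
  assumes "cholesky t c S L N" "s \<in> {1..t}"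
  shows "innov N s x = (\<Sum>r=1..t. N s r * x r)"
  unfolding innov_def using assms by (intro sum_lower_triangular[symmetric]) (auto simp: cholesky_def)

lemma delta_compose:
  fixes A B :: "nat \<Rightarrow> nat \<Rightarrow> real"
  assumes AB: "\<And>k. k \<in> {1..t} \<Longrightarrow> (\<Sum>q=1..t. A s q * B q k) = (if s = k then 1 else 0)" and s: "s \<in> {1..t}"
  shows "(\<Sum>q=1..t. A s q * (\<Sum>k=1..t. B q k * x k)) = x s"
proof -
  have "(\<Sum>q=1..t. A s q * (\<Sum>k=1..t. B q k * x k)) = (\<Sum>k=1..t. (\<Sum>q=1..t. A s q * B q k) * x k)"
    unfolding sum_distrib_left sum_distrib_right by (subst sum.swap) (simp add: mult.assoc)
  also have "\<dots> = (\<Sum>k=1..t. if s = k then x k else 0)"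
    by (intro sum.cong refl) (simp only: AB, simp)
  finally show ?thesis using s by simp
qed

lemma factor_of_innov:
  assumes ch: "cholesky t c S L N" and s: "s \<in> {1..t}"
  shows "(\<Sum>q=1..t. L s q * innov N q x) = x s"
proof -
  have "(\<Sum>q=1..t. L s q * innov N q x) = (\<Sum>q=1..t. L s q * (\<Sum>k=1..t. N q k * x k))"
    by (intro sum.cong refl) (simp only: innov_full[OF ch])
  also have "\<dots> = x s" using ch s by (intro delta_compose) (auto simp: cholesky_def)
  finally show ?thesis .
qed

lemma innov_of_factor:
  assumes ch: "cholesky t c S L N" and s: "s \<in> {1..t}" and x: "\<And>r. r \<in> {1..t} \<Longrightarrow> x r = (\<Sum>k=1..t. L r k * g k)"
  shows "innov N s x = g s"
proof -
  have "innov N s x = (\<Sum>q=1..t. N s q * (\<Sum>k=1..t. L q k * g k))"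
    unfolding innov_full[OF ch s] by (intro sum.cong refl) (simp only: x)
  also have "\<dots> = g s" using ch s by (intro delta_compose) (auto simp: cholesky_def)
  finally show ?thesis .
qed

lemma sets_PiM_lborel: "sets (\<Pi>\<^sub>M s\<in>I. lborel) = sets (\<Pi>\<^sub>M s\<in>I. borel)"
  by (intro sets_PiM_cong) auto

lemma sets_PiM_std: "sets (\<Pi>\<^sub>M s\<in>I. std_normal_distribution) = sets (\<Pi>\<^sub>M s\<in>I. borel)"
  by (intro sets_PiM_cong) auto

lemma innov_measurable [measurable]:
  "s \<le> t \<Longrightarrow> innov N s \<in> borel_measurable (\<Pi>\<^sub>M s\<in>{1..t}. borel)"
  unfolding innov_def[abs_def]
  by (intro borel_measurable_sum borel_measurable_times borel_measurable_const measurable_component_singleton) auto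

lemma row_density_measurable:
  "row_density L N t \<in> borel_measurable (\<Pi>\<^sub>M s\<in>{1..t}. borel)"
  unfolding row_density_def[abs_def]
  by (intro borel_measurable_prod borel_measurable_divide borel_measurable_const measurable_compose[OF innov_measurable borel_measurable_normal_density]) auto

lemma row_density_nonneg:
  assumes "\<And>s. s \<in> {1..t} \<Longrightarrow> L s s \<ge> 0"
  shows "row_density L N t x \<ge> 0"
  unfolding row_density_def by (intro prod_nonneg divide_nonneg_nonneg normal_density_nonneg assms) auto

text \<open>
  The triangular map x = L g is handled one coordinate at a time: with the earlier coordinates
  fixed, the last one is an affine function of the last entry of g.
\<close>

lemma row_density_nn_integral:
  assumes "cholesky t c S L N" "c > 0" "F \<in> borel_measurable (\<Pi>\<^sub>M s\<in>{1..t}. borel)"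
  shows "(\<integral>\<^sup>+x. F x * ennreal (row_density L N t x) \<partial>(\<Pi>\<^sub>M s\<in>{1..t}. lborel))
    = (\<integral>\<^sup>+g. F (\<lambda>s\<in>{1..t}. \<Sum>k=1..s. L s k * g k) \<partial>(\<Pi>\<^sub>M s\<in>{1..t}. std_normal_distribution))"
  using assms
proof (induction t arbitrary: F)
  case 0
  then show ?case by (simp add: row_density_def PiM_empty nn_integral_count_space_finite)
next
  case (Suc t)
  interpret lb: product_sigma_finite "\<lambda>_::nat. lborel::real measure" by standard
  interpret st: product_sigma_finite "\<lambda>_::nat. std_normal_distribution"
    by (simp add: product_sigma_finite_def prob_space_imp_sigma_finite prob_space_std_normal)
  note ch = \<open>cholesky (Suc t) c S L N\<close>
  note ch' = cholesky_Suc[OF ch]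
  note tri = cholesky_tri[OF ch]
  note [measurable_cong] = sets_PiM_lborel sets_PiM_std
  let ?n = "Suc t"
  have ins: "{1..Suc t} = insert ?n {1..t}" by auto
  have F[measurable]: "F \<in> borel_measurable (\<Pi>\<^sub>M s\<in>insert ?n {1..t}. borel)" using Suc.prems(3) unfolding ins .
  define l where "l = L ?n ?n"
  have l: "l > 0" unfolding l_def by (rule cholesky_diag_pos[OF ch \<open>c > 0\<close>]) simp
  define m where "m x = (\<Sum>q=1..t. L ?n q * innov N q x)" for x
  have m_meas[measurable]: "m \<in> borel_measurable (\<Pi>\<^sub>M s\<in>{1..t}. borel)"
    unfolding m_def[abs_def] by (intro borel_measurable_sum borel_measurable_times borel_measurable_const innov_measurable) auto
  have upd[measurable]: "(\<lambda>(x, z). x(?n := m x + l * z)) \<in> (\<Pi>\<^sub>M s\<in>{1..t}. borel) \<Otimes>\<^sub>M borel \<rightarrow>\<^sub>M (\<Pi>\<^sub>M s\<in>insert ?n {1..t}. borel)"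
    unfolding case_prod_beta
  proof (rule measurable_fun_upd[where J="{1..t}"])
    show "insert ?n {1..t} = {1..t} \<union> {?n}" by auto
    show "(\<lambda>p. m (fst p) + l * snd p) \<in> borel_measurable ((\<Pi>\<^sub>M s\<in>{1..t}. borel) \<Otimes>\<^sub>M borel)"
      by (intro borel_measurable_add borel_measurable_times borel_measurable_const measurable_compose[OF measurable_fst m_meas] measurable_snd)
  qed (rule measurable_fst)
  define F' where "F' x = (\<integral>\<^sup>+z. F (x(?n := m x + l * z)) \<partial>std_normal_distribution)" for x
  have F'[measurable]: "F' \<in> borel_measurable (\<Pi>\<^sub>M s\<in>{1..t}. borel)"
    unfolding F'_def[abs_def]
    by (rule sigma_finite_measure.borel_measurable_nn_integral[OF prob_space_imp_sigma_finite[OF prob_space_std_normal]])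
      (use measurable_compose[OF upd F] in \<open>simp add: case_prod_unfold\<close>)
  have innov_upd: "innov N s (x(?n := y)) = innov N s x" if "s \<le> t" for s x y
    unfolding innov_def using that by (intro sum.cong) auto
  have rd: "row_density L N ?n (x(?n := m x + l * z)) = row_density L N t x * (std_normal_density z / l)" for x z
  proof -
    have NL: "N ?n ?n * l = 1"
    proof -
      have "(\<Sum>k=1..?n. N ?n k * L k ?n) = 1" using cholesky_inverse(2)[OF ch, of ?n ?n] by simp
      moreover have "(\<Sum>k=1..t. N ?n k * L k ?n) = 0" by (intro sum.neutral) (auto simp: tri)
      ultimately show ?thesis by (simp add: l_def)
    qed
    have Nm: "N ?n ?n * m x = - (\<Sum>k=1..t. N ?n k * x k)"
    proof -
      have "N ?n ?n * m x = (\<Sum>q=1..t. (N ?n ?n * L ?n q) * innov N q x)"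
        by (simp add: m_def sum_distrib_left mult.assoc)
      also have "\<dots> = (\<Sum>q=1..t. (- (\<Sum>k=1..t. N ?n k * L k q)) * innov N q x)"
      proof (intro sum.cong refl)
        fix q assume q: "q \<in> {1..t}"
        have "(\<Sum>k=1..?n. N ?n k * L k q) = 0" using cholesky_inverse(2)[OF ch, of ?n q] q by simp
        then have "N ?n ?n * L ?n q = - (\<Sum>k=1..t. N ?n k * L k q)" by simp
        then show "(N ?n ?n * L ?n q) * innov N q x = (- (\<Sum>k=1..t. N ?n k * L k q)) * innov N q x" by simp
      qed
      also have "\<dots> = - (\<Sum>q=1..t. \<Sum>k=1..t. N ?n k * (L k q * innov N q x))"
        by (simp add: sum_negf sum_distrib_right mult.assoc)
      also have "\<dots> = - (\<Sum>k=1..t. N ?n k * (\<Sum>q=1..t. L k q * innov N q x))"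
        by (subst sum.swap) (simp add: sum_distrib_left)
      also have "\<dots> = - (\<Sum>k=1..t. N ?n k * x k)"
        by (intro arg_cong[where f=uminus] sum.cong refl) (simp only: factor_of_innov[OF ch'])
      finally show ?thesis .
    qed
    have "innov N ?n (x(?n := m x + l * z)) = (\<Sum>k=1..t. N ?n k * x k) + N ?n ?n * (m x + l * z)"
    proof -
      have "(\<Sum>k=1..t. N ?n k * (x(?n := m x + l * z)) k) = (\<Sum>k=1..t. N ?n k * x k)"
        by (intro sum.cong) auto
      then show ?thesis by (simp add: innov_def)
    qed
    also have "\<dots> = N ?n ?n * l * z" unfolding distrib_left Nm by simp
    finally have "innov N ?n (x(?n := m x + l * z)) = z" using NL by simp
    moreover have "row_density L N t (x(?n := m x + l * z)) = row_density L N t x"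
      unfolding row_density_def by (intro prod.cong refl) (simp add: innov_upd)
    ultimately show ?thesis by (simp add: row_density_def l_def)
  qed
  have rdn: "row_density L N t x \<ge> 0" for x
    using cholesky_diag_pos[OF ch' \<open>c > 0\<close>] by (intro row_density_nonneg) (auto intro: less_imp_le)
  note [measurable] = row_density_measurable
  have inner: "(\<integral>\<^sup>+y. F (x(?n := y)) * ennreal (row_density L N ?n (x(?n := y))) \<partial>lborel) = F' x * ennreal (row_density L N t x)"
    if x: "x \<in> space (\<Pi>\<^sub>M s\<in>{1..t}. borel)" for x
  proof -
    have um: "(\<lambda>y. x(?n := y)) \<in> borel \<rightarrow>\<^sub>M (\<Pi>\<^sub>M s\<in>insert ?n {1..t}. borel)"
      by (rule measurable_fun_upd[where J="{1..t}"]) (use x in auto)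
    have rdm: "row_density L N ?n \<in> borel_measurable (\<Pi>\<^sub>M s\<in>insert ?n {1..t}. borel)"
      using row_density_measurable[of L N ?n] unfolding ins .
    have m1: "(\<lambda>y. F (x(?n := y)) * ennreal (row_density L N ?n (x(?n := y)))) \<in> borel_measurable borel"
      by (intro borel_measurable_times_ennreal measurable_compose[OF um F] measurable_compose[OF measurable_compose[OF um rdm] measurable_ennreal])
    have m2: "(\<lambda>z. F (x(?n := m x + l * z))) \<in> borel_measurable borel"
      by (rule measurable_compose[OF _ measurable_compose[OF um F]]) simp
    have "(\<integral>\<^sup>+y. F (x(?n := y)) * ennreal (row_density L N ?n (x(?n := y))) \<partial>lborel)
       = ennreal l * (\<integral>\<^sup>+z. F (x(?n := m x + l * z)) * ennreal (row_density L N t x * (std_normal_density z / l)) \<partial>lborel)"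
      using l by (subst nn_integral_real_affine[where c=l and t="m x", OF m1]) (auto simp: rd)
    also have "\<dots> = (\<integral>\<^sup>+z. ennreal l * (F (x(?n := m x + l * z)) * ennreal (row_density L N t x * (std_normal_density z / l))) \<partial>lborel)"
      using m2 by (intro nn_integral_cmult[symmetric]) simp
    also have "\<dots> = (\<integral>\<^sup>+z. ennreal (row_density L N t x) * (ennreal (std_normal_density z) * F (x(?n := m x + l * z))) \<partial>lborel)"
    proof (intro nn_integral_cong)
      fix z
      have e: "ennreal l * ennreal (row_density L N t x * (std_normal_density z / l)) = ennreal (row_density L N t x) * ennreal (std_normal_density z)"
        using l rdn by (simp add: ennreal_mult[symmetric])
      have "a * (G * b) = c * (d * G)" if "a * b = c * d" for a b c d G :: ennreal
        using that by (metis mult.assoc mult.commute)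
      from this[OF e] show "ennreal l * (F (x(?n := m x + l * z)) * ennreal (row_density L N t x * (std_normal_density z / l))) = ennreal (row_density L N t x) * (ennreal (std_normal_density z) * F (x(?n := m x + l * z)))" .
    qed
    also have "\<dots> = ennreal (row_density L N t x) * (\<integral>\<^sup>+z. ennreal (std_normal_density z) * F (x(?n := m x + l * z)) \<partial>lborel)"
      using m2 by (intro nn_integral_cmult) simp
    also have "(\<integral>\<^sup>+z. ennreal (std_normal_density z) * F (x(?n := m x + l * z)) \<partial>lborel) = F' x"
      unfolding F'_def using m2 by (intro nn_integral_density[symmetric]) auto
    finally show ?thesis by (simp only: mult.commute[of "F' x"])
  qed
  have "(\<integral>\<^sup>+x. F x * ennreal (row_density L N ?n x) \<partial>(\<Pi>\<^sub>M s\<in>{1..?n}. lborel))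
     = (\<integral>\<^sup>+x. (\<integral>\<^sup>+y. F (x(?n := y)) * ennreal (row_density L N ?n (x(?n := y))) \<partial>lborel) \<partial>(\<Pi>\<^sub>M s\<in>{1..t}. lborel))"
    unfolding ins
  proof (rule lb.product_nn_integral_insert)
    show "(\<lambda>x. F x * ennreal (row_density L N ?n x)) \<in> borel_measurable (\<Pi>\<^sub>M s\<in>insert ?n {1..t}. lborel)"
      unfolding measurable_cong_sets[OF sets_PiM_lborel refl]
      using F row_density_measurable[of L N ?n] unfolding ins by measurable
  qed auto
  also have "\<dots> = (\<integral>\<^sup>+x. F' x * ennreal (row_density L N t x) \<partial>(\<Pi>\<^sub>M s\<in>{1..t}. lborel))"
    by (intro nn_integral_cong inner) (simp add: space_PiM)
  also have "\<dots> = (\<integral>\<^sup>+g. F' (\<lambda>s\<in>{1..t}. \<Sum>k=1..s. L s k * g k) \<partial>(\<Pi>\<^sub>M s\<in>{1..t}. std_normal_distribution))"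
    by (rule Suc.IH[OF ch' \<open>c > 0\<close> F'])
  also have "\<dots> = (\<integral>\<^sup>+g. (\<integral>\<^sup>+z. F (\<lambda>s\<in>{1..?n}. \<Sum>k=1..s. L s k * (g(?n := z)) k) \<partial>std_normal_distribution) \<partial>(\<Pi>\<^sub>M s\<in>{1..t}. std_normal_distribution))"
    unfolding F'_def
  proof (intro nn_integral_cong arg_cong[where f=F] ext)
    fix g z s
    let ?x = "\<lambda>s\<in>{1..t}. \<Sum>k=1..s. L s k * g k"
    have "innov N q ?x = g q" if q: "q \<in> {1..t}" for q
    proof (rule innov_of_factor[OF ch' q])
      fix r assume r: "r \<in> {1..t}"
      then have "(\<Sum>k=1..t. L r k * g k) = (\<Sum>k=1..r. L r k * g k)"
        by (intro sum_lower_triangular tri(1)) auto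
      then show "?x r = (\<Sum>k=1..t. L r k * g k)" using r by simp
    qed
    then have "m ?x = (\<Sum>q=1..t. L ?n q * g q)" unfolding m_def by (intro sum.cong) auto
    moreover have "(\<Sum>k=1..s. L s k * (g(?n := z)) k) = (\<Sum>k=1..s. L s k * g k)" if "s \<le> t"
      using that by (intro sum.cong) auto
    moreover have "(\<Sum>k=1..t. L ?n k * (g(?n := z)) k) = (\<Sum>k=1..t. L ?n k * g k)"
      by (intro sum.cong) auto
    ultimately show "(?x(?n := m ?x + l * z)) s = (\<lambda>s\<in>{1..?n}. \<Sum>k=1..s. L s k * (g(?n := z)) k) s"
      by (cases "s = ?n"; cases "s \<in> {1..t}") (auto simp: l_def)
  qed
  also have "\<dots> = (\<integral>\<^sup>+g. F (\<lambda>s\<in>{1..?n}. \<Sum>k=1..s. L s k * g k) \<partial>(\<Pi>\<^sub>M s\<in>{1..?n}. std_normal_distribution))"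
    unfolding ins
  proof (rule st.product_nn_integral_insert[symmetric])
    have "(\<lambda>g. \<lambda>s\<in>insert ?n {1..t}. \<Sum>k=1..s. L s k * g k) \<in> (\<Pi>\<^sub>M s\<in>insert ?n {1..t}. borel) \<rightarrow>\<^sub>M (\<Pi>\<^sub>M s\<in>insert ?n {1..t}. borel)"
      by (intro measurable_restrict borel_measurable_sum borel_measurable_times borel_measurable_const measurable_component_singleton) auto
    from measurable_compose[OF this F]
    show "(\<lambda>g. F (\<lambda>s\<in>insert ?n {1..t}. \<Sum>k=1..s. L s k * g k)) \<in> borel_measurable (\<Pi>\<^sub>M s\<in>insert ?n {1..t}. std_normal_distribution)"
      unfolding measurable_cong_sets[OF sets_PiM_std refl] .
  qed auto
  finally show ?case .
qed

lemma PiM_density: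
  fixes f :: "'i \<Rightarrow> 'a \<Rightarrow> ennreal"
  assumes I: "finite I" and M: "\<And>i. sigma_finite_measure (M i)"
    and f: "\<And>i. f i \<in> borel_measurable (M i)" and d: "\<And>i. sigma_finite_measure (density (M i) (f i))"
  shows "(\<Pi>\<^sub>M i\<in>I. density (M i) (f i)) = density (PiM I M) (\<lambda>x. \<Prod>i\<in>I. f i (x i))"
proof (rule product_sigma_finite.PiM_eqI[symmetric])
  interpret product_sigma_finite M using M by (simp add: product_sigma_finite_def)
  show "product_sigma_finite (\<lambda>i. density (M i) (f i))" using d by (simp add: product_sigma_finite_def)
  show "sets (density (PiM I M) (\<lambda>x. \<Prod>i\<in>I. f i (x i))) = sets (\<Pi>\<^sub>M i\<in>I. density (M i) (f i))"
    unfolding sets_density by (intro sets_PiM_cong refl sets_density[symmetric])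
  fix A assume "\<And>i. i \<in> I \<Longrightarrow> A i \<in> sets (density (M i) (f i))"
  then have A: "\<And>i. i \<in> I \<Longrightarrow> A i \<in> sets (M i)" by simp
  have m: "(\<lambda>x. \<Prod>i\<in>I. f i (x i)) \<in> borel_measurable (PiM I M)"
  proof (rule borel_measurable_prod_ennreal)
    fix i assume i: "i \<in> I"
    show "(\<lambda>x. f i (x i)) \<in> borel_measurable (PiM I M)"
      by (rule measurable_compose[OF measurable_component_singleton[OF i], where g="f i"]) (rule f)
  qed
  have "emeasure (density (PiM I M) (\<lambda>x. \<Prod>i\<in>I. f i (x i))) (Pi\<^sub>E I A)
    = (\<integral>\<^sup>+x. (\<Prod>i\<in>I. f i (x i)) * indicator (Pi\<^sub>E I A) x \<partial>PiM I M)"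
    using A I by (intro emeasure_density m sets_PiM_I_finite) auto
  also have "\<dots> = (\<integral>\<^sup>+x. (\<Prod>i\<in>I. f i (x i) * indicator (A i) (x i)) \<partial>PiM I M)"
  proof (intro nn_integral_cong)
    fix x assume "x \<in> space (PiM I M)"
    then have "indicator (Pi\<^sub>E I A) x = (\<Prod>i\<in>I. indicator (A i) (x i) :: ennreal)"
      using I by (auto simp: indicator_def PiE_iff space_PiM prod.If_cases)
    then show "(\<Prod>i\<in>I. f i (x i)) * indicator (Pi\<^sub>E I A) x = (\<Prod>i\<in>I. f i (x i) * indicator (A i) (x i))"
      by (simp add: prod.distrib)
  qed
  also have "\<dots> = (\<Prod>i\<in>I. \<integral>\<^sup>+y. f i y * indicator (A i) y \<partial>M i)"
    using A f I by (intro product_nn_integral_prod) auto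
  also have "\<dots> = (\<Prod>i\<in>I. emeasure (density (M i) (f i)) (A i))"
    using A f by (intro prod.cong refl emeasure_density[symmetric]) auto
  finally show "emeasure (density (PiM I M) (\<lambda>x. \<Prod>i\<in>I. f i (x i))) (Pi\<^sub>E I A) = (\<Prod>i\<in>I. emeasure (density (M i) (f i)) (A i))" .
qed (use I in auto)

definition entries :: "real mat \<Rightarrow> nat \<Rightarrow> nat \<Rightarrow> real" where
  "entries S r s = S $$ (r - 1, s - 1)"

lemma has_factor_cholesky:
  assumes S: "S \<in> carrier_mat t t" and ch: "cholesky t c (entries S) L N"
  shows "has_factor t S"
  unfolding has_factor_def
proof (intro conjI bexI)
  let ?A = "mat t t (\<lambda>(i,j). L (Suc i) (Suc j))"
  show "dim_row S = t" using S by simp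
  show "?A * transpose_mat ?A = S"
  proof (rule eq_matI)
    fix i j assume "i < dim_row S" "j < dim_col S"
    then have ij: "i < t" "j < t" using S by auto
    have "(?A * transpose_mat ?A) $$ (i,j) = (\<Sum>k=0..<t. L (Suc i) (Suc k) * L (Suc j) (Suc k))"
      using ij by (auto simp: scalar_prod_def intro!: sum.cong)
    also have "\<dots> = (\<Sum>k=1..t. L (Suc i) k * L (Suc j) k)"
      by (subst sum_shift1) (intro sum.cong; simp)
    also have "\<dots> = entries S (Suc i) (Suc j)" using ch ij by (simp add: cholesky_def)
    finally show "(?A * transpose_mat ?A) $$ (i,j) = S $$ (i,j)" by (simp add: entries_def)
  qed (use S in auto)
qed simp

text \<open>
  The Cholesky factor L gives one factor of S, and the transform does not distinguish it from the
  one in the definition, so S has the law of L g, whose density the preceding lemmas compute.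
\<close>

lemma gauss_density:
  assumes S: "S \<in> carrier_mat t t" and ch: "cholesky t c (entries S) L N" and c: "c > 0"
  shows "gauss S = density (\<Pi>\<^sub>M s\<in>{1..t}. lborel) (\<lambda>x. ennreal (row_density L N t x))"
proof -
  let ?P = "\<Pi>\<^sub>M s\<in>{1..t}. std_normal_distribution" and ?B = "\<Pi>\<^sub>M s\<in>{1..t}. borel :: real measure"
  let ?L = "\<lambda>g. \<lambda>s\<in>{1..t}. \<Sum>k=1..s. L s k * g k"
  have hf: "has_factor t S" by (rule has_factor_cholesky[OF S ch])
  have Lm: "?L \<in> measurable ?P ?B"
    unfolding measurable_cong_sets[OF sets_PiM_std refl]
    by (intro measurable_restrict borel_measurable_sum borel_measurable_times borel_measurable_const measurable_component_singleton) auto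
  have "gauss S = distr ?P ?B ?L"
  proof (rule measure_eqI_char[where I="{1..t}" and S="?B" and X="\<lambda>s x. x s" and r="\<lambda>x. x"])
    show "sets (gauss S) = sets ?B" using S by (intro sets_gauss) auto
    show "prob_space (distr ?P ?B ?L)"
      by (intro prob_space.prob_space_distr prob_space_PiM prob_space_std_normal Lm)
    show "(\<lambda>i\<in>{1..t}. x i) = x" if "x \<in> space ?B" for x
      using that by (simp add: space_PiM PiE_def extensional_restrict)
    fix \<theta>
    have "(\<lambda>x. \<Sum>s=1..t. \<theta> s * x s) \<in> borel_measurable ?B"
      by (intro borel_measurable_sum borel_measurable_times borel_measurable_const measurable_component_singleton)
    then have "(\<lambda>x. iexp (\<Sum>s=1..t. \<theta> s * x s)) \<in> borel_measurable ?B"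
      by (rule measurable_compose[where g="\<lambda>y. iexp y"]) simp
    then have "(CLINT x|distr ?P ?B ?L. iexp (\<Sum>s=1..t. \<theta> s * x s)) = (CLINT g|?P. iexp (\<Sum>s=1..t. \<theta> s * ?L g s))"
      by (rule integral_distr[OF Lm])
    also have "\<dots> = (CLINT g|?P. iexp (\<Sum>k=1..t. (\<Sum>s=1..t. \<theta> s * L s k) * g k))"
    proof -
      have "(\<Sum>s=1..t. \<theta> s * ?L g s) = (\<Sum>k=1..t. (\<Sum>s=1..t. \<theta> s * L s k) * g k)" for g
      proof -
        have "(\<Sum>s=1..t. \<theta> s * ?L g s) = (\<Sum>s=1..t. \<Sum>k=1..t. \<theta> s * L s k * g k)"
        proof (intro sum.cong refl)
          fix s assume s: "s \<in> {1..t}"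
          then have "(\<Sum>k=1..t. L s k * g k) = (\<Sum>k=1..s. L s k * g k)"
            by (intro sum_lower_triangular cholesky_tri[OF ch]) auto
          then show "\<theta> s * ?L g s = (\<Sum>k=1..t. \<theta> s * L s k * g k)" using s by (simp add: sum_distrib_left[symmetric] mult.assoc)
        qed
        also have "\<dots> = (\<Sum>k=1..t. (\<Sum>s=1..t. \<theta> s * L s k) * g k)"
          unfolding sum_distrib_right by (rule sum.swap)
        finally show ?thesis .
      qed
      then show ?thesis by simp
    qed
    also have "\<dots> = complex_of_real (exp (- (\<Sum>k=1..t. (\<Sum>s=1..t. \<theta> s * L s k)\<^sup>2) / 2))"
      by (rule PiM_std_normal_char) simp
    also have "(\<Sum>k=1..t. (\<Sum>s=1..t. \<theta> s * L s k)\<^sup>2) = quad t S \<theta>"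
      by (rule quad_factor[symmetric]) (use ch in \<open>auto simp: cholesky_def entries_def\<close>)
    finally show "(CLINT x|gauss S. iexp (\<Sum>s=1..t. \<theta> s * x s)) = (CLINT x|distr ?P ?B ?L. iexp (\<Sum>s=1..t. \<theta> s * x s))"
      by (simp only: gauss_char[OF hf])
  qed (use prob_space_gauss in auto)
  also have "\<dots> = density (\<Pi>\<^sub>M s\<in>{1..t}. lborel) (\<lambda>x. ennreal (row_density L N t x))"
  proof (rule measure_eqI)
    show "sets (distr ?P ?B ?L) = sets (density (\<Pi>\<^sub>M s\<in>{1..t}. lborel) (\<lambda>x. ennreal (row_density L N t x)))"
      by (simp add: sets_PiM_lborel)
    fix A assume "A \<in> sets (distr ?P ?B ?L)"
    then have A: "A \<in> sets ?B" by simp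
    have rm: "(\<lambda>x. ennreal (row_density L N t x)) \<in> borel_measurable (\<Pi>\<^sub>M s\<in>{1..t}. lborel)"
      unfolding measurable_cong_sets[OF sets_PiM_lborel refl]
      by (rule measurable_compose[OF row_density_measurable measurable_ennreal])
    have "emeasure (density (\<Pi>\<^sub>M s\<in>{1..t}. lborel) (\<lambda>x. ennreal (row_density L N t x))) A
       = (\<integral>\<^sup>+x. indicator A x * ennreal (row_density L N t x) \<partial>(\<Pi>\<^sub>M s\<in>{1..t}. lborel))"
      using A by (subst emeasure_density[OF rm]) (simp_all add: sets_PiM_lborel mult.commute)
    also have "\<dots> = (\<integral>\<^sup>+g. indicator A (?L g) \<partial>?P)"
      by (rule row_density_nn_integral[OF ch c]) (use A in simp)
    also have "\<dots> = (\<integral>\<^sup>+x. indicator A x \<partial>distr ?P ?B ?L)"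
      by (rule nn_integral_distr[OF Lm, symmetric]) (use A in simp)
    also have "\<dots> = emeasure (distr ?P ?B ?L) A" using A by simp
    finally show "emeasure (distr ?P ?B ?L) A = emeasure (density (\<Pi>\<^sub>M s\<in>{1..t}. lborel) (\<lambda>x. ennreal (row_density L N t x))) A" by simp
  qed
  finally show ?thesis .
qed

lemma gauss_rows_density:
  assumes S: "S \<in> carrier_mat t t" and ch: "cholesky t c (entries S) L N" and c: "c > 0"
  shows "gauss_rows n S = density (mat_lborel n t) (\<lambda>x. ennreal (\<Prod>i=1..n. row_density L N t (x i)))"
proof -
  interpret lb: product_sigma_finite "\<lambda>_::nat. lborel::real measure" by standard
  have rdn: "row_density L N t x \<ge> 0" for x
    using cholesky_diag_pos[OF ch c] by (intro row_density_nonneg) (auto intro: less_imp_le)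
  have "gauss_rows n S = density (mat_lborel n t) (\<lambda>x. \<Prod>i\<in>{1..n}. ennreal (row_density L N t (x i)))"
    unfolding gauss_rows_def mat_lborel_def gauss_density[OF S ch c]
  proof (rule PiM_density)
    show "sigma_finite_measure (\<Pi>\<^sub>M s\<in>{1..t}. lborel :: real measure)" by (rule lb.sigma_finite) simp
    show "(\<lambda>x. ennreal (row_density L N t x)) \<in> borel_measurable (\<Pi>\<^sub>M s\<in>{1..t}. lborel)"
      unfolding measurable_cong_sets[OF sets_PiM_lborel refl]
      by (rule measurable_compose[OF row_density_measurable measurable_ennreal])
    show "sigma_finite_measure (density (\<Pi>\<^sub>M s\<in>{1..t}. lborel) (\<lambda>x. ennreal (row_density L N t x)))"
      unfolding gauss_density[OF S ch c, symmetric] by (rule prob_space_imp_sigma_finite[OF prob_space_gauss])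
  qed simp
  then show ?thesis by (simp add: prod_ennreal rdn)
qed

section \<open>Smooth compactly supported functions\<close>

text \<open>
  Every function of the form p(1/y) exp(-1/y), extended by 0 to the left of 0, has a derivative
  of the same form, which makes exp(-1/y) smooth.
\<close>

definition flat_exp :: "real poly \<Rightarrow> real \<Rightarrow> real" where
  "flat_exp p y = (if y > 0 then poly p (1 / y) * exp (- (1 / y)) else 0)"

primrec flat_poly :: "nat \<Rightarrow> real poly" where
  "flat_poly 0 = 1"
| "flat_poly (Suc k) = [:0, 0, 1:] * (flat_poly k - pderiv (flat_poly k))"

lemma power_exp_minus_le: "0 \<le> u \<Longrightarrow> u ^ k * exp (- u) \<le> fact k" for u :: real
proof -
  assume u: "0 \<le> u"
  have "(\<Sum>n\<in>{k}. u ^ n /\<^sub>R fact n) \<le> suminf (\<lambda>n. u ^ n /\<^sub>R fact n)"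
    using u by (intro sum_le_suminf summable_exp_generic) auto
  then have "u ^ k / fact k \<le> exp u" by (simp add: exp_def divide_inverse mult.commute)
  then have "u ^ k \<le> fact k * exp u" by (simp add: field_simps)
  then show ?thesis by (simp add: exp_minus field_simps)
qed

lemma poly_exp_minus_bounded: "\<exists>C. \<forall>u\<ge>0. \<bar>poly p u * exp (- u)\<bar> \<le> (C::real)"
proof (intro exI allI impI)
  fix u :: real assume u: "u \<ge> 0"
  have "\<bar>poly p u * exp (- u)\<bar> = \<bar>\<Sum>i\<le>degree p. coeff p i * (u ^ i * exp (- u))\<bar>"
    by (simp add: poly_altdef sum_distrib_right mult.assoc)
  also have "\<dots> \<le> (\<Sum>i\<le>degree p. \<bar>coeff p i\<bar> * fact i)"
    by (intro order_trans[OF sum_abs] sum_mono)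
       (use u power_exp_minus_le[OF u] in \<open>auto simp: abs_mult intro!: mult_left_mono\<close>)
  finally show "\<bar>poly p u * exp (- u)\<bar> \<le> (\<Sum>i\<le>degree p. \<bar>coeff p i\<bar> * fact i)" .
qed

lemma flat_deriv: "(flat_exp p has_real_derivative flat_exp ([:0, 0, 1:] * (p - pderiv p)) y) (at y)"
proof -
  consider "y > 0" | "y < 0" | "y = 0" by linarith
  then show ?thesis
  proof cases
    case 1
    have "((\<lambda>y. poly p (1 / y) * exp (- (1 / y))) has_real_derivative
        flat_exp ([:0, 0, 1:] * (p - pderiv p)) y) (at y)"
      using 1 by (auto intro!: derivative_eq_intros DERIV_chain'[where g="poly p" and f="\<lambda>y. 1 / y"] poly_DERIV
          simp: flat_exp_def field_simps power2_eq_square)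
    then show ?thesis
      by (rule has_field_derivative_transform_within_open[where S="{0<..}"]) (use 1 in \<open>auto simp: flat_exp_def\<close>)
  next
    case 2
    have "((\<lambda>y. 0) has_real_derivative flat_exp ([:0, 0, 1:] * (p - pderiv p)) y) (at y)"
      using 2 by (auto simp: flat_exp_def)
    then show ?thesis
      by (rule has_field_derivative_transform_within_open[where S="{..<0}"]) (use 2 in \<open>auto simp: flat_exp_def\<close>)
  next
    case 3
    obtain C where C: "\<And>u. u \<ge> 0 \<Longrightarrow> \<bar>poly ([:0, 0, 1:] * p) u * exp (- u)\<bar> \<le> C"
      using poly_exp_minus_bounded by meson
    have C0: "C \<ge> 0" using C[of 0] by simp
    have b: "\<bar>flat_exp p h\<bar> \<le> C * h\<^sup>2" for h
    proof (cases "h > 0")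
      case True
      define Q where "Q = poly ([:0, 0, 1:] * p) (1 / h) * exp (- (1 / h))"
      have "flat_exp p h = Q * h\<^sup>2"
        unfolding Q_def using True by (simp add: flat_exp_def field_simps power2_eq_square)
      moreover have "\<bar>Q\<bar> \<le> C" unfolding Q_def using True by (intro C) simp
      ultimately show ?thesis by (simp add: abs_mult mult_right_mono)
    qed (use C0 in \<open>auto simp: flat_exp_def\<close>)
    have "(\<lambda>h. (flat_exp p (0 + h) - flat_exp p 0) / h) \<midarrow>0\<rightarrow> 0"
    proof (rule Lim_null_comparison)
      show "\<forall>\<^sub>F h in at 0. norm ((flat_exp p (0 + h) - flat_exp p 0) / h) \<le> C * \<bar>h\<bar>"
      proof (rule eventually_at_ball'[of 1, THEN eventually_mono])
        fix h :: real assume "h \<in> ball 0 1 \<and> h \<noteq> 0 \<and> h \<in> UNIV"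
        then have h: "h \<noteq> 0" by simp
        have "norm ((flat_exp p (0 + h) - flat_exp p 0) / h) = \<bar>flat_exp p h\<bar> / \<bar>h\<bar>" by (simp add: flat_exp_def)
        also have "\<dots> \<le> C * h\<^sup>2 / \<bar>h\<bar>" using b by (intro divide_right_mono) auto
        also have "\<dots> = C * \<bar>h\<bar>" using h by (simp add: power2_eq_square field_simps)
        finally show "norm ((flat_exp p (0 + h) - flat_exp p 0) / h) \<le> C * \<bar>h\<bar>" .
      qed simp
      have "(\<lambda>h. C * \<bar>h\<bar>) \<midarrow>0\<rightarrow> C * \<bar>0\<bar>" by (intro tendsto_intros)
      then show "(\<lambda>h. C * \<bar>h\<bar>) \<midarrow>0\<rightarrow> 0" by simp
    qed
    then show ?thesis using 3 by (simp add: has_field_derivative_iff flat_exp_def)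
  qed
qed

lemma flat_poly_deriv: "(flat_exp (flat_poly k) has_real_derivative flat_exp (flat_poly (Suc k)) y) (at y)"
  unfolding flat_poly.simps by (rule flat_deriv)

text \<open>
  A class of functions that contains the partial derivatives of its members, so that membership
  already implies smoothness. In the last clause each D k is differentiable with derivative D (k + 1),
  so this is composition with a smooth function of one variable.
\<close>

inductive smooth_expr :: "nat \<Rightarrow> nat \<Rightarrow> (rmat \<Rightarrow> real) \<Rightarrow> bool" for n t where
  const: "smooth_expr n t (\<lambda>x. c)"
| entry: "i \<in> {1..n} \<Longrightarrow> s \<in> {1..t} \<Longrightarrow> smooth_expr n t (\<lambda>x. x i s)"
| add: "smooth_expr n t a \<Longrightarrow> smooth_expr n t b \<Longrightarrow> smooth_expr n t (\<lambda>x. a x + b x)"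
| mult: "smooth_expr n t a \<Longrightarrow> smooth_expr n t b \<Longrightarrow> smooth_expr n t (\<lambda>x. a x * b x)"
| comp: "(\<And>k y. (D k has_real_derivative D (Suc k) y) (at y)) \<Longrightarrow> smooth_expr n t a \<Longrightarrow> smooth_expr n t (\<lambda>x. D (k::nat) (a x))"

lemma smooth_expr_sum:
  assumes "\<And>k. k \<in> I \<Longrightarrow> smooth_expr n t (a k)"
  shows "smooth_expr n t (\<lambda>x. \<Sum>k\<in>I. a k x)"
  using assms by (induction I rule: infinite_finite_induct) (auto intro: smooth_expr.intros)

lemma continuous_on_smooth_expr: "smooth_expr n t a \<Longrightarrow> continuous_on UNIV a"
proof (induction rule: smooth_expr.induct)
  case (entry i s)
  have "continuous_on UNIV (\<lambda>x :: rmat. x i)" by (rule continuous_on_product_coordinates)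
  then show ?case by (rule continuous_on_product_then_coordinatewise)
next
  case (comp D a k)
  have "isCont (D k) y" for y using comp(1)[of k y] by (rule DERIV_isCont)
  then have "continuous_on UNIV (D k)" by (simp add: continuous_at_imp_continuous_on)
  from continuous_on_compose2[OF this comp(3)] show ?case by simp
qed (auto intro: continuous_intros)

lemma smooth_expr_partial:
  assumes "smooth_expr n t a" "i \<in> {1..n}" "s \<in> {1..t}"
  shows "\<exists>a'. has_partial n t i s a a' \<and> smooth_expr n t a'"
  using assms
proof (induction rule: smooth_expr.induct)
  case (const c)
  then show ?case
    by (intro exI[of _ "\<lambda>x. 0"]) (auto simp: has_partial_def intro: smooth_expr.const)
next
  case (entry j r)
  have "((\<lambda>h. (x(i := (x i)(s := h))) j r) has_real_derivative (if j = i \<and> r = s then 1 else 0)) (at (x i s))" for x :: rmat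
    by (cases "j = i"; cases "r = s") auto
  then show ?case
    by (intro exI[of _ "\<lambda>x. if j = i \<and> r = s then 1 else 0"] conjI smooth_expr.const) (auto simp only: has_partial_def)
next
  case (add a b)
  then obtain a' b' where "has_partial n t i s a a'" "smooth_expr n t a'" "has_partial n t i s b b'" "smooth_expr n t b'" by blast
  then show ?case
    by (intro exI[of _ "\<lambda>x. a' x + b' x"]) (auto simp: has_partial_def intro: smooth_expr.add DERIV_add)
next
  case (mult a b)
  then obtain a' b' where *: "has_partial n t i s a a'" "smooth_expr n t a'" "has_partial n t i s b b'" "smooth_expr n t b'" by blast
  have "has_partial n t i s (\<lambda>x. a x * b x) (\<lambda>x. a' x * b x + b' x * a x)"
    unfolding has_partial_def
  proof
    fix x assume x: "x \<in> space (matrices n t)"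
    let ?y = "\<lambda>h. x(i := (x i)(s := h))"
    have "((\<lambda>h. a (?y h)) has_real_derivative a' x) (at (x i s))" "((\<lambda>h. b (?y h)) has_real_derivative b' x) (at (x i s))"
      using * x by (auto simp: has_partial_def)
    from DERIV_mult[OF this]
    show "((\<lambda>h. a (?y h) * b (?y h)) has_real_derivative a' x * b x + b' x * a x) (at (x i s))" by simp
  qed
  moreover have "smooth_expr n t (\<lambda>x. a' x * b x + b' x * a x)"
    using * mult by (intro smooth_expr.add smooth_expr.mult)
  ultimately show ?case by blast
next
  case (comp D a k)
  then obtain a' where *: "has_partial n t i s a a'" "smooth_expr n t a'" by blast
  have "has_partial n t i s (\<lambda>x. D k (a x)) (\<lambda>x. D (Suc k) (a x) * a' x)"
    unfolding has_partial_def
  proof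
    fix x assume x: "x \<in> space (matrices n t)"
    let ?y = "\<lambda>h. x(i := (x i)(s := h))"
    have "((\<lambda>h. a (?y h)) has_real_derivative a' x) (at (x i s))" using * x by (auto simp: has_partial_def)
    moreover have "(D k has_real_derivative D (Suc k) (a x)) (at (a (?y (x i s))))" using comp(1)[of k "a x"] by simp
    ultimately show "((\<lambda>h. D k (a (?y h))) has_real_derivative D (Suc k) (a x) * a' x) (at (x i s))"
      by (rule DERIV_chain2[rotated])
  qed
  moreover have "smooth_expr n t (\<lambda>x. D (Suc k) (a x) * a' x)"
    by (rule smooth_expr.mult[OF _ *(2)], rule smooth_expr.comp) (fact comp)+
  ultimately show ?case by blast
qed

lemma smooth_expr_C_k: "smooth_expr n t a \<Longrightarrow> C_k n t k a"
proof (induction k arbitrary: a)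
  case 0
  show ?case unfolding C_k.simps by (rule continuous_on_subset[OF continuous_on_smooth_expr[OF 0] subset_UNIV])
next
  case (Suc k)
  show ?case unfolding C_k.simps
  proof (intro conjI ballI)
    show "continuous_on (space (matrices n t)) a"
      by (rule continuous_on_subset[OF continuous_on_smooth_expr[OF Suc.prems] subset_UNIV])
    fix i s assume "i \<in> {1..n}" "s \<in> {1..t}"
    from smooth_expr_partial[OF Suc.prems this]
    show "\<exists>\<phi>'. has_partial n t i s a \<phi>' \<and> C_k n t k \<phi>'" using Suc.IH by blast
  qed
qed

section \<open>Gaussian integration by parts\<close>

definition gauss_exponent :: "(nat \<Rightarrow> nat \<Rightarrow> real) \<Rightarrow> nat \<Rightarrow> nat \<Rightarrow> rmat \<Rightarrow> real" where
  "gauss_exponent N n t x = (\<Sum>j=1..n. \<Sum>s=1..t. innov N s (x j) * innov N s (x j))"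

lemma rows_density_exp:
  "(\<Prod>i=1..n. row_density L N t (x i)) = (\<Prod>s=1..t. 1 / (sqrt (2 * pi) * L s s)) ^ n * exp (- (1 / 2) * gauss_exponent N n t x)"
proof -
  have row: "row_density L N t y = (\<Prod>s=1..t. 1 / (sqrt (2 * pi) * L s s)) * exp (\<Sum>s=1..t. - (1 / 2) * (innov N s y * innov N s y))" for y
    unfolding row_density_def by (simp add: exp_sum prod.distrib[symmetric] std_normal_density_def power2_eq_square)
  show ?thesis
    unfolding row gauss_exponent_def by (simp add: prod.distrib exp_sum sum_distrib_left)
qed

definition sq_norm :: "nat \<Rightarrow> nat \<Rightarrow> rmat \<Rightarrow> real" where
  "sq_norm n t x = (\<Sum>j=1..n. \<Sum>s=1..t. x j s * x j s)"

text \<open>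
  A bump with value 1 at the origin and support in the ball of radius R: up to the factor e it is
  the flat function exp(-1/y) at y = 1 - |x|^2 / R^2.
\<close>

definition cutoff :: "nat \<Rightarrow> nat \<Rightarrow> real \<Rightarrow> rmat \<Rightarrow> real" where
  "cutoff n t R x = exp 1 * flat_exp (flat_poly 0) (1 + (- (1 / R\<^sup>2)) * sq_norm n t x)"

definition cutoff_deriv :: "nat \<Rightarrow> nat \<Rightarrow> real \<Rightarrow> nat \<Rightarrow> nat \<Rightarrow> rmat \<Rightarrow> real" where
  "cutoff_deriv n t R i r x = exp 1 * (flat_exp (flat_poly 1) (1 + (- (1 / R\<^sup>2)) * sq_norm n t x) * ((- (1 / R\<^sup>2)) * (2 * x i r)))"

lemma smooth_innov:
  assumes "i \<in> {1..n}" "s \<in> {1..t}"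
  shows "smooth_expr n t (\<lambda>x. innov N s (x i))"
  unfolding innov_def
  by (intro smooth_expr_sum smooth_expr.mult smooth_expr.const smooth_expr.entry) (use assms in auto)

lemma smooth_gauss: "smooth_expr n t (\<lambda>x. exp (- (1 / 2) * gauss_exponent N n t x))"
proof -
  have "smooth_expr n t (\<lambda>x. - (1 / 2) * gauss_exponent N n t x)"
    unfolding gauss_exponent_def
    by (intro smooth_expr_sum smooth_expr.mult smooth_expr.const smooth_innov) auto
  then show ?thesis by (rule smooth_expr.comp[where D="\<lambda>_. exp", rotated]) simp
qed

lemma smooth_cutoff: "smooth_expr n t (cutoff n t R)"
proof -
  have "smooth_expr n t (\<lambda>x. 1 + (- (1 / R\<^sup>2)) * sq_norm n t x)"
    unfolding sq_norm_def
    by (intro smooth_expr_sum smooth_expr.add smooth_expr.mult smooth_expr.const smooth_expr.entry) auto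
  then show ?thesis unfolding cutoff_def
    by (intro smooth_expr.mult[OF smooth_expr.const] smooth_expr.comp[where D="\<lambda>k. flat_exp (flat_poly k)"] flat_poly_deriv)
qed

lemma sq_norm_nonneg: "0 \<le> sq_norm n t x"
  unfolding sq_norm_def by (intro sum_nonneg) auto

lemma entry_le_sq_norm:
  assumes "i \<in> {1..n}" "r \<in> {1..t}"
  shows "(x i r)\<^sup>2 \<le> sq_norm n t x"
proof -
  have "(x i r)\<^sup>2 \<le> (\<Sum>s=1..t. x i s * x i s)"
    using member_le_sum[of r "{1..t}" "\<lambda>s. x i s * x i s"] assms by (simp add: power2_eq_square)
  also have "\<dots> \<le> sq_norm n t x" unfolding sq_norm_def
    by (rule member_le_sum) (use assms in \<open>auto intro: sum_nonneg\<close>)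
  finally show ?thesis .
qed

lemma flat_zero_bound: "y \<le> 1 \<Longrightarrow> 0 \<le> flat_exp (flat_poly 0) y \<and> flat_exp (flat_poly 0) y \<le> exp (- 1)"
  by (auto simp: flat_exp_def field_simps)

lemma flat_one_bound: "\<bar>flat_exp (flat_poly 1) y\<bar> \<le> 2"
  using power_exp_minus_le[of "1 / y" 2] by (auto simp: flat_exp_def power2_eq_square fact_2)

lemma cutoff_bounds: "0 \<le> cutoff n t R x \<and> cutoff n t R x \<le> 1"
proof -
  define y where "y = 1 + (- (1 / R\<^sup>2)) * sq_norm n t x"
  have "y \<le> 1" using sq_norm_nonneg[of n t x] by (simp add: y_def)
  then have "0 \<le> flat_exp (flat_poly 0) y" "flat_exp (flat_poly 0) y \<le> exp (- 1)" using flat_zero_bound by auto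
  then have "0 \<le> exp 1 * flat_exp (flat_poly 0) y" "exp 1 * flat_exp (flat_poly 0) y \<le> exp 1 * exp (- 1)"
    by (auto intro: mult_left_mono)
  then show ?thesis by (simp add: cutoff_def y_def mult_exp_exp)
qed

lemma cutoff_deriv_bound:
  assumes R: "R \<ge> 1" and ir: "i \<in> {1..n}" "r \<in> {1..t}"
  shows "\<bar>cutoff_deriv n t R i r x\<bar> \<le> 4 * exp 1 / R"
proof (cases "sq_norm n t x < R\<^sup>2")
  case True
  then have "(x i r)\<^sup>2 \<le> R\<^sup>2" using entry_le_sq_norm[OF ir, of x] by linarith
  then have x: "\<bar>x i r\<bar> \<le> R" using R by (simp add: abs_le_square_iff[symmetric])
  have "\<bar>cutoff_deriv n t R i r x\<bar> = exp 1 * (\<bar>flat_exp (flat_poly 1) (1 + (- (1 / R\<^sup>2)) * sq_norm n t x)\<bar> * (1 / R\<^sup>2 * (2 * \<bar>x i r\<bar>)))"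
    unfolding cutoff_deriv_def by (simp add: abs_mult)
  also have "\<dots> \<le> exp 1 * (2 * (1 / R\<^sup>2 * (2 * R)))"
    using x R by (intro mult_left_mono mult_mono flat_one_bound) (auto intro!: divide_nonneg_nonneg)
  also have "\<dots> = 4 * exp 1 / R" using R by (simp add: field_simps power2_eq_square)
  finally show ?thesis .
next
  case False
  then have "1 + (- (1 / R\<^sup>2)) * sq_norm n t x \<le> 0" using R by (simp add: field_simps)
  then have "flat_exp (flat_poly 1) (1 + (- (1 / R\<^sup>2)) * sq_norm n t x) = 0" by (simp only: flat_exp_def) simp
  then show ?thesis using R by (simp add: cutoff_deriv_def)
qed

lemma cutoff_limit: "(\<lambda>k. cutoff n t (real (Suc k)) x) \<longlonglongrightarrow> 1"
proof -
  have "(\<lambda>k. 1 / real (Suc k)) \<longlonglongrightarrow> 0" using LIMSEQ_inverse_real_of_nat by (simp add: inverse_eq_divide)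
  then have "(\<lambda>k. 1 + (- ((1 / real (Suc k))\<^sup>2)) * sq_norm n t x) \<longlonglongrightarrow> 1 + (- (0\<^sup>2)) * sq_norm n t x"
    by (intro tendsto_intros)
  then have "(\<lambda>k. 1 + (- (1 / (real (Suc k))\<^sup>2)) * sq_norm n t x) \<longlonglongrightarrow> 1" by (simp add: power_divide)
  then have "(\<lambda>k. flat_exp (flat_poly 0) (1 + (- (1 / (real (Suc k))\<^sup>2)) * sq_norm n t x)) \<longlonglongrightarrow> flat_exp (flat_poly 0) 1"
    by (rule isCont_tendsto_compose[OF DERIV_isCont[OF flat_poly_deriv]])
  then have "(\<lambda>k. cutoff n t (real (Suc k)) x) \<longlonglongrightarrow> exp 1 * flat_exp (flat_poly 0) 1"
    unfolding cutoff_def by (intro tendsto_mult tendsto_const)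
  then show ?thesis by (simp add: flat_exp_def mult_exp_exp)
qed

lemma cutoff_deriv_limit:
  assumes "i \<in> {1..n}" "r \<in> {1..t}"
  shows "(\<lambda>k. cutoff_deriv n t (real (Suc k)) i r x) \<longlonglongrightarrow> 0"
proof (rule Lim_null_comparison)
  show "\<forall>\<^sub>F k in sequentially. norm (cutoff_deriv n t (real (Suc k)) i r x) \<le> 4 * exp 1 / real (Suc k)"
    using cutoff_deriv_bound[OF _ assms] by (intro always_eventually allI) simp
  have "(\<lambda>k. 4 * exp 1 * (1 / real (Suc k))) \<longlonglongrightarrow> 4 * exp 1 * 0"
    using LIMSEQ_inverse_real_of_nat by (intro tendsto_intros) (simp add: inverse_eq_divide)
  then show "(\<lambda>k. 4 * exp 1 / real (Suc k)) \<longlonglongrightarrow> 0" by simp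
qed

lemma innov_deriv:
  assumes tri: "s < r \<Longrightarrow> N s r = 0" and r: "r \<ge> 1"
  shows "((\<lambda>h. innov N s ((x(i := (x i)(r := h))) j)) has_real_derivative (if j = i then N s r else 0)) (at z)"
proof (cases "j = i")
  case True
  have d: "((\<lambda>h. N s p * ((x i)(r := h)) p) has_real_derivative (if p = r then N s r else 0)) (at z)" for p
    by (cases "p = r") (auto intro!: derivative_eq_intros)
  have "((\<lambda>h. \<Sum>p=1..s. N s p * ((x i)(r := h)) p) has_real_derivative (\<Sum>p=1..s. if p = r then N s r else 0)) (at z)"
    by (intro DERIV_sum d)
  also have "(\<Sum>p=1..s. if p = r then N s r else 0) = N s r"
    using tri r by (cases "r \<le> s") auto
  finally show ?thesis using True by (simp add: innov_def)
next
  case False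
  then show ?thesis by simp
qed

lemma gauss_exponent_deriv:
  assumes tri: "\<And>s r. s < r \<Longrightarrow> N s r = 0" and i: "i \<in> {1..n}" and r: "r \<ge> 1"
  shows "((\<lambda>h. gauss_exponent N n t (x(i := (x i)(r := h)))) has_real_derivative 2 * (\<Sum>s=1..t. innov N s (x i) * N s r)) (at (x i r))"
proof -
  let ?y = "\<lambda>h. x(i := (x i)(r := h))"
  have "((\<lambda>h. innov N s (?y h j) * innov N s (?y h j)) has_real_derivative
      (if j = i then 2 * (innov N s (x i) * N s r) else 0)) (at (x i r))" for s j
  proof -
    have d: "((\<lambda>h. innov N s (?y h j)) has_real_derivative (if j = i then N s r else 0)) (at (x i r))"
      by (rule innov_deriv) (use tri r in auto)
    from DERIV_mult[OF d d] show ?thesis by (cases "j = i") (simp_all add: mult_ac)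
  qed
  then have "((\<lambda>h. gauss_exponent N n t (?y h)) has_real_derivative
      (\<Sum>j=1..n. \<Sum>s=1..t. if j = i then 2 * (innov N s (x i) * N s r) else 0)) (at (x i r))"
    unfolding gauss_exponent_def by (intro DERIV_sum)
  also have "(\<Sum>j=1..n. \<Sum>s=1..t. if j = i then 2 * (innov N s (x i) * N s r) else 0) = 2 * (\<Sum>s=1..t. innov N s (x i) * N s r)"
    by (subst sum.swap) (use i in \<open>simp add: sum_distrib_left\<close>)
  finally show ?thesis .
qed

lemma sq_norm_deriv:
  assumes i: "i \<in> {1..n}" and r: "r \<in> {1..t}"
  shows "((\<lambda>h. sq_norm n t (x(i := (x i)(r := h)))) has_real_derivative 2 * x i r) (at (x i r))"
proof -
  let ?y = "\<lambda>h. x(i := (x i)(r := h))"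
  have "((\<lambda>h. ?y h j s * ?y h j s) has_real_derivative
      (if j = i then if s = r then 2 * x i r else 0 else 0)) (at (x i r))" for s j
    by (cases "j = i"; cases "s = r") (auto intro!: derivative_eq_intros)
  then have "((\<lambda>h. sq_norm n t (?y h)) has_real_derivative
      (\<Sum>j=1..n. \<Sum>s=1..t. if j = i then if s = r then 2 * x i r else 0 else 0)) (at (x i r))"
    unfolding sq_norm_def by (intro DERIV_sum)
  also have "(\<Sum>j=1..n. \<Sum>s=1..t. if j = i then if s = r then 2 * x i r else 0 else 0) = 2 * x i r"
    by (subst sum.swap) (use i r in simp)
  finally show ?thesis .
qed

lemma truncated_gauss_partial:
  assumes tri: "\<And>s r. s < r \<Longrightarrow> N s r = 0" and i: "i \<in> {1..n}" and r: "r \<in> {1..t}"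
  shows "has_partial n t i r (\<lambda>x. K * exp (- (1 / 2) * gauss_exponent N n t x) * cutoff n t R x)
    (\<lambda>x. K * exp (- (1 / 2) * gauss_exponent N n t x) * (cutoff_deriv n t R i r x - (\<Sum>s=1..t. innov N s (x i) * N s r) * cutoff n t R x))"
  unfolding has_partial_def
proof
  fix x :: rmat
  let ?y = "\<lambda>h. x(i := (x i)(r := h))"
  let ?A = "\<Sum>s=1..t. innov N s (x i) * N s r"
  have g: "((\<lambda>h. exp (- (1 / 2) * gauss_exponent N n t (?y h))) has_real_derivative
      exp (- (1 / 2) * gauss_exponent N n t x) * (- (1 / 2) * (2 * ?A))) (at (x i r))"
    using r DERIV_chain2[OF DERIV_exp DERIV_cmult[OF gauss_exponent_deriv[where x=x and r=r and t=t and N=N, OF tri i], of "- (1 / 2)"]] by simp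
  have q: "((\<lambda>h. cutoff n t R (?y h)) has_real_derivative cutoff_deriv n t R i r x) (at (x i r))"
  proof -
    have "((\<lambda>h. 1 + (- (1 / R\<^sup>2)) * sq_norm n t (?y h)) has_real_derivative 0 + (- (1 / R\<^sup>2)) * (2 * x i r)) (at (x i r))"
      by (intro DERIV_add DERIV_const DERIV_cmult sq_norm_deriv i r)
    then have "((\<lambda>h. 1 + (- (1 / R\<^sup>2)) * sq_norm n t (?y h)) has_real_derivative (- (1 / R\<^sup>2)) * (2 * x i r)) (at (x i r))" by simp
    from DERIV_cmult[OF DERIV_chain2[OF flat_poly_deriv[of 0] this], of "exp 1"]
    show ?thesis by (simp add: cutoff_def cutoff_deriv_def)
  qed
  from DERIV_cmult[OF DERIV_mult[OF g q], of K]
  show "((\<lambda>h. K * exp (- (1 / 2) * gauss_exponent N n t (?y h)) * cutoff n t R (?y h)) has_real_derivative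
     K * exp (- (1 / 2) * gauss_exponent N n t x) * (cutoff_deriv n t R i r x - ?A * cutoff n t R x)) (at (x i r))"
    by (simp add: algebra_simps)
qed

lemma truncated_gauss_test_function:
  assumes R: "R \<ge> 1"
  shows "test_function n t (\<lambda>x. K * exp (- (1 / 2) * gauss_exponent N n t x) * cutoff n t R x)"
  unfolding test_function_def
proof (intro conjI allI exI ballI)
  show "C_k n t k (\<lambda>x. K * exp (- (1 / 2) * gauss_exponent N n t x) * cutoff n t R x)" for k
    by (intro smooth_expr_C_k smooth_expr.mult smooth_expr.const smooth_gauss smooth_cutoff)
  fix x assume "x \<in> space (matrices n t) - cube n t R"
  then obtain i s where e: "i \<in> {1..n}" "s \<in> {1..t}" "\<bar>x i s\<bar> > R" by (auto simp: cube_def not_le)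
  then have "(x i s)\<^sup>2 > R\<^sup>2" using R e(3) by (simp add: abs_le_square_iff[symmetric] flip: not_le)
  then have "sq_norm n t x > R\<^sup>2" using entry_le_sq_norm[OF e(1,2), of x] by linarith
  then have "1 + (- (1 / R\<^sup>2)) * sq_norm n t x \<le> 0" using R by (simp add: field_simps)
  then have "cutoff n t R x = 0" by (simp add: cutoff_def flat_exp_def)
  then show "K * exp (- (1 / 2) * gauss_exponent N n t x) * cutoff n t R x = 0" by simp
qed

lemma smooth_expr_measurable:
  assumes "smooth_expr n t a"
  shows "a \<in> borel_measurable (matrices n t)"
  using assms
proof (induction rule: smooth_expr.induct)
  case (comp D a k)
  have "isCont (D k) y" for y using comp(1)[of k y] by (rule DERIV_isCont)
  then have "D k \<in> borel_measurable borel"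
    by (intro borel_measurable_continuous_onI) (simp add: continuous_at_imp_continuous_on)
  from measurable_compose[OF comp(3) this] show ?case .
qed (auto intro: matrices_entry)

lemma cutoff_deriv_measurable:
  assumes "i \<in> {1..n}" "r \<in> {1..t}"
  shows "cutoff_deriv n t R i r \<in> borel_measurable (matrices n t)"
proof (rule smooth_expr_measurable)
  have "smooth_expr n t (\<lambda>x. 1 + (- (1 / R\<^sup>2)) * sq_norm n t x)"
    unfolding sq_norm_def
    by (intro smooth_expr_sum smooth_expr.add smooth_expr.mult smooth_expr.const smooth_expr.entry) auto
  then show "smooth_expr n t (cutoff_deriv n t R i r)"
    unfolding cutoff_deriv_def[abs_def]
    by (intro smooth_expr.mult[OF smooth_expr.const] smooth_expr.mult smooth_expr.entry assms
        smooth_expr.comp[where D="\<lambda>k. flat_exp (flat_poly k)"] flat_poly_deriv)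
qed

lemma sets_mat_lborel: "sets (mat_lborel n t) = sets (matrices n t)"
  unfolding mat_lborel_def matrices_def by (intro sets_PiM_cong refl sets_PiM_lborel)

text \<open>
  The test function is the Gaussian density times a cutoff at scale R. As R grows, the terms
  with the derivative of the cutoff vanish and dominated convergence leaves the Gaussian identity.
\<close>

lemma gaussian_by_parts:
  assumes S: "S \<in> carrier_mat t t" and ch: "cholesky t c (entries S) L N" and c: "c > 0"
    and i: "i \<in> {1..n}" and r: "r \<in> {1..t}"
    and w: "is_weak_partial n t i r h g" and hm: "h \<in> borel_measurable (matrices n t)"
    and hi: "integrable (gauss_rows n S) h"
    and hA: "integrable (gauss_rows n S) (\<lambda>x. h x * (\<Sum>s=1..t. innov N s (x i) * N s r))"
    and gi: "integrable (gauss_rows n S) g"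
  shows "(LINT x|gauss_rows n S. h x * (\<Sum>s=1..t. innov N s (x i) * N s r)) = (LINT x|gauss_rows n S. g x)"
proof -
  define A where "A x = (\<Sum>s=1..t. innov N s (x i) * N s r)" for x :: rmat
  define K where "K = (\<Prod>s=1..t. 1 / (sqrt (2 * pi) * L s s)) ^ n"
  define \<rho> where "\<rho> x = K * exp (- (1 / 2) * gauss_exponent N n t x)" for x
  note tri = cholesky_tri(2)[OF ch]
  have K: "K \<ge> 0" unfolding K_def
    using cholesky_diag_pos[OF ch c] by (intro zero_le_power prod_nonneg) (auto intro!: mult_nonneg_nonneg less_imp_le)
  have \<rho>0: "\<rho> x \<ge> 0" for x using K by (simp add: \<rho>_def)
  have G: "gauss_rows n S = density (mat_lborel n t) (\<lambda>x. ennreal (\<rho> x))"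
    unfolding gauss_rows_density[OF S ch c] rows_density_exp \<rho>_def K_def ..
  have sG: "sets (gauss_rows n S) = sets (matrices n t)" using S by (intro sets_gauss_rows) auto
  have gm: "g \<in> borel_measurable (matrices n t)" using w by (simp add: is_weak_partial_def loc_integrable_def)
  have \<rho>m: "\<rho> \<in> borel_measurable (matrices n t)" unfolding \<rho>_def[abs_def]
    by (intro smooth_expr_measurable smooth_expr.mult smooth_expr.const smooth_gauss)
  have Am: "A \<in> borel_measurable (matrices n t)" unfolding A_def[abs_def]
    by (intro smooth_expr_measurable smooth_expr_sum smooth_expr.mult smooth_expr.const smooth_innov i) auto
  have qm: "cutoff n t R \<in> borel_measurable (matrices n t)" for R by (intro smooth_expr_measurable smooth_cutoff)
  note qdm = cutoff_deriv_measurable[OF i r]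
  have dens: "(LINT x|gauss_rows n S. f x) = (LINT x|mat_lborel n t. \<rho> x * f x)" if "f \<in> borel_measurable (matrices n t)" for f
    unfolding G using that \<rho>m \<rho>0
    by (subst integral_density) (auto simp: measurable_cong_sets[OF sets_mat_lborel refl])
  have eq: "(LINT x|gauss_rows n S. h x * (cutoff_deriv n t R i r x - A x * cutoff n t R x)) = - (LINT x|gauss_rows n S. g x * cutoff n t R x)"
    if R: "R \<ge> 1" for R
  proof -
    have "(LINT x|mat_lborel n t. h x * (\<rho> x * (cutoff_deriv n t R i r x - A x * cutoff n t R x))) = - (LINT x|mat_lborel n t. g x * (\<rho> x * cutoff n t R x))"
      using w truncated_gauss_test_function[OF R, where K=K and N=N and n=n and t=t] truncated_gauss_partial[where N=N and K=K and R=R, OF tri i r]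
      unfolding is_weak_partial_def \<rho>_def A_def by blast
    moreover have "(LINT x|gauss_rows n S. h x * (cutoff_deriv n t R i r x - A x * cutoff n t R x)) = (LINT x|mat_lborel n t. \<rho> x * (h x * (cutoff_deriv n t R i r x - A x * cutoff n t R x)))"
      by (intro dens borel_measurable_times borel_measurable_diff hm qdm Am qm)
    moreover have "(LINT x|gauss_rows n S. g x * cutoff n t R x) = (LINT x|mat_lborel n t. \<rho> x * (g x * cutoff n t R x))"
      by (intro dens borel_measurable_times gm qm)
    ultimately show ?thesis by (simp only: mult.left_commute)
  qed
  have conv: "f \<in> borel_measurable (gauss_rows n S)" if "f \<in> borel_measurable (matrices n t)" for f :: "rmat \<Rightarrow> real"
    using that by (simp add: measurable_cong_sets[OF sG refl])
  let ?q = "\<lambda>k. cutoff n t (real (Suc k))" and ?d = "\<lambda>k. cutoff_deriv n t (real (Suc k)) i r"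
  have "(\<lambda>k. LINT x|gauss_rows n S. h x * (?d k x - A x * ?q k x)) \<longlonglongrightarrow> (LINT x|gauss_rows n S. - (h x * A x))"
  proof (rule integral_dominated_convergence[where w="\<lambda>x. \<bar>h x\<bar> * (4 * exp 1) + \<bar>h x * A x\<bar>"])
    show "(\<lambda>x. - (h x * A x)) \<in> borel_measurable (gauss_rows n S)"
      by (intro conv borel_measurable_uminus borel_measurable_times hm Am)
    show "(\<lambda>x. h x * (?d k x - A x * ?q k x)) \<in> borel_measurable (gauss_rows n S)" for k
      by (intro conv borel_measurable_times borel_measurable_diff hm qdm Am qm)
    show "integrable (gauss_rows n S) (\<lambda>x. \<bar>h x\<bar> * (4 * exp 1) + \<bar>h x * A x\<bar>)"
      by (intro Bochner_Integration.integrable_add integrable_mult_left integrable_abs hi hA[folded A_def])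
    show "AE x in gauss_rows n S. (\<lambda>k. h x * (?d k x - A x * ?q k x)) \<longlonglongrightarrow> - (h x * A x)"
    proof (rule AE_I2)
      fix x
      have "(\<lambda>k. h x * (?d k x - A x * ?q k x)) \<longlonglongrightarrow> h x * (0 - A x * 1)"
        by (intro tendsto_intros cutoff_limit cutoff_deriv_limit i r)
      then show "(\<lambda>k. h x * (?d k x - A x * ?q k x)) \<longlonglongrightarrow> - (h x * A x)" by simp
    qed
    show "AE x in gauss_rows n S. norm (h x * (?d k x - A x * ?q k x)) \<le> \<bar>h x\<bar> * (4 * exp 1) + \<bar>h x * A x\<bar>" for k
    proof (rule AE_I2)
      fix x
      have "\<bar>?d k x\<bar> \<le> 4 * exp 1 / real (Suc k)" by (intro cutoff_deriv_bound i r) simp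
      also have "\<dots> \<le> 4 * exp 1" by (simp add: divide_le_eq)
      finally have d: "\<bar>?d k x\<bar> \<le> 4 * exp 1" .
      have "\<bar>A x * ?q k x\<bar> \<le> \<bar>A x\<bar>"
        using cutoff_bounds[of n t "real (Suc k)" x] by (simp add: abs_mult mult_left_le)
      then have "\<bar>?d k x - A x * ?q k x\<bar> \<le> 4 * exp 1 + \<bar>A x\<bar>" using d by linarith
      then have "\<bar>h x\<bar> * \<bar>?d k x - A x * ?q k x\<bar> \<le> \<bar>h x\<bar> * (4 * exp 1 + \<bar>A x\<bar>)" by (intro mult_left_mono) auto
      then show "norm (h x * (?d k x - A x * ?q k x)) \<le> \<bar>h x\<bar> * (4 * exp 1) + \<bar>h x * A x\<bar>"
        by (simp add: abs_mult distrib_left)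
    qed
  qed
  moreover have "(\<lambda>k. LINT x|gauss_rows n S. g x * ?q k x) \<longlonglongrightarrow> (LINT x|gauss_rows n S. g x)"
  proof (rule integral_dominated_convergence[where w="\<lambda>x. \<bar>g x\<bar>"])
    show "g \<in> borel_measurable (gauss_rows n S)" by (intro conv gm)
    show "(\<lambda>x. g x * ?q k x) \<in> borel_measurable (gauss_rows n S)" for k
      by (intro conv borel_measurable_times gm qm)
    show "integrable (gauss_rows n S) (\<lambda>x. \<bar>g x\<bar>)" by (intro integrable_abs gi)
    show "AE x in gauss_rows n S. (\<lambda>k. g x * ?q k x) \<longlonglongrightarrow> g x"
    proof (rule AE_I2)
      fix x
      have "(\<lambda>k. g x * ?q k x) \<longlonglongrightarrow> g x * 1" by (intro tendsto_intros cutoff_limit)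
      then show "(\<lambda>k. g x * ?q k x) \<longlonglongrightarrow> g x" by simp
    qed
    show "AE x in gauss_rows n S. norm (g x * ?q k x) \<le> \<bar>g x\<bar>" for k
      using cutoff_bounds[of n t "real (Suc k)"] by (intro AE_I2) (simp add: abs_mult mult_left_le)
  qed
  then have "(\<lambda>k. - (LINT x|gauss_rows n S. g x * ?q k x)) \<longlonglongrightarrow> - (LINT x|gauss_rows n S. g x)" by (rule tendsto_minus)
  then have "(\<lambda>k. LINT x|gauss_rows n S. h x * (?d k x - A x * ?q k x)) \<longlonglongrightarrow> - (LINT x|gauss_rows n S. g x)"
    by (subst eq) simp_all
  ultimately have "(LINT x|gauss_rows n S. - (h x * A x)) = - (LINT x|gauss_rows n S. g x)"
    by (rule LIMSEQ_unique)
  then show ?thesis by (simp add: A_def)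
qed

lemma integrable_product_of_squares:
  fixes f g :: "'a \<Rightarrow> real"
  assumes [measurable]: "f \<in> borel_measurable M" "g \<in> borel_measurable M"
    and "integrable M (\<lambda>x. (f x)\<^sup>2)" "integrable M (\<lambda>x. (g x)\<^sup>2)"
  shows "integrable M (\<lambda>x. f x * g x)"
proof (rule Bochner_Integration.integrable_bound)
  show "integrable M (\<lambda>x. (f x)\<^sup>2 + (g x)\<^sup>2)" using assms by auto
  have "\<bar>f x * g x\<bar> \<le> (f x)\<^sup>2 + (g x)\<^sup>2" for x
  proof -
    have "0 \<le> (\<bar>f x\<bar> - \<bar>g x\<bar>)\<^sup>2" by simp
    then have "2 * \<bar>f x * g x\<bar> \<le> (f x)\<^sup>2 + (g x)\<^sup>2" by (simp add: power2_diff abs_mult)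
    then show ?thesis by linarith
  qed
  then show "AE x in M. norm (f x * g x) \<le> norm ((f x)\<^sup>2 + (g x)\<^sup>2)" by simp
qed simp

lemma integrable_square_sum:
  fixes f :: "'k \<Rightarrow> 'a \<Rightarrow> real"
  assumes "\<And>k. k \<in> I \<Longrightarrow> f k \<in> borel_measurable M" "\<And>k. k \<in> I \<Longrightarrow> integrable M (\<lambda>x. (f k x)\<^sup>2)"
  shows "integrable M (\<lambda>x. (\<Sum>k\<in>I. f k x)\<^sup>2)"
proof -
  have "integrable M (\<lambda>x. \<Sum>j\<in>I. \<Sum>k\<in>I. f j x * f k x)"
    by (intro Bochner_Integration.integrable_sum integrable_product_of_squares assms)
  then show ?thesis by (simp add: power2_eq_square sum_product)
qed

lemma normal_cols_component:
  assumes "s \<in> {1..T}" "i \<in> {1..n}" "integrable std_normal_distribution \<phi>"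
  shows "integrable (normal_cols n T) (\<lambda>X. \<phi> (X s i) :: real)"
proof -
  have v: "distr (normal_cols n T) (normal_vec n) (\<lambda>X. X s) = normal_vec n"
    unfolding normal_cols_def by (rule distr_PiM_component) (use assms prob_space_normal_vec in auto)
  have e: "distr (normal_vec n) std_normal_distribution (\<lambda>x. x i) = std_normal_distribution"
    unfolding normal_vec_def by (rule distr_PiM_component) (use assms prob_space_std_normal in auto)
  have ci: "(\<lambda>x. x i) \<in> normal_vec n \<rightarrow>\<^sub>M std_normal_distribution"
    unfolding normal_vec_def by (rule measurable_component_singleton[OF assms(2)])
  have cs: "(\<lambda>X. X s) \<in> normal_cols n T \<rightarrow>\<^sub>M normal_vec n"
    unfolding normal_cols_def by (rule measurable_component_singleton[OF assms(1)])
  have "integrable (normal_vec n) (\<lambda>x. \<phi> (x i))"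
    by (rule integrable_distr[OF ci]) (simp only: e assms)
  then show ?thesis
    by (intro integrable_distr[OF cs]) (simp only: v)
qed

lemma normal_cols_sq_integrable:
  assumes "s \<in> {1..T}" "i \<in> {1..n}"
  shows "integrable (normal_cols n T) (\<lambda>X. (X s i)\<^sup>2)"
  using normal_cols_component[OF assms std_normal_distribution_even_moments(2)[of 1]] by simp

text \<open>The Gaussian matrix with row covariance L times its transpose.\<close>

definition mix :: "nat \<Rightarrow> nat \<Rightarrow> nat \<Rightarrow> (nat \<Rightarrow> nat \<Rightarrow> real) \<Rightarrow> rmat \<Rightarrow> rmat" where
  "mix n t T L X = (\<lambda>i\<in>{1..n}. \<lambda>s\<in>{1..t}. \<Sum>k=1..T. L s k * X k i)"

lemma mix_measurable: "mix n t T L \<in> normal_cols n T \<rightarrow>\<^sub>M matrices n t"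
  unfolding mix_def[abs_def]
  by (intro measurable_matricesI borel_measurable_sum borel_measurable_times borel_measurable_const normal_cols_entry) auto

lemma leading_factor:
  assumes S: "S \<in> carrier_mat T T" and S': "S' \<in> carrier_mat t t" and t: "t \<le> T"
    and ch: "cholesky T c (entries S) L N"
    and eq: "\<And>r s. r \<in> {1..t} \<Longrightarrow> s \<in> {1..t} \<Longrightarrow> entries S' r s = entries S r s"
  shows "cholesky t c (entries S') L N" "has_factor t S'"
proof -
  have "cholesky t c (entries S) L N" by (rule cholesky_leading[OF ch t])
  then show *: "cholesky t c (entries S') L N" using eq by (simp add: cholesky_def)
  show "has_factor t S'" by (rule has_factor_cholesky[OF S' *])
qed

lemma gauss_rows_mix:
  assumes S: "S \<in> carrier_mat T T" and S': "S' \<in> carrier_mat t t" and t: "t \<le> T"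
    and ch: "cholesky T c (entries S) L N"
    and eq: "\<And>r s. r \<in> {1..t} \<Longrightarrow> s \<in> {1..t} \<Longrightarrow> entries S' r s = entries S r s"
  shows "distr (normal_cols n T) (matrices n t) (mix n t T L) = gauss_rows n S'"
proof -
  have "has_gauss_law (normal_cols n T) n t (\<lambda>X. \<lambda>i\<in>{1..n}. \<lambda>s\<in>{1..t}. \<Sum>k=1..T. L s k * X k i) S'"
  proof (rule mixed_cols_law)
    show "has_factor t S'" by (rule leading_factor[OF assms])
    fix r s assume rs: "r \<in> {1..t}" "s \<in> {1..t}"
    then have "entries S' r s = entries S r s" by (rule eq)
    also have "\<dots> = (\<Sum>k=1..T. L r k * L s k)" using ch rs t by (auto simp: cholesky_def)
    finally show "S' $$ (r - 1, s - 1) = (\<Sum>k=1..T. L r k * L s k)" by (simp add: entries_def)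
  qed
  then show ?thesis by (simp add: has_gauss_law_def mix_def[abs_def])
qed

lemma mix_has_gauss_law:
  assumes "S \<in> carrier_mat T T" "cholesky T c (entries S) L N"
  shows "has_gauss_law (normal_cols n T) n T (mix n T T L) S"
  unfolding has_gauss_law_def using mix_measurable gauss_rows_mix[OF assms(1,1) order_refl assms(2)] by auto

lemma gauss_rows_marginal:
  assumes S: "S \<in> carrier_mat T T" and S': "S' \<in> carrier_mat t t" and t: "t \<le> T"
    and ch: "cholesky T c (entries S) L N"
    and eq: "\<And>r s. r \<in> {1..t} \<Longrightarrow> s \<in> {1..t} \<Longrightarrow> entries S' r s = entries S r s"
  shows "distr (gauss_rows n S) (matrices n t) (take_cols n t) = gauss_rows n S'"
proof -
  have tm: "take_cols n t \<in> matrices n T \<rightarrow>\<^sub>M matrices n t"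
    by (rule take_cols_measurable) (use t in \<open>auto intro: matrices_entry\<close>)
  have "distr (gauss_rows n S) (matrices n t) (take_cols n t) = distr (distr (normal_cols n T) (matrices n T) (mix n T T L)) (matrices n t) (take_cols n t)"
    by (simp add: gauss_rows_mix[OF S S order_refl ch])
  also have "\<dots> = distr (normal_cols n T) (matrices n t) (take_cols n t \<circ> mix n T T L)"
    by (rule distr_distr[OF tm mix_measurable])
  also have "take_cols n t \<circ> mix n T T L = mix n t T L"
    using t by (auto simp: take_cols_def mix_def fun_eq_iff)
  also have "distr (normal_cols n T) (matrices n t) (mix n t T L) = gauss_rows n S'"
    by (rule gauss_rows_mix[OF assms])
  finally show ?thesis .
qed

lemma innov_mix:
  assumes ch: "cholesky t c S L N" and s: "s \<in> {1..t}" and i: "i \<in> {1..n}"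
  shows "innov N s (mix n t t L X i) = X s i"
  by (rule innov_of_factor[OF ch s]) (use i in \<open>simp add: mix_def\<close>)

text \<open>
  The gradient of the log-density is linear in x, with coefficient matrix the inverse covariance.
  Integration by parts against it in all coordinates of a row, recombined with the entries of S,
  leaves the single coordinate x i s on the left.
\<close>

lemma stein_identity:
  assumes S: "S \<in> carrier_mat t t" and ch: "cholesky t c (entries S) L N" and c: "c > 0"
    and i: "i \<in> {1..n}" and s: "s \<in> {1..t}"
    and w: "\<And>r. r \<in> {1..t} \<Longrightarrow> is_weak_partial n t i r h (g r)" and hm: "h \<in> borel_measurable (matrices n t)"
    and h2: "integrable (gauss_rows n S) (\<lambda>x. (h x)\<^sup>2)"
    and gi: "\<And>r. r \<in> {1..t} \<Longrightarrow> integrable (gauss_rows n S) (g r)"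
  shows "integrable (gauss_rows n S) (\<lambda>x. x i s * h x)"
    and "(LINT x|gauss_rows n S. x i s * h x) = (\<Sum>r=1..t. entries S s r * (LINT x|gauss_rows n S. g r x))"
proof -
  let ?G = "gauss_rows n S"
  interpret G: prob_space ?G by (rule prob_space_gauss_rows)
  have G: "?G = distr (normal_cols n t) (matrices n t) (mix n t t L)"
    by (rule gauss_rows_mix[OF S S order_refl ch, symmetric]) simp
  have sG: "sets ?G = sets (matrices n t)" using S by (intro sets_gauss_rows) auto
  have conv: "f \<in> borel_measurable ?G" if "f \<in> borel_measurable (matrices n t)" for f :: "rmat \<Rightarrow> real"
    using that by (simp add: measurable_cong_sets[OF sG refl])
  have im: "(\<lambda>x. innov N q (x i)) \<in> borel_measurable (matrices n t)" if "q \<in> {1..t}" for q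
    by (intro smooth_expr_measurable smooth_innov i that)
  have isq: "integrable ?G (\<lambda>x. (innov N q (x i))\<^sup>2)" if q: "q \<in> {1..t}" for q
    unfolding G
  proof (subst integrable_distr_eq[OF mix_measurable])
    show "(\<lambda>x. (innov N q (x i))\<^sup>2) \<in> borel_measurable (matrices n t)" using im[OF q] by simp
    show "integrable (normal_cols n t) (\<lambda>X. (innov N q (mix n t t L X i))\<^sup>2)"
      unfolding innov_mix[OF ch q i] by (rule normal_cols_sq_integrable[OF q i])
  qed
  let ?A = "\<lambda>r x. \<Sum>q=1..t. innov N q (x i) * N q r"
  have Asq: "integrable ?G (\<lambda>x. (?A r x)\<^sup>2)" for r
  proof (rule integrable_square_sum)
    fix q assume q: "q \<in> {1..t}"
    show "(\<lambda>x. innov N q (x i) * N q r) \<in> borel_measurable ?G" using conv[OF im[OF q]] by simp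
    show "integrable ?G (\<lambda>x. (innov N q (x i) * N q r)\<^sup>2)"
      unfolding power_mult_distrib by (intro integrable_mult_left isq q)
  qed
  have Am: "?A r \<in> borel_measurable ?G" for r
    by (intro conv borel_measurable_sum borel_measurable_times borel_measurable_const im)
  have hA: "integrable ?G (\<lambda>x. h x * ?A r x)" for r
    by (rule integrable_product_of_squares[OF conv[OF hm] Am h2 Asq])
  have "integrable ?G (\<lambda>x. h x * 1)"
    by (rule integrable_product_of_squares[OF conv[OF hm] _ h2]) auto
  then have hi: "integrable ?G h" by simp
  have byparts: "(LINT x|?G. h x * ?A r x) = (LINT x|?G. g r x)" if r: "r \<in> {1..t}" for r
    by (rule gaussian_by_parts[OF S ch c i r w[OF r] hm hi hA gi[OF r]])
  have x: "x i s * h x = (\<Sum>r=1..t. entries S s r * (h x * ?A r x))" for x :: rmat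
  proof -
    have "(\<Sum>r=1..t. entries S s r * (\<Sum>q=1..t. innov N q (x i) * N q r))
        = (\<Sum>r=1..t. \<Sum>q=1..t. \<Sum>k=1..t. L s k * (L r k * (innov N q (x i) * N q r)))"
    proof (intro sum.cong refl)
      fix r assume "r \<in> {1..t}"
      then have "entries S s r = (\<Sum>k=1..t. L s k * L r k)" using ch s by (auto simp: cholesky_def)
      then show "entries S s r * (\<Sum>q=1..t. innov N q (x i) * N q r) = (\<Sum>q=1..t. \<Sum>k=1..t. L s k * (L r k * (innov N q (x i) * N q r)))"
        by (simp add: sum_distrib_left sum_distrib_right mult.assoc)
    qed
    also have "\<dots> = (\<Sum>q=1..t. \<Sum>k=1..t. \<Sum>r=1..t. L s k * (L r k * (innov N q (x i) * N q r)))"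
      by (subst sum.swap) (intro sum.cong refl sum.swap)
    also have "\<dots> = (\<Sum>q=1..t. innov N q (x i) * (\<Sum>k=1..t. L s k * (\<Sum>r=1..t. N q r * L r k)))"
      by (simp add: sum_distrib_left mult_ac)
    also have "\<dots> = (\<Sum>q=1..t. innov N q (x i) * L s q)"
    proof (intro sum.cong refl)
      fix q assume q: "q \<in> {1..t}"
      have "(\<Sum>k=1..t. L s k * (\<Sum>r=1..t. N q r * L r k)) = (\<Sum>k=1..t. if q = k then L s k else 0)"
        by (intro sum.cong refl) (simp only: cholesky_inverse(2)[OF ch q], simp)
      then show "innov N q (x i) * (\<Sum>k=1..t. L s k * (\<Sum>r=1..t. N q r * L r k)) = innov N q (x i) * L s q"
        using q by simp
    qed
    also have "\<dots> = x i s" using factor_of_innov[OF ch s, of "x i"] by (simp add: mult.commute)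
    finally have "(\<Sum>r=1..t. entries S s r * ?A r x) = x i s" .
    then show ?thesis
      by (simp only: mult.left_commute[of _ "h x"] sum_distrib_left[symmetric] mult.commute[of "x i s"])
  qed
  show "integrable ?G (\<lambda>x. x i s * h x)"
    unfolding x by (intro Bochner_Integration.integrable_sum integrable_mult_right hA)
  have "(LINT x|?G. x i s * h x) = (\<Sum>r=1..t. LINT x|?G. entries S s r * (h x * ?A r x))"
    unfolding x by (intro Bochner_Integration.integral_sum integrable_mult_right hA)
  also have "\<dots> = (\<Sum>r=1..t. entries S s r * (LINT x|?G. g r x))"
    by (intro sum.cong refl) (simp only: integral_mult_right_zero byparts)
  finally show "(LINT x|?G. x i s * h x) = (\<Sum>r=1..t. entries S s r * (LINT x|?G. g r x))" .
qed

section \<open>State evolution at a fixed dimension\<close>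

lemma se_cov_carrier: "se_cov n v f t \<in> carrier_mat t t"
  by (cases "(n, v, f, t)" rule: se_cov.cases) auto

lemma se_cov_sym:
  assumes "i < t" "j < t"
  shows "se_cov n v f t $$ (i, j) = se_cov n v f t $$ (j, i)"
  using assms by (cases "(n, v, f, t)" rule: se_cov.cases) (auto simp: dot_def mult.commute)

lemma dot_cong: "(\<And>i. i \<in> {1..n} \<Longrightarrow> a i = a' i) \<Longrightarrow> (\<And>i. i \<in> {1..n} \<Longrightarrow> b i = b' i) \<Longrightarrow> dot n a b = dot n a' b'"
  unfolding dot_def by (intro sum.cong) auto

lemma dot_measurable:
  assumes "\<And>i. i \<in> {1..n} \<Longrightarrow> (\<lambda>x. a x i) \<in> borel_measurable M" "\<And>i. i \<in> {1..n} \<Longrightarrow> (\<lambda>x. b x i) \<in> borel_measurable M"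
  shows "(\<lambda>x. dot n (a x) (b x)) \<in> borel_measurable M"
  unfolding dot_def by (intro borel_measurable_sum borel_measurable_times assms)

lemma take_cols_take_cols: "r \<le> t \<Longrightarrow> take_cols n r (take_cols n t x) = take_cols n r x"
  by (auto simp: take_cols_def fun_eq_iff)

lemma nonlin_take_cols: "r \<le> t \<Longrightarrow> nonlin n v f r (take_cols n t x) = nonlin n v f r x"
  by (simp add: nonlin_def take_cols_take_cols)

lemma cholesky_of_lambda_min:
  assumes "c > 0" "t \<ge> 1" "lambda_min (se_cov n v f t) > c"
  shows "\<exists>L N. cholesky t c (entries (se_cov n v f t)) L N"
proof (rule cholesky_exists[OF assms(1)])
  fix w
  show "(\<Sum>r=1..t. \<Sum>s=1..t. w r * w s * entries (se_cov n v f t) r s) \<ge> c * (\<Sum>s=1..t. (w s)\<^sup>2)"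
    using lambda_min_quad[OF se_cov_carrier assms(2) se_cov_sym assms(3), of w] by (simp add: quad_def entries_def)
  fix r s assume "r \<in> {1..t}" "s \<in> {1..t}"
  then show "entries (se_cov n v f t) r s = entries (se_cov n v f t) s r" unfolding entries_def by (intro se_cov_sym) auto
qed

text \<open>
  The data at one dimension n. L is the Cholesky factor of the last covariance and N its inverse;
  as the covariances are nested, their leading blocks serve the earlier ones.
\<close>

locale amp_instance =
  fixes n T :: nat and v :: rvec and f :: "nat \<Rightarrow> rmat \<Rightarrow> rvec" and c C :: real
    and L N :: "nat \<Rightarrow> nat \<Rightarrow> real"
  assumes n: "n \<ge> 1" and T: "T \<ge> 1" and c: "c > 0"
    and wd: "\<And>t. t \<in> {1..<T} \<Longrightarrow> weakly_differentiable n t (f t)"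
    and si: "se_integrable T n v f"
    and lam: "\<And>t. t \<in> {1..T} \<Longrightarrow> lambda_min (se_cov n v f t) > c"
    and opn: "\<And>t. t \<in> {1..T} \<Longrightarrow> op_norm (se_cov n v f t) < C"
    and ons: "\<And>t s. t \<in> {1..T} \<Longrightarrow> s \<in> {1..<t} \<Longrightarrow> \<bar>onsager n v f t s\<bar> < C"
    and ch: "cholesky T c (entries (se_cov n v f T)) L N"
begin

abbreviation "\<Sigma> t \<equiv> se_cov n v f t"

lemma f_measurable:
  assumes "t \<in> {1..<T}" "j \<in> {1..n}"
  shows "(\<lambda>x. f t x j) \<in> borel_measurable (matrices n t)"
  using wd[OF assms(1)] assms(2) by (auto simp: weakly_differentiable_def loc_integrable_def)

lemma nonlin_measurable:
  assumes "r \<le> t" "r < T" "j \<in> {1..n}"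
  shows "(\<lambda>x. nonlin n v f r x j) \<in> borel_measurable (matrices n t)"
proof (cases "r = 0")
  case False
  have "take_cols n r \<in> matrices n t \<rightarrow>\<^sub>M matrices n r"
    by (rule take_cols_measurable) (use assms in \<open>auto intro: matrices_entry\<close>)
  from measurable_compose[OF this f_measurable[of r j]] show ?thesis
    using False assms by (simp add: nonlin_def)
qed (simp add: nonlin_def)

lemma dot_nonlin_measurable:
  assumes "r \<le> t" "s \<le> t" "r < T" "s < T"
  shows "(\<lambda>x. dot n (nonlin n v f r x) (nonlin n v f s x)) \<in> borel_measurable (matrices n t)"
  using assms by (intro dot_measurable nonlin_measurable)

lemma cholesky_any: "t \<in> {1..T} \<Longrightarrow> \<exists>L' N'. cholesky t c (entries (\<Sigma> t)) L' N'"
  by (rule cholesky_of_lambda_min[OF c _ lam]) auto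

text \<open>
  The covariances are nested. Their entries are expectations of functions of the first columns,
  and by induction the first columns have the law prescribed by the smaller covariance.
\<close>

lemma se_cov_Suc:
  assumes "Suc t \<le> T" "1 \<le> t" "r \<in> {1..t}" "s \<in> {1..t}"
  shows "entries (\<Sigma> (Suc t)) r s = entries (\<Sigma> t) r s"
  using assms
proof (induction t arbitrary: r s)
  case (Suc t)
  show ?case
  proof (cases t)
    case 0
    interpret G: prob_space "gauss_rows n (\<Sigma> (Suc 0))" by (rule prob_space_gauss_rows)
    from 0 Suc.prems have "r = 1" "s = 1" by auto
    then show ?thesis using 0 G.prob_space by (simp add: entries_def nonlin_def)
  next
    case (Suc u)
    then have t1: "1 \<le> t" by simp
    obtain L' N' where ch': "cholesky (Suc t) c (entries (\<Sigma> (Suc t))) L' N'"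
      using cholesky_any[of "Suc t"] Suc.prems by auto
    have marg: "distr (gauss_rows n (\<Sigma> (Suc t))) (matrices n t) (take_cols n t) = gauss_rows n (\<Sigma> t)"
      using Suc.IH Suc.prems t1
      by (intro gauss_rows_marginal[OF se_cov_carrier se_cov_carrier _ ch']) auto
    have tm: "take_cols n t \<in> gauss_rows n (\<Sigma> (Suc t)) \<rightarrow>\<^sub>M matrices n t"
      using sets_gauss_rows[of "\<Sigma> (Suc t)" "Suc t" n] se_cov_carrier[of n v f "Suc t"]
      by (subst measurable_cong_sets[OF _ refl]) (auto intro!: take_cols_measurable matrices_entry)
    have lt: "r - 1 < Suc (Suc t)" "s - 1 < Suc (Suc t)" "r - 1 < Suc t" "s - 1 < Suc t" using Suc.prems by auto
    have "entries (\<Sigma> (Suc (Suc t))) r s = (LINT x|gauss_rows n (\<Sigma> (Suc t)). dot n (nonlin n v f (r - 1) x) (nonlin n v f (s - 1) x)) / real n"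
      using lt by (simp add: entries_def)
    also have "(LINT x|gauss_rows n (\<Sigma> (Suc t)). dot n (nonlin n v f (r - 1) x) (nonlin n v f (s - 1) x))
       = (LINT x|gauss_rows n (\<Sigma> (Suc t)). dot n (nonlin n v f (r - 1) (take_cols n t x)) (nonlin n v f (s - 1) (take_cols n t x)))"
      using Suc.prems by (subst (1 2) nonlin_take_cols) auto
    also have "\<dots> = (LINT x|gauss_rows n (\<Sigma> t). dot n (nonlin n v f (r - 1) x) (nonlin n v f (s - 1) x))"
      unfolding marg[symmetric]
      by (rule integral_distr[OF tm dot_nonlin_measurable, symmetric]) (use Suc.prems in auto)
    also have "\<dots> / real n = entries (\<Sigma> (Suc t)) r s"
      using lt \<open>t = Suc u\<close> by (simp add: entries_def)
    finally show ?thesis .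
  qed
qed simp

lemma se_cov_nested:
  assumes "t \<le> T" "r \<in> {1..t}" "s \<in> {1..t}"
  shows "entries (\<Sigma> t) r s = entries (\<Sigma> T) r s"
  using assms
proof (induction t rule: inc_induct)
  case (step m)
  then have "entries (\<Sigma> m) r s = entries (\<Sigma> (Suc m)) r s" by (intro se_cov_Suc[symmetric]) auto
  then show ?case using step by auto
qed simp

lemma ch_leading:
  assumes "t \<le> T"
  shows "cholesky t c (entries (\<Sigma> t)) L N"
  by (rule leading_factor(1)[OF se_cov_carrier se_cov_carrier assms ch]) (rule se_cov_nested[OF assms])

lemma gauss_rows_take_cols:
  assumes "t \<le> T" "F \<in> borel_measurable (matrices n t)"
  shows "(LINT x|gauss_rows n (\<Sigma> T). F (take_cols n t x)) = (LINT x|gauss_rows n (\<Sigma> t). F x :: real)"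
proof -
  have tm: "take_cols n t \<in> gauss_rows n (\<Sigma> T) \<rightarrow>\<^sub>M matrices n t"
    using sets_gauss_rows[of "\<Sigma> T" "T" n] se_cov_carrier[of n v f "T"] assms
    by (subst measurable_cong_sets[OF _ refl]) (auto intro!: take_cols_measurable matrices_entry)
  have "distr (gauss_rows n (\<Sigma> T)) (matrices n t) (take_cols n t) = gauss_rows n (\<Sigma> t)"
    using assms by (intro gauss_rows_marginal[OF se_cov_carrier se_cov_carrier _ ch] se_cov_nested) auto
  then show ?thesis using integral_distr[OF tm assms(2)] by simp
qed

text \<open>
  State evolution defines the last covariance by these expectations under the law of the first
  columns; by nestedness they can be taken under the law of all T columns.
\<close>

lemma gram_expectation:
  assumes "r < T" "s < T"
  shows "(LINT x|gauss_rows n (\<Sigma> T). dot n (nonlin n v f r x) (nonlin n v f s x)) = real n * entries (\<Sigma> T) (Suc r) (Suc s)"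
proof (cases "T = 1")
  case True
  interpret G: prob_space "gauss_rows n (\<Sigma> T)" by (rule prob_space_gauss_rows)
  show ?thesis using assms True n G.prob_space by (simp add: entries_def nonlin_def)
next
  case False
  then obtain u where u: "T = Suc (Suc u)" using T by (metis One_nat_def Suc_pred le_0_eq not0_implies_Suc not_less_eq_eq)
  have "(LINT x|gauss_rows n (\<Sigma> T). dot n (nonlin n v f r x) (nonlin n v f s x))
     = (LINT x|gauss_rows n (\<Sigma> T). dot n (nonlin n v f r (take_cols n (Suc u) x)) (nonlin n v f s (take_cols n (Suc u) x)))"
  proof -
    have "r \<le> Suc u" "s \<le> Suc u" using assms u by auto
    then show ?thesis by (simp only: nonlin_take_cols)
  qed
  also have "\<dots> = (LINT x|gauss_rows n (\<Sigma> (Suc u)). dot n (nonlin n v f r x) (nonlin n v f s x))"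
  proof (rule gauss_rows_take_cols)
    show "Suc u \<le> T" using u by simp
    show "(\<lambda>x. dot n (nonlin n v f r x) (nonlin n v f s x)) \<in> borel_measurable (matrices n (Suc u))"
      using assms u by (intro dot_nonlin_measurable) linarith+
  qed
  also have "\<dots> = real n * entries (\<Sigma> T) (Suc r) (Suc s)"
  proof -
    have "r < Suc (Suc u)" "s < Suc (Suc u)" using assms u by auto
    then show ?thesis unfolding u entries_def using n by simp
  qed
  finally show ?thesis .
qed

text \<open>
  The Onsager coefficients are the averaged partial derivatives that Gaussian integration by parts
  produces.
\<close>

lemma cross_expectation:
  assumes s: "s \<in> {1..<T}" and t: "t \<in> {1..s}"
  shows "(LINT x|gauss_rows n (\<Sigma> T). dot n (\<lambda>i. x i t) (nonlin n v f s x))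
     = real n * (\<Sum>r=1..s. entries (\<Sigma> T) t r * onsager n v f (Suc s) r)"
proof -
  let ?G = "gauss_rows n (\<Sigma> s)"
  let ?g = "\<lambda>i r. weak_partial n s i r (\<lambda>y. f s y i)"
  have wp: "is_weak_partial n s i r (\<lambda>y. f s y i) (?g i r)" if "i \<in> {1..n}" "r \<in> {1..s}" for i r
    unfolding weak_partial_def using wd[OF s] that
    by (intro someI_ex[of "is_weak_partial n s i r (\<lambda>y. f s y i)"]) (auto simp: weakly_differentiable_def)
  have sG: "sets ?G = sets (matrices n s)" using se_cov_carrier[of n v f s] by (intro sets_gauss_rows) auto
  have fm: "(\<lambda>y. f s y i) \<in> borel_measurable (matrices n s)" if "i \<in> {1..n}" for i using f_measurable[OF s that] .
  have f2: "integrable ?G (\<lambda>x. (f s x i)\<^sup>2)" if i: "i \<in> {1..n}" for i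
  proof (rule Bochner_Integration.integrable_bound)
    show "integrable ?G (\<lambda>x. dot n (f s x) (f s x))" using si s by (auto simp: se_integrable_def)
    show "(\<lambda>x. (f s x i)\<^sup>2) \<in> borel_measurable ?G"
      using fm[OF i] by (simp add: measurable_cong_sets[OF sG refl])
    show "AE x in ?G. norm ((f s x i)\<^sup>2) \<le> norm (dot n (f s x) (f s x))"
    proof (rule AE_I2)
      fix x
      have "(f s x i)\<^sup>2 \<le> dot n (f s x) (f s x)"
        unfolding dot_def using member_le_sum[of i "{1..n}" "\<lambda>i. f s x i * f s x i"] i by (simp add: power2_eq_square)
      then show "norm ((f s x i)\<^sup>2) \<le> norm (dot n (f s x) (f s x))" by simp
    qed
  qed
  have gi: "integrable ?G (?g i r)" if "i \<in> {1..n}" "r \<in> {1..s}" for i r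
    using si s that by (auto simp: se_integrable_def)
  have s': "s \<le> T" using s by auto
  note stein = stein_identity[OF se_cov_carrier ch_leading[OF s'] c _ t wp fm f2 gi]
  have "(LINT x|gauss_rows n (\<Sigma> T). dot n (\<lambda>i. x i t) (nonlin n v f s x))
     = (LINT x|gauss_rows n (\<Sigma> T). dot n (\<lambda>i. take_cols n s x i t) (f s (take_cols n s x)))"
    using s t by (intro Bochner_Integration.integral_cong refl dot_cong) (auto simp: nonlin_def take_cols_def)
  also have "\<dots> = (LINT x|?G. dot n (\<lambda>i. x i t) (f s x))"
    by (rule gauss_rows_take_cols[OF s']) (use t fm in \<open>auto intro!: dot_measurable matrices_entry\<close>)
  also have "\<dots> = (\<Sum>i=1..n. LINT x|?G. x i t * f s x i)"
    unfolding dot_def by (intro Bochner_Integration.integral_sum stein(1)) auto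
  also have "\<dots> = (\<Sum>i=1..n. \<Sum>r=1..s. entries (\<Sigma> s) t r * (LINT x|?G. ?g i r x))"
    by (intro sum.cong refl stein(2))
  also have "\<dots> = (\<Sum>r=1..s. entries (\<Sigma> s) t r * (\<Sum>i=1..n. LINT x|?G. ?g i r x))"
    by (subst sum.swap) (simp add: sum_distrib_left)
  also have "\<dots> = (\<Sum>r=1..s. entries (\<Sigma> T) t r * (real n * onsager n v f (Suc s) r))"
    using n t by (intro sum.cong refl arg_cong2[where f="(*)"] se_cov_nested[OF s']) (auto simp: onsager_def)
  finally show ?thesis by (simp add: sum_distrib_left mult_ac)
qed

lemma diag_bound: "s \<in> {1..T} \<Longrightarrow> entries (\<Sigma> T) s s \<le> C"
  using diag_le_op_norm[OF se_cov_carrier[of n v f T], of "s - 1"] opn[of T] T by (force simp: entries_def)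

lemma L_diag: "s \<in> {1..T} \<Longrightarrow> L s s \<ge> sqrt c"
  using ch by (simp add: cholesky_def)

lemma L_factor:
  assumes "r \<in> {1..T}" "s \<in> {1..r}"
  shows "entries (\<Sigma> T) r s = (\<Sum>k=1..s. L r k * L s k)" "entries (\<Sigma> T) s r = (\<Sum>k=1..s. L r k * L s k)"
proof -
  have "entries (\<Sigma> T) s r = (\<Sum>k=1..T. L s k * L r k)" using ch assms by (auto simp: cholesky_def)
  also have "\<dots> = (\<Sum>k=1..s. L s k * L r k)"
    using assms by (intro sum_lower_triangular cholesky_tri(1)[OF ch]) auto
  finally show *: "entries (\<Sigma> T) s r = (\<Sum>k=1..s. L r k * L s k)" by (simp add: mult.commute)
  have "entries (\<Sigma> T) r s = entries (\<Sigma> T) s r" unfolding entries_def using assms by (intro se_cov_sym) auto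
  then show "entries (\<Sigma> T) r s = (\<Sum>k=1..s. L r k * L s k)" using * by simp
qed

lemma L_bound:
  assumes "r \<in> {1..T}" "s \<in> {1..r}"
  shows "\<bar>L r s\<bar> \<le> sqrt C"
proof -
  have "(L r s)\<^sup>2 \<le> (\<Sum>k=1..r. L r k * L r k)"
    using member_le_sum[of s "{1..r}" "\<lambda>k. L r k * L r k"] assms by (simp add: power2_eq_square)
  also have "\<dots> = entries (\<Sigma> T) r r" using L_factor(1)[of r r] assms by simp
  also have "\<dots> \<le> C" by (rule diag_bound[OF assms(1)])
  finally have "sqrt ((L r s)\<^sup>2) \<le> sqrt C" by (rule real_sqrt_le_mono)
  then show ?thesis by simp
qed

end

section \<open>Calculus of stochastic domination\<close>

text \<open>
  Domination in outer probability: a failure event only has to be covered by a measurable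
  set. Rules for sums and products then follow from inclusions between events alone.
\<close>

definition prob_at_rate :: "(nat \<Rightarrow> 'w measure) \<Rightarrow> (nat \<Rightarrow> 'w \<Rightarrow> bool) \<Rightarrow> real \<Rightarrow> bool" where
  "prob_at_rate M A D \<longleftrightarrow> (\<forall>\<^sub>F n in sequentially. \<exists>B\<in>sets (M n).
     {\<omega>\<in>space (M n). \<not> A n \<omega>} \<subseteq> B \<and> measure (M n) B < real n powr (- D))"

definition whp :: "(nat \<Rightarrow> 'w measure) \<Rightarrow> (nat \<Rightarrow> 'w \<Rightarrow> bool) \<Rightarrow> bool" where
  "whp M A \<longleftrightarrow> (\<forall>D>0. prob_at_rate M A D)"

definition outer_le :: "(nat \<Rightarrow> 'w measure) \<Rightarrow> (nat \<Rightarrow> 'w \<Rightarrow> real) \<Rightarrow> real \<Rightarrow> bool" where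
  "outer_le M X a \<longleftrightarrow> (\<forall>D>0. \<exists>C>0.
     prob_at_rate M (\<lambda>n \<omega>. \<bar>X n \<omega>\<bar> \<le> ln (real n) powr C * real n powr (- a)) D)"

lemma eventually_ln_ge: "\<forall>\<^sub>F n in sequentially. ln (real n) \<ge> K"
proof -
  have "filterlim (\<lambda>n. ln (real n)) at_top sequentially" by real_asymp
  then show ?thesis by (simp add: filterlim_at_top)
qed

lemma prob_at_rate_mono:
  assumes "prob_at_rate M A D" "\<forall>\<^sub>F n in sequentially. \<forall>\<omega>\<in>space (M n). A n \<omega> \<longrightarrow> B n \<omega>"
  shows "prob_at_rate M B D"
  using assms unfolding prob_at_rate_def by eventually_elim blast

lemma prob_at_rate_conj:
  assumes "prob_at_rate M A (D + 1)" "prob_at_rate M B (D + 1)"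
  shows "prob_at_rate M (\<lambda>n \<omega>. A n \<omega> \<and> B n \<omega>) D"
  using assms eventually_ge_at_top[of 2] unfolding prob_at_rate_def
proof eventually_elim
  case (elim n)
  then obtain U V where U: "U \<in> sets (M n)" "{\<omega>\<in>space (M n). \<not> A n \<omega>} \<subseteq> U" "measure (M n) U < real n powr (- (D + 1))"
    and V: "V \<in> sets (M n)" "{\<omega>\<in>space (M n). \<not> B n \<omega>} \<subseteq> V" "measure (M n) V < real n powr (- (D + 1))" by blast
  have "measure (M n) (U \<union> V) \<le> measure (M n) U + measure (M n) V" using U V by (intro measure_Un_le)
  also have "\<dots> < 2 * real n powr (- (D + 1))" using U V by simp
  also have "\<dots> \<le> real n * real n powr (- (D + 1))" using elim by (intro mult_right_mono) auto
  also have "\<dots> = real n powr (1 + - (D + 1))" using elim by (subst powr_add) simp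
  finally have "measure (M n) (U \<union> V) < real n powr (- D)" by simp
  then show ?case using U V by (intro bexI[of _ "U \<union> V"]) auto
qed

lemma whp_mono:
  assumes "whp M A" "\<forall>\<^sub>F n in sequentially. \<forall>\<omega>\<in>space (M n). A n \<omega> \<longrightarrow> B n \<omega>"
  shows "whp M B"
  using assms prob_at_rate_mono unfolding whp_def by blast

lemma whp_True: "\<forall>\<^sub>F n in sequentially. \<forall>\<omega>\<in>space (M n). A n \<omega> \<Longrightarrow> whp M A"
  unfolding whp_def prob_at_rate_def
proof (intro allI impI)
  fix D :: real assume "\<forall>\<^sub>F n in sequentially. \<forall>\<omega>\<in>space (M n). A n \<omega>"
  then show "\<forall>\<^sub>F n in sequentially. \<exists>B\<in>sets (M n). {\<omega> \<in> space (M n). \<not> A n \<omega>} \<subseteq> B \<and> measure (M n) B < real n powr - D"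
    using eventually_gt_at_top[of 0] by eventually_elim (intro bexI[of _ "{}"]; auto)
qed

lemma whp_conj:
  assumes "whp M A" "whp M B"
  shows "whp M (\<lambda>n \<omega>. A n \<omega> \<and> B n \<omega>)"
  unfolding whp_def
proof (intro allI impI prob_at_rate_conj)
  fix D :: real assume "D > 0"
  then show "prob_at_rate M A (D + 1)" "prob_at_rate M B (D + 1)" using assms by (simp_all add: whp_def)
qed

lemma whp_ball:
  assumes "finite I" "\<And>i. i \<in> I \<Longrightarrow> whp M (A i)"
  shows "whp M (\<lambda>n \<omega>. \<forall>i\<in>I. A i n \<omega>)"
  using assms by (induction I) (auto intro: whp_conj whp_True)

lemma outer_le_whp_mono:
  assumes "whp M G" "outer_le M Y a"
    and "\<forall>\<^sub>F n in sequentially. \<forall>\<omega>\<in>space (M n). G n \<omega> \<longrightarrow> \<bar>X n \<omega>\<bar> \<le> \<bar>Y n \<omega>\<bar>"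
  shows "outer_le M X a"
  unfolding outer_le_def
proof (intro allI impI)
  fix D :: real assume D: "D > 0"
  then have D1: "D + 1 > 0" by simp
  then obtain C where C: "C > 0" "prob_at_rate M (\<lambda>n \<omega>. \<bar>Y n \<omega>\<bar> \<le> ln (real n) powr C * real n powr (- a)) (D + 1)"
    using assms(2) unfolding outer_le_def by blast
  have "prob_at_rate M G (D + 1)" using assms(1) D unfolding whp_def by simp
  from prob_at_rate_conj[OF this C(2)]
  have "prob_at_rate M (\<lambda>n \<omega>. \<bar>X n \<omega>\<bar> \<le> ln (real n) powr C * real n powr (- a)) D"
    by (rule prob_at_rate_mono) (use assms(3) in \<open>eventually_elim, force\<close>)
  then show "\<exists>C>0. prob_at_rate M (\<lambda>n \<omega>. \<bar>X n \<omega>\<bar> \<le> ln (real n) powr C * real n powr (- a)) D"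
    using C by blast
qed

lemma outer_le_mono:
  assumes "outer_le M Y a" "\<And>n \<omega>. n \<ge> 1 \<Longrightarrow> \<omega> \<in> space (M n) \<Longrightarrow> \<bar>X n \<omega>\<bar> \<le> \<bar>Y n \<omega>\<bar>"
  shows "outer_le M X a"
proof (rule outer_le_whp_mono[OF whp_True assms(1)])
  show "\<forall>\<^sub>F n in sequentially. \<forall>\<omega>\<in>space (M n). True \<longrightarrow> \<bar>X n \<omega>\<bar> \<le> \<bar>Y n \<omega>\<bar>"
    using eventually_ge_at_top[of 1] by eventually_elim (use assms(2) in auto)
qed simp

lemma outer_le_cong:
  assumes "outer_le M Y a" "\<And>n \<omega>. n \<ge> 1 \<Longrightarrow> \<omega> \<in> space (M n) \<Longrightarrow> X n \<omega> = Y n \<omega>"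
  shows "outer_le M X a"
  by (rule outer_le_mono[OF assms(1)]) (simp add: assms(2))

lemma outer_le_add:
  assumes "outer_le M X a" "outer_le M Y a"
  shows "outer_le M (\<lambda>n \<omega>. X n \<omega> + Y n \<omega>) a"
  unfolding outer_le_def
proof (intro allI impI)
  fix D :: real assume D: "D > 0"
  then have D1: "D + 1 > 0" by simp
  obtain C1 where C1: "C1 > 0" "prob_at_rate M (\<lambda>n \<omega>. \<bar>X n \<omega>\<bar> \<le> ln (real n) powr C1 * real n powr (- a)) (D + 1)"
    using assms(1) D1 unfolding outer_le_def by blast
  obtain C2 where C2: "C2 > 0" "prob_at_rate M (\<lambda>n \<omega>. \<bar>Y n \<omega>\<bar> \<le> ln (real n) powr C2 * real n powr (- a)) (D + 1)"
    using assms(2) D1 unfolding outer_le_def by blast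
  have "prob_at_rate M (\<lambda>n \<omega>. \<bar>X n \<omega> + Y n \<omega>\<bar> \<le> ln (real n) powr (C1 + C2 + 1) * real n powr (- a)) D"
  proof (rule prob_at_rate_mono[OF prob_at_rate_conj[OF C1(2) C2(2)]])
    show "\<forall>\<^sub>F n in sequentially. \<forall>\<omega>\<in>space (M n). \<bar>X n \<omega>\<bar> \<le> ln (real n) powr C1 * real n powr (- a) \<and> \<bar>Y n \<omega>\<bar> \<le> ln (real n) powr C2 * real n powr (- a)
       \<longrightarrow> \<bar>X n \<omega> + Y n \<omega>\<bar> \<le> ln (real n) powr (C1 + C2 + 1) * real n powr (- a)"
      using eventually_ln_ge[of 2]
    proof (eventually_elim, intro ballI impI)
      fix n \<omega>
      assume l: "2 \<le> ln (real n)" and b: "\<bar>X n \<omega>\<bar> \<le> ln (real n) powr C1 * real n powr (- a) \<and> \<bar>Y n \<omega>\<bar> \<le> ln (real n) powr C2 * real n powr (- a)"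
      define l where "l = ln (real n)"
      have "l powr C1 \<le> l powr (C1 + C2)" "l powr C2 \<le> l powr (C1 + C2)" using C1 C2 l by (auto intro!: powr_mono simp: l_def)
      then have "l powr C1 + l powr C2 \<le> l powr (C1 + C2) * 2" by linarith
      also have "\<dots> \<le> l powr (C1 + C2) * l" using l by (intro mult_left_mono) (auto simp: l_def)
      also have "\<dots> = l powr (C1 + C2 + 1)" using l by (simp add: powr_add l_def)
      finally have "(l powr C1 + l powr C2) * real n powr (- a) \<le> l powr (C1 + C2 + 1) * real n powr (- a)"
        by (intro mult_right_mono) auto
      then show "\<bar>X n \<omega> + Y n \<omega>\<bar> \<le> ln (real n) powr (C1 + C2 + 1) * real n powr (- a)"
        using b unfolding l_def distrib_right by linarith
    qed
  qed
  then show "\<exists>C>0. prob_at_rate M (\<lambda>n \<omega>. \<bar>X n \<omega> + Y n \<omega>\<bar> \<le> ln (real n) powr C * real n powr (- a)) D"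
    using C1 C2 by (intro exI[of _ "C1 + C2 + 1"]) auto
qed

text \<open>
  The product of two powers of the logarithm is again one, with the sum of the exponents.
\<close>

lemma outer_le_mult:
  assumes "outer_le M X a" "outer_le M Y b"
  shows "outer_le M (\<lambda>n \<omega>. X n \<omega> * Y n \<omega>) (a + b)"
  unfolding outer_le_def
proof (intro allI impI)
  fix D :: real assume D: "D > 0"
  then have D1: "D + 1 > 0" by simp
  obtain C1 where C1: "C1 > 0" "prob_at_rate M (\<lambda>n \<omega>. \<bar>X n \<omega>\<bar> \<le> ln (real n) powr C1 * real n powr (- a)) (D + 1)"
    using assms(1) D1 unfolding outer_le_def by blast
  obtain C2 where C2: "C2 > 0" "prob_at_rate M (\<lambda>n \<omega>. \<bar>Y n \<omega>\<bar> \<le> ln (real n) powr C2 * real n powr (- b)) (D + 1)"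
    using assms(2) D1 unfolding outer_le_def by blast
  have "prob_at_rate M (\<lambda>n \<omega>. \<bar>X n \<omega> * Y n \<omega>\<bar> \<le> ln (real n) powr (C1 + C2) * real n powr (- (a + b))) D"
  proof (rule prob_at_rate_mono[OF prob_at_rate_conj[OF C1(2) C2(2)]], intro always_eventually allI ballI impI)
    fix n \<omega>
    assume b: "\<bar>X n \<omega>\<bar> \<le> ln (real n) powr C1 * real n powr (- a) \<and> \<bar>Y n \<omega>\<bar> \<le> ln (real n) powr C2 * real n powr (- b)"
    have "\<bar>X n \<omega> * Y n \<omega>\<bar> \<le> (ln (real n) powr C1 * real n powr (- a)) * (ln (real n) powr C2 * real n powr (- b))"
      unfolding abs_mult using b by (intro mult_mono) auto
    also have "\<dots> = ln (real n) powr (C1 + C2) * real n powr (- a + - b)" by (simp only: powr_add mult_ac)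
    finally show "\<bar>X n \<omega> * Y n \<omega>\<bar> \<le> ln (real n) powr (C1 + C2) * real n powr (- (a + b))" by (simp add: algebra_simps)
  qed
  then show "\<exists>C>0. prob_at_rate M (\<lambda>n \<omega>. \<bar>X n \<omega> * Y n \<omega>\<bar> \<le> ln (real n) powr C * real n powr (- (a + b))) D"
    using C1 C2 by (intro exI[of _ "C1 + C2"]) auto
qed

lemma outer_le_mult_rate:
  assumes "outer_le M X a" "outer_le M Y b" "a + b = d"
  shows "outer_le M (\<lambda>n \<omega>. X n \<omega> * Y n \<omega>) d"
  using outer_le_mult[OF assms(1,2)] assms(3) by simp

lemma outer_le_const:
  assumes "\<And>n. n \<ge> 1 \<Longrightarrow> \<bar>k n\<bar> \<le> K"
  shows "outer_le M (\<lambda>n \<omega>. k n) 0"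
  unfolding outer_le_def
proof (intro allI impI exI conjI)
  fix D :: real assume "D > 0"
  have "whp M (\<lambda>n \<omega>. \<bar>k n\<bar> \<le> ln (real n) powr 1 * real n powr (- 0))"
  proof (rule whp_True)
    show "\<forall>\<^sub>F n in sequentially. \<forall>\<omega>\<in>space (M n). \<bar>k n\<bar> \<le> ln (real n) powr 1 * real n powr (- 0)"
      using eventually_ln_ge[of "max K 1"] eventually_ge_at_top[of 1]
      by eventually_elim (use assms in \<open>force intro: order_trans\<close>)
  qed
  then show "prob_at_rate M (\<lambda>n \<omega>. \<bar>k n\<bar> \<le> ln (real n) powr 1 * real n powr (- 0)) D" using \<open>D > 0\<close> by (simp only: whp_def)
qed simp

lemma outer_le_zero: "outer_le M (\<lambda>n \<omega>. 0) a"
  unfolding outer_le_def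
proof (intro allI impI exI conjI)
  fix D :: real assume "D > 0"
  have "whp M (\<lambda>n \<omega>. \<bar>0\<bar> \<le> ln (real n) powr 1 * real n powr (- a))" by (rule whp_True) simp
  then show "prob_at_rate M (\<lambda>n \<omega>. \<bar>0\<bar> \<le> ln (real n) powr 1 * real n powr (- a)) D" using \<open>D > 0\<close> by (simp only: whp_def)
qed simp

lemma outer_le_powr: "outer_le M (\<lambda>n \<omega>. real n powr (- a)) a"
  unfolding outer_le_def
proof (intro allI impI exI conjI)
  fix D :: real assume "D > 0"
  have "whp M (\<lambda>n \<omega>. \<bar>real n powr (- a)\<bar> \<le> ln (real n) powr 1 * real n powr (- a))"
  proof (rule whp_True)
    show "\<forall>\<^sub>F n in sequentially. \<forall>\<omega>\<in>space (M n). \<bar>real n powr (- a)\<bar> \<le> ln (real n) powr 1 * real n powr (- a)"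
      using eventually_ln_ge[of 1]
    proof eventually_elim
      case (elim n)
      then have "1 * real n powr (- a) \<le> ln (real n) powr 1 * real n powr (- a)" by (intro mult_right_mono) auto
      then show ?case by simp
    qed
  qed
  then show "prob_at_rate M (\<lambda>n \<omega>. \<bar>real n powr (- a)\<bar> \<le> ln (real n) powr 1 * real n powr (- a)) D" using \<open>D > 0\<close> by (simp only: whp_def)
qed simp

lemma outer_le_sum:
  assumes "\<And>i. i \<in> I \<Longrightarrow> outer_le M (X i) a"
  shows "outer_le M (\<lambda>n \<omega>. \<Sum>i\<in>I. X i n \<omega>) a"
  using assms by (induction I rule: infinite_finite_induct) (auto intro: outer_le_add outer_le_zero)

lemma outer_le_uminus: "outer_le M X a \<Longrightarrow> outer_le M (\<lambda>n \<omega>. - X n \<omega>) a"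
  by (rule outer_le_mono) auto

lemma outer_le_abs: "outer_le M X a \<Longrightarrow> outer_le M (\<lambda>n \<omega>. \<bar>X n \<omega>\<bar>) a"
  by (rule outer_le_mono) auto

lemma outer_le_diff:
  assumes "outer_le M X a" "outer_le M Y a"
  shows "outer_le M (\<lambda>n \<omega>. X n \<omega> - Y n \<omega>) a"
  using outer_le_add[OF assms(1) outer_le_uminus[OF assms(2)]] by simp

lemma outer_le_weaken:
  assumes "outer_le M X b" "a \<le> b"
  shows "outer_le M X a"
proof -
  have "outer_le M (\<lambda>n \<omega>. real n powr (- (a - b))) (a - b)" by (rule outer_le_powr)
  then have "outer_le M (\<lambda>n \<omega>. X n \<omega> * real n powr (- (a - b))) a"
    by (intro outer_le_mult_rate[OF assms(1)]) auto
  then show ?thesis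
  proof (rule outer_le_mono)
    fix n :: nat and \<omega> assume "n \<ge> 1"
    then have "1 \<le> real n powr (- (a - b))" using assms by (intro ge_one_powr_ge_zero) auto
    then show "\<bar>X n \<omega>\<bar> \<le> \<bar>X n \<omega> * real n powr (- (a - b))\<bar>" by (simp add: abs_mult mult_le_cancel_left1)
  qed
qed

lemma whp_small:
  assumes "outer_le M X a" "a > 0" "\<epsilon> > 0"
  shows "whp M (\<lambda>n \<omega>. \<bar>X n \<omega>\<bar> \<le> \<epsilon>)"
  unfolding whp_def
proof (intro allI impI)
  fix D :: real assume "D > 0"
  then obtain C where C: "C > 0" "prob_at_rate M (\<lambda>n \<omega>. \<bar>X n \<omega>\<bar> \<le> ln (real n) powr C * real n powr (- a)) D"
    using assms(1) unfolding outer_le_def by blast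
  have "(\<lambda>n. ln (real n) powr C * real n powr (- a)) \<longlonglongrightarrow> 0" using assms(2) C(1) by real_asymp
  then have ev: "\<forall>\<^sub>F n in sequentially. ln (real n) powr C * real n powr (- a) < \<epsilon>"
    using assms(3) by (rule order_tendstoD(2))
  show "prob_at_rate M (\<lambda>n \<omega>. \<bar>X n \<omega>\<bar> \<le> \<epsilon>) D"
  proof (rule prob_at_rate_mono[OF C(2)])
    show "\<forall>\<^sub>F n in sequentially. \<forall>\<omega>\<in>space (M n). \<bar>X n \<omega>\<bar> \<le> ln (real n) powr C * real n powr (- a) \<longrightarrow> \<bar>X n \<omega>\<bar> \<le> \<epsilon>"
      using ev by eventually_elim auto
  qed
qed

lemma outer_le_of_stoch_le:
  assumes "stoch_le M X a" "\<And>n. n \<ge> 1 \<Longrightarrow> X n \<in> borel_measurable (M n)"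
  shows "outer_le M X a"
  unfolding outer_le_def
proof (intro allI impI)
  fix D :: real assume "D > 0"
  then obtain C where C: "C > 0" and ev: "\<forall>\<^sub>F n in sequentially.
        measure (M n) {\<omega> \<in> space (M n). \<bar>X n \<omega>\<bar> > ln (real n) powr C * real n powr (- a)} < real n powr (- D)"
    using assms(1) unfolding stoch_le_def by blast
  have "prob_at_rate M (\<lambda>n \<omega>. \<bar>X n \<omega>\<bar> \<le> ln (real n) powr C * real n powr (- a)) D"
    unfolding prob_at_rate_def using ev eventually_ge_at_top[of 1]
  proof eventually_elim
    case (elim n)
    have [measurable]: "X n \<in> borel_measurable (M n)" using elim assms(2) by simp
    show ?case
      by (intro bexI[of _ "{\<omega> \<in> space (M n). \<bar>X n \<omega>\<bar> > ln (real n) powr C * real n powr (- a)}"])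
         (use elim in \<open>auto simp: not_le\<close>)
  qed
  then show "\<exists>C>0. prob_at_rate M (\<lambda>n \<omega>. \<bar>X n \<omega>\<bar> \<le> ln (real n) powr C * real n powr (- a)) D"
    using C by blast
qed

lemma stoch_le_of_outer_le:
  assumes "outer_le M X a" "\<And>n. n \<ge> 1 \<Longrightarrow> prob_space (M n)"
  shows "stoch_le M X a"
  unfolding stoch_le_def
proof (intro allI impI)
  fix D :: real assume "D > 0"
  then obtain C where C: "C > 0" "prob_at_rate M (\<lambda>n \<omega>. \<bar>X n \<omega>\<bar> \<le> ln (real n) powr C * real n powr (- a)) D"
    using assms(1) unfolding outer_le_def by blast
  have "\<forall>\<^sub>F n in sequentially. measure (M n) {\<omega> \<in> space (M n). \<bar>X n \<omega>\<bar> > ln (real n) powr C * real n powr (- a)} < real n powr (- D)"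
    using C(2) eventually_ge_at_top[of 1] unfolding prob_at_rate_def
  proof eventually_elim
    case (elim n)
    interpret prob_space "M n" using elim assms(2) by simp
    let ?A = "{\<omega> \<in> space (M n). \<bar>X n \<omega>\<bar> > ln (real n) powr C * real n powr (- a)}"
    from elim obtain B where B: "B \<in> sets (M n)" "?A \<subseteq> B" "measure (M n) B < real n powr (- D)"
      by (auto simp: not_le)
    have "measure (M n) ?A \<le> measure (M n) B"
    proof (cases "?A \<in> sets (M n)")
      case False
      then have "measure (M n) ?A = 0" by (rule measure_notin_sets)
      then show ?thesis by (simp only: measure_nonneg)
    qed (rule finite_measure_mono[OF B(2,1)])
    then show ?case using B by linarith
  qed
  then show "\<exists>C>0. \<forall>\<^sub>F n in sequentially. measure (M n) {\<omega> \<in> space (M n). \<bar>X n \<omega>\<bar> > ln (real n) powr C * real n powr (- a)} < real n powr (- D)"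
    using C by blast
qed

lemma outer_le_distr:
  assumes "outer_le M (\<lambda>n \<omega>. X n (\<phi> n \<omega>)) a" "\<And>n. n \<ge> 1 \<Longrightarrow> \<phi> n \<in> measurable (M n) (N n)"
    and "\<And>n. n \<ge> 1 \<Longrightarrow> prob_space (M n)" "\<And>n. n \<ge> 1 \<Longrightarrow> X n \<in> borel_measurable (N n)"
  shows "outer_le (\<lambda>n. distr (M n) (N n) (\<phi> n)) X a"
proof -
  note s = stoch_le_of_outer_le[OF assms(1,3)]
  have "stoch_le (\<lambda>n. distr (M n) (N n) (\<phi> n)) X a"
    unfolding stoch_le_def
  proof (intro allI impI)
    fix D :: real assume "D > 0"
    then obtain C where C: "C > 0" and ev: "\<forall>\<^sub>F n in sequentially.
        measure (M n) {\<omega> \<in> space (M n). \<bar>X n (\<phi> n \<omega>)\<bar> > ln (real n) powr C * real n powr (- a)} < real n powr (- D)"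
      using s unfolding stoch_le_def by blast
    have "\<forall>\<^sub>F n in sequentially. measure (distr (M n) (N n) (\<phi> n)) {\<omega> \<in> space (distr (M n) (N n) (\<phi> n)). \<bar>X n \<omega>\<bar> > ln (real n) powr C * real n powr (- a)} < real n powr (- D)"
      using ev eventually_ge_at_top[of 1]
    proof eventually_elim
      case (elim n)
      have m[measurable]: "\<phi> n \<in> measurable (M n) (N n)" "X n \<in> borel_measurable (N n)" using elim assms by auto
      have "measure (distr (M n) (N n) (\<phi> n)) {\<omega> \<in> space (N n). \<bar>X n \<omega>\<bar> > ln (real n) powr C * real n powr (- a)}
        = measure (M n) {\<omega> \<in> space (M n). \<bar>X n (\<phi> n \<omega>)\<bar> > ln (real n) powr C * real n powr (- a)}"
        by (subst measure_distr) (auto intro!: arg_cong[where f="measure (M n)"] dest: measurable_space[OF m(1)])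
      then show ?case using elim by simp
    qed
    then show "\<exists>C>0. \<forall>\<^sub>F n in sequentially. measure (distr (M n) (N n) (\<phi> n)) {\<omega> \<in> space (distr (M n) (N n) (\<phi> n)). \<bar>X n \<omega>\<bar> > ln (real n) powr C * real n powr (- a)} < real n powr (- D)"
      using C by blast
  qed
  then show ?thesis by (rule outer_le_of_stoch_le) (use assms in auto)
qed

lemma outer_le_pullback:
  assumes "outer_le N X a" "\<And>n. n \<ge> 1 \<Longrightarrow> \<phi> n \<in> measurable (M n) (N n)"
    and law: "\<And>n. n \<ge> 1 \<Longrightarrow> distr (M n) (N n) (\<phi> n) = N n"
  shows "outer_le M (\<lambda>n \<omega>. X n (\<phi> n \<omega>)) a"
  unfolding outer_le_def
proof (intro allI impI)
  fix D :: real assume "D > 0"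
  then obtain C where C: "C > 0" "prob_at_rate N (\<lambda>n \<omega>. \<bar>X n \<omega>\<bar> \<le> ln (real n) powr C * real n powr (- a)) D"
    using assms(1) unfolding outer_le_def by blast
  have "prob_at_rate M (\<lambda>n \<omega>. \<bar>X n (\<phi> n \<omega>)\<bar> \<le> ln (real n) powr C * real n powr (- a)) D"
    using C(2) eventually_ge_at_top[of 1] unfolding prob_at_rate_def
  proof eventually_elim
    case (elim n)
    then obtain B where B: "B \<in> sets (N n)" "{\<omega> \<in> space (N n). \<not> \<bar>X n \<omega>\<bar> \<le> ln (real n) powr C * real n powr (- a)} \<subseteq> B" "measure (N n) B < real n powr (- D)"
      by blast
    have m: "\<phi> n \<in> measurable (M n) (N n)" using elim assms by auto
    have "measure (N n) B = measure (M n) (\<phi> n -` B \<inter> space (M n))"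
      using law[of n] elim measure_distr[OF m B(1)] by simp
    then show ?case
      using B measurable_space[OF m] measurable_sets[OF m B(1)]
      by (intro bexI[of _ "\<phi> n -` B \<inter> space (M n)"]) auto
  qed
  then show "\<exists>C>0. prob_at_rate M (\<lambda>n \<omega>. \<bar>X n (\<phi> n \<omega>)\<bar> \<le> ln (real n) powr C * real n powr (- a)) D"
    using C by blast
qed

lemma whp_pullback:
  assumes "whp N A" "\<And>n. n \<ge> 1 \<Longrightarrow> \<phi> n \<in> measurable (M n) (N n)"
    and law: "\<And>n. n \<ge> 1 \<Longrightarrow> distr (M n) (N n) (\<phi> n) = N n"
  shows "whp M (\<lambda>n \<omega>. A n (\<phi> n \<omega>))"
  unfolding whp_def
proof (intro allI impI)
  fix D :: real assume "D > 0"
  then have C: "prob_at_rate N A D" using assms(1) unfolding whp_def by blast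
  show "prob_at_rate M (\<lambda>n \<omega>. A n (\<phi> n \<omega>)) D"
    using C eventually_ge_at_top[of 1] unfolding prob_at_rate_def
  proof eventually_elim
    case (elim n)
    then obtain B where B: "B \<in> sets (N n)" "{\<omega> \<in> space (N n). \<not> A n \<omega>} \<subseteq> B" "measure (N n) B < real n powr (- D)"
      by blast
    have m: "\<phi> n \<in> measurable (M n) (N n)" using elim assms by auto
    have "measure (N n) B = measure (M n) (\<phi> n -` B \<inter> space (M n))"
      using law[of n] elim measure_distr[OF m B(1)] by simp
    then show ?case
      using B measurable_space[OF m] measurable_sets[OF m B(1)]
      by (intro bexI[of _ "\<phi> n -` B \<inter> space (M n)"]) auto
  qed
qed

section \<open>Gaussian tails\<close>

lemma std_normal_tail:
  assumes "a \<ge> 0"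
  shows "measure std_normal_distribution {x. \<bar>x\<bar> > a} \<le> sqrt 2 * exp (- a\<^sup>2 / 4)"
proof -
  interpret prob_space std_normal_distribution by (rule prob_space_std_normal)
  have "emeasure std_normal_distribution {x. \<bar>x\<bar> > a} = (\<integral>\<^sup>+x. ennreal (std_normal_density x) * indicator {x. \<bar>x\<bar> > a} x \<partial>lborel)"
    by (subst emeasure_density) auto
  also have "\<dots> \<le> (\<integral>\<^sup>+x. ennreal (sqrt 2 * exp (- a\<^sup>2 / 4)) * ennreal (normal_density 0 (sqrt 2) x) \<partial>lborel)"
  proof (intro nn_integral_mono)
    fix x :: real
    have "std_normal_density x \<le> sqrt 2 * exp (- a\<^sup>2 / 4) * normal_density 0 (sqrt 2) x" if x: "\<bar>x\<bar> > a"
    proof -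
      have "a\<^sup>2 \<le> x\<^sup>2" using x assms by (simp add: abs_le_square_iff[symmetric])
      then have "exp (- x\<^sup>2 / 2) \<le> exp (- a\<^sup>2 / 4 + - x\<^sup>2 / 4)" by simp
      then have "1 / sqrt (2 * pi) * exp (- x\<^sup>2 / 2) \<le> 1 / sqrt (2 * pi) * (exp (- a\<^sup>2 / 4) * exp (- x\<^sup>2 / 4))"
        unfolding exp_add by (intro mult_left_mono) auto
      also have "\<dots> = sqrt 2 * exp (- a\<^sup>2 / 4) * normal_density 0 (sqrt 2) x"
        by (simp add: normal_density_def real_sqrt_mult field_simps)
      finally show ?thesis by (simp add: std_normal_density_def)
    qed
    then show "ennreal (std_normal_density x) * indicator {x. \<bar>x\<bar> > a} x \<le> ennreal (sqrt 2 * exp (- a\<^sup>2 / 4)) * ennreal (normal_density 0 (sqrt 2) x)"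
      by (auto simp: indicator_def ennreal_mult[symmetric] intro!: ennreal_leI)
  qed
  also have "\<dots> = ennreal (sqrt 2 * exp (- a\<^sup>2 / 4)) * emeasure (density lborel (normal_density 0 (sqrt 2))) UNIV"
    by (subst nn_integral_cmult) (auto simp: emeasure_density)
  also have "emeasure (density lborel (normal_density 0 (sqrt 2))) UNIV = 1"
    using prob_space.emeasure_space_1[OF prob_space_normal_density[of "sqrt 2" 0]] by simp
  finally show ?thesis by (simp add: emeasure_eq_measure)
qed

text \<open>
  At height a = ln n, exp (- a^2 / 4) is smaller than every power of n, so it absorbs the factor n
  of a union bound.
\<close>

lemma outer_le_gaussian_tail:
  assumes "\<And>n. n \<ge> 1 \<Longrightarrow> X n \<in> borel_measurable (M n)"
    and "\<And>n a. n \<ge> 1 \<Longrightarrow> a \<ge> 0 \<Longrightarrow> measure (M n) {\<omega>\<in>space (M n). \<bar>X n \<omega>\<bar> > a} \<le> real n * (sqrt 2 * exp (- a\<^sup>2 / 4))"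
  shows "outer_le M X 0"
proof (rule outer_le_of_stoch_le[OF _ assms(1)])
  show "stoch_le M X 0"
    unfolding stoch_le_def
  proof (intro allI impI exI conjI)
    fix D :: real assume "D > 0"
    have "(\<lambda>n. real n * (sqrt 2 * exp (- (ln (real n))\<^sup>2 / 4)) * real n powr D) \<longlonglongrightarrow> 0"
      using \<open>D > 0\<close> by real_asymp
    then have "\<forall>\<^sub>F n in sequentially. real n * (sqrt 2 * exp (- (ln (real n))\<^sup>2 / 4)) * real n powr D < 1"
      by (rule order_tendstoD(2)) simp
    then show "\<forall>\<^sub>F n in sequentially. measure (M n) {\<omega> \<in> space (M n). ln (real n) powr 1 * real n powr (- 0) < \<bar>X n \<omega>\<bar>} < real n powr (- D)"
      using eventually_ge_at_top[of 1] eventually_ln_ge[of 1]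
    proof eventually_elim
      case (elim n)
      have "ln (real n) powr 1 * real n powr (- 0) = ln (real n)" using elim by simp
      then have "measure (M n) {\<omega> \<in> space (M n). ln (real n) powr 1 * real n powr (- 0) < \<bar>X n \<omega>\<bar>} \<le> real n * (sqrt 2 * exp (- (ln (real n))\<^sup>2 / 4))"
        using assms(2)[of n "ln (real n)"] elim by simp
      also have "\<dots> < real n powr (- D)"
        using elim by (simp add: powr_minus field_simps)
      finally show ?case .
    qed
  qed simp
qed

section \<open>Gram-Schmidt orthonormalization\<close>

lemma dot_commute: "dot n a b = dot n b a"
  by (simp add: dot_def mult.commute)

lemma dot_linear:
  "dot n (\<lambda>i. a i + b i) x = dot n a x + dot n b x"
  "dot n (\<lambda>i. a i - b i) x = dot n a x - dot n b x"
  "dot n x (\<lambda>i. a i + b i) = dot n x a + dot n x b"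
  "dot n x (\<lambda>i. a i - b i) = dot n x a - dot n x b"
  "dot n (\<lambda>i. k * a i) x = k * dot n a x"
  "dot n x (\<lambda>i. k * a i) = k * dot n x a"
  "dot n (\<lambda>i. a i / k) x = dot n a x / k"
  "dot n x (\<lambda>i. a i / k) = dot n x a / k"
  by (simp_all add: dot_def sum.distrib sum_subtractf distrib_left distrib_right left_diff_distrib right_diff_distrib
      sum_distrib_left sum_divide_distrib mult_ac)

lemma dot_sum:
  "dot n (\<lambda>i. \<Sum>k\<in>K. a k i) x = (\<Sum>k\<in>K. dot n (a k) x)"
  "dot n x (\<lambda>i. \<Sum>k\<in>K. a k i) = (\<Sum>k\<in>K. dot n x (a k))"
  by (simp_all add: dot_def sum_distrib_left sum_distrib_right, (rule sum.swap)+)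

lemma dot_self_nonneg: "0 \<le> dot n a a"
  unfolding dot_def by (intro sum_nonneg) auto

lemma dot_self_eq_0: "dot n a a = 0 \<Longrightarrow> i \<in> {1..n} \<Longrightarrow> a i = 0"
  unfolding dot_def by (subst (asm) sum_nonneg_eq_0_iff) auto

definition unitize :: "nat \<Rightarrow> rvec \<Rightarrow> rvec" where
  "unitize n w = (if dot n w w = 0 then (\<lambda>i. if i = 1 then 1 else 0) else (\<lambda>i. w i / sqrt (dot n w w)))"

lemma unitize_unit: "n \<ge> 1 \<Longrightarrow> dot n (unitize n w) (unitize n w) = 1"
proof (cases "dot n w w = 0")
  case True
  assume "n \<ge> 1"
  moreover have "dot n (\<lambda>i. if i = 1 then 1 else 0) (\<lambda>i. if i = 1 then 1 else 0) = (\<Sum>i=1..n. if i = 1 then 1 else 0)"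
    unfolding dot_def by (intro sum.cong) auto
  ultimately show ?thesis using True by (simp add: unitize_def)
next
  case False
  then show ?thesis using dot_self_nonneg[of n w] by (simp add: unitize_def dot_linear)
qed

lemma unitize_scale: "i \<in> {1..n} \<Longrightarrow> sqrt (dot n w w) * unitize n w i = w i"
  using dot_self_eq_0[of n w i] by (auto simp: unitize_def)

text \<open>
  When a residual vanishes, the definition substitutes a fixed unit vector, so the vectors
  always have norm 1; they are orthonormal as long as no residual vanishes.
\<close>

function gs :: "nat \<Rightarrow> (nat \<Rightarrow> rvec) \<Rightarrow> nat \<Rightarrow> rvec" where
  "gs n U t = unitize n (\<lambda>i. U t i - (\<Sum>q\<in>{1..<t}. dot n (U t) (gs n U q) * gs n U q i))"
  by pat_completeness auto
termination by (relation "Wellfounded.measure (\<lambda>(n, U, t). t)") auto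

declare gs.simps [simp del]

definition resid :: "nat \<Rightarrow> (nat \<Rightarrow> rvec) \<Rightarrow> nat \<Rightarrow> rvec" where
  "resid n U t = (\<lambda>i. U t i - (\<Sum>q\<in>{1..<t}. dot n (U t) (gs n U q) * gs n U q i))"

lemma gs_resid: "gs n U t = unitize n (resid n U t)"
  by (subst gs.simps) (simp add: resid_def)

lemma gs_unit: "n \<ge> 1 \<Longrightarrow> dot n (gs n U t) (gs n U t) = 1"
  unfolding gs_resid by (rule unitize_unit)

lemma gs_cong: "(\<And>s. s \<in> {1..t} \<Longrightarrow> U s = U' s) \<Longrightarrow> t \<ge> 1 \<Longrightarrow> gs n U t = gs n U' t"
proof (induction t rule: less_induct)
  case (less t)
  have "U t = U' t" using less.prems by auto
  moreover have "gs n U q = gs n U' q" if "q \<in> {1..<t}" for q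
    using that less.prems by (intro less.IH) auto
  ultimately show ?case by (subst (1 2) gs.simps) (intro arg_cong[where f="unitize n"] ext, simp)
qed

lemma resid_scale: "i \<in> {1..n} \<Longrightarrow> resid n U t i = sqrt (dot n (resid n U t) (resid n U t)) * gs n U t i"
  unfolding gs_resid by (rule unitize_scale[symmetric])

lemma dot_resid_scale: "dot n x (resid n U t) = sqrt (dot n (resid n U t) (resid n U t)) * dot n x (gs n U t)"
proof -
  have "dot n x (resid n U t) = dot n x (\<lambda>i. sqrt (dot n (resid n U t) (resid n U t)) * gs n U t i)"
    by (rule dot_cong) (auto intro: resid_scale)
  then show ?thesis by (simp only: dot_linear)
qed

lemma dot_resid: "dot n x (resid n U t) = dot n x (U t) - (\<Sum>q\<in>{1..<t}. dot n (U t) (gs n U q) * dot n x (gs n U q))"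
  unfolding resid_def by (simp only: dot_linear dot_sum)

text \<open>The triangular system for the coefficients of the orthonormalization.\<close>

lemma gs_coeff: "dot n (U r) (gs n U s) * sqrt (dot n (resid n U s) (resid n U s))
    = dot n (U r) (U s) - (\<Sum>q\<in>{1..<s}. dot n (U s) (gs n U q) * dot n (U r) (gs n U q))"
  using dot_resid[of n "U r" U s] dot_resid_scale[of n "U r" U s] by (simp add: mult.commute)

text \<open>
  Each residual is the vector minus its projections on the earlier directions, so it is orthogonal
  to them as soon as these are orthonormal.
\<close>

lemma gs_orthonormal:
  assumes n: "n \<ge> 1" and nz: "\<And>s. s \<in> {1..t} \<Longrightarrow> dot n (resid n U s) (resid n U s) \<noteq> 0"
    and "p \<in> {1..t}" "q \<in> {1..t}"
  shows "dot n (gs n U p) (gs n U q) = (if p = q then 1 else 0)"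
proof -
  have lt: "dot n (gs n U q) (gs n U s) = 0" if "1 \<le> q" "q < s" "s \<le> t" for q s
    using that
  proof (induction s arbitrary: q rule: less_induct)
    case (less s)
    have orth: "dot n (gs n U q) (gs n U p) = (if p = q then 1 else 0)" if "p \<in> {1..<s}" for p
    proof (cases p q rule: linorder_cases)
      case less': less
      have "dot n (gs n U p) (gs n U q) = 0" using that less' less.prems by (intro less.IH) auto
      then show ?thesis using less' by (simp add: dot_commute)
    next
      case equal then show ?thesis by (simp add: gs_unit[OF n])
    next
      case greater
      have "dot n (gs n U q) (gs n U p) = 0" using that greater less.prems by (intro less.IH) auto
      then show ?thesis using greater by simp
    qed
    have "sqrt (dot n (resid n U s) (resid n U s)) * dot n (gs n U q) (gs n U s)
       = dot n (gs n U q) (U s) - (\<Sum>p\<in>{1..<s}. dot n (U s) (gs n U p) * dot n (gs n U q) (gs n U p))"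
      using dot_resid[of n "gs n U q" U s] dot_resid_scale[of n "gs n U q" U s] by simp
    also have "(\<Sum>p\<in>{1..<s}. dot n (U s) (gs n U p) * dot n (gs n U q) (gs n U p)) = (\<Sum>p\<in>{1..<s}. if p = q then dot n (U s) (gs n U p) else 0)"
      by (intro sum.cong refl) (simp add: orth)
    also have "\<dots> = dot n (U s) (gs n U q)" using less.prems by simp
    finally have "sqrt (dot n (resid n U s) (resid n U s)) * dot n (gs n U q) (gs n U s) = 0"
      by (simp add: dot_commute)
    moreover have "sqrt (dot n (resid n U s) (resid n U s)) \<noteq> 0" using nz[of s] less.prems by simp
    ultimately show ?case by simp
  qed
  show ?thesis
    using lt[of p q] lt[of q p] assms(3,4) gs_unit[OF n] by (cases p q rule: linorder_cases) (auto simp: dot_commute)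
qed

lemma gs_expand:
  assumes n: "n \<ge> 1" and nz: "\<And>s. s \<in> {1..t} \<Longrightarrow> dot n (resid n U s) (resid n U s) \<noteq> 0"
    and s: "s \<in> {1..t}" and i: "i \<in> {1..n}"
  shows "U s i = (\<Sum>q=1..s. dot n (U s) (gs n U q) * gs n U q i)"
proof -
  have "dot n (gs n U s) (resid n U s) = dot n (gs n U s) (U s) - (\<Sum>q\<in>{1..<s}. dot n (U s) (gs n U q) * dot n (gs n U s) (gs n U q))"
    by (rule dot_resid)
  also have "(\<Sum>q\<in>{1..<s}. dot n (U s) (gs n U q) * dot n (gs n U s) (gs n U q)) = 0"
  proof (intro sum.neutral ballI)
    fix q assume q: "q \<in> {1..<s}"
    have "dot n (gs n U s) (gs n U q) = (if s = q then 1 else 0)"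
      by (rule gs_orthonormal[OF n, where t=t]) (use nz s q in auto)
    then show "dot n (U s) (gs n U q) * dot n (gs n U s) (gs n U q) = 0" using q by simp
  qed
  finally have "dot n (U s) (gs n U s) = sqrt (dot n (resid n U s) (resid n U s))"
    using dot_resid_scale[of n "gs n U s" U s] gs_unit[OF n] by (simp add: dot_commute)
  then have "resid n U s i = dot n (U s) (gs n U s) * gs n U s i" using resid_scale[OF i] by simp
  then have "U s i = (\<Sum>q\<in>{1..<s}. dot n (U s) (gs n U q) * gs n U q i) + dot n (U s) (gs n U s) * gs n U s i"
    by (simp add: resid_def)
  moreover have "{1..s} = insert s {1..<s}" using s by auto
  ultimately show ?thesis by simp
qed

lemma resid_norm:
  assumes n: "n \<ge> 1" and nz: "\<And>q. q \<in> {1..<s} \<Longrightarrow> dot n (resid n U q) (resid n U q) \<noteq> 0"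
  shows "dot n (resid n U s) (resid n U s) = dot n (U s) (U s) - (\<Sum>q\<in>{1..<s}. (dot n (U s) (gs n U q))\<^sup>2)"
proof -
  have orth: "dot n (gs n U p) (gs n U q) = (if p = q then 1 else 0)" if "p \<in> {1..<s}" "q \<in> {1..<s}" for p q
    by (rule gs_orthonormal[OF n, where t="s - 1"]) (use that nz in auto)
  have perp: "dot n (gs n U q) (resid n U s) = 0" if q: "q \<in> {1..<s}" for q
  proof -
    have "(\<Sum>p\<in>{1..<s}. dot n (U s) (gs n U p) * dot n (gs n U q) (gs n U p)) = (\<Sum>p\<in>{1..<s}. if p = q then dot n (U s) (gs n U p) else 0)"
      using q by (intro sum.cong refl) (simp add: orth)
    also have "\<dots> = dot n (U s) (gs n U q)" using q by simp
    finally show ?thesis unfolding dot_resid by (simp add: dot_commute)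
  qed
  have "dot n (resid n U s) (resid n U s) = dot n (resid n U s) (U s) - (\<Sum>q\<in>{1..<s}. dot n (U s) (gs n U q) * dot n (resid n U s) (gs n U q))"
    by (rule dot_resid)
  also have "(\<Sum>q\<in>{1..<s}. dot n (U s) (gs n U q) * dot n (resid n U s) (gs n U q)) = 0"
    using perp by (intro sum.neutral) (simp add: dot_commute)
  also have "dot n (resid n U s) (U s) = dot n (U s) (resid n U s)" by (rule dot_commute)
  also have "\<dots> = dot n (U s) (U s) - (\<Sum>q\<in>{1..<s}. (dot n (U s) (gs n U q))\<^sup>2)"
    unfolding dot_resid by (simp add: power2_eq_square)
  finally show ?thesis by simp
qed

section \<open>A symmetric matrix on a span, read from fresh directions\<close>

definition mv :: "nat \<Rightarrow> rmat \<Rightarrow> rvec \<Rightarrow> rvec" where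
  "mv n w x = (\<lambda>i. \<Sum>j=1..n. w i j * x j)"

definition symmetric_on :: "nat \<Rightarrow> rmat \<Rightarrow> bool" where
  "symmetric_on n w \<longleftrightarrow> (\<forall>i\<in>{1..n}. \<forall>j\<in>{1..n}. w i j = w j i)"

lemma dot_mv_commute:
  assumes "symmetric_on n w"
  shows "dot n x (mv n w y) = dot n y (mv n w x)"
proof -
  have "dot n x (mv n w y) = (\<Sum>i=1..n. \<Sum>j=1..n. x i * (w i j * y j))"
    by (simp add: dot_def mv_def sum_distrib_left)
  also have "\<dots> = (\<Sum>j=1..n. \<Sum>i=1..n. x i * (w i j * y j))" by (rule sum.swap)
  also have "\<dots> = (\<Sum>j=1..n. \<Sum>i=1..n. y j * (w j i * x i))"
    using assms by (intro sum.cong refl) (auto simp: symmetric_on_def)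
  also have "\<dots> = dot n y (mv n w x)" by (simp add: dot_def mv_def sum_distrib_left)
  finally show ?thesis .
qed

lemma mv_sum: "mv n w (\<lambda>j. \<Sum>k\<in>K. c k * a k j) i = (\<Sum>k\<in>K. c k * mv n w (a k) i)"
  unfolding mv_def by (simp add: sum_distrib_left mult_ac) (rule sum.swap)

lemma mv_cong: "(\<And>j. j \<in> {1..n} \<Longrightarrow> x j = y j) \<Longrightarrow> mv n w x i = mv n w y i"
  unfolding mv_def by (intro sum.cong) auto

text \<open>
  The image of u under the matrix, written in terms of orthonormal directions e and of vectors g
  that contain the image of each direction up to the earlier ones.
\<close>

definition span_apply :: "nat \<Rightarrow> (nat \<Rightarrow> rvec) \<Rightarrow> (nat \<Rightarrow> rvec) \<Rightarrow> rvec \<Rightarrow> nat \<Rightarrow> rvec" where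
  "span_apply n e g u t = (\<lambda>i. (\<Sum>s=1..t. dot n u (e s) * g s i
      + (dot n u (g s) + sqrt 2 * dot n u (e s) * dot n (e s) (g s)
         - (\<Sum>p=1..s. dot n u (e p) * dot n (e p) (g s))
         - (\<Sum>r=s..t. dot n u (e r) * dot n (e s) (g r))) * e s i) / sqrt (real n))"

text \<open>
  By the first hypothesis on g, the image of e s minus g s / sqrt n lies in the span of the first
  s directions. The coefficients of the later directions in the image of u are read from
  the images of the earlier ones, by symmetry.
\<close>

lemma mv_span_apply:
  assumes n: "n \<ge> 1" and sym: "symmetric_on n w"
    and orth: "\<And>p q. p \<in> {1..t} \<Longrightarrow> q \<in> {1..t} \<Longrightarrow> dot n (e p) (e q) = (if p = q then 1 else 0)"
    and perp: "\<And>s x. s \<in> {1..t} \<Longrightarrow> (\<And>q. q \<in> {1..s} \<Longrightarrow> dot n x (e q) = 0) \<Longrightarrow> dot n x (mv n w (e s)) = dot n x (g s) / sqrt (real n)"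
    and diag: "\<And>s. s \<in> {1..t} \<Longrightarrow> dot n (e s) (mv n w (e s)) = sqrt 2 * dot n (e s) (g s) / sqrt (real n)"
    and u: "\<And>i. i \<in> {1..n} \<Longrightarrow> u i = (\<Sum>s=1..t. dot n u (e s) * e s i)"
    and i: "i \<in> {1..n}"
  shows "mv n w u i = span_apply n e g u t i"
proof -
  define \<nu> where "\<nu> = sqrt (real n)"
  define R where "R s = dot n u (e s)" for s
  define \<omega> where "\<omega> q s = dot n (e q) (mv n w (e s))" for q s
  have \<omega>sym: "\<omega> q s = \<omega> s q" for q s unfolding \<omega>_def by (rule dot_mv_commute[OF sym])
  define \<kappa> where "\<kappa> q s = \<omega> q s - dot n (e q) (g s) / \<nu>" for q s
  have col: "mv n w (e s) j = g s j / \<nu> + (\<Sum>q=1..s. \<kappa> q s * e q j)" if s: "s \<in> {1..t}" and j: "j \<in> {1..n}" for s j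
  proof -
    define y where "y = (\<lambda>j. mv n w (e s) j - g s j / \<nu>)"
    have ye: "dot n y (e q) = \<kappa> q s" for q
      unfolding y_def \<kappa>_def \<omega>_def by (simp only: dot_linear) (simp add: dot_commute)
    define x where "x = (\<lambda>j. y j - (\<Sum>q=1..s. \<kappa> q s * e q j))"
    have xe: "dot n x (e q) = 0" if q: "q \<in> {1..s}" for q
    proof -
      have "dot n x (e q) = \<kappa> q s - (\<Sum>p=1..s. \<kappa> p s * dot n (e p) (e q))"
        unfolding x_def by (simp only: dot_linear dot_sum ye)
      also have "(\<Sum>p=1..s. \<kappa> p s * dot n (e p) (e q)) = (\<Sum>p=1..s. if p = q then \<kappa> p s else 0)"
        using q s by (intro sum.cong refl) (simp add: orth)
      also have "\<dots> = \<kappa> q s" using q by simp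
      finally show ?thesis by simp
    qed
    have "dot n x y = 0" using perp[OF s xe] unfolding y_def by (simp add: dot_linear \<nu>_def)
    moreover have "dot n x x = dot n x y - (\<Sum>q=1..s. \<kappa> q s * dot n x (e q))"
      by (subst (2) x_def) (simp only: dot_linear dot_sum)
    moreover have "(\<Sum>q=1..s. \<kappa> q s * dot n x (e q)) = 0" by (intro sum.neutral) (simp add: xe)
    ultimately have "dot n x x = 0" by simp
    then have "x j = 0" by (rule dot_self_eq_0) (rule j)
    then show ?thesis by (simp add: x_def y_def)
  qed
  have split: "(\<Sum>s=1..t. F s) = (\<Sum>s=1..q. F s) + (\<Sum>s=q+1..t. F s)" if "q \<in> {1..t}" for q and F :: "nat \<Rightarrow> real"
  proof -
    have "{1..t} = {1..q} \<union> {q+1..t}" "{1..q} \<inter> {q+1..t} = {}" using that by auto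
    then show ?thesis by (simp add: sum.union_disjoint)
  qed
  \<comment> \<open>symmetry turns the coefficients along later directions into data of column q\<close>
  have later: "(\<Sum>s=q+1..t. R s * \<omega> q s) = dot n u (g q) / \<nu> - (\<Sum>p=1..q. R p * dot n (e p) (g q)) / \<nu>" if q: "q \<in> {1..t}" for q
  proof -
    have "(\<Sum>s=1..t. R s * \<omega> s q) = dot n (\<lambda>i. \<Sum>s=1..t. R s * e s i) (mv n w (e q))"
      unfolding \<omega>_def by (simp only: dot_linear dot_sum)
    also have "\<dots> = dot n u (mv n w (e q))" by (rule dot_cong) (simp_all add: u R_def)
    also have "\<dots> = dot n u (\<lambda>i. g q i / \<nu> + (\<Sum>p=1..q. \<kappa> p q * e p i))"
      by (rule dot_cong) (simp_all add: col[OF q])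
    also have "\<dots> = dot n u (g q) / \<nu> + (\<Sum>p=1..q. \<kappa> p q * R p)"
      unfolding R_def by (simp only: dot_linear dot_sum)
    also have "(\<Sum>p=1..q. \<kappa> p q * R p) = (\<Sum>p=1..q. R p * \<omega> p q) - (\<Sum>p=1..q. R p * dot n (e p) (g q)) / \<nu>"
      unfolding sum_divide_distrib sum_subtractf[symmetric] \<kappa>_def
      by (intro sum.cong refl) (simp add: algebra_simps)
    finally have "(\<Sum>s=q+1..t. R s * \<omega> s q) = dot n u (g q) / \<nu> - (\<Sum>p=1..q. R p * dot n (e p) (g q)) / \<nu>"
      unfolding split[OF q] by simp
    then show ?thesis by (simp only: \<omega>sym[of q])
  qed
  have "mv n w u i = mv n w (\<lambda>i. \<Sum>s=1..t. R s * e s i) i" by (rule mv_cong) (simp add: u R_def)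
  also have "\<dots> = (\<Sum>s=1..t. R s * mv n w (e s) i)" by (rule mv_sum)
  also have "\<dots> = (\<Sum>s=1..t. R s * g s i / \<nu> + (\<Sum>q=1..s. R s * \<kappa> q s * e q i))"
    using i by (intro sum.cong refl) (simp add: col distrib_left sum_distrib_left mult.assoc)
  also have "\<dots> = (\<Sum>s=1..t. R s * g s i / \<nu>) + (\<Sum>s=1..t. \<Sum>q=1..s. R s * \<kappa> q s * e q i)"
    by (rule sum.distrib)
  also have "(\<Sum>s=1..t. \<Sum>q=1..s. R s * \<kappa> q s * e q i) = (\<Sum>s=1..t. \<Sum>q=1..t. if q \<le> s then R s * \<kappa> q s * e q i else 0)"
    by (rule sum.cong, rule refl, rule sum.mono_neutral_cong_left) auto
  also have "\<dots> = (\<Sum>q=1..t. \<Sum>s=1..t. if q \<le> s then R s * \<kappa> q s * e q i else 0)" by (rule sum.swap)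
  also have "\<dots> = (\<Sum>q=1..t. (\<Sum>s=q..t. R s * \<kappa> q s) * e q i)"
    unfolding sum_distrib_right by (rule sum.cong, rule refl, rule sum.mono_neutral_cong_right) auto
  also have "\<dots> = (\<Sum>q=1..t. (dot n u (g q) + sqrt 2 * R q * dot n (e q) (g q) - (\<Sum>p=1..q. R p * dot n (e p) (g q)) - (\<Sum>r=q..t. R r * dot n (e q) (g r))) / \<nu> * e q i)"
  proof (intro sum.cong refl arg_cong2[where f="(*)"])
    fix q assume q: "q \<in> {1..t}"
    have "(\<Sum>s=q..t. R s * \<omega> q s) = R q * \<omega> q q + (\<Sum>s=q+1..t. R s * \<omega> q s)"
      using q by (subst sum.atLeast_Suc_atMost) auto
    also have "R q * \<omega> q q = sqrt 2 * R q * dot n (e q) (g q) / \<nu>"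
      unfolding \<omega>_def diag[OF q] by (simp add: \<nu>_def)
    finally have "(\<Sum>s=q..t. R s * \<omega> q s) = sqrt 2 * R q * dot n (e q) (g q) / \<nu> + (dot n u (g q) / \<nu> - (\<Sum>p=1..q. R p * dot n (e p) (g q)) / \<nu>)"
      unfolding later[OF q] .
    moreover have "(\<Sum>s=q..t. R s * \<kappa> q s) = (\<Sum>s=q..t. R s * \<omega> q s) - (\<Sum>r=q..t. R r * dot n (e q) (g r)) / \<nu>"
      by (simp add: \<kappa>_def sum_subtractf right_diff_distrib sum_divide_distrib)
    ultimately show "(\<Sum>s=q..t. R s * \<kappa> q s) = (dot n u (g q) + sqrt 2 * R q * dot n (e q) (g q) - (\<Sum>p=1..q. R p * dot n (e p) (g q)) - (\<Sum>r=q..t. R r * dot n (e q) (g r))) / \<nu>"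
      by (simp add: add_divide_distrib diff_divide_distrib)
  qed
  finally show ?thesis
    by (simp add: span_apply_def R_def \<nu>_def sum.distrib sum_divide_distrib add_divide_distrib)
qed

section \<open>The algorithm driven by independent Gaussian vectors\<close>

definition iter_u :: "nat \<Rightarrow> rvec \<Rightarrow> (nat \<Rightarrow> rmat \<Rightarrow> rvec) \<Rightarrow> rmat \<Rightarrow> nat \<Rightarrow> rvec" where
  "iter_u n v f z t = nonlin n v f (t - 1) z"

text \<open>
  The iterates as functions of the vectors g alone: the matrix has been eliminated.
\<close>

primrec gauss_amp :: "nat \<Rightarrow> rvec \<Rightarrow> (nat \<Rightarrow> rmat \<Rightarrow> rvec) \<Rightarrow> nat \<Rightarrow> (nat \<Rightarrow> rvec) \<Rightarrow> rmat" where
  "gauss_amp n v f 0 g = (\<lambda>i s. 0)"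
| "gauss_amp n v f (Suc t) g = (\<lambda>i s. if s = Suc t then
       span_apply n (gs n (iter_u n v f (gauss_amp n v f t g))) g (iter_u n v f (gauss_amp n v f t g) (Suc t)) (Suc t) i
       - (\<Sum>r=1..t. onsager n v f (Suc t) r * iter_u n v f (gauss_amp n v f t g) r i)
     else gauss_amp n v f t g i s)"

abbreviation amp_dir :: "nat \<Rightarrow> rvec \<Rightarrow> (nat \<Rightarrow> rmat \<Rightarrow> rvec) \<Rightarrow> nat \<Rightarrow> (nat \<Rightarrow> rvec) \<Rightarrow> nat \<Rightarrow> rvec" where
  "amp_dir n v f t g \<equiv> gs n (iter_u n v f (gauss_amp n v f t g))"

lemma nonlin_cong:
  assumes "\<And>i s. i \<in> {1..n} \<Longrightarrow> s \<in> {1..r} \<Longrightarrow> z i s = z' i s"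
  shows "nonlin n v f r z = nonlin n v f r z'"
proof -
  have "take_cols n r z = take_cols n r z'" using assms by (auto simp: take_cols_def fun_eq_iff)
  then show ?thesis by (simp add: nonlin_def)
qed

lemma gauss_amp_stable: "s \<le> k \<Longrightarrow> k \<le> m \<Longrightarrow> gauss_amp n v f m g i s = gauss_amp n v f k g i s"
  by (induction m) (auto simp: le_Suc_eq)

lemma iter_u_stable:
  assumes "t \<le> Suc k" "k \<le> m"
  shows "iter_u n v f (gauss_amp n v f m g) t = iter_u n v f (gauss_amp n v f k g) t"
  unfolding iter_u_def by (rule nonlin_cong, rule gauss_amp_stable) (use assms in auto)

lemma amp_dir_stable:
  assumes "1 \<le> t" "t \<le> Suc k" "k \<le> m"
  shows "amp_dir n v f m g t = amp_dir n v f k g t"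
  by (rule gs_cong) (use assms in \<open>auto intro: iter_u_stable\<close>)

lemma span_apply_cong:
  assumes "\<And>s. s \<in> {1..t} \<Longrightarrow> e s = e' s" "\<And>s. s \<in> {1..t} \<Longrightarrow> g s = g' s"
  shows "span_apply n e g u t = span_apply n e' g' u t"
  unfolding span_apply_def
  by (intro ext arg_cong2[where f="(/)"] refl sum.cong arg_cong2[where f="(+)"] arg_cong2[where f="(-)"] arg_cong2[where f="(*)"])
     (use assms in auto)

lemma gauss_amp_eq:
  assumes "t \<in> {1..T}"
  shows "gauss_amp n v f T g i t = span_apply n (amp_dir n v f T g) g (iter_u n v f (gauss_amp n v f T g) t) t i
     - (\<Sum>r\<in>{1..<t}. onsager n v f t r * iter_u n v f (gauss_amp n v f T g) r i)"
proof -
  obtain k where k: "t = Suc k" using assms by (cases t) auto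
  have "gauss_amp n v f T g i t = gauss_amp n v f (Suc k) g i (Suc k)"
    unfolding k by (rule gauss_amp_stable) (use assms k in auto)
  moreover have "iter_u n v f (gauss_amp n v f T g) r = iter_u n v f (gauss_amp n v f k g) r" if "r \<le> Suc k" for r
    using that assms k by (intro iter_u_stable) auto
  moreover have "span_apply n (amp_dir n v f T g) g u t = span_apply n (amp_dir n v f k g) g u t" for u
    using assms k by (intro span_apply_cong amp_dir_stable) auto
  moreover have "{1..<t} = {1..k}" using k by auto
  ultimately show ?thesis using k by simp
qed

lemma gauss_amp_cong:
  assumes "\<And>s. s \<in> {1..k} \<Longrightarrow> g s = g' s"
  shows "gauss_amp n v f k g = gauss_amp n v f k g'"
  using assms
proof (induction k)
  case (Suc k)
  then have IH: "gauss_amp n v f k g = gauss_amp n v f k g'" by auto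
  have "span_apply n e g u (Suc k) = span_apply n e g' u (Suc k)" for e u
    by (rule span_apply_cong) (use Suc.prems in auto)
  then show ?case by (simp only: gauss_amp.simps IH)
qed simp

section \<open>Replacing the explored part of the matrix\<close>

text \<open>
  The e-component is divided by sqrt 2, the ratio of the standard deviations of a diagonal and an
  off-diagonal entry of the GOE. Applied to the image of e under a GOE matrix, this gives a
  vector with independent entries of equal variance.
\<close>

definition shrink :: "nat \<Rightarrow> rvec \<Rightarrow> rvec \<Rightarrow> rvec" where
  "shrink n e a = (\<lambda>i. a i - (1 - 1 / sqrt 2) * dot n e a * e i)"

definition new_col :: "nat \<Rightarrow> rvec \<Rightarrow> rmat \<Rightarrow> rvec" where
  "new_col n e w = (\<lambda>i\<in>{1..n}. sqrt (real n) * shrink n e (mv n w e) i)"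

definition row_shift :: "nat \<Rightarrow> rvec \<Rightarrow> rmat \<Rightarrow> rvec \<Rightarrow> rvec" where
  "row_shift n e w a = (\<lambda>i. shrink n e a i / sqrt (real n) - mv n w e i + dot n e (mv n w e) / 2 * e i)"

text \<open>
  The row and column of w in the direction e are replaced by fresh ones made from a. The part
  of w on the orthogonal complement of e is untouched.
\<close>

definition new_mat :: "nat \<Rightarrow> rvec \<Rightarrow> rmat \<Rightarrow> rvec \<Rightarrow> rmat" where
  "new_mat n e w a = (\<lambda>i\<in>{1..n}. \<lambda>j\<in>{1..n}. w i j + e i * row_shift n e w a j + row_shift n e w a i * e j)"

text \<open>
  The direction of step s is computed from the columns before s, which earlier steps have already
  replaced by vectors read off the matrix; column s of X still holds unused noise and is
  traded for the row of the matrix in this direction.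
\<close>

definition explore :: "nat \<Rightarrow> rvec \<Rightarrow> (nat \<Rightarrow> rmat \<Rightarrow> rvec) \<Rightarrow> nat \<Rightarrow> rmat \<times> rmat \<Rightarrow> rmat \<times> rmat" where
  "explore n v f s = (\<lambda>(w, X). (new_mat n (amp_dir n v f (s - 1) X s) w (X s), X(s := new_col n (amp_dir n v f (s - 1) X s) w)))"

primrec explored :: "nat \<Rightarrow> rvec \<Rightarrow> (nat \<Rightarrow> rmat \<Rightarrow> rvec) \<Rightarrow> nat \<Rightarrow> rmat \<times> rmat \<Rightarrow> rmat \<times> rmat" where
  "explored n v f 0 p = p"
| "explored n v f (Suc k) p = explore n v f (Suc k) (explored n v f k p)"

lemma mv_new_mat:
  assumes "i \<in> {1..n}"
  shows "mv n (new_mat n e w a) x i = mv n w x i + e i * dot n (row_shift n e w a) x + row_shift n e w a i * dot n e x"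
proof -
  have "mv n (new_mat n e w a) x i = (\<Sum>j=1..n. w i j * x j + e i * (row_shift n e w a j * x j) + row_shift n e w a i * (e j * x j))"
    unfolding mv_def new_mat_def using assms by (intro sum.cong refl) (simp add: algebra_simps)
  then show ?thesis by (simp add: mv_def dot_def sum.distrib sum_distrib_left)
qed

lemma new_mat_perp:
  assumes "dot n x e = 0" "dot n y e = 0"
  shows "dot n x (mv n (new_mat n e w a) y) = dot n x (mv n w y)"
proof -
  have "dot n x (mv n (new_mat n e w a) y) = dot n x (\<lambda>i. mv n w y i + dot n (row_shift n e w a) y * e i + dot n e y * row_shift n e w a i)"
    by (rule dot_cong) (auto simp: mv_new_mat)
  then show ?thesis using assms by (simp only: dot_linear) (simp add: dot_commute)
qed

lemma explored_columns: "s \<le> k \<Longrightarrow> k \<le> m \<Longrightarrow> snd (explored n v f m p) s = snd (explored n v f k p) s"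
  by (induction m) (auto simp: le_Suc_eq explore_def case_prod_unfold)

lemma explored_dir:
  assumes "Suc k \<le> T"
  shows "amp_dir n v f k (snd (explored n v f k p)) (Suc k) = amp_dir n v f T (snd (explored n v f T p)) (Suc k)"
proof -
  have "gauss_amp n v f k (snd (explored n v f k p)) = gauss_amp n v f k (snd (explored n v f T p))"
    by (rule gauss_amp_cong, rule explored_columns[symmetric]) (use assms in auto)
  then have "amp_dir n v f k (snd (explored n v f k p)) (Suc k) = amp_dir n v f k (snd (explored n v f T p)) (Suc k)" by simp
  also have "\<dots> = amp_dir n v f T (snd (explored n v f T p)) (Suc k)"
    by (rule amp_dir_stable[symmetric]) (use assms in auto)
  finally show ?thesis .
qed

text \<open>
  If no residual vanishes, the original matrix and the explored one have the same quadratic form on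
  the complement of the explored directions, so the vectors read off in the exploration describe
  the original matrix, and the iterates of the algorithm are those driven by these vectors.
\<close>

lemma amp_run_eq_gauss_amp:
  assumes n: "n \<ge> 1" and sym: "symmetric_on n w"
    and run: "is_amp_run T n v f w z u"
    and G: "G = snd (explored n v f T (w, X))"
    and nz: "\<And>s. s \<in> {1..T} \<Longrightarrow> dot n (resid n (iter_u n v f (gauss_amp n v f T G)) s) (resid n (iter_u n v f (gauss_amp n v f T G)) s) \<noteq> 0"
    and t: "t \<in> {1..T}" and i: "i \<in> {1..n}"
  shows "z i t = gauss_amp n v f T G i t"
proof -
  define e where "e = amp_dir n v f T G"
  define U where "U = iter_u n v f (gauss_amp n v f T G)"
  have eU: "e = gs n U" by (simp add: e_def U_def)
  have orth: "dot n (e p) (e q) = (if p = q then 1 else 0)" if "p \<in> {1..T}" "q \<in> {1..T}" for p q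
    unfolding eU by (rule gs_orthonormal[OF n nz[folded U_def] that])
  let ?w = "\<lambda>k. fst (explored n v f k (w, X))" and ?X = "\<lambda>k. snd (explored n v f k (w, X))"
  have wS: "?w (Suc k) = new_mat n (e (Suc k)) (?w k) (?X k (Suc k))" if "Suc k \<le> T" for k
    using explored_dir[OF that, of n v f "(w, X)"] by (simp add: explore_def case_prod_unfold e_def G)
  have GS: "G (Suc k) = new_col n (e (Suc k)) (?w k)" if "Suc k \<le> T" for k
  proof -
    have "G (Suc k) = ?X (Suc k) (Suc k)" unfolding G by (rule explored_columns) (use that in auto)
    then show ?thesis
      using explored_dir[OF that, of n v f "(w, X)"] by (simp add: explore_def case_prod_unfold e_def G)
  qed
  \<comment> \<open>each step changes only the row and column of its own direction\<close>
  have inv: "dot n x (mv n (?w k) y) = dot n x (mv n w y)"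
    if "k \<le> T" "\<And>q. q \<in> {1..k} \<Longrightarrow> dot n x (e q) = 0" "\<And>q. q \<in> {1..k} \<Longrightarrow> dot n y (e q) = 0" for k x y
    using that
  proof (induction k)
    case (Suc k)
    have "dot n x (mv n (?w (Suc k)) y) = dot n x (mv n (?w k) y)"
      unfolding wS[OF Suc.prems(1)] by (rule new_mat_perp) (use Suc.prems in auto)
    also have "\<dots> = dot n x (mv n w y)" by (rule Suc.IH) (use Suc.prems in auto)
    finally show ?case .
  qed simp
  have dotG: "dot n x (G (Suc k)) = sqrt (real n) * (dot n x (mv n (?w k) (e (Suc k))) - (1 - 1 / sqrt 2) * dot n (e (Suc k)) (mv n (?w k) (e (Suc k))) * dot n x (e (Suc k)))"
    if "Suc k \<le> T" for k x
  proof -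
    have "dot n x (G (Suc k)) = dot n x (\<lambda>i. sqrt (real n) * (mv n (?w k) (e (Suc k)) i - (1 - 1 / sqrt 2) * dot n (e (Suc k)) (mv n (?w k) (e (Suc k))) * e (Suc k) i))"
      unfolding GS[OF that] by (rule dot_cong) (simp_all add: new_col_def shrink_def)
    then show ?thesis by (simp only: dot_linear)
  qed
  have perp: "dot n x (mv n w (e s)) = dot n x (G s) / sqrt (real n)"
    if s: "s \<in> {1..T}" and x: "\<And>q. q \<in> {1..s} \<Longrightarrow> dot n x (e q) = 0" for s x
  proof -
    obtain k where k: "s = Suc k" using s by (cases s) auto
    have "dot n x (mv n (?w k) (e s)) = dot n x (mv n w (e s))"
      by (rule inv) (use s k x in \<open>auto simp: orth\<close>)
    moreover have "dot n x (e (Suc k)) = 0" using x[of s] s k by auto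
    ultimately show ?thesis using dotG[of k x] s k n by simp
  qed
  have diag: "dot n (e s) (mv n w (e s)) = sqrt 2 * dot n (e s) (G s) / sqrt (real n)" if s: "s \<in> {1..T}" for s
  proof -
    obtain k where k: "s = Suc k" using s by (cases s) auto
    have "dot n (e s) (mv n (?w k) (e s)) = dot n (e s) (mv n w (e s))"
      by (rule inv) (use s k in \<open>auto simp: orth\<close>)
    moreover have "dot n (e s) (e s) = 1" using orth[OF s s] by simp
    ultimately have "dot n (e s) (G s) = sqrt (real n) * (1 / sqrt 2) * dot n (e s) (mv n w (e s))"
      using dotG[of k "e s"] s k by (simp add: algebra_simps)
    then show ?thesis using n by simp
  qed
  have expand: "U s i = (\<Sum>q=1..s. dot n (U s) (e q) * e q i)" if "s \<in> {1..T}" "i \<in> {1..n}" for s i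
    unfolding eU by (rule gs_expand[OF n nz[folded U_def] that])
  have "\<forall>i\<in>{1..n}. z i t = gauss_amp n v f T G i t"
    using t
  proof (induction t rule: less_induct)
    case (less t)
    have uU: "u i r = U r i" if r: "r \<in> {1..t}" and i: "i \<in> {1..n}" for r i
    proof (cases "r = 1")
      case True
      then show ?thesis using run i by (simp add: is_amp_run_def U_def iter_u_def nonlin_def)
    next
      case False
      then have r1: "r - 1 \<in> {1..<T}" "Suc (r - 1) = r" using r less.prems by auto
      have eq: "take_cols n (r - 1) z = take_cols n (r - 1) (gauss_amp n v f T G)"
        unfolding take_cols_def using less.IH less.prems r by (intro restrict_ext) auto
      have "u i (r - 1 + 1) = f (r - 1) (take_cols n (r - 1) z) i"
        using run r1(1) i unfolding is_amp_run_def by blast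
      then show ?thesis using r1 False r unfolding eq by (simp add: U_def iter_u_def nonlin_def)
    qed
    show ?case
    proof
      fix i assume i: "i \<in> {1..n}"
      have "z i t = (\<Sum>j=1..n. w i j * u j t) - (\<Sum>s=1..<t. onsager n v f t s * u i s)"
        using run less.prems i by (simp add: is_amp_run_def)
      also have "(\<Sum>j=1..n. w i j * u j t) = mv n w (U t) i"
        unfolding mv_def using uU less.prems by (intro sum.cong refl) auto
      also have "mv n w (U t) i = span_apply n e G (U t) t i"
      proof (rule mv_span_apply[OF n sym _ _ _ _ i])
        show "U t j = (\<Sum>s=1..t. dot n (U t) (e s) * e s j)" if "j \<in> {1..n}" for j
          by (rule expand[OF less.prems that])
      qed (use less.prems in \<open>auto intro: perp diag simp: orth\<close>)
      also have "(\<Sum>s=1..<t. onsager n v f t s * u i s) = (\<Sum>s\<in>{1..<t}. onsager n v f t s * U s i)"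
        using uU i by (intro sum.cong refl) auto
      finally show "z i t = gauss_amp n v f T G i t"
        using gauss_amp_eq[OF less.prems, of n v f G i] by (simp add: e_def U_def)
    qed
  qed
  then show ?thesis using i by blast
qed

section \<open>The exploration preserves the Gaussian law\<close>

lemma pair_char:
  assumes "prob_space M" "prob_space N" and \<phi>: "\<phi> \<in> borel_measurable M" and \<psi>: "\<psi> \<in> borel_measurable N"
  shows "(CLINT p|M \<Otimes>\<^sub>M N. iexp (\<phi> (fst p) + \<psi> (snd p))) = (CLINT x|M. iexp (\<phi> x)) * (CLINT y|N. iexp (\<psi> y))"
proof -
  interpret M: prob_space M by fact
  interpret N: prob_space N by fact
  interpret P: pair_prob_space M N by standard
  have m: "(\<lambda>p. \<phi> (fst p) + \<psi> (snd p)) \<in> borel_measurable (M \<Otimes>\<^sub>M N)"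
    by (intro borel_measurable_add measurable_compose[OF measurable_fst \<phi>] measurable_compose[OF measurable_snd \<psi>])
  have i: "integrable (M \<Otimes>\<^sub>M N) (\<lambda>p. iexp (\<phi> (fst p) + \<psi> (snd p)))"
    by (rule finite_measure.integrable_iexp[OF P.finite_measure m])
  have "(CLINT p|M \<Otimes>\<^sub>M N. iexp (\<phi> (fst p) + \<psi> (snd p))) = (CLINT x|M. CLINT y|N. iexp (\<phi> x + \<psi> y))"
    using P.integral_fst'[OF i] by simp
  also have "\<dots> = (CLINT x|M. CLINT y|N. iexp (\<phi> x) * iexp (\<psi> y))"
    by (simp add: exp_add distrib_left)
  also have "\<dots> = (CLINT x|M. iexp (\<phi> x)) * (CLINT y|N. iexp (\<psi> y))"
    by (simp only: integral_mult_right_zero integral_mult_left_zero)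
  finally show ?thesis .
qed

definition goe_law :: "nat \<Rightarrow> rmat measure \<Rightarrow> bool" where
  "goe_law n \<mu> \<longleftrightarrow> prob_space \<mu> \<and> sets \<mu> = sets (matrices n n) \<and>
     (\<forall>\<theta>. (CLINT w|\<mu>. iexp (\<Sum>i=1..n. \<Sum>j=1..n. \<theta> i j * w i j)) = goe_char n \<theta>)"

lemma goe_entry:
  assumes "goe_law n \<mu>" "i \<in> {1..n}" "j \<in> {1..n}"
  shows "(\<lambda>w. w i j) \<in> borel_measurable \<mu>"
  using assms matrices_entry by (auto simp: goe_law_def cong: measurable_cong_sets)

lemma mv_measurable:
  assumes "\<And>i j. i \<in> {1..n} \<Longrightarrow> j \<in> {1..n} \<Longrightarrow> (\<lambda>x. w x i j) \<in> borel_measurable K"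
    and "\<And>i. i \<in> {1..n} \<Longrightarrow> (\<lambda>x. e x i) \<in> borel_measurable K" and "i \<in> {1..n}"
  shows "(\<lambda>x. mv n (w x) (e x) i) \<in> borel_measurable K"
  unfolding mv_def by (intro borel_measurable_sum borel_measurable_times assms)

lemma shrink_measurable:
  assumes "\<And>i. i \<in> {1..n} \<Longrightarrow> (\<lambda>x. e x i) \<in> borel_measurable K" "\<And>i. i \<in> {1..n} \<Longrightarrow> (\<lambda>x. a x i) \<in> borel_measurable K" "i \<in> {1..n}"
  shows "(\<lambda>x. shrink n (e x) (a x) i) \<in> borel_measurable K"
  unfolding shrink_def
  by (intro borel_measurable_diff borel_measurable_times borel_measurable_const dot_measurable assms)

lemma new_col_measurable:
  assumes "\<And>i j. i \<in> {1..n} \<Longrightarrow> j \<in> {1..n} \<Longrightarrow> (\<lambda>x. w x i j) \<in> borel_measurable K"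
    and "\<And>i. i \<in> {1..n} \<Longrightarrow> (\<lambda>x. e x i) \<in> borel_measurable K"
  shows "(\<lambda>x. new_col n (e x) (w x)) \<in> K \<rightarrow>\<^sub>M normal_vec n"
  unfolding measurable_cong_sets[OF refl sets_normal_vec] new_col_def
  by (intro measurable_restrict borel_measurable_times borel_measurable_const shrink_measurable mv_measurable assms)

lemma new_mat_measurable:
  assumes "\<And>i j. i \<in> {1..n} \<Longrightarrow> j \<in> {1..n} \<Longrightarrow> (\<lambda>x. w x i j) \<in> borel_measurable K"
    and "\<And>i. i \<in> {1..n} \<Longrightarrow> (\<lambda>x. e x i) \<in> borel_measurable K" "\<And>i. i \<in> {1..n} \<Longrightarrow> (\<lambda>x. a x i) \<in> borel_measurable K"
  shows "(\<lambda>x. new_mat n (e x) (w x) (a x)) \<in> K \<rightarrow>\<^sub>M matrices n n"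
  unfolding new_mat_def row_shift_def
  by (intro measurable_matricesI borel_measurable_add borel_measurable_diff borel_measurable_times borel_measurable_divide
      borel_measurable_const dot_measurable shrink_measurable mv_measurable assms)

lemma shrink_sym: "dot n x (shrink n e y) = dot n (shrink n e x) y"
  unfolding shrink_def by (simp only: dot_linear) (simp add: dot_commute)

text \<open>
  Exchanging the e-row of a GOE matrix with an independent Gaussian vector preserves the joint
  law: both sides are Gaussian, and this is the equality of their variances. With s and p as
  below, it follows by separating the components along e and orthogonal to e.
\<close>

lemma exchange_variance:
  fixes \<Theta> :: rmat and \<alpha> e :: rvec
  assumes n: "n \<ge> 1" and e: "dot n e e = 1"
  defines "s \<equiv> (\<lambda>i. \<Sum>j=1..n. (\<Theta> i j + \<Theta> j i) * e j)"
  defines "p \<equiv> (\<lambda>i. sqrt (real n) * shrink n e \<alpha> i - s i + dot n e s / 2 * e i)"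
  shows "(\<Sum>i=1..n. \<Sum>j=1..n. ((\<Theta> i j + p i * e j) + (\<Theta> j i + p j * e i))\<^sup>2) / (4 * real n) + (\<Sum>i=1..n. (shrink n e s i / sqrt (real n))\<^sup>2) / 2
    = (\<Sum>i=1..n. \<Sum>j=1..n. (\<Theta> i j + \<Theta> j i)\<^sup>2) / (4 * real n) + (\<Sum>i=1..n. (\<alpha> i)\<^sup>2) / 2"
proof -
  define S where "S i j = \<Theta> i j + \<Theta> j i" for i j
  define Q where "Q = (\<Sum>i=1..n. \<Sum>j=1..n. (S i j)\<^sup>2)"
  have Ssym: "S i j = S j i" for i j by (simp add: S_def)
  have sS: "s = (\<lambda>i. \<Sum>j=1..n. S i j * e j)" by (simp add: s_def S_def)
  have "(\<Sum>i=1..n. \<Sum>j=1..n. ((\<Theta> i j + p i * e j) + (\<Theta> j i + p j * e i))\<^sup>2)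
     = (\<Sum>i=1..n. \<Sum>j=1..n. (S i j)\<^sup>2 + 2 * (p i * (S i j * e j)) + 2 * (p j * (S j i * e i))
        + ((p i * p i) * (e j * e j) + (e i * e i) * (p j * p j) + 2 * ((p i * e i) * (p j * e j))))"
    by (intro sum.cong refl) (simp add: S_def power2_eq_square algebra_simps)
  also have "\<dots> = Q + 2 * dot n p s + 2 * dot n p s + (dot n p p * dot n e e + dot n e e * dot n p p + 2 * (dot n p e * dot n p e))"
  proof -
    have 1: "(\<Sum>i=1..n. \<Sum>j=1..n. 2 * (p i * (S i j * e j))) = 2 * dot n p s"
      by (simp add: sS dot_def sum_distrib_left)
    have 2: "(\<Sum>i=1..n. \<Sum>j=1..n. 2 * (p j * (S j i * e i))) = 2 * dot n p s"
      by (subst sum.swap) (rule 1)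
    show ?thesis
      unfolding sum.distrib 1 2 Q_def
      by (simp only: sum_distrib_left[symmetric] sum_distrib_right[symmetric] dot_def)
  qed
  finally have A: "(\<Sum>i=1..n. \<Sum>j=1..n. ((\<Theta> i j + p i * e j) + (\<Theta> j i + p j * e i))\<^sup>2)
     = Q + 4 * dot n p s + 2 * dot n p p + 2 * (dot n p e)\<^sup>2"
    using e by (simp add: power2_eq_square)
  define k where "k = 1 - 1 / sqrt (2::real)"
  have k: "k\<^sup>2 = 2 * k - 1 / 2" by (simp add: k_def power2_eq_square algebra_simps)
  define y where "y = (\<lambda>i. sqrt (real n) * shrink n e \<alpha> i)"
  have py: "p = (\<lambda>i. y i - s i + dot n e s / 2 * e i)" by (simp add: p_def y_def)
  have shr: "dot n (shrink n e x) (shrink n e x) = dot n x x - (dot n e x)\<^sup>2 / 2" for x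
  proof -
    have "dot n (shrink n e x) (shrink n e x) = dot n x x - 2 * k * (dot n e x)\<^sup>2 + k\<^sup>2 * (dot n e x)\<^sup>2"
      unfolding shrink_def k_def[symmetric] by (simp only: dot_linear e) (simp add: dot_commute power2_eq_square algebra_simps)
    also have "\<dots> = dot n x x - (dot n e x)\<^sup>2 / 2" unfolding k by (simp add: algebra_simps)
    finally show ?thesis .
  qed
  have she: "(dot n (shrink n e x) e)\<^sup>2 = (dot n e x)\<^sup>2 / 2" for x
  proof -
    have "dot n (shrink n e x) e = (1 - k) * dot n e x"
      unfolding shrink_def k_def[symmetric] by (simp only: dot_linear e) (simp add: dot_commute algebra_simps)
    then show ?thesis by (simp add: k_def power_mult_distrib power_divide)
  qed
  have yy: "dot n y y + (dot n y e)\<^sup>2 = real n * dot n \<alpha> \<alpha>"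
    unfolding y_def by (simp only: dot_linear power_mult_distrib she mult.assoc[symmetric]) (simp add: shr algebra_simps)
  have B: "(\<Sum>i=1..n. (shrink n e s i / sqrt (real n))\<^sup>2) = (dot n s s - (dot n e s)\<^sup>2 / 2) / real n"
    unfolding shr[symmetric] by (simp add: dot_def power_divide sum_divide_distrib power2_eq_square)
  have "4 * dot n p s + 2 * dot n p p + 2 * (dot n p e)\<^sup>2 + 2 * (dot n s s - (dot n e s)\<^sup>2 / 2)
     = 2 * (dot n y y + (dot n y e)\<^sup>2)"
    unfolding py by (simp only: dot_linear e) (simp add: dot_commute power2_eq_square algebra_simps)
  also have "\<dots> = 2 * real n * dot n \<alpha> \<alpha>" by (simp add: yy)
  finally have C: "4 * dot n p s + 2 * dot n p p + 2 * (dot n p e)\<^sup>2 + 2 * (dot n s s - (dot n e s)\<^sup>2 / 2) = 2 * real n * dot n \<alpha> \<alpha>" .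
  have "(Q + 4 * dot n p s + 2 * dot n p p + 2 * (dot n p e)\<^sup>2) / (4 * real n) + ((dot n s s - (dot n e s)\<^sup>2 / 2) / real n) / 2
     = (Q + (4 * dot n p s + 2 * dot n p p + 2 * (dot n p e)\<^sup>2 + 2 * (dot n s s - (dot n e s)\<^sup>2 / 2))) / (4 * real n)"
    using n by (simp add: field_simps)
  also have "\<dots> = Q / (4 * real n) + dot n \<alpha> \<alpha> / 2" unfolding C using n by (simp add: field_simps)
  finally have fin: "(Q + 4 * dot n p s + 2 * dot n p p + 2 * (dot n p e)\<^sup>2) / (4 * real n) + ((dot n s s - (dot n e s)\<^sup>2 / 2) / real n) / 2
     = Q / (4 * real n) + dot n \<alpha> \<alpha> / 2" .
  have "dot n \<alpha> \<alpha> = (\<Sum>i=1..n. (\<alpha> i)\<^sup>2)" by (simp add: dot_def power2_eq_square)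
  then show ?thesis unfolding A B using fin by (simp add: Q_def S_def)
qed

text \<open>
  The exchange is linear in the pair of w and a; the coefficients on the right are those of its
  transpose.
\<close>

lemma exchange_linear:
  fixes \<Theta> :: rmat and \<alpha> e :: rvec
  assumes n: "n \<ge> 1"
  defines "s \<equiv> (\<lambda>i. \<Sum>j=1..n. (\<Theta> i j + \<Theta> j i) * e j)"
  defines "p \<equiv> (\<lambda>i. sqrt (real n) * shrink n e \<alpha> i - s i + dot n e s / 2 * e i)"
  shows "(\<Sum>i=1..n. \<Sum>j=1..n. \<Theta> i j * new_mat n e w a i j) + (\<Sum>i=1..n. \<alpha> i * new_col n e w i)
    = (\<Sum>i=1..n. \<Sum>j=1..n. (\<Theta> i j + p i * e j) * w i j) + (\<Sum>i=1..n. (shrink n e s i / sqrt (real n)) * a i)"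
proof -
  define d where "d = row_shift n e w a"
  have "(\<Sum>i=1..n. \<Sum>j=1..n. \<Theta> i j * new_mat n e w a i j)
     = (\<Sum>i=1..n. \<Sum>j=1..n. \<Theta> i j * w i j + d j * (\<Theta> i j * e i) + d i * (\<Theta> i j * e j))"
    by (intro sum.cong refl) (simp add: new_mat_def d_def algebra_simps)
  also have "\<dots> = (\<Sum>i=1..n. \<Sum>j=1..n. \<Theta> i j * w i j) + (\<Sum>i=1..n. \<Sum>j=1..n. d j * (\<Theta> i j * e i)) + (\<Sum>i=1..n. \<Sum>j=1..n. d i * (\<Theta> i j * e j))"
    by (simp only: sum.distrib)
  also have "(\<Sum>i=1..n. \<Sum>j=1..n. d j * (\<Theta> i j * e i)) = (\<Sum>i=1..n. \<Sum>j=1..n. d i * (\<Theta> j i * e j))"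
    by (rule sum.swap)
  also have "(\<Sum>i=1..n. \<Sum>j=1..n. \<Theta> i j * w i j) + (\<Sum>i=1..n. \<Sum>j=1..n. d i * (\<Theta> j i * e j)) + (\<Sum>i=1..n. \<Sum>j=1..n. d i * (\<Theta> i j * e j))
     = (\<Sum>i=1..n. \<Sum>j=1..n. \<Theta> i j * w i j) + dot n d s"
    by (simp add: dot_def s_def sum_distrib_left sum.distrib[symmetric] algebra_simps)
  finally have 1: "(\<Sum>i=1..n. \<Sum>j=1..n. \<Theta> i j * new_mat n e w a i j) = (\<Sum>i=1..n. \<Sum>j=1..n. \<Theta> i j * w i j) + dot n d s" .
  have 2: "dot n d s = dot n (shrink n e s) a / sqrt (real n) - dot n s (mv n w e) + dot n e s / 2 * dot n e (mv n w e)"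
  proof -
    have sh: "dot n (shrink n e a) s = dot n (shrink n e s) a"
      using shrink_sym[of n s e a] by (simp only: dot_commute[of n "shrink n e a"])
    show ?thesis
      unfolding d_def row_shift_def by (simp only: dot_linear sh) (simp add: dot_commute[of n "mv n w e"])
  qed
  have "(\<Sum>i=1..n. \<alpha> i * new_col n e w i) = dot n \<alpha> (\<lambda>i. sqrt (real n) * shrink n e (mv n w e) i)"
    unfolding dot_def by (intro sum.cong refl) (simp add: new_col_def)
  then have 3: "(\<Sum>i=1..n. \<alpha> i * new_col n e w i) = sqrt (real n) * dot n (shrink n e \<alpha>) (mv n w e)"
    by (simp only: dot_linear shrink_sym)
  have 4: "(\<Sum>i=1..n. \<Sum>j=1..n. (\<Theta> i j + p i * e j) * w i j) = (\<Sum>i=1..n. \<Sum>j=1..n. \<Theta> i j * w i j) + dot n p (mv n w e)"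
    by (simp add: dot_def mv_def sum.distrib sum_distrib_left algebra_simps)
  have 5: "(\<Sum>i=1..n. (shrink n e s i / sqrt (real n)) * a i) = dot n (shrink n e s) a / sqrt (real n)"
    by (simp add: dot_def sum_divide_distrib)
  have 6: "dot n p (mv n w e) = sqrt (real n) * dot n (shrink n e \<alpha>) (mv n w e) - dot n s (mv n w e) + dot n e s / 2 * dot n e (mv n w e)"
    unfolding p_def by (simp only: dot_linear)
  show ?thesis unfolding 1 2 3 4 5 6 by simp
qed

lemma exchange_law:
  assumes \<mu>: "goe_law n \<mu>" and n: "n \<ge> 1" and e: "dot n e e = 1"
  shows "(\<lambda>(w, a). (new_mat n e w a, new_col n e w)) \<in> \<mu> \<Otimes>\<^sub>M normal_vec n \<rightarrow>\<^sub>M \<mu> \<Otimes>\<^sub>M normal_vec n" (is "?\<Psi> \<in> ?K \<rightarrow>\<^sub>M ?K")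
    and "distr (\<mu> \<Otimes>\<^sub>M normal_vec n) (\<mu> \<Otimes>\<^sub>M normal_vec n) (\<lambda>(w, a). (new_mat n e w a, new_col n e w)) = \<mu> \<Otimes>\<^sub>M normal_vec n"
proof -
  interpret \<mu>: prob_space \<mu> using \<mu> by (simp add: goe_law_def)
  interpret \<gamma>: prob_space "normal_vec n" by (rule prob_space_normal_vec)
  interpret P: pair_prob_space \<mu> "normal_vec n" by standard
  have s\<mu>: "sets \<mu> = sets (matrices n n)" using \<mu> by (simp add: goe_law_def)
  have w: "(\<lambda>p. fst p i j) \<in> borel_measurable ?K" if "i \<in> {1..n}" "j \<in> {1..n}" for i j
    by (rule measurable_compose[OF measurable_fst goe_entry[OF \<mu> that]])
  have a: "(\<lambda>p. snd p i) \<in> borel_measurable ?K" if "i \<in> {1..n}" for i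
    by (rule measurable_compose[OF measurable_snd normal_vec_entry[OF that]])
  show \<Psi>: "?\<Psi> \<in> ?K \<rightarrow>\<^sub>M ?K"
    unfolding case_prod_unfold
    by (intro measurable_Pair new_col_measurable w borel_measurable_const)
       (subst measurable_cong_sets[OF refl s\<mu>], intro new_mat_measurable w a borel_measurable_const)
  let ?I = "({1..n} \<times> {1..n}) <+> {1..n} :: (nat \<times> nat + nat) set"
  let ?c = "\<lambda>k (p :: rmat \<times> rvec). (case k of Inl (i, j) \<Rightarrow> fst p i j | Inr i \<Rightarrow> snd p i)"
  let ?r = "\<lambda>z. (\<lambda>i\<in>{1..n}. \<lambda>j\<in>{1..n}. z (Inl (i, j)), \<lambda>i\<in>{1..n}. z (Inr i))"
  show "distr ?K ?K ?\<Psi> = ?K"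
  proof (rule measure_eqI_char[where I="?I" and S="?K" and X="?c" and r="?r"])
    show "?c k \<in> borel_measurable ?K" if "k \<in> ?I" for k :: "nat \<times> nat + nat" using that w a by (auto split: sum.split)
    show "?r \<in> (\<Pi>\<^sub>M k\<in>?I. borel) \<rightarrow>\<^sub>M ?K"
    proof (rule measurable_Pair)
      show "(\<lambda>z. \<lambda>i\<in>{1..n}. \<lambda>j\<in>{1..n}. z (Inl (i, j))) \<in> (\<Pi>\<^sub>M k\<in>?I. borel) \<rightarrow>\<^sub>M \<mu>"
        unfolding measurable_cong_sets[OF refl s\<mu>]
        by (intro measurable_matricesI measurable_component_singleton) auto
      show "(\<lambda>z. \<lambda>i\<in>{1..n}. z (Inr i)) \<in> (\<Pi>\<^sub>M k\<in>?I. borel) \<rightarrow>\<^sub>M normal_vec n"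
        unfolding measurable_cong_sets[OF refl sets_normal_vec]
        by (intro measurable_restrict measurable_component_singleton) auto
    qed
    show "?r (\<lambda>k\<in>?I. ?c k p) = p" if "p \<in> space ?K" for p
    proof -
      have "fst p \<in> space (matrices n n)" "snd p \<in> space (\<Pi>\<^sub>M i\<in>{1..n}. borel :: real measure)"
        using that sets_eq_imp_space_eq[OF s\<mu>] sets_eq_imp_space_eq[OF sets_normal_vec, of n] by (auto simp: space_pair_measure)
      then have "take_cols n n (fst p) = fst p" "restrict (snd p) {1..n} = snd p"
        by (auto simp: take_cols_id space_PiM PiE_def extensional_restrict)
      then show ?thesis by (cases p) (simp add: take_cols_def InlI InrI cong: restrict_cong)
    qed
    fix \<theta> :: "nat \<times> nat + nat \<Rightarrow> real"
    define \<Theta> where "\<Theta> i j = \<theta> (Inl (i, j))" for i j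
    define \<alpha> where "\<alpha> i = \<theta> (Inr i)" for i
    have lin: "(\<Sum>k\<in>?I. \<theta> k * ?c k p) = (\<Sum>i=1..n. \<Sum>j=1..n. \<Theta> i j * fst p i j) + (\<Sum>i=1..n. \<alpha> i * snd p i)" for p
      by (simp add: sum.Plus \<Theta>_def \<alpha>_def sum.cartesian_product case_prod_unfold)
    have lm: "(\<lambda>p. (\<Sum>i=1..n. \<Sum>j=1..n. A i j * fst p i j) + (\<Sum>i=1..n. B i * snd p i)) \<in> borel_measurable ?K" for A :: rmat and B :: rvec
      by (intro borel_measurable_add borel_measurable_sum borel_measurable_times borel_measurable_const w a)
    have cf: "(CLINT p|?K. iexp ((\<Sum>i=1..n. \<Sum>j=1..n. A i j * fst p i j) + (\<Sum>i=1..n. B i * snd p i)))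
       = complex_of_real (exp (- ((\<Sum>i=1..n. \<Sum>j=1..n. (A i j + A j i)\<^sup>2) / (4 * real n) + (\<Sum>i=1..n. (B i)\<^sup>2) / 2)))" for A :: rmat and B :: rvec
    proof -
      have "(CLINT p|?K. iexp ((\<Sum>i=1..n. \<Sum>j=1..n. A i j * fst p i j) + (\<Sum>i=1..n. B i * snd p i)))
         = (CLINT w|\<mu>. iexp (\<Sum>i=1..n. \<Sum>j=1..n. A i j * w i j)) * (CLINT a|normal_vec n. iexp (\<Sum>i=1..n. B i * a i))"
        by (rule pair_char[OF \<mu>.prob_space_axioms \<gamma>.prob_space_axioms])
           (intro borel_measurable_sum borel_measurable_times borel_measurable_const goe_entry[OF \<mu>] normal_vec_entry; assumption)+
      also have "\<dots> = complex_of_real (exp (- (\<Sum>i=1..n. \<Sum>j=1..n. (A i j + A j i)\<^sup>2) / (4 * real n)) * exp (- (\<Sum>i=1..n. (B i)\<^sup>2) / 2))"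
        using \<mu> normal_vec_char[where n=n and c=B] unfolding goe_law_def goe_char_def by (simp only: of_real_mult)
      also have "\<dots> = complex_of_real (exp (- ((\<Sum>i=1..n. \<Sum>j=1..n. (A i j + A j i)\<^sup>2) / (4 * real n) + (\<Sum>i=1..n. (B i)\<^sup>2) / 2)))"
        by (simp only: exp_add[symmetric] minus_add_distrib minus_divide_left)
      finally show ?thesis .
    qed
    define s where "s = (\<lambda>i. \<Sum>j=1..n. (\<Theta> i j + \<Theta> j i) * e j)"
    define p' where "p' = (\<lambda>i. sqrt (real n) * shrink n e \<alpha> i - s i + dot n e s / 2 * e i)"
    have "(CLINT p|distr ?K ?K ?\<Psi>. iexp (\<Sum>k\<in>?I. \<theta> k * ?c k p)) = (CLINT p|?K. iexp (\<Sum>k\<in>?I. \<theta> k * ?c k (?\<Psi> p)))"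
      unfolding lin by (rule integral_distr[OF \<Psi>], rule measurable_compose[OF lm, of "\<lambda>y. iexp y"]) simp
    also have "\<dots> = (CLINT p|?K. iexp ((\<Sum>i=1..n. \<Sum>j=1..n. (\<Theta> i j + p' i * e j) * fst p i j) + (\<Sum>i=1..n. (shrink n e s i / sqrt (real n)) * snd p i)))"
      unfolding lin using exchange_linear[OF n, of \<Theta> e] by (simp only: case_prod_unfold fst_conv snd_conv s_def p'_def)
    also have "\<dots> = complex_of_real (exp (- ((\<Sum>i=1..n. \<Sum>j=1..n. (\<Theta> i j + \<Theta> j i)\<^sup>2) / (4 * real n) + (\<Sum>i=1..n. (\<alpha> i)\<^sup>2) / 2)))"
      unfolding cf using exchange_variance[OF n e, of \<Theta> \<alpha>] by (simp only: s_def p'_def)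
    also have "\<dots> = (CLINT p|?K. iexp (\<Sum>k\<in>?I. \<theta> k * ?c k p))" unfolding lin cf ..
    finally show "(CLINT p|distr ?K ?K ?\<Psi>. iexp (\<Sum>k\<in>?I. \<theta> k * ?c k p)) = (CLINT p|?K. iexp (\<Sum>k\<in>?I. \<theta> k * ?c k p))" .
  qed (auto intro!: P.prob_space_distr \<Psi> P.prob_space_axioms)
qed

lemma normal_cols_insert:
  assumes "s \<in> {1..T}"
  shows "normal_cols n T = (\<Pi>\<^sub>M i\<in>insert s ({1..T} - {s}). normal_vec n)"
  using assms by (simp add: normal_cols_def insert_absorb)

text \<open>
  This isolates the pair of variables on which one exchange acts, for fixed values of all the other
  columns.
\<close>

lemma column_integral:
  assumes \<mu>: "prob_space \<mu>" and s: "s \<in> {1..T}" and F: "F \<in> borel_measurable (\<mu> \<Otimes>\<^sub>M normal_cols n T)"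
  shows "(\<integral>\<^sup>+p. F p \<partial>(\<mu> \<Otimes>\<^sub>M normal_cols n T))
    = (\<integral>\<^sup>+x. (\<integral>\<^sup>+p. F (fst p, x(s := snd p)) \<partial>(\<mu> \<Otimes>\<^sub>M normal_vec n)) \<partial>(\<Pi>\<^sub>M i\<in>{1..T} - {s}. normal_vec n))"
proof -
  let ?J = "\<Pi>\<^sub>M i\<in>{1..T} - {s}. normal_vec n"
  note ins = normal_cols_insert[OF s, of n]
  interpret \<mu>: prob_space \<mu> by fact
  interpret \<gamma>: prob_space "normal_vec n" by (rule prob_space_normal_vec)
  interpret J: prob_space ?J by (intro prob_space_PiM prob_space_normal_vec)
  interpret G: prob_space "normal_cols n T" by (rule prob_space_normal_cols)
  interpret ps: product_sigma_finite "\<lambda>_::nat. normal_vec n"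
    by (simp add: product_sigma_finite_def prob_space_imp_sigma_finite prob_space_normal_vec)
  interpret \<mu>J: pair_sigma_finite \<mu> ?J by standard
  have upd: "(\<lambda>q. (fst (fst q), (snd (fst q))(s := snd q))) \<in> (\<mu> \<Otimes>\<^sub>M ?J) \<Otimes>\<^sub>M normal_vec n \<rightarrow>\<^sub>M \<mu> \<Otimes>\<^sub>M normal_cols n T"
    unfolding ins
    by (intro measurable_Pair measurable_fun_upd[where J="{1..T} - {s}"] measurable_compose[OF measurable_fst measurable_fst]
        measurable_compose[OF measurable_fst measurable_snd] measurable_snd) auto
  note Fu = measurable_compose[OF upd F]
  have sec: "(\<lambda>X. F (w, X)) \<in> borel_measurable (normal_cols n T)" if "w \<in> space \<mu>" for w
    by (rule measurable_compose[OF measurable_Pair1'[OF that] F])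
  have "(\<integral>\<^sup>+p. F p \<partial>(\<mu> \<Otimes>\<^sub>M normal_cols n T)) = (\<integral>\<^sup>+w. (\<integral>\<^sup>+X. F (w, X) \<partial>normal_cols n T) \<partial>\<mu>)"
    by (rule G.nn_integral_fst[OF F, symmetric])
  also have "\<dots> = (\<integral>\<^sup>+w. (\<integral>\<^sup>+x. (\<integral>\<^sup>+y. F (w, x(s := y)) \<partial>normal_vec n) \<partial>?J) \<partial>\<mu>)"
    unfolding ins
    by (intro nn_integral_cong ps.product_nn_integral_insert) (use sec in \<open>auto simp: ins\<close>)
  also have "\<dots> = (\<integral>\<^sup>+x. (\<integral>\<^sup>+w. (\<integral>\<^sup>+y. F (w, x(s := y)) \<partial>normal_vec n) \<partial>\<mu>) \<partial>?J)"
  proof (rule \<mu>J.Fubini'[symmetric])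
    show "(\<lambda>(w, x). \<integral>\<^sup>+y. F (w, x(s := y)) \<partial>normal_vec n) \<in> borel_measurable (\<mu> \<Otimes>\<^sub>M ?J)"
      unfolding case_prod_unfold
      by (rule \<gamma>.borel_measurable_nn_integral) (use Fu in \<open>simp add: case_prod_unfold\<close>)
  qed
  also have "\<dots> = (\<integral>\<^sup>+x. (\<integral>\<^sup>+p. F (fst p, x(s := snd p)) \<partial>(\<mu> \<Otimes>\<^sub>M normal_vec n)) \<partial>?J)"
  proof (intro nn_integral_cong)
    fix x assume x: "x \<in> space ?J"
    have "(\<lambda>p. ((fst p, x), snd p)) \<in> \<mu> \<Otimes>\<^sub>M normal_vec n \<rightarrow>\<^sub>M (\<mu> \<Otimes>\<^sub>M ?J) \<Otimes>\<^sub>M normal_vec n"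
      by (intro measurable_Pair measurable_fst measurable_snd measurable_const x)
    from measurable_compose[OF this Fu]
    have "(\<lambda>p. F (fst p, x(s := snd p))) \<in> borel_measurable (\<mu> \<Otimes>\<^sub>M normal_vec n)" by simp
    from \<gamma>.nn_integral_fst[OF this]
    show "(\<integral>\<^sup>+w. (\<integral>\<^sup>+y. F (w, x(s := y)) \<partial>normal_vec n) \<partial>\<mu>) = (\<integral>\<^sup>+p. F (fst p, x(s := snd p)) \<partial>(\<mu> \<Otimes>\<^sub>M normal_vec n))" by simp
  qed
  finally show ?thesis .
qed

text \<open>
  One step of the exploration. The direction depends on the other columns only; with these fixed,
  the step is the exchange above.
\<close>

lemma exploration_step_law:
  assumes \<mu>: "goe_law n \<mu>" and n: "n \<ge> 1" and s: "s \<in> {1..T}"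
    and em: "\<And>i. i \<in> {1..n} \<Longrightarrow> (\<lambda>X. e X i) \<in> borel_measurable (normal_cols n T)"
    and unit: "\<And>X. dot n (e X) (e X) = 1" and indep: "\<And>X y. e (X(s := y)) = e X"
  defines "\<Phi> \<equiv> (\<lambda>(w, X). (new_mat n (e X) w (X s), X(s := new_col n (e X) w)))"
  shows "\<Phi> \<in> \<mu> \<Otimes>\<^sub>M normal_cols n T \<rightarrow>\<^sub>M \<mu> \<Otimes>\<^sub>M normal_cols n T"
    and "distr (\<mu> \<Otimes>\<^sub>M normal_cols n T) (\<mu> \<Otimes>\<^sub>M normal_cols n T) \<Phi> = \<mu> \<Otimes>\<^sub>M normal_cols n T"
proof -
  let ?K = "\<mu> \<Otimes>\<^sub>M normal_cols n T" and ?J = "\<Pi>\<^sub>M i\<in>{1..T} - {s}. normal_vec n"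
  have p\<mu>: "prob_space \<mu>" and s\<mu>: "sets \<mu> = sets (matrices n n)" using \<mu> by (simp_all add: goe_law_def)
  have w: "(\<lambda>p. fst p i j) \<in> borel_measurable ?K" if "i \<in> {1..n}" "j \<in> {1..n}" for i j
    by (rule measurable_compose[OF measurable_fst goe_entry[OF \<mu> that]])
  have a: "(\<lambda>p. snd p s i) \<in> borel_measurable ?K" if "i \<in> {1..n}" for i
    by (rule measurable_compose[OF measurable_snd normal_cols_entry[OF s that]])
  have ee: "(\<lambda>p. e (snd p) i) \<in> borel_measurable ?K" if "i \<in> {1..n}" for i
    by (rule measurable_compose[OF measurable_snd em[OF that]])
  have sndm: "(\<lambda>p. (snd p)(s := new_col n (e (snd p)) (fst p))) \<in> ?K \<rightarrow>\<^sub>M normal_cols n T"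
  proof -
    have "(\<lambda>p. (snd p)(s := new_col n (e (snd p)) (fst p))) \<in> ?K \<rightarrow>\<^sub>M (\<Pi>\<^sub>M i\<in>{1..T}. normal_vec n)"
    proof (rule measurable_fun_upd[where J="{1..T}"])
      show "snd \<in> ?K \<rightarrow>\<^sub>M (\<Pi>\<^sub>M i\<in>{1..T}. normal_vec n)" unfolding normal_cols_def by (rule measurable_snd)
      show "(\<lambda>p. new_col n (e (snd p)) (fst p)) \<in> ?K \<rightarrow>\<^sub>M normal_vec n" by (intro new_col_measurable w ee)
    qed (use s in auto)
    then show ?thesis by (simp add: normal_cols_def)
  qed
  show \<Phi>: "\<Phi> \<in> ?K \<rightarrow>\<^sub>M ?K"
    unfolding \<Phi>_def case_prod_unfold
    by (intro measurable_Pair sndm)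
       (subst measurable_cong_sets[OF refl s\<mu>], intro new_mat_measurable w a ee)
  show "distr ?K ?K \<Phi> = ?K"
  proof (rule measure_eqI)
    fix A assume "A \<in> sets (distr ?K ?K \<Phi>)"
    then have A: "A \<in> sets ?K" by simp
    then have iA: "indicator A \<in> borel_measurable ?K" by simp
    have "emeasure (distr ?K ?K \<Phi>) A = (\<integral>\<^sup>+p. indicator A p \<partial>distr ?K ?K \<Phi>)" using A by simp
    also have "\<dots> = (\<integral>\<^sup>+p. indicator A (\<Phi> p) \<partial>?K)" by (rule nn_integral_distr[OF \<Phi>]) (use iA in simp)
    also have "\<dots> = (\<integral>\<^sup>+x. (\<integral>\<^sup>+p. indicator A (\<Phi> (fst p, x(s := snd p))) \<partial>(\<mu> \<Otimes>\<^sub>M normal_vec n)) \<partial>?J)"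
      by (rule column_integral[OF p\<mu> s measurable_compose[OF \<Phi> iA]])
    also have "\<dots> = (\<integral>\<^sup>+x. (\<integral>\<^sup>+p. indicator A (fst p, x(s := snd p)) \<partial>(\<mu> \<Otimes>\<^sub>M normal_vec n)) \<partial>?J)"
    proof (rule nn_integral_cong)
      fix x assume x: "x \<in> space ?J"
      let ?\<Psi> = "\<lambda>(w, a). (new_mat n (e x) w a, new_col n (e x) w)" and ?P = "\<mu> \<Otimes>\<^sub>M normal_vec n"
      note ex = exchange_law[OF \<mu> n unit, of x]
      have um: "(\<lambda>p. (fst p, x(s := snd p))) \<in> ?P \<rightarrow>\<^sub>M ?K"
        unfolding normal_cols_insert[OF s]
        by (intro measurable_Pair measurable_fst measurable_fun_upd[where J="{1..T} - {s}"] measurable_snd measurable_const x) auto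
      have "(\<integral>\<^sup>+p. indicator A (\<Phi> (fst p, x(s := snd p))) \<partial>?P) = (\<integral>\<^sup>+p. indicator A (fst (?\<Psi> p), x(s := snd (?\<Psi> p))) \<partial>?P)"
        by (intro nn_integral_cong) (simp add: \<Phi>_def case_prod_unfold indep)
      also have "\<dots> = (\<integral>\<^sup>+p. indicator A (fst p, x(s := snd p)) \<partial>distr ?P ?P ?\<Psi>)"
        by (rule nn_integral_distr[OF ex(1), symmetric]) (use measurable_compose[OF um iA] in simp)
      also have "distr ?P ?P ?\<Psi> = ?P" by (rule ex(2))
      finally show "(\<integral>\<^sup>+p. indicator A (\<Phi> (fst p, x(s := snd p))) \<partial>?P) = (\<integral>\<^sup>+p. indicator A (fst p, x(s := snd p)) \<partial>?P)" .
    qed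
    also have "\<dots> = (\<integral>\<^sup>+p. indicator A p \<partial>?K)" by (rule column_integral[OF p\<mu> s iA, symmetric])
    also have "\<dots> = emeasure ?K A" using A by simp
    finally show "emeasure (distr ?K ?K \<Phi>) A = emeasure ?K A" .
  qed simp
qed

lemma unitize_measurable:
  assumes "\<And>i. i \<in> {1..n} \<Longrightarrow> (\<lambda>x. a x i) \<in> borel_measurable K" "i \<in> {1..n}"
  shows "(\<lambda>x. unitize n (a x) i) \<in> borel_measurable K"
proof -
  have d[measurable]: "(\<lambda>x. dot n (a x) (a x)) \<in> borel_measurable K" by (intro dot_measurable assms)
  have [measurable]: "(\<lambda>x. a x i) \<in> borel_measurable K" by (intro assms)
  have "(\<lambda>x. if dot n (a x) (a x) = 0 then (if i = 1 then 1 else 0) else a x i / sqrt (dot n (a x) (a x))) \<in> borel_measurable K"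
    by measurable
  then show ?thesis by (simp add: unitize_def if_distrib[of "\<lambda>g. g i"] cong: if_cong)
qed

lemma gs_measurable:
  assumes "\<And>s i. s \<in> {1..t} \<Longrightarrow> i \<in> {1..n} \<Longrightarrow> (\<lambda>x. U x s i) \<in> borel_measurable K" "t \<ge> 1" "i \<in> {1..n}"
  shows "(\<lambda>x. gs n (U x) t i) \<in> borel_measurable K"
  using assms
proof (induction t arbitrary: i rule: less_induct)
  case (less t)
  have IH: "(\<lambda>x. gs n (U x) q j) \<in> borel_measurable K" if "q \<in> {1..<t}" "j \<in> {1..n}" for q j
    by (rule less.IH) (use that less.prems in auto)
  have Ut: "(\<lambda>x. U x t j) \<in> borel_measurable K" if "j \<in> {1..n}" for j
    by (rule less.prems(1)) (use that less.prems in auto)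
  have "(\<lambda>x. resid n (U x) t j) \<in> borel_measurable K" if "j \<in> {1..n}" for j
    unfolding resid_def
    by (intro borel_measurable_diff borel_measurable_sum borel_measurable_times dot_measurable IH Ut that)
  then show ?case
    unfolding gs_resid by (rule unitize_measurable) (use less.prems in auto)
qed

lemma span_apply_measurable:
  assumes "\<And>s i. s \<in> {1..t} \<Longrightarrow> i \<in> {1..n} \<Longrightarrow> (\<lambda>x. e x s i) \<in> borel_measurable K"
    and "\<And>s i. s \<in> {1..t} \<Longrightarrow> i \<in> {1..n} \<Longrightarrow> (\<lambda>x. g x s i) \<in> borel_measurable K"
    and "\<And>i. i \<in> {1..n} \<Longrightarrow> (\<lambda>x. u x i) \<in> borel_measurable K" and i: "i \<in> {1..n}"
  shows "(\<lambda>x. span_apply n (e x) (g x) (u x) t i) \<in> borel_measurable K"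
  unfolding span_apply_def
  by (intro borel_measurable_divide borel_measurable_sum borel_measurable_add borel_measurable_diff borel_measurable_times
      borel_measurable_const dot_measurable) (use assms in auto)

context amp_instance
begin

lemma iter_u_measurable:
  assumes z: "\<And>i s. i \<in> {1..n} \<Longrightarrow> s \<in> {1..k} \<Longrightarrow> (\<lambda>X. z X i s) \<in> borel_measurable K"
    and r: "r \<in> {1..Suc k}" "r \<le> T" and i: "i \<in> {1..n}"
  shows "(\<lambda>X. iter_u n v f (z X) r i) \<in> borel_measurable K"
proof -
  have "(\<lambda>X. take_cols n (r - 1) (z X)) \<in> K \<rightarrow>\<^sub>M matrices n (r - 1)"
    by (rule take_cols_measurable, rule z) (use r in auto)
  moreover have "(\<lambda>x. nonlin n v f (r - 1) x i) \<in> borel_measurable (matrices n (r - 1))"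
    by (rule nonlin_measurable) (use r i in auto)
  ultimately have "(\<lambda>X. nonlin n v f (r - 1) (take_cols n (r - 1) (z X)) i) \<in> borel_measurable K"
    by (rule measurable_compose)
  then show ?thesis by (simp add: iter_u_def nonlin_take_cols)
qed

lemma gauss_amp_measurable:
  assumes "k \<le> T" "i \<in> {1..n}" "s \<in> {1..k}"
  shows "(\<lambda>X. gauss_amp n v f k X i s) \<in> borel_measurable (normal_cols n T)"
  using assms
proof (induction k arbitrary: i s)
  case (Suc k)
  have IH: "(\<lambda>X. gauss_amp n v f k X i s) \<in> borel_measurable (normal_cols n T)" if "i \<in> {1..n}" "s \<in> {1..k}" for i s
    by (rule Suc.IH) (use that Suc.prems in auto)
  have U: "(\<lambda>X. iter_u n v f (gauss_amp n v f k X) r i) \<in> borel_measurable (normal_cols n T)" if "r \<in> {1..Suc k}" "i \<in> {1..n}" for r i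
    by (rule iter_u_measurable[where k=k, OF IH]) (use that Suc.prems in auto)
  show ?case
  proof (cases "s = Suc k")
    case True
    have "(\<lambda>X. span_apply n (amp_dir n v f k X) X (iter_u n v f (gauss_amp n v f k X) (Suc k)) (Suc k) i) \<in> borel_measurable (normal_cols n T)"
    proof (rule span_apply_measurable)
      show "(\<lambda>X. amp_dir n v f k X s i) \<in> borel_measurable (normal_cols n T)" if "s \<in> {1..Suc k}" "i \<in> {1..n}" for s i
        by (rule gs_measurable, rule U) (use that in auto)
      show "(\<lambda>X. X s i) \<in> borel_measurable (normal_cols n T)" if "s \<in> {1..Suc k}" "i \<in> {1..n}" for s i
        by (rule normal_cols_entry) (use that Suc.prems in auto)
      show "(\<lambda>X. iter_u n v f (gauss_amp n v f k X) (Suc k) i) \<in> borel_measurable (normal_cols n T)" if "i \<in> {1..n}" for i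
        by (rule U) (use that in auto)
    qed (use Suc.prems in auto)
    moreover have "(\<lambda>X. \<Sum>r=1..k. onsager n v f (Suc k) r * iter_u n v f (gauss_amp n v f k X) r i) \<in> borel_measurable (normal_cols n T)"
      by (intro borel_measurable_sum borel_measurable_times borel_measurable_const U) (use Suc.prems in auto)
    ultimately show ?thesis unfolding True gauss_amp.simps by (simp only: if_True simp_thms) (rule borel_measurable_diff)
  next
    case False
    then show ?thesis using IH[of i s] Suc.prems by simp
  qed
qed simp

lemma amp_dir_measurable:
  assumes "k \<le> T" "s \<in> {1..Suc k}" "s \<le> T" "i \<in> {1..n}"
  shows "(\<lambda>X. amp_dir n v f k X s i) \<in> borel_measurable (normal_cols n T)"
proof (rule gs_measurable)
  show "(\<lambda>X. iter_u n v f (gauss_amp n v f k X) r i) \<in> borel_measurable (normal_cols n T)" if "r \<in> {1..s}" "i \<in> {1..n}" for r i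
    by (rule iter_u_measurable[where k=k], rule gauss_amp_measurable) (use that assms in auto)
qed (use assms in auto)

text \<open>
  By induction on the steps: every step preserves the law of the pair, whatever direction the
  earlier columns have selected.
\<close>

lemma explored_law:
  assumes \<mu>: "goe_law n \<mu>" and "k \<le> T"
  shows "explored n v f k \<in> \<mu> \<Otimes>\<^sub>M normal_cols n T \<rightarrow>\<^sub>M \<mu> \<Otimes>\<^sub>M normal_cols n T \<and>
     distr (\<mu> \<Otimes>\<^sub>M normal_cols n T) (\<mu> \<Otimes>\<^sub>M normal_cols n T) (explored n v f k) = \<mu> \<Otimes>\<^sub>M normal_cols n T"
  using assms(2)
proof (induction k)
  case 0
  have "explored n v f 0 = (\<lambda>p. p)" by auto
  then show ?case by (simp add: distr_id2)
next
  case (Suc k)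
  let ?K = "\<mu> \<Otimes>\<^sub>M normal_cols n T"
  have step: "explore n v f (Suc k) \<in> ?K \<rightarrow>\<^sub>M ?K" "distr ?K ?K (explore n v f (Suc k)) = ?K"
  proof -
    have eq: "explore n v f (Suc k) = (\<lambda>(w, X). (new_mat n (amp_dir n v f k X (Suc k)) w (X (Suc k)), X(Suc k := new_col n (amp_dir n v f k X (Suc k)) w)))"
      by (simp add: explore_def)
    have indep: "amp_dir n v f k (X(Suc k := y)) (Suc k) = amp_dir n v f k X (Suc k)" for X y
    proof -
      have "gauss_amp n v f k (X(Suc k := y)) = gauss_amp n v f k X" by (rule gauss_amp_cong) auto
      then show ?thesis by simp
    qed
    have sk: "Suc k \<in> {1..T}" using Suc.prems by simp
    have em: "(\<lambda>X. amp_dir n v f k X (Suc k) i) \<in> borel_measurable (normal_cols n T)" if "i \<in> {1..n}" for i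
      by (rule amp_dir_measurable) (use that Suc.prems in auto)
    note * = exploration_step_law[OF \<mu> n sk, where e="\<lambda>X. amp_dir n v f k X (Suc k)", OF em gs_unit[OF n] indep]
    show "explore n v f (Suc k) \<in> ?K \<rightarrow>\<^sub>M ?K" unfolding eq by (rule *(1))
    show "distr ?K ?K (explore n v f (Suc k)) = ?K" unfolding eq by (rule *(2))
  qed
  have IH: "explored n v f k \<in> ?K \<rightarrow>\<^sub>M ?K" "distr ?K ?K (explored n v f k) = ?K" using Suc by auto
  have eq: "explored n v f (Suc k) = explore n v f (Suc k) \<circ> explored n v f k" by auto
  have "distr ?K ?K (explore n v f (Suc k) \<circ> explored n v f k) = distr (distr ?K ?K (explored n v f k)) ?K (explore n v f (Suc k))"
    by (rule distr_distr[OF step(1) IH(1), symmetric])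
  also have "\<dots> = ?K" by (simp only: IH(2) step(2))
  finally show ?case unfolding eq by (intro conjI measurable_comp[OF IH(1) step(1)])
qed

end

section \<open>Gaussian estimates along adapted directions\<close>

lemma dot_normal_law:
  assumes "dot n e e = 1"
  shows "distr (normal_vec n) borel (dot n e) = std_normal_distribution"
proof (rule finite_measure_char_eqI)
  have m: "dot n e \<in> borel_measurable (normal_vec n)"
    unfolding dot_def by (intro borel_measurable_sum borel_measurable_times borel_measurable_const normal_vec_entry)
  show "finite_measure (distr (normal_vec n) borel (dot n e))"
    by (intro prob_space.finite_measure prob_space.prob_space_distr prob_space_normal_vec m)
  show "finite_measure std_normal_distribution" by (rule prob_space.finite_measure[OF prob_space_std_normal])
  fix t
  have "(CLINT x|distr (normal_vec n) borel (dot n e). iexp (t * x)) = (CLINT y|normal_vec n. iexp (t * dot n e y))"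
    by (rule integral_distr[OF m]) simp
  also have "\<dots> = (CLINT y|normal_vec n. iexp (\<Sum>i=1..n. (t * e i) * y i))"
    by (simp only: dot_def sum_distrib_left mult.assoc)
  also have "\<dots> = complex_of_real (exp (- (\<Sum>i=1..n. (t * e i)\<^sup>2) / 2))" by (rule normal_vec_char)
  also have "(\<Sum>i=1..n. (t * e i)\<^sup>2) = t\<^sup>2 * dot n e e"
    by (simp add: dot_def sum_distrib_left power2_eq_square mult_ac)
  finally show "(CLINT x|distr (normal_vec n) borel (dot n e). iexp (t * x)) = (CLINT x|std_normal_distribution. iexp (t * x))"
    by (simp only: assms char_std_normal mult_1_right)
qed auto

text \<open>
  Given the other columns the direction is a fixed unit vector, so the inner product with column s
  is standard normal.
\<close>

lemma adapted_dot_tail: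
  assumes s: "s \<in> {1..T}" and a: "a \<ge> 0"
    and em: "\<And>i. i \<in> {1..n} \<Longrightarrow> (\<lambda>X. e X i) \<in> borel_measurable (normal_cols n T)"
    and unit: "\<And>X. dot n (e X) (e X) = 1" and indep: "\<And>X y. e (X(s := y)) = e X"
  shows "measure (normal_cols n T) {X\<in>space (normal_cols n T). \<bar>dot n (e X) (X s)\<bar> > a} \<le> sqrt 2 * exp (- a\<^sup>2 / 4)"
proof -
  let ?A = "{X\<in>space (normal_cols n T). \<bar>dot n (e X) (X s)\<bar> > a}" and ?J = "\<Pi>\<^sub>M i\<in>{1..T} - {s}. normal_vec n"
  interpret G: prob_space "normal_cols n T" by (rule prob_space_normal_cols)
  interpret J: prob_space ?J by (intro prob_space_PiM prob_space_normal_vec)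
  interpret \<gamma>: prob_space "normal_vec n" by (rule prob_space_normal_vec)
  interpret S: prob_space std_normal_distribution by (rule prob_space_std_normal)
  interpret ps: product_sigma_finite "\<lambda>_::nat. normal_vec n"
    by (simp add: product_sigma_finite_def prob_space_imp_sigma_finite prob_space_normal_vec)
  have dm: "(\<lambda>X. dot n (e X) (X s)) \<in> borel_measurable (normal_cols n T)"
    by (intro dot_measurable em normal_cols_entry s)
  then have A: "?A \<in> sets (normal_cols n T)" by measurable
  have "emeasure (normal_cols n T) ?A = (\<integral>\<^sup>+X. indicator ?A X \<partial>normal_cols n T)" using A by simp
  also have "\<dots> = (\<integral>\<^sup>+x. (\<integral>\<^sup>+y. indicator ?A (x(s := y)) \<partial>normal_vec n) \<partial>?J)"
    unfolding normal_cols_insert[OF s, of n]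
    by (rule ps.product_nn_integral_insert) (use A in \<open>simp_all add: normal_cols_insert[OF s, of n]\<close>)
  also have "\<dots> \<le> (\<integral>\<^sup>+x. ennreal (sqrt 2 * exp (- a\<^sup>2 / 4)) \<partial>?J)"
  proof (rule nn_integral_mono)
    fix x assume x: "x \<in> space ?J"
    have m: "dot n (e x) \<in> borel_measurable (normal_vec n)"
      unfolding dot_def by (intro borel_measurable_sum borel_measurable_times borel_measurable_const normal_vec_entry)
    have B: "{y. \<bar>y\<bar> > a} \<in> sets borel" by measurable
    have "(\<integral>\<^sup>+y. indicator ?A (x(s := y)) \<partial>normal_vec n) \<le> (\<integral>\<^sup>+y. indicator {y. \<bar>y\<bar> > a} (dot n (e x) y) \<partial>normal_vec n)"
      by (intro nn_integral_mono) (auto simp: indicator_def indep)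
    also have "\<dots> = (\<integral>\<^sup>+z. indicator {y. \<bar>y\<bar> > a} z \<partial>distr (normal_vec n) borel (dot n (e x)))"
      by (rule nn_integral_distr[OF m, symmetric]) (use B in simp)
    also have "\<dots> = emeasure std_normal_distribution {y. \<bar>y\<bar> > a}"
      unfolding dot_normal_law[OF unit] using B by simp
    also have "\<dots> \<le> ennreal (sqrt 2 * exp (- a\<^sup>2 / 4))"
      using std_normal_tail[OF a] by (simp add: S.emeasure_eq_measure)
    finally show "(\<integral>\<^sup>+y. indicator ?A (x(s := y)) \<partial>normal_vec n) \<le> ennreal (sqrt 2 * exp (- a\<^sup>2 / 4))" .
  qed
  also have "\<dots> = ennreal (sqrt 2 * exp (- a\<^sup>2 / 4))"
    unfolding nn_integral_const J.emeasure_space_1 by simp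
  finally show ?thesis by (simp add: G.emeasure_eq_measure)
qed

lemma normal_cols_entry_tail:
  assumes "s \<in> {1..T}" "i \<in> {1..n}" "a \<ge> 0"
  shows "measure (normal_cols n T) {X\<in>space (normal_cols n T). \<bar>X s i\<bar> > a} \<le> sqrt 2 * exp (- a\<^sup>2 / 4)"
proof -
  define \<delta> :: rvec where "\<delta> = (\<lambda>j. if j = i then 1 else 0)"
  have d: "dot n \<delta> x = x i" for x
  proof -
    have "dot n \<delta> x = (\<Sum>j=1..n. if j = i then x i else 0)" unfolding dot_def \<delta>_def by (intro sum.cong) auto
    then show ?thesis using assms(2) by simp
  qed
  have "dot n \<delta> \<delta> = 1" unfolding d by (simp add: \<delta>_def)
  from adapted_dot_tail[OF assms(1,3), of n "\<lambda>_. \<delta>", OF _ this] show ?thesis by (simp add: d)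
qed

text \<open>
  Each entry is of logarithmic size, by a union bound over the n entries; so is their mean square.
\<close>

lemma outer_le_column_norm:
  assumes s: "s \<in> {1..T}"
  shows "outer_le (\<lambda>n. normal_cols n T) (\<lambda>n X. L2_set (X s) {1..n} / sqrt (real n)) 0"
proof (rule outer_le_gaussian_tail)
  fix n :: nat assume n: "n \<ge> 1"
  have "(\<lambda>X. \<Sum>i=1..n. (X s i)\<^sup>2) \<in> borel_measurable (normal_cols n T)"
    by (intro borel_measurable_sum borel_measurable_power normal_cols_entry s)
  then have "(\<lambda>X. sqrt (\<Sum>i=1..n. (X s i)\<^sup>2) / sqrt (real n)) \<in> borel_measurable (normal_cols n T)"
    by (rule measurable_compose[where g="\<lambda>y. sqrt y / sqrt (real n)"]) simp
  then show "(\<lambda>X. L2_set (X s) {1..n} / sqrt (real n)) \<in> borel_measurable (normal_cols n T)" by (simp add: L2_set_def)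
  fix a :: real assume a: "a \<ge> 0"
  interpret G: prob_space "normal_cols n T" by (rule prob_space_normal_cols)
  let ?A = "\<lambda>i. {X\<in>space (normal_cols n T). \<bar>X s i\<bar> > a}"
  have Am: "?A i \<in> sets (normal_cols n T)" if "i \<in> {1..n}" for i
    using normal_cols_entry[OF s that] by measurable
  have sub: "{X\<in>space (normal_cols n T). \<bar>L2_set (X s) {1..n} / sqrt (real n)\<bar> > a} \<subseteq> (\<Union>i\<in>{1..n}. ?A i)"
  proof (rule subsetI, rule ccontr)
    fix X assume X: "X \<in> {X\<in>space (normal_cols n T). \<bar>L2_set (X s) {1..n} / sqrt (real n)\<bar> > a}" and nX: "X \<notin> (\<Union>i\<in>{1..n}. ?A i)"
    have "(X s i)\<^sup>2 \<le> a\<^sup>2" if "i \<in> {1..n}" for i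
    proof -
      have "\<bar>X s i\<bar> \<le> a" using X nX that by force
      then show ?thesis using a by (simp add: abs_le_square_iff[symmetric])
    qed
    then have "(\<Sum>i=1..n. (X s i)\<^sup>2) \<le> (\<Sum>i=1..n. a\<^sup>2)" by (intro sum_mono)
    then have "L2_set (X s) {1..n} \<le> sqrt (real n * a\<^sup>2)" unfolding L2_set_def by (intro real_sqrt_le_mono) simp
    also have "\<dots> = sqrt (real n) * a" using a by (simp add: real_sqrt_mult)
    finally have "\<bar>L2_set (X s) {1..n} / sqrt (real n)\<bar> \<le> a" using n by (simp add: field_simps)
    then show False using X by simp
  qed
  have "measure (normal_cols n T) {X\<in>space (normal_cols n T). \<bar>L2_set (X s) {1..n} / sqrt (real n)\<bar> > a} \<le> measure (normal_cols n T) (\<Union>i\<in>{1..n}. ?A i)"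
    using Am by (intro G.finite_measure_mono sub) auto
  also have "\<dots> \<le> (\<Sum>i\<in>{1..n}. measure (normal_cols n T) (?A i))"
    by (intro measure_UNION_le Am) auto
  also have "\<dots> \<le> (\<Sum>i\<in>{1..n}. sqrt 2 * exp (- a\<^sup>2 / 4))"
    by (intro sum_mono normal_cols_entry_tail s a)
  finally show "measure (normal_cols n T) {X\<in>space (normal_cols n T). \<bar>L2_set (X s) {1..n} / sqrt (real n)\<bar> > a} \<le> real n * (sqrt 2 * exp (- a\<^sup>2 / 4))"
    by simp
qed

lemma outer_le_of_distr:
  assumes "outer_le (\<lambda>n. distr (M n) (N n) (\<phi> n)) X a" "\<And>n. n \<ge> 1 \<Longrightarrow> \<phi> n \<in> measurable (M n) (N n)"
  shows "outer_le M (\<lambda>n \<omega>. X n (\<phi> n \<omega>)) a"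
proof (rule outer_le_pullback[OF assms(1)])
  fix n :: nat assume n: "n \<ge> 1"
  show "\<phi> n \<in> M n \<rightarrow>\<^sub>M distr (M n) (N n) (\<phi> n)" using assms(2)[OF n] by simp
  show "distr (M n) (distr (M n) (N n) (\<phi> n)) (\<phi> n) = distr (M n) (N n) (\<phi> n)"
    by (intro distr_cong) auto
qed

lemma outer_le_bounded_mult:
  assumes "\<And>n. n \<ge> 1 \<Longrightarrow> \<bar>k n\<bar> \<le> K" "outer_le M X a"
  shows "outer_le M (\<lambda>n \<omega>. k n * X n \<omega>) a"
  by (rule outer_le_mult_rate[OF outer_le_const[OF assms(1)] assms(2)]) auto

lemma outer_le_sqrt:
  assumes "outer_le M X 0"
  shows "outer_le M (\<lambda>n \<omega>. sqrt \<bar>X n \<omega>\<bar>) 0"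
proof (rule outer_le_mono)
  show "outer_le M (\<lambda>n \<omega>. 1 + \<bar>X n \<omega>\<bar>) 0"
    by (intro outer_le_add outer_le_abs assms outer_le_const[where K=1]) simp
  fix n \<omega>
  have "sqrt \<bar>X n \<omega>\<bar> \<le> sqrt ((1 + \<bar>X n \<omega>\<bar>)\<^sup>2)"
    by (intro real_sqrt_le_mono) (simp add: power2_eq_square algebra_simps)
  then show "\<bar>sqrt \<bar>X n \<omega>\<bar>\<bar> \<le> \<bar>1 + \<bar>X n \<omega>\<bar>\<bar>" by simp
qed

lemma dot_L2_set: "\<bar>dot n a b\<bar> \<le> L2_set a {1..n} * L2_set b {1..n}"
proof -
  have "\<bar>dot n a b\<bar> \<le> (\<Sum>i=1..n. \<bar>a i\<bar> * \<bar>b i\<bar>)"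
    unfolding dot_def by (rule order_trans[OF sum_abs]) (simp add: abs_mult)
  also have "\<dots> \<le> L2_set a {1..n} * L2_set b {1..n}" by (rule L2_set_mult_ineq)
  finally show ?thesis .
qed

lemma L2_set_dot: "L2_set a {1..n} = sqrt (dot n a a)"
  by (simp add: L2_set_def dot_def power2_eq_square)

lemma L2_set_scale: "L2_set (\<lambda>i. k * a i) A = \<bar>k\<bar> * L2_set a A"
  by (simp add: L2_set_def power_mult_distrib sum_distrib_left[symmetric] real_sqrt_mult)

lemma L2_set_lincomb: "L2_set (\<lambda>i. \<Sum>k\<in>K. c k * a k i) A \<le> (\<Sum>k\<in>K. \<bar>c k\<bar> * L2_set (a k) A)"
proof (induction K rule: infinite_finite_induct)
  case (insert x F)
  have "L2_set (\<lambda>i. \<Sum>k\<in>insert x F. c k * a k i) A = L2_set (\<lambda>i. c x * a x i + (\<Sum>k\<in>F. c k * a k i)) A"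
    using insert by simp
  also have "\<dots> \<le> L2_set (\<lambda>i. c x * a x i) A + L2_set (\<lambda>i. \<Sum>k\<in>F. c k * a k i) A"
    by (rule L2_set_triangle_ineq)
  finally show ?case using insert by (simp add: L2_set_scale)
qed (simp_all add: L2_set_def)

section \<open>The iterates driven by Gaussian vectors follow state evolution\<close>

locale amp_sequence =
  fixes T :: nat and v :: "nat \<Rightarrow> rvec" and f :: "nat \<Rightarrow> nat \<Rightarrow> rmat \<Rightarrow> rvec" and c C :: real
    and L N :: "nat \<Rightarrow> nat \<Rightarrow> nat \<Rightarrow> real"
  assumes inst: "\<And>n. n \<ge> 1 \<Longrightarrow> amp_instance n T (v n) (f n) c C (L n) (N n)"
    and stable: "amp_stable T v f"
begin

abbreviation "\<Gamma> \<equiv> \<lambda>n. normal_cols n T"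

text \<open>
  The hats mark the algorithm driven by the columns of X: its iterates, its vectors u and
  their Gram-Schmidt directions. Z is the Gaussian matrix with which the iterates are compared.
\<close>

definition zh :: "nat \<Rightarrow> rmat \<Rightarrow> rmat" where "zh n X = gauss_amp n (v n) (f n) T X"
definition Uh :: "nat \<Rightarrow> rmat \<Rightarrow> nat \<Rightarrow> rvec" where "Uh n X = iter_u n (v n) (f n) (zh n X)"
definition eh :: "nat \<Rightarrow> rmat \<Rightarrow> nat \<Rightarrow> rvec" where "eh n X = gs n (Uh n X)"
definition Z :: "nat \<Rightarrow> rmat \<Rightarrow> rmat" where "Z n X = mix n T T (L n) X"
definition S :: "nat \<Rightarrow> nat \<Rightarrow> nat \<Rightarrow> real" where "S n = entries (se_cov n (v n) (f n) T)"
definition b :: "nat \<Rightarrow> nat \<Rightarrow> nat \<Rightarrow> real" where "b n t r = onsager n (v n) (f n) t r"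

text \<open>The rescaled Gram-Schmidt coefficients and squared residuals.\<close>

definition R :: "nat \<Rightarrow> rmat \<Rightarrow> nat \<Rightarrow> nat \<Rightarrow> real" where "R n X r s = dot n (Uh n X r) (eh n X s) / sqrt (real n)"
definition \<rho> :: "nat \<Rightarrow> rmat \<Rightarrow> nat \<Rightarrow> real" where "\<rho> n X s = dot n (resid n (Uh n X) s) (resid n (Uh n X) s) / real n"
definition err :: "nat \<Rightarrow> nat \<Rightarrow> rmat \<Rightarrow> real" where "err t n X = L2_set (\<lambda>i. zh n X i t - Z n X i t) {1..n}"

lemma T1: "T \<ge> 1" using inst[of 1] by (simp add: amp_instance_def)
lemma c0: "c > 0" using inst[of 1] by (simp add: amp_instance_def)

text \<open>
  Direction p is a function of the columns before p, none of which is column q.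
\<close>

lemma outer_le_dir_dot:
  assumes "1 \<le> p" "p \<le> q" "q \<le> T"
  shows "outer_le \<Gamma> (\<lambda>n X. dot n (eh n X p) (X q)) 0"
proof (rule outer_le_gaussian_tail)
  fix n :: nat assume n: "n \<ge> 1"
  interpret amp_instance n T "v n" "f n" c C "L n" "N n" by (rule inst[OF n])
  have q: "q \<in> {1..T}" using assms by auto
  have em: "(\<lambda>X. eh n X p i) \<in> borel_measurable (normal_cols n T)" if "i \<in> {1..n}" for i
    unfolding eh_def Uh_def zh_def by (rule amp_dir_measurable) (use that assms in auto)
  show "(\<lambda>X. dot n (eh n X p) (X q)) \<in> borel_measurable (normal_cols n T)"
    by (intro dot_measurable em normal_cols_entry q)
  have early: "eh n X p = amp_dir n (v n) (f n) (p - 1) X p" for X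
    unfolding eh_def Uh_def zh_def by (rule amp_dir_stable) (use assms in auto)
  have indep: "eh n (X(q := y)) p = eh n X p" for X y
  proof -
    have "gauss_amp n (v n) (f n) (p - 1) (X(q := y)) = gauss_amp n (v n) (f n) (p - 1) X"
      by (rule gauss_amp_cong) (use assms in auto)
    then show ?thesis unfolding early by simp
  qed
  have unit: "dot n (eh n X p) (eh n X p) = 1" for X unfolding eh_def by (rule gs_unit[OF n])
  fix a :: real assume a: "a \<ge> 0"
  have "measure (normal_cols n T) {X \<in> space (normal_cols n T). a < \<bar>dot n (eh n X p) (X q)\<bar>} \<le> 1 * (sqrt 2 * exp (- a\<^sup>2 / 4))"
    unfolding mult_1 by (rule adapted_dot_tail[OF q a em unit indep])
  also have "1 * (sqrt 2 * exp (- a\<^sup>2 / 4)) \<le> real n * (sqrt 2 * exp (- a\<^sup>2 / 4))"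
    by (rule mult_right_mono) (use n in auto)
  finally show "measure (normal_cols n T) {X \<in> space (normal_cols n T). a < \<bar>dot n (eh n X p) (X q)\<bar>} \<le> real n * (sqrt 2 * exp (- a\<^sup>2 / 4))" .
qed

lemma L_bounded:
  assumes "n \<ge> 1" "r \<in> {1..T}" "s \<in> {1..r}"
  shows "\<bar>L n r s\<bar> \<le> sqrt C"
proof -
  interpret amp_instance n T "v n" "f n" c C "L n" "N n" by (rule inst[OF assms(1)])
  show ?thesis by (rule L_bound[OF assms(2,3)])
qed

lemma b_bounded:
  assumes "n \<ge> 1" "t \<in> {1..T}" "r \<in> {1..<t}"
  shows "\<bar>b n t r\<bar> \<le> C"
proof -
  interpret amp_instance n T "v n" "f n" c C "L n" "N n" by (rule inst[OF assms(1)])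
  show ?thesis using ons[OF assms(2,3)] by (simp add: b_def)
qed

text \<open>
  The stability assumption, applied to the Gaussian matrix Z with the errors of the first t - 1
  iterates. The expectations in it are entries of the covariance and, by integration by parts,
  combinations of the Onsager coefficients.
\<close>

lemma stability_consequences:
  assumes t: "t \<in> {1..T}" and H: "\<And>s. s \<in> {1..<t} \<Longrightarrow> outer_le \<Gamma> (err s) 0"
  shows "\<And>r s. r \<in> {1..t} \<Longrightarrow> s \<in> {1..t} \<Longrightarrow> outer_le \<Gamma> (\<lambda>n X. dot n (Uh n X r) (Uh n X s) / real n - S n r s) (1/2)"
    and "\<And>s. s \<in> {1..<t} \<Longrightarrow> outer_le \<Gamma> (\<lambda>n X. dot n (\<lambda>i. zh n X i s) (Uh n X t) / real n - (\<Sum>r\<in>{1..<t}. S n s r * b n t r)) (1/2)"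
proof -
  \<comment> \<open>the errors of the later iterates, on which nothing is known yet, are set to 0\<close>
  define E where "E n X = (\<lambda>i\<in>{1..n}. \<lambda>s\<in>{1..T}. if s < t then zh n X i s - Z n X i s else 0)" for n :: nat and X
  let ?P = "\<lambda>n. matrices n T \<Otimes>\<^sub>M matrices n T"
  define \<phi> where "\<phi> n X = (Z n X, E n X)" for n X
  \<comment> \<open>the assumption speaks of spaces of pairs of matrices, so the joint law is pushed forward\<close>
  define M where "M n = distr (\<Gamma> n) (?P n) (\<phi> n)" for n
  have zm: "(\<lambda>X. zh n X i s) \<in> borel_measurable (\<Gamma> n)" if "n \<ge> 1" "i \<in> {1..n}" "s \<in> {1..T}" for n i s
    unfolding zh_def by (rule amp_instance.gauss_amp_measurable[OF inst[OF that(1)] order_refl that(2,3)])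
  have Zm: "Z n \<in> \<Gamma> n \<rightarrow>\<^sub>M matrices n T" for n unfolding Z_def by (rule mix_measurable)
  have Zem: "(\<lambda>X. Z n X i s) \<in> borel_measurable (\<Gamma> n)" if "i \<in> {1..n}" "s \<in> {1..T}" for n i s
    by (rule measurable_compose[OF Zm matrices_entry[OF that]])
  have Em: "E n \<in> \<Gamma> n \<rightarrow>\<^sub>M matrices n T" if "n \<ge> 1" for n
    unfolding E_def
  proof (rule measurable_matricesI)
    fix i s assume "i \<in> {1..n}" "s \<in> {1..T}"
    then show "(\<lambda>X. if s < t then zh n X i s - Z n X i s else 0) \<in> borel_measurable (\<Gamma> n)"
      using zm[OF that] Zem by (cases "s < t") auto
  qed
  have \<phi>m: "\<phi> n \<in> \<Gamma> n \<rightarrow>\<^sub>M ?P n" if "n \<ge> 1" for n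
    unfolding \<phi>_def by (intro measurable_Pair Zm Em that)
  have sM: "sets (M n) = sets (?P n)" for n unfolding M_def by simp
  have pM: "prob_space (M n)" if "n \<ge> 1" for n
    unfolding M_def by (rule prob_space.prob_space_distr[OF prob_space_normal_cols \<phi>m[OF that]])
  have fstm: "fst \<in> M n \<rightarrow>\<^sub>M matrices n T" and sndm: "snd \<in> M n \<rightarrow>\<^sub>M matrices n T" for n
    unfolding M_def by simp_all
  have lawZ: "distr (M n) (matrices n T) fst = gauss_rows n (se_cov n (v n) (f n) T)" if n: "n \<ge> 1" for n
  proof -
    interpret amp_instance n T "v n" "f n" c C "L n" "N n" by (rule inst[OF n])
    have "distr (M n) (matrices n T) fst = distr (\<Gamma> n) (matrices n T) (fst \<circ> \<phi> n)"
      unfolding M_def by (rule distr_distr[OF measurable_fst \<phi>m[OF n]])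
    also have "fst \<circ> \<phi> n = mix n T T (L n)" by (auto simp: \<phi>_def Z_def)
    also have "distr (\<Gamma> n) (matrices n T) (mix n T T (L n)) = gauss_rows n (se_cov n (v n) (f n) T)"
      by (rule gauss_rows_mix[OF se_cov_carrier se_cov_carrier order_refl ch]) simp
    finally show ?thesis .
  qed
  have gl: "has_gauss_law (M n) n T fst (se_cov n (v n) (f n) T)" if n: "n \<ge> 1" for n
    unfolding has_gauss_law_def using lawZ[OF n] fstm by blast
  have frobE: "frob_norm n T (E n X) = sqrt (\<Sum>s\<in>{1..<t}. (err s n X)\<^sup>2)" for n X
  proof -
    have "(\<Sum>i=1..n. \<Sum>s=1..T. (E n X i s)\<^sup>2) = (\<Sum>s=1..T. \<Sum>i=1..n. (E n X i s)\<^sup>2)" by (rule sum.swap)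
    also have "\<dots> = (\<Sum>s=1..T. if s < t then (err s n X)\<^sup>2 else 0)"
      by (rule sum.cong[OF refl]) (auto simp: E_def err_def L2_set_def sum_nonneg)
    also have "\<dots> = (\<Sum>s\<in>{1..<t}. (err s n X)\<^sup>2)"
      using t by (intro sum.mono_neutral_cong_right) auto
    finally show ?thesis by (simp add: frob_norm_def)
  qed
  have "outer_le \<Gamma> (\<lambda>n X. \<Sum>s\<in>{1..<t}. (err s n X) * (err s n X)) 0"
    by (intro outer_le_sum outer_le_mult_rate[OF H H]) auto
  then have "outer_le \<Gamma> (\<lambda>n X. sqrt \<bar>\<Sum>s\<in>{1..<t}. (err s n X) * (err s n X)\<bar>) 0" by (rule outer_le_sqrt)
  then have oE: "outer_le \<Gamma> (\<lambda>n X. frob_norm n T (snd (\<phi> n X))) 0"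
    by (rule outer_le_cong) (simp add: \<phi>_def frobE power2_eq_square sum_nonneg)
  have frobm: "(\<lambda>p. frob_norm n T (snd p)) \<in> borel_measurable (?P n)" for n
  proof -
    have "(\<lambda>p. \<Sum>i=1..n. \<Sum>s=1..T. (snd p i s)\<^sup>2) \<in> borel_measurable (?P n)"
      by (intro borel_measurable_sum borel_measurable_power measurable_compose[OF measurable_snd matrices_entry])
    then show ?thesis unfolding frob_norm_def by (rule measurable_compose[where g=sqrt]) simp
  qed
  have "outer_le M (\<lambda>n p. frob_norm n T (snd p)) 0"
    unfolding M_def by (rule outer_le_distr[OF oE \<phi>m prob_space_normal_cols frobm])
  then have sE: "stoch_le M (\<lambda>n p. frob_norm n T (snd p)) 0" by (rule stoch_le_of_outer_le[OF _ pM])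
  have hyp: "\<forall>n\<ge>1. prob_space (M n) \<and> has_gauss_law (M n) n T (fst :: rmat \<times> rmat \<Rightarrow> rmat) (se_cov n (v n) (f n) T) \<and> (snd :: rmat \<times> rmat \<Rightarrow> rmat) \<in> measurable (M n) (matrices n T)"
    using pM gl sndm by blast
  let ?s = "\<lambda>p. mat_add (fst p) (snd p)"
  have concl: "\<forall>s<T. \<forall>t<T. stoch_le M (\<lambda>n \<omega>.
           1 / real n * \<bar>dot n (nonlin n (v n) (f n) t (?s \<omega>)) (nonlin n (v n) (f n) s (?s \<omega>))
              - (LINT \<xi>|M n. dot n (nonlin n (v n) (f n) t (fst \<xi>)) (nonlin n (v n) (f n) s (fst \<xi>)))\<bar>) (1 / 2)"
    "\<forall>t\<in>{1..T}. \<forall>s<T. stoch_le M (\<lambda>n \<omega>.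
           1 / real n * \<bar>dot n (\<lambda>i. ?s \<omega> i t) (nonlin n (v n) (f n) s (?s \<omega>))
              - (LINT \<xi>|M n. dot n (\<lambda>i. fst \<xi> i t) (nonlin n (v n) (f n) s (fst \<xi>)))\<bar>) (1 / 2)"
    using stable[unfolded amp_stable_def, rule_format, of M "\<lambda>_. fst" "\<lambda>_. snd"] hyp sE by blast+
  have sm: "(\<lambda>p. ?s p i s) \<in> borel_measurable (?P n)" if "i \<in> {1..n}" "s \<in> {1..T}" for n i s
    unfolding mat_add_def
    by (intro borel_measurable_add measurable_compose[OF measurable_fst matrices_entry[OF that]] measurable_compose[OF measurable_snd matrices_entry[OF that]])
  have nlm: "(\<lambda>p. nonlin n (v n) (f n) r (?s p) i) \<in> borel_measurable (?P n)" if n: "n \<ge> 1" and "i \<in> {1..n}" "r < T" for n i r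
  proof -
    interpret amp_instance n T "v n" "f n" c C "L n" "N n" by (rule inst[OF n])
    have 1: "(\<lambda>p. take_cols n T (?s p)) \<in> ?P n \<rightarrow>\<^sub>M matrices n T" by (intro take_cols_measurable sm)
    have 2: "(\<lambda>x. nonlin n (v n) (f n) r x i) \<in> borel_measurable (matrices n T)"
      by (rule nonlin_measurable) (use that in auto)
    show ?thesis using measurable_compose[OF 1 2] unfolding nonlin_take_cols[OF less_imp_le[OF \<open>r < T\<close>]] .
  qed
  have s\<phi>: "?s (\<phi> n X) i s = zh n X i s" if "i \<in> {1..n}" "s \<in> {1..<t}" for n X i s
    using that t by (simp add: mat_add_def \<phi>_def E_def)
  have nl\<phi>: "nonlin n (v n) (f n) r (?s (\<phi> n X)) = Uh n X (Suc r)" if "r < t" for n X r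
    unfolding Uh_def iter_u_def diff_Suc_1 by (rule nonlin_cong, rule s\<phi>) (use that in auto)
  have rel: "1 / real n * \<bar>a - real n * d\<bar> = \<bar>a / real n - d\<bar>" if "n \<ge> 1" for n a d
  proof -
    have "a / real n - d = (a - real n * d) / real n" using that by (simp add: field_simps)
    then show ?thesis by (simp add: abs_divide)
  qed
  {
    fix r s assume rs: "r \<in> {1..t}" "s \<in> {1..t}"
    then have rs': "r - 1 < T" "s - 1 < T" "r - 1 < t" "s - 1 < t" "Suc (r - 1) = r" "Suc (s - 1) = s" using t by auto
    let ?F = "\<lambda>n \<omega>. 1 / real n * \<bar>dot n (nonlin n (v n) (f n) (r - 1) (?s \<omega>)) (nonlin n (v n) (f n) (s - 1) (?s \<omega>))
              - (LINT \<xi>|M n. dot n (nonlin n (v n) (f n) (r - 1) (fst \<xi>)) (nonlin n (v n) (f n) (s - 1) (fst \<xi>)))\<bar>"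
    have "outer_le M ?F (1/2)"
    proof (rule outer_le_of_stoch_le)
      show "stoch_le M ?F (1/2)" using concl(1) rs' by blast
      fix n :: nat assume n: "n \<ge> 1"
      have "?F n \<in> borel_measurable (?P n)"
        by (intro borel_measurable_times borel_measurable_const borel_measurable_abs borel_measurable_diff dot_measurable nlm n rs')
      then show "?F n \<in> borel_measurable (M n)" by (simp only: measurable_cong_sets[OF sM refl])
    qed
    then have o: "outer_le \<Gamma> (\<lambda>n X. ?F n (\<phi> n X)) (1/2)"
      unfolding M_def by (rule outer_le_of_distr) (rule \<phi>m)
    show "outer_le \<Gamma> (\<lambda>n X. dot n (Uh n X r) (Uh n X s) / real n - S n r s) (1/2)"
    proof (rule outer_le_mono[OF o])
      fix n X assume n: "n \<ge> (1::nat)"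
      interpret amp_instance n T "v n" "f n" c C "L n" "N n" by (rule inst[OF n])
      have "(LINT \<xi>|M n. dot n (nonlin n (v n) (f n) (r - 1) (fst \<xi>)) (nonlin n (v n) (f n) (s - 1) (fst \<xi>)))
        = (LINT x|gauss_rows n (se_cov n (v n) (f n) T). dot n (nonlin n (v n) (f n) (r - 1) x) (nonlin n (v n) (f n) (s - 1) x))"
        unfolding lawZ[OF n, symmetric]
        by (rule integral_distr[OF fstm dot_nonlin_measurable, symmetric]) (use rs' in auto)
      also have "\<dots> = real n * S n r s"
        unfolding gram_expectation[OF rs'(1,2)] S_def rs'(5,6) ..
      finally have e: "(LINT \<xi>|M n. dot n (nonlin n (v n) (f n) (r - 1) (fst \<xi>)) (nonlin n (v n) (f n) (s - 1) (fst \<xi>))) = real n * S n r s" .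
      show "\<bar>dot n (Uh n X r) (Uh n X s) / real n - S n r s\<bar> \<le> \<bar>?F n (\<phi> n X)\<bar>"
        unfolding e rel[OF n] nl\<phi>[OF rs'(3)] nl\<phi>[OF rs'(4)] rs'(5,6) by simp
    qed
  }
  {
    fix s assume s: "s \<in> {1..<t}"
    then have s': "t - 1 < T" "t - 1 < t" "Suc (t - 1) = t" "t - 1 \<in> {1..<T}" "s \<in> {1..t - 1}" "s \<in> {1..T}" using t by auto
    let ?F = "\<lambda>n \<omega>. 1 / real n * \<bar>dot n (\<lambda>i. ?s \<omega> i s) (nonlin n (v n) (f n) (t - 1) (?s \<omega>))
              - (LINT \<xi>|M n. dot n (\<lambda>i. fst \<xi> i s) (nonlin n (v n) (f n) (t - 1) (fst \<xi>)))\<bar>"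
    have "outer_le M ?F (1/2)"
    proof (rule outer_le_of_stoch_le)
      show "stoch_le M ?F (1/2)" using concl(2) s' by blast
      fix n :: nat assume n: "n \<ge> 1"
      have "?F n \<in> borel_measurable (?P n)"
        by (intro borel_measurable_times borel_measurable_const borel_measurable_abs borel_measurable_diff dot_measurable nlm n s' sm)
      then show "?F n \<in> borel_measurable (M n)" by (simp only: measurable_cong_sets[OF sM refl])
    qed
    then have o: "outer_le \<Gamma> (\<lambda>n X. ?F n (\<phi> n X)) (1/2)"
      unfolding M_def by (rule outer_le_of_distr) (rule \<phi>m)
    show "outer_le \<Gamma> (\<lambda>n X. dot n (\<lambda>i. zh n X i s) (Uh n X t) / real n - (\<Sum>r\<in>{1..<t}. S n s r * b n t r)) (1/2)"
    proof (rule outer_le_mono[OF o])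
      fix n X assume n: "n \<ge> (1::nat)"
      interpret amp_instance n T "v n" "f n" c C "L n" "N n" by (rule inst[OF n])
      have "(LINT \<xi>|M n. dot n (\<lambda>i. fst \<xi> i s) (nonlin n (v n) (f n) (t - 1) (fst \<xi>)))
        = (LINT x|gauss_rows n (se_cov n (v n) (f n) T). dot n (\<lambda>i. x i s) (nonlin n (v n) (f n) (t - 1) x))"
        unfolding lawZ[OF n, symmetric]
        by (rule integral_distr[OF fstm, symmetric]) (intro dot_measurable matrices_entry nonlin_measurable; use s' in auto)
      also have "\<dots> = real n * (\<Sum>r=1..t - 1. S n s r * b n t r)"
        unfolding cross_expectation[OF s'(4,5)] S_def b_def s'(3) ..
      also have "{1..t - 1} = {1..<t}" using s' by auto
      finally have e: "(LINT \<xi>|M n. dot n (\<lambda>i. fst \<xi> i s) (nonlin n (v n) (f n) (t - 1) (fst \<xi>))) = real n * (\<Sum>r\<in>{1..<t}. S n s r * b n t r)" .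
      have d: "dot n (\<lambda>i. ?s (\<phi> n X) i s) (Uh n X t) = dot n (\<lambda>i. zh n X i s) (Uh n X t)"
        by (rule dot_cong) (simp_all add: s\<phi>[OF _ s])
      show "\<bar>dot n (\<lambda>i. zh n X i s) (Uh n X t) / real n - (\<Sum>r\<in>{1..<t}. S n s r * b n t r)\<bar> \<le> \<bar>?F n (\<phi> n X)\<bar>"
        unfolding e rel[OF n] nl\<phi>[OF s'(2)] s'(3) d by simp
    qed
  }
qed

end

lemma outer_le_prod_close:
  assumes "outer_le M (\<lambda>n \<omega>. A n \<omega> - a n) h" "outer_le M (\<lambda>n \<omega>. B n \<omega> - b n) h" "h \<ge> 0"
    and "\<And>n. n \<ge> 1 \<Longrightarrow> \<bar>a n\<bar> \<le> K" "\<And>n. n \<ge> 1 \<Longrightarrow> \<bar>b n\<bar> \<le> K"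
  shows "outer_le M (\<lambda>n \<omega>. A n \<omega> * B n \<omega> - a n * b n) h"
proof (rule outer_le_cong)
  have "outer_le M (\<lambda>n \<omega>. (A n \<omega> - a n) * (B n \<omega> - b n)) h"
    by (rule outer_le_weaken[OF outer_le_mult[OF assms(1,2)]]) (use assms(3) in simp)
  then show "outer_le M (\<lambda>n \<omega>. (A n \<omega> - a n) * (B n \<omega> - b n) + (b n * (A n \<omega> - a n) + a n * (B n \<omega> - b n))) h"
    by (intro outer_le_add outer_le_bounded_mult[OF assms(4)] outer_le_bounded_mult[OF assms(5)] assms)
qed (simp add: algebra_simps)

context amp_sequence
begin

lemma S_factor:
  assumes "n \<ge> 1" "r \<in> {1..T}" "s \<in> {1..r}"
  shows "S n r s = (\<Sum>k=1..s. L n r k * L n s k)" "S n s r = (\<Sum>k=1..s. L n r k * L n s k)"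
proof -
  interpret amp_instance n T "v n" "f n" c C "L n" "N n" by (rule inst[OF assms(1)])
  show "S n r s = (\<Sum>k=1..s. L n r k * L n s k)" "S n s r = (\<Sum>k=1..s. L n r k * L n s k)"
    unfolding S_def using L_factor[OF assms(2,3)] by simp_all
qed

lemma S_diag_bound: "n \<ge> 1 \<Longrightarrow> s \<in> {1..T} \<Longrightarrow> \<bar>S n s s\<bar> \<le> C"
proof -
  assume n: "n \<ge> 1" and s: "s \<in> {1..T}"
  interpret amp_instance n T "v n" "f n" c C "L n" "N n" by (rule inst[OF n])
  have "S n s s = (\<Sum>k=1..s. L n s k * L n s k)" using S_factor(1)[OF n s, of s] s by simp
  then have "S n s s \<ge> 0" by (simp add: sum_nonneg)
  then show "\<bar>S n s s\<bar> \<le> C" using diag_bound[OF s] by (simp add: S_def)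
qed

lemma L_diag_ge: "n \<ge> 1 \<Longrightarrow> s \<in> {1..T} \<Longrightarrow> L n s s \<ge> sqrt c"
  using amp_instance.L_diag[OF inst] by blast

lemma L_upper: "n \<ge> 1 \<Longrightarrow> r < s \<Longrightarrow> L n r s = 0"
  using amp_instance.ch[OF inst] cholesky_tri(1) by blast

lemma R_coeff:
  "R n X r s * sqrt (\<rho> n X s) = dot n (Uh n X r) (Uh n X s) / real n - (\<Sum>q\<in>{1..<s}. R n X s q * R n X r q)"
proof -
  have "R n X r s * sqrt (\<rho> n X s) = (dot n (Uh n X r) (eh n X s) * sqrt (dot n (resid n (Uh n X) s) (resid n (Uh n X) s))) / real n"
    by (simp add: R_def \<rho>_def real_sqrt_divide)
  also have "\<dots> = dot n (Uh n X r) (Uh n X s) / real n - (\<Sum>q\<in>{1..<s}. dot n (Uh n X s) (eh n X q) * dot n (Uh n X r) (eh n X q)) / real n"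
    unfolding eh_def gs_coeff by (simp add: diff_divide_distrib)
  also have "(\<Sum>q\<in>{1..<s}. dot n (Uh n X s) (eh n X q) * dot n (Uh n X r) (eh n X q)) / real n = (\<Sum>q\<in>{1..<s}. R n X s q * R n X r q)"
    by (simp add: R_def sum_divide_distrib)
  finally show ?thesis .
qed

lemma \<rho>_eq:
  assumes "n \<ge> 1" "\<And>q. q \<in> {1..<s} \<Longrightarrow> \<rho> n X q \<noteq> 0"
  shows "\<rho> n X s = dot n (Uh n X s) (Uh n X s) / real n - (\<Sum>q\<in>{1..<s}. R n X s q * R n X s q)"
proof -
  have "\<rho> n X s = dot n (Uh n X s) (Uh n X s) / real n - (\<Sum>q\<in>{1..<s}. (dot n (Uh n X s) (eh n X q))\<^sup>2) / real n"
    unfolding \<rho>_def eh_def by (subst resid_norm) (use assms in \<open>auto simp: \<rho>_def diff_divide_distrib\<close>)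
  also have "(\<Sum>q\<in>{1..<s}. (dot n (Uh n X s) (eh n X q))\<^sup>2) / real n = (\<Sum>q\<in>{1..<s}. R n X s q * R n X s q)"
    by (simp add: R_def sum_divide_distrib power2_eq_square)
  finally show ?thesis .
qed

lemma \<rho>_nonneg: "\<rho> n X s \<ge> 0"
  unfolding \<rho>_def by (intro divide_nonneg_nonneg dot_self_nonneg) simp

text \<open>
  Gram-Schmidt solves the same triangular system as the Cholesky factorization, with the Gram
  matrix in place of the covariance; the diagonal entries of L are bounded below, so the
  solutions are close, and with high probability no residual vanishes.
\<close>

lemma gram_schmidt_close:
  assumes t: "t \<in> {1..T}"
    and gram: "\<And>r s. r \<in> {1..t} \<Longrightarrow> s \<in> {1..t} \<Longrightarrow> outer_le \<Gamma> (\<lambda>n X. dot n (Uh n X r) (Uh n X s) / real n - S n r s) (1/2)"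
    and s: "s \<in> {1..t}"
  shows "(\<forall>r\<in>{s..t}. outer_le \<Gamma> (\<lambda>n X. R n X r s - L n r s) (1/2)) \<and> whp \<Gamma> (\<lambda>n X. \<rho> n X s \<noteq> 0)"
  using s
proof (induction s rule: less_induct)
  case (less s)
  have sT: "s \<in> {1..T}" using less.prems t by auto
  have Rq: "outer_le \<Gamma> (\<lambda>n X. R n X r q - L n r q) (1/2)" if "q \<in> {1..<s}" "r \<in> {s..t}" for q r
    using less.IH[of q] that less.prems by auto
  have pq: "whp \<Gamma> (\<lambda>n X. \<forall>q\<in>{1..<s}. \<rho> n X q \<noteq> 0)"
    by (rule whp_ball) (use less.IH less.prems in auto)
  have num: "outer_le \<Gamma> (\<lambda>n X. (dot n (Uh n X r) (Uh n X s) / real n - (\<Sum>q\<in>{1..<s}. R n X s q * R n X r q)) - L n r s * L n s s) (1/2)"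
    if r: "r \<in> {s..t}" for r
  proof (rule outer_le_cong)
    have prod: "outer_le \<Gamma> (\<lambda>n X. R n X s q * R n X r q - L n s q * L n r q) (1/2)" if q: "q \<in> {1..<s}" for q
      by (rule outer_le_prod_close[where K="sqrt C", OF Rq[OF q] Rq[OF q r]])
         (use q r less.prems t in \<open>auto intro: L_bounded\<close>)
    show "outer_le \<Gamma> (\<lambda>n X. (dot n (Uh n X r) (Uh n X s) / real n - S n r s) - (\<Sum>q\<in>{1..<s}. R n X s q * R n X r q - L n s q * L n r q)) (1/2)"
      by (rule outer_le_diff[OF gram outer_le_sum[OF prod]]) (use r less.prems in auto)
    fix n X assume n: "n \<ge> (1::nat)"
    have "S n r s = (\<Sum>k=1..s. L n r k * L n s k)" by (rule S_factor(1)[OF n]) (use r less.prems t in auto)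
    also have "{1..s} = insert s {1..<s}" using less.prems by auto
    also have "(\<Sum>k\<in>insert s {1..<s}. L n r k * L n s k) = L n r s * L n s s + (\<Sum>q\<in>{1..<s}. L n s q * L n r q)"
      by (simp add: mult.commute)
    finally have Srs: "S n r s = L n r s * L n s s + (\<Sum>q\<in>{1..<s}. L n s q * L n r q)" .
    show "(dot n (Uh n X r) (Uh n X s) / real n - (\<Sum>q\<in>{1..<s}. R n X s q * R n X r q)) - L n r s * L n s s
      = (dot n (Uh n X r) (Uh n X s) / real n - S n r s) - (\<Sum>q\<in>{1..<s}. R n X s q * R n X r q - L n s q * L n r q)"
      unfolding Srs sum_subtractf by simp
  qed
  have \<rho>: "outer_le \<Gamma> (\<lambda>n X. \<rho> n X s - L n s s * L n s s) (1/2)"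
  proof (rule outer_le_whp_mono[OF pq num[of s]])
    show "\<forall>\<^sub>F n in sequentially. \<forall>X\<in>space (\<Gamma> n). (\<forall>q\<in>{1..<s}. \<rho> n X q \<noteq> 0) \<longrightarrow> \<bar>\<rho> n X s - L n s s * L n s s\<bar>
       \<le> \<bar>dot n (Uh n X s) (Uh n X s) / real n - (\<Sum>q\<in>{1..<s}. R n X s q * R n X s q) - L n s s * L n s s\<bar>"
      using eventually_ge_at_top[of 1]
    proof (eventually_elim, intro ballI impI)
      fix n X assume "1 \<le> (n::nat)" "\<forall>q\<in>{1..<s}. \<rho> n X q \<noteq> 0"
      then have "\<rho> n X s = dot n (Uh n X s) (Uh n X s) / real n - (\<Sum>q\<in>{1..<s}. R n X s q * R n X s q)"
        by (intro \<rho>_eq) auto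
      then show "\<bar>\<rho> n X s - L n s s * L n s s\<bar>
       \<le> \<bar>dot n (Uh n X s) (Uh n X s) / real n - (\<Sum>q\<in>{1..<s}. R n X s q * R n X s q) - L n s s * L n s s\<bar>"
        by (simp only: order_refl)
    qed
  qed (use less.prems in auto)
  have Lsq: "L n s s * L n s s \<ge> c" if "n \<ge> 1" for n
  proof -
    have "sqrt c > 0" using c0 by simp
    then have "sqrt c * sqrt c \<le> L n s s * L n s s"
      using L_diag_ge[OF that sT] by (intro mult_mono) linarith+
    then show ?thesis using c0 by simp
  qed
  \<comment> \<open>the squared residual is close to the squared diagonal entry of L, which is at least c\<close>
  have big: "whp \<Gamma> (\<lambda>n X. \<rho> n X s \<ge> c / 2)"
  proof (rule whp_mono[OF whp_small[OF \<rho>, of "c / 2"]])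
    show "\<forall>\<^sub>F n in sequentially. \<forall>X\<in>space (\<Gamma> n). \<bar>\<rho> n X s - L n s s * L n s s\<bar> \<le> c / 2 \<longrightarrow> c / 2 \<le> \<rho> n X s"
      using eventually_ge_at_top[of 1]
    proof (eventually_elim, intro ballI impI)
      fix n X assume n: "1 \<le> (n::nat)" and a: "\<bar>\<rho> n X s - L n s s * L n s s\<bar> \<le> c / 2"
      show "c / 2 \<le> \<rho> n X s" using Lsq[OF n] a by linarith
    qed
  qed (use c0 in auto)
  have nz: "whp \<Gamma> (\<lambda>n X. \<rho> n X s \<noteq> 0)"
    by (rule whp_mono[OF big]) (use c0 in auto)
  have root: "outer_le \<Gamma> (\<lambda>n X. sqrt (\<rho> n X s) - L n s s) (1/2)"
  proof (rule outer_le_mono)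
    show "outer_le \<Gamma> (\<lambda>n X. (1 / sqrt c) * (\<rho> n X s - L n s s * L n s s)) (1/2)"
      by (rule outer_le_bounded_mult[where K="1 / sqrt c", OF _ \<rho>]) (use c0 in simp)
    fix n X assume n: "n \<ge> (1::nat)"
    have L: "L n s s \<ge> sqrt c" by (rule L_diag_ge[OF n sT])
    have sc: "sqrt c > 0" using c0 by simp
    have "\<bar>sqrt (\<rho> n X s) - L n s s\<bar> * sqrt c \<le> \<bar>sqrt (\<rho> n X s) - L n s s\<bar> * (sqrt (\<rho> n X s) + L n s s)"
      using L real_sqrt_ge_zero[OF \<rho>_nonneg[of n X s]] by (intro mult_left_mono) linarith+
    also have "\<dots> = \<bar>(sqrt (\<rho> n X s) - L n s s) * (sqrt (\<rho> n X s) + L n s s)\<bar>"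
    proof -
      have "\<bar>sqrt (\<rho> n X s) + L n s s\<bar> = sqrt (\<rho> n X s) + L n s s"
        using L sc real_sqrt_ge_zero[OF \<rho>_nonneg[of n X s]] by linarith
      then show ?thesis by (simp only: abs_mult)
    qed
    also have "(sqrt (\<rho> n X s) - L n s s) * (sqrt (\<rho> n X s) + L n s s) = \<rho> n X s - L n s s * L n s s"
      using \<rho>_nonneg[of n X s] by (simp add: algebra_simps)
    finally show "\<bar>sqrt (\<rho> n X s) - L n s s\<bar> \<le> \<bar>(1 / sqrt c) * (\<rho> n X s - L n s s * L n s s)\<bar>"
      using sc by (simp add: abs_mult field_simps)
  qed
  have "outer_le \<Gamma> (\<lambda>n X. R n X r s - L n r s) (1/2)" if r: "r \<in> {s..t}" for r
  proof (rule outer_le_whp_mono[OF big])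
    let ?num = "\<lambda>n X. ((dot n (Uh n X r) (Uh n X s) / real n - (\<Sum>q\<in>{1..<s}. R n X s q * R n X r q)) - L n r s * L n s s)
         - L n r s * (sqrt (\<rho> n X s) - L n s s)"
    have "outer_le \<Gamma> ?num (1/2)"
      by (rule outer_le_diff[OF num[OF r] outer_le_bounded_mult[where K="sqrt C", OF L_bounded root]]) (use r less.prems t in auto)
    then show "outer_le \<Gamma> (\<lambda>n X. (1 / sqrt (c / 2)) * ?num n X) (1/2)"
      by (intro outer_le_bounded_mult[where K="1 / sqrt (c / 2)"]) (use c0 in simp)
    show "\<forall>\<^sub>F n in sequentially. \<forall>X\<in>space (\<Gamma> n). c / 2 \<le> \<rho> n X s \<longrightarrow> \<bar>R n X r s - L n r s\<bar> \<le> \<bar>(1 / sqrt (c / 2)) * ?num n X\<bar>"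
    proof (intro always_eventually allI ballI impI)
      fix n X assume "c / 2 \<le> \<rho> n X s"
      then have rt: "sqrt (c / 2) \<le> sqrt (\<rho> n X s)" by simp
      have sc: "sqrt (c / 2) > 0" using c0 by simp
      have "?num n X = (R n X r s - L n r s) * sqrt (\<rho> n X s)"
        unfolding R_coeff[symmetric] by (simp add: algebra_simps)
      then have "\<bar>?num n X\<bar> = \<bar>R n X r s - L n r s\<bar> * sqrt (\<rho> n X s)" using \<rho>_nonneg[of n X s] by (simp add: abs_mult)
      also have "\<dots> \<ge> \<bar>R n X r s - L n r s\<bar> * sqrt (c / 2)" using rt by (intro mult_left_mono) auto
      finally have "\<bar>R n X r s - L n r s\<bar> \<le> \<bar>?num n X\<bar> / sqrt (c / 2)" using sc by (simp only: pos_le_divide_eq)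
      then show "\<bar>R n X r s - L n r s\<bar> \<le> \<bar>(1 / sqrt (c / 2)) * ?num n X\<bar>"
        unfolding abs_mult using sc by simp
    qed
  qed
  then show ?case using nz by blast
qed

lemma R_bounded:
  assumes "outer_le \<Gamma> (\<lambda>n X. R n X r s - L n r s) (1/2)" "s \<in> {1..r}" "r \<in> {1..T}"
  shows "outer_le \<Gamma> (\<lambda>n X. R n X r s) 0"
proof -
  have "outer_le \<Gamma> (\<lambda>n X. (R n X r s - L n r s) + L n r s) 0"
    by (intro outer_le_add outer_le_weaken[OF assms(1)] outer_le_const[where K="sqrt C"] L_bounded) (use assms in auto)
  then show ?thesis by simp
qed

text \<open>
  The coefficients of an iterate along the Gram-Schmidt directions once the columns of X have been
  taken out, with the Onsager correction expanded in the same directions.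
\<close>

definition \<kappa> :: "nat \<Rightarrow> rmat \<Rightarrow> nat \<Rightarrow> nat \<Rightarrow> real" where
  "\<kappa> n X t q = dot n (Uh n X t) (X q) / sqrt (real n) + sqrt 2 * (R n X t q * dot n (eh n X q) (X q))
     - (\<Sum>p=1..q. R n X t p * dot n (eh n X p) (X q)) - (\<Sum>r=q..t. R n X t r * dot n (eh n X q) (X r))
     - sqrt (real n) * (\<Sum>r\<in>{q..<t}. b n t r * R n X r q)"

text \<open>
  The error of an iterate: the main terms differ by the coefficients, and what remains lies in
  the span of the Gram-Schmidt directions.
\<close>

lemma iterate_error:
  assumes n: "n \<ge> 1" and t: "t \<in> {1..T}" and nz: "\<And>s. s \<in> {1..t} \<Longrightarrow> \<rho> n X s \<noteq> 0" and i: "i \<in> {1..n}"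
  shows "zh n X i t - Z n X i t = (\<Sum>s=1..t. (R n X t s - L n t s) * X s i) + (\<Sum>q=1..t. \<kappa> n X t q * eh n X q i)"
proof -
  define \<nu> where "\<nu> = sqrt (real n)"
  have \<nu>: "\<nu> > 0" using n by (simp add: \<nu>_def)
  have R: "dot n (Uh n X r) (eh n X s) = \<nu> * R n X r s" for r s using \<nu> by (simp add: R_def \<nu>_def)
  have rz: "dot n (resid n (Uh n X) s) (resid n (Uh n X) s) \<noteq> 0" if "s \<in> {1..t}" for s
    using nz[OF that] by (auto simp: \<rho>_def)
  have U: "Uh n X r i = (\<Sum>q=1..r. \<nu> * R n X r q * eh n X q i)" if "r \<in> {1..t}" for r
    using gs_expand[OF n rz that i] unfolding eh_def[symmetric] R .
  have "(\<Sum>r\<in>{1..<t}. b n t r * Uh n X r i) = (\<Sum>r\<in>{1..<t}. \<Sum>q=1..r. b n t r * (\<nu> * R n X r q * eh n X q i))"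
    unfolding sum_distrib_left[symmetric] by (intro sum.cong refl) (simp add: U)
  also have "\<dots> = (\<Sum>r\<in>{1..<t}. \<Sum>q=1..t. if q \<le> r then b n t r * (\<nu> * R n X r q * eh n X q i) else 0)"
    by (rule sum.cong, rule refl, rule sum.mono_neutral_cong_left) auto
  also have "\<dots> = (\<Sum>q=1..t. \<Sum>r\<in>{1..<t}. if q \<le> r then b n t r * (\<nu> * R n X r q * eh n X q i) else 0)" by (rule sum.swap)
  also have "\<dots> = (\<Sum>q=1..t. \<Sum>r\<in>{q..<t}. b n t r * (\<nu> * R n X r q * eh n X q i))"
    by (rule sum.cong, rule refl, rule sum.mono_neutral_cong_right) auto
  also have "\<dots> = (\<Sum>q=1..t. (\<nu> * (\<Sum>r\<in>{q..<t}. b n t r * R n X r q)) * eh n X q i)"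
    by (simp add: sum_distrib_left sum_distrib_right mult_ac)
  finally have ons: "(\<Sum>r\<in>{1..<t}. b n t r * Uh n X r i) = (\<Sum>q=1..t. (\<nu> * (\<Sum>r\<in>{q..<t}. b n t r * R n X r q)) * eh n X q i)" .
  have "span_apply n (eh n X) X (Uh n X t) t i = (\<Sum>s=1..t. R n X t s * X s i
      + (\<kappa> n X t s + \<nu> * (\<Sum>r\<in>{s..<t}. b n t r * R n X r s)) * eh n X s i)"
    unfolding span_apply_def \<nu>_def[symmetric] sum_divide_distrib R
  proof (rule sum.cong[OF refl])
    fix s assume "s \<in> {1..t}"
    have 1: "(\<Sum>p=1..s. \<nu> * R n X t p * dot n (eh n X p) (X s)) = \<nu> * (\<Sum>p=1..s. R n X t p * dot n (eh n X p) (X s))"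
      "(\<Sum>r=s..t. \<nu> * R n X t r * dot n (eh n X s) (X r)) = \<nu> * (\<Sum>r=s..t. R n X t r * dot n (eh n X s) (X r))"
      by (simp_all add: sum_distrib_left mult.assoc)
    show "(\<nu> * R n X t s * X s i + (dot n (Uh n X t) (X s) + sqrt 2 * (\<nu> * R n X t s) * dot n (eh n X s) (X s)
         - (\<Sum>p=1..s. \<nu> * R n X t p * dot n (eh n X p) (X s)) - (\<Sum>r=s..t. \<nu> * R n X t r * dot n (eh n X s) (X r))) * eh n X s i) / \<nu>
       = R n X t s * X s i + (\<kappa> n X t s + \<nu> * (\<Sum>r\<in>{s..<t}. b n t r * R n X r s)) * eh n X s i"
      unfolding 1 \<kappa>_def \<nu>_def[symmetric] using \<nu> by (simp add: field_simps)
  qed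
  also have "\<dots> = (\<Sum>s=1..t. R n X t s * X s i) + (\<Sum>s=1..t. \<kappa> n X t s * eh n X s i) + (\<Sum>s=1..t. (\<nu> * (\<Sum>r\<in>{s..<t}. b n t r * R n X r s)) * eh n X s i)"
    by (simp only: distrib_right sum.distrib add.assoc)
  finally have sp: "span_apply n (eh n X) X (Uh n X t) t i = (\<Sum>s=1..t. R n X t s * X s i) + (\<Sum>s=1..t. \<kappa> n X t s * eh n X s i) + (\<Sum>s=1..t. (\<nu> * (\<Sum>r\<in>{s..<t}. b n t r * R n X r s)) * eh n X s i)" .
  have "zh n X i t = span_apply n (eh n X) X (Uh n X t) t i - (\<Sum>r\<in>{1..<t}. b n t r * Uh n X r i)"
    using gauss_amp_eq[OF t, of n "v n" "f n" X i] by (simp add: zh_def Uh_def eh_def b_def)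
  moreover have "Z n X i t = (\<Sum>k=1..t. L n t k * X k i)"
  proof -
    have "(\<Sum>k=1..T. L n t k * X k i) = (\<Sum>k=1..t. L n t k * X k i)"
      by (rule sum_lower_triangular) (use t L_upper[OF n] in auto)
    then show ?thesis using i t by (simp add: Z_def mix_def)
  qed
  ultimately show ?thesis unfolding sp ons by (simp add: left_diff_distrib sum_subtractf)
qed

text \<open>
  By the stability assumption and Gaussian integration by parts, u t has inner product about
  n (b L) with an earlier column of X; this would contribute a coefficient of order sqrt n along
  each earlier direction, and the Onsager term is what cancels it, up to replacing L by R.
  The other terms of the coefficients are inner products of columns with directions that do not
  depend on them, hence of logarithmic size. The remaining error is a combination
  of columns of norm about sqrt n with coefficients of order 1 / sqrt n.
\<close>

lemma iterate_close:
  assumes t: "t \<in> {1..T}" and H: "\<And>s. s \<in> {1..<t} \<Longrightarrow> outer_le \<Gamma> (err s) 0"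
  shows "outer_le \<Gamma> (err t) 0" "whp \<Gamma> (\<lambda>n X. \<forall>s\<in>{1..t}. \<rho> n X s \<noteq> 0)"
proof -
  have gram: "outer_le \<Gamma> (\<lambda>n X. dot n (Uh n X r) (Uh n X s) / real n - S n r s) (1/2)" if "r \<in> {1..t}" "s \<in> {1..t}" for r s
    by (rule stability_consequences(1)[OF t _ that]) (rule H)
  have cross: "outer_le \<Gamma> (\<lambda>n X. dot n (\<lambda>i. zh n X i s) (Uh n X t) / real n - (\<Sum>r\<in>{1..<t}. S n s r * b n t r)) (1/2)"
    if "s \<in> {1..<t}" for s
    by (rule stability_consequences(2)[OF t _ that]) (rule H)
  have close: "(\<forall>r\<in>{s..t}. outer_le \<Gamma> (\<lambda>n X. R n X r s - L n r s) (1/2)) \<and> whp \<Gamma> (\<lambda>n X. \<rho> n X s \<noteq> 0)" if "s \<in> {1..t}" for s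
    by (rule gram_schmidt_close[OF t _ that]) (rule gram)
  have RL: "outer_le \<Gamma> (\<lambda>n X. R n X r s - L n r s) (1/2)" if "s \<in> {1..r}" "r \<in> {1..t}" for r s
    using close[of s] that by auto
  have R0: "outer_le \<Gamma> (\<lambda>n X. R n X r s) 0" if "s \<in> {1..r}" "r \<in> {1..t}" for r s
    by (rule R_bounded[OF RL]) (use that t in auto)
  show nz: "whp \<Gamma> (\<lambda>n X. \<forall>s\<in>{1..t}. \<rho> n X s \<noteq> 0)"
    by (rule whp_ball) (use close in auto)
  have Unorm: "outer_le \<Gamma> (\<lambda>n X. L2_set (Uh n X r) {1..n} / sqrt (real n)) 0" if r: "r \<in> {1..t}" for r
  proof -
    have "outer_le \<Gamma> (\<lambda>n X. (dot n (Uh n X r) (Uh n X r) / real n - S n r r) + S n r r) 0"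
      by (intro outer_le_add outer_le_weaken[OF gram] outer_le_const[where K=C] S_diag_bound) (use r t in auto)
    then have "outer_le \<Gamma> (\<lambda>n X. sqrt \<bar>dot n (Uh n X r) (Uh n X r) / real n\<bar>) 0" by (intro outer_le_sqrt) simp
    then show ?thesis
      by (rule outer_le_cong) (unfold L2_set_dot, simp add: real_sqrt_divide dot_self_nonneg)
  qed
  have rootn: "outer_le \<Gamma> (\<lambda>n X. 1 / sqrt (real n)) (1/2)"
  proof (rule outer_le_cong[OF outer_le_powr])
    show "1 / sqrt (real n) = real n powr (- (1/2))" for n :: nat
      using powr_half_sqrt[of "real n"] powr_minus_divide[of "real n" "1/2"] by simp
  qed
  have rootn': "outer_le \<Gamma> (\<lambda>n X. sqrt (real n)) (- (1/2))"
  proof (rule outer_le_cong[OF outer_le_powr])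
    show "sqrt (real n) = real n powr (- (- (1/2)))" for n :: nat
      using powr_half_sqrt[of "real n"] by simp
  qed
  \<comment> \<open>the inner products with the Gaussian approximations of the iterates\<close>
  have Zdot: "outer_le \<Gamma> (\<lambda>n X. dot n (\<lambda>i. Z n X i s) (Uh n X t) / real n - (\<Sum>r\<in>{1..<t}. S n s r * b n t r)) (1/2)"
    if s: "s \<in> {1..<t}" for s
  proof -
    have "outer_le \<Gamma> (\<lambda>n X. (err s n X * (L2_set (Uh n X t) {1..n} / sqrt (real n))) * (1 / sqrt (real n))) (1/2)"
      by (rule outer_le_mult_rate[OF outer_le_mult_rate[OF H[OF s] Unorm] rootn, where a=0]) (use t in auto)
    then have d: "outer_le \<Gamma> (\<lambda>n X. dot n (\<lambda>i. zh n X i s - Z n X i s) (Uh n X t) / real n) (1/2)"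
    proof (rule outer_le_mono)
      fix n X assume n: "n \<ge> (1::nat)"
      have "\<bar>dot n (\<lambda>i. zh n X i s - Z n X i s) (Uh n X t)\<bar> \<le> err s n X * L2_set (Uh n X t) {1..n}"
        unfolding err_def by (rule dot_L2_set)
      then have "\<bar>dot n (\<lambda>i. zh n X i s - Z n X i s) (Uh n X t) / real n\<bar> \<le> err s n X * L2_set (Uh n X t) {1..n} / real n"
        by (simp add: abs_divide divide_right_mono)
      also have "\<dots> = err s n X * (L2_set (Uh n X t) {1..n} / sqrt (real n)) * (1 / sqrt (real n))" by simp
      finally show "\<bar>dot n (\<lambda>i. zh n X i s - Z n X i s) (Uh n X t) / real n\<bar> \<le> \<bar>err s n X * (L2_set (Uh n X t) {1..n} / sqrt (real n)) * (1 / sqrt (real n))\<bar>"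
        by linarith
    qed
    show ?thesis
      by (rule outer_le_cong[OF outer_le_diff[OF cross[OF s] d]]) (simp add: dot_linear diff_divide_distrib)
  qed
  \<comment> \<open>solving the triangular system gives those with the columns themselves\<close>
  define K where "K n q = (\<Sum>r\<in>{1..<t}. b n t r * L n r q)" for n q
  have col: "outer_le \<Gamma> (\<lambda>n X. dot n (X q) (Uh n X t) / real n - K n q) (1/2)" if "q \<in> {1..<t}" for q
    using that
  proof (induction q rule: less_induct)
    case (less q)
    have qT: "q \<in> {1..T}" using less.prems t by auto
    have "outer_le \<Gamma> (\<lambda>n X. (dot n (\<lambda>i. Z n X i q) (Uh n X t) / real n - (\<Sum>r\<in>{1..<t}. S n q r * b n t r))
        - (\<Sum>p\<in>{1..<q}. L n q p * (dot n (X p) (Uh n X t) / real n - K n p))) (1/2)" (is "outer_le \<Gamma> ?rhs _")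
    proof (rule outer_le_diff[OF Zdot[OF less.prems] outer_le_sum])
      fix p assume p: "p \<in> {1..<q}"
      show "outer_le \<Gamma> (\<lambda>n X. L n q p * (dot n (X p) (Uh n X t) / real n - K n p)) (1/2)"
        by (rule outer_le_bounded_mult[where K="sqrt C", OF L_bounded less.IH]) (use p less.prems t in auto)
    qed
    then have "outer_le \<Gamma> (\<lambda>n X. (1 / sqrt c) * ?rhs n X) (1/2)"
      by (intro outer_le_bounded_mult[where K="1 / sqrt c"]) (use c0 in simp)
    then show ?case
    proof (rule outer_le_mono)
      fix n X assume n: "n \<ge> (1::nat)"
      have "dot n (\<lambda>i. Z n X i q) (Uh n X t) = dot n (\<lambda>i. \<Sum>p=1..q. L n q p * X p i) (Uh n X t)"
      proof (rule dot_cong)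
        fix i assume i: "i \<in> {1..n}"
        have "(\<Sum>k=1..T. L n q k * X k i) = (\<Sum>k=1..q. L n q k * X k i)"
          by (rule sum_lower_triangular) (use qT L_upper[OF n] in auto)
        then show "Z n X i q = (\<Sum>p=1..q. L n q p * X p i)" using i qT by (simp add: Z_def mix_def)
      qed simp
      then have Zq: "dot n (\<lambda>i. Z n X i q) (Uh n X t) / real n = (\<Sum>p=1..q. L n q p * (dot n (X p) (Uh n X t) / real n))"
        by (simp add: dot_sum dot_linear sum_divide_distrib)
      have Sq: "S n q r = (\<Sum>p=1..q. L n q p * L n r p)" if r: "r \<in> {1..<t}" for r
      proof (cases "r \<le> q")
        case True
        then have "S n q r = (\<Sum>p=1..r. L n r p * L n q p)"
          using S_factor(1)[OF n qT, of r] r by (simp add: mult.commute)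
        also have "\<dots> = (\<Sum>p=1..q. L n r p * L n q p)"
          by (rule sum_lower_triangular[symmetric]) (use True L_upper[OF n] in auto)
        finally show ?thesis by (simp add: mult.commute)
      next
        case False
        then show ?thesis using S_factor(2)[OF n, of r q] r t qT by (simp add: mult.commute)
      qed
      have "(\<Sum>r\<in>{1..<t}. S n q r * b n t r) = (\<Sum>r\<in>{1..<t}. \<Sum>p=1..q. L n q p * (b n t r * L n r p))"
        by (intro sum.cong refl) (simp add: Sq sum_distrib_left sum_distrib_right mult_ac)
      also have "\<dots> = (\<Sum>p=1..q. L n q p * K n p)"
        by (subst sum.swap) (simp add: K_def sum_distrib_left)
      finally have Sb: "(\<Sum>r\<in>{1..<t}. S n q r * b n t r) = (\<Sum>p=1..q. L n q p * K n p)" .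
      have "{1..q} = insert q {1..<q}" using less.prems by auto
      then have "(\<Sum>p=1..q. F p) = F q + (\<Sum>p\<in>{1..<q}. F p)" for F :: "nat \<Rightarrow> real" by simp
      note split = this
      have "?rhs n X = L n q q * (dot n (X q) (Uh n X t) / real n - K n q)"
        unfolding Zq Sb split by (simp add: algebra_simps sum_subtractf)
      then have "\<bar>?rhs n X\<bar> = L n q q * \<bar>dot n (X q) (Uh n X t) / real n - K n q\<bar>"
        using L_diag_ge[OF n qT] c0 by (simp add: abs_mult) (metis abs_of_nonneg order_trans real_sqrt_ge_0_iff less_imp_le)
      also have "\<dots> \<ge> sqrt c * \<bar>dot n (X q) (Uh n X t) / real n - K n q\<bar>"
        using L_diag_ge[OF n qT] by (intro mult_right_mono) auto
      finally have "\<bar>dot n (X q) (Uh n X t) / real n - K n q\<bar> \<le> \<bar>?rhs n X\<bar> / sqrt c"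
        using c0 by (simp add: pos_le_divide_eq mult.commute)
      also have "\<dots> = \<bar>(1 / sqrt c) * ?rhs n X\<bar>" unfolding abs_mult using c0 by simp
      finally show "\<bar>dot n (X q) (Uh n X t) / real n - K n q\<bar> \<le> \<bar>(1 / sqrt c) * ?rhs n X\<bar>" .
    qed
  qed
  \<comment> \<open>the Onsager cancellation; direction t itself needs none, as column t is fresh\<close>
  have lead: "outer_le \<Gamma> (\<lambda>n X. dot n (Uh n X t) (X q) / sqrt (real n) - sqrt (real n) * (\<Sum>r\<in>{q..<t}. b n t r * R n X r q)) 0"
    if q: "q \<in> {1..t}" for q
  proof (cases "q = t")
    case True
    have "outer_le \<Gamma> (\<lambda>n X. \<Sum>s=1..t. R n X t s * dot n (eh n X s) (X t)) 0"
      by (intro outer_le_sum outer_le_mult_rate[OF R0 outer_le_dir_dot]) (use t in auto)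
    then show ?thesis
    proof (rule outer_le_whp_mono[OF nz])
      show "\<forall>\<^sub>F n in sequentially. \<forall>X\<in>space (\<Gamma> n). (\<forall>s\<in>{1..t}. \<rho> n X s \<noteq> 0) \<longrightarrow>
         \<bar>dot n (Uh n X t) (X q) / sqrt (real n) - sqrt (real n) * (\<Sum>r\<in>{q..<t}. b n t r * R n X r q)\<bar> \<le> \<bar>\<Sum>s=1..t. R n X t s * dot n (eh n X s) (X t)\<bar>"
        using eventually_ge_at_top[of 1]
      proof (eventually_elim, intro ballI impI)
        fix n X assume n: "1 \<le> (n::nat)" and r: "\<forall>s\<in>{1..t}. \<rho> n X s \<noteq> 0"
        have rz: "dot n (resid n (Uh n X) s) (resid n (Uh n X) s) \<noteq> 0" if "s \<in> {1..t}" for s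
          using r that by (auto simp: \<rho>_def)
        have "dot n (Uh n X t) (X t) = dot n (\<lambda>i. \<Sum>s=1..t. dot n (Uh n X t) (eh n X s) * eh n X s i) (X t)"
          unfolding eh_def by (rule dot_cong) (use gs_expand[OF n rz] t in auto)
        also have "\<dots> = (\<Sum>s=1..t. dot n (Uh n X t) (eh n X s) * dot n (eh n X s) (X t))" by (simp only: dot_sum dot_linear)
        finally have "dot n (Uh n X t) (X t) / sqrt (real n) = (\<Sum>s=1..t. R n X t s * dot n (eh n X s) (X t))"
          by (simp add: R_def sum_divide_distrib)
        then show "\<bar>dot n (Uh n X t) (X q) / sqrt (real n) - sqrt (real n) * (\<Sum>r\<in>{q..<t}. b n t r * R n X r q)\<bar> \<le> \<bar>\<Sum>s=1..t. R n X t s * dot n (eh n X s) (X t)\<bar>"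
          using True by simp
      qed
    qed
  next
    case False
    then have q': "q \<in> {1..<t}" using q by auto
    have "outer_le \<Gamma> (\<lambda>n X. (dot n (X q) (Uh n X t) / real n - K n q) - (\<Sum>r\<in>{q..<t}. b n t r * (R n X r q - L n r q))) (1/2)"
      by (rule outer_le_diff[OF col[OF q'] outer_le_sum[OF outer_le_bounded_mult[where K=C, OF b_bounded RL]]]) (use q' t in auto)
    then have "outer_le \<Gamma> (\<lambda>n X. sqrt (real n) * ((dot n (X q) (Uh n X t) / real n - K n q) - (\<Sum>r\<in>{q..<t}. b n t r * (R n X r q - L n r q)))) 0"
      by (intro outer_le_mult_rate[OF rootn']) auto
    then show ?thesis
    proof (rule outer_le_cong)
      fix n X assume n: "n \<ge> (1::nat)"
      have Kq: "K n q = (\<Sum>r\<in>{q..<t}. b n t r * L n r q)"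
        unfolding K_def using q' L_upper[OF n] by (intro sum.mono_neutral_right) auto
      have rt: "sqrt (real n) * (x / real n) = x / sqrt (real n)" for x
        using n by (simp add: field_simps)
      show "dot n (Uh n X t) (X q) / sqrt (real n) - sqrt (real n) * (\<Sum>r\<in>{q..<t}. b n t r * R n X r q)
        = sqrt (real n) * ((dot n (X q) (Uh n X t) / real n - K n q) - (\<Sum>r\<in>{q..<t}. b n t r * (R n X r q - L n r q)))"
        unfolding Kq right_diff_distrib sum_subtractf rt by (simp add: dot_commute)
    qed
  qed
  have \<kappa>0: "outer_le \<Gamma> (\<lambda>n X. \<kappa> n X t q) 0" if q: "q \<in> {1..t}" for q
  proof -
    have 1: "outer_le \<Gamma> (\<lambda>n X. R n X t q * dot n (eh n X q) (X q)) 0"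
      by (intro outer_le_mult_rate[OF R0 outer_le_dir_dot]) (use t q in auto)
    have 2: "outer_le \<Gamma> (\<lambda>n X. \<Sum>p=1..q. R n X t p * dot n (eh n X p) (X q)) 0"
      by (intro outer_le_sum outer_le_mult_rate[OF R0 outer_le_dir_dot]) (use t q in auto)
    have 3: "outer_le \<Gamma> (\<lambda>n X. \<Sum>r=q..t. R n X t r * dot n (eh n X q) (X r)) 0"
      by (intro outer_le_sum outer_le_mult_rate[OF R0 outer_le_dir_dot]) (use t q in auto)
    have "outer_le \<Gamma> (\<lambda>n X. (dot n (Uh n X t) (X q) / sqrt (real n) - sqrt (real n) * (\<Sum>r\<in>{q..<t}. b n t r * R n X r q))
       + (sqrt 2 * (R n X t q * dot n (eh n X q) (X q)) - (\<Sum>p=1..q. R n X t p * dot n (eh n X p) (X q)) - (\<Sum>r=q..t. R n X t r * dot n (eh n X q) (X r)))) 0"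
      by (rule outer_le_add[OF lead[OF q] outer_le_diff[OF outer_le_diff[OF outer_le_bounded_mult[where K="sqrt 2", OF _ 1] 2] 3]]) simp
    then show ?thesis by (rule outer_le_cong) (simp add: \<kappa>_def)
  qed
  have "outer_le \<Gamma> (\<lambda>n X. (\<Sum>s=1..t. \<bar>R n X t s - L n t s\<bar> * (sqrt (real n) * (L2_set (X s) {1..n} / sqrt (real n)))) + (\<Sum>q=1..t. \<bar>\<kappa> n X t q\<bar>)) 0"
  proof (intro outer_le_add outer_le_sum outer_le_abs)
    fix s assume s: "s \<in> {1..t}"
    have "outer_le \<Gamma> (\<lambda>n X. sqrt (real n) * (L2_set (X s) {1..n} / sqrt (real n))) (- (1/2))"
      by (rule outer_le_mult_rate[OF rootn' outer_le_column_norm]) (use s t in auto)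
    then show "outer_le \<Gamma> (\<lambda>n X. \<bar>R n X t s - L n t s\<bar> * (sqrt (real n) * (L2_set (X s) {1..n} / sqrt (real n)))) 0"
      by (intro outer_le_mult_rate[OF outer_le_abs[OF RL]]) (use s t in auto)
  next
    fix q assume "q \<in> {1..t}"
    then show "outer_le \<Gamma> (\<lambda>n X. \<kappa> n X t q) 0" by (rule \<kappa>0)
  qed
  then show "outer_le \<Gamma> (err t) 0"
  proof (rule outer_le_whp_mono[OF nz])
    show "\<forall>\<^sub>F n in sequentially. \<forall>X\<in>space (\<Gamma> n). (\<forall>s\<in>{1..t}. \<rho> n X s \<noteq> 0) \<longrightarrow> \<bar>err t n X\<bar>
       \<le> \<bar>(\<Sum>s=1..t. \<bar>R n X t s - L n t s\<bar> * (sqrt (real n) * (L2_set (X s) {1..n} / sqrt (real n)))) + (\<Sum>q=1..t. \<bar>\<kappa> n X t q\<bar>)\<bar>"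
      using eventually_ge_at_top[of 1]
    proof (eventually_elim, intro ballI impI)
      fix n X assume n: "1 \<le> (n::nat)" and r: "\<forall>s\<in>{1..t}. \<rho> n X s \<noteq> 0"
      have "err t n X = L2_set (\<lambda>i. (\<Sum>s=1..t. (R n X t s - L n t s) * X s i) + (\<Sum>q=1..t. \<kappa> n X t q * eh n X q i)) {1..n}"
        unfolding err_def by (rule L2_set_cong[OF refl], rule iterate_error[OF n t]) (use r in auto)
      also have "\<dots> \<le> L2_set (\<lambda>i. \<Sum>s=1..t. (R n X t s - L n t s) * X s i) {1..n} + L2_set (\<lambda>i. \<Sum>q=1..t. \<kappa> n X t q * eh n X q i) {1..n}"
        by (rule L2_set_triangle_ineq)
      also have "\<dots> \<le> (\<Sum>s=1..t. \<bar>R n X t s - L n t s\<bar> * L2_set (X s) {1..n}) + (\<Sum>q=1..t. \<bar>\<kappa> n X t q\<bar> * L2_set (eh n X q) {1..n})"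
        by (intro add_mono L2_set_lincomb)
      also have "(\<Sum>q=1..t. \<bar>\<kappa> n X t q\<bar> * L2_set (eh n X q) {1..n}) = (\<Sum>q=1..t. \<bar>\<kappa> n X t q\<bar>)"
        unfolding L2_set_dot eh_def gs_unit[OF n] by simp
      also have "(\<Sum>s=1..t. \<bar>R n X t s - L n t s\<bar> * L2_set (X s) {1..n}) = (\<Sum>s=1..t. \<bar>R n X t s - L n t s\<bar> * (sqrt (real n) * (L2_set (X s) {1..n} / sqrt (real n))))"
        using n by simp
      finally have "err t n X \<le> (\<Sum>s=1..t. \<bar>R n X t s - L n t s\<bar> * (sqrt (real n) * (L2_set (X s) {1..n} / sqrt (real n)))) + (\<Sum>q=1..t. \<bar>\<kappa> n X t q\<bar>)" .
      moreover have "err t n X \<ge> 0" by (simp add: err_def L2_set_nonneg)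
      ultimately show "\<bar>err t n X\<bar> \<le> \<bar>(\<Sum>s=1..t. \<bar>R n X t s - L n t s\<bar> * (sqrt (real n) * (L2_set (X s) {1..n} / sqrt (real n)))) + (\<Sum>q=1..t. \<bar>\<kappa> n X t q\<bar>)\<bar>"
        by linarith
    qed
  qed
qed

theorem gaussian_iterates_close:
  shows "\<And>t. t \<in> {1..T} \<Longrightarrow> outer_le \<Gamma> (err t) 0" "whp \<Gamma> (\<lambda>n X. \<forall>s\<in>{1..T}. \<rho> n X s \<noteq> 0)"
proof -
  show all: "outer_le \<Gamma> (err t) 0" if "t \<in> {1..T}" for t
    using that
  proof (induction t rule: less_induct)
    case (less t)
    show ?case
    proof (rule iterate_close(1)[OF less.prems])
      fix s assume "s \<in> {1..<t}"
      then show "outer_le \<Gamma> (err s) 0" using less.prems by (intro less.IH) auto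
    qed
  qed
  show "whp \<Gamma> (\<lambda>n X. \<forall>s\<in>{1..T}. \<rho> n X s \<noteq> 0)"
  proof (rule iterate_close(2))
    show "T \<in> {1..T}" using T1 by simp
    show "outer_le \<Gamma> (err s) 0" if "s \<in> {1..<T}" for s using that by (intro all) simp
  qed
qed

end

section \<open>Auxiliary randomness and the coupling\<close>

text \<open>
  The auxiliary randomness is a sequence of reals, while the exploration consumes a family of vectors;
  a pairing of the indices converts between them.
\<close>

definition encode_cols :: "nat \<Rightarrow> nat \<Rightarrow> (nat \<Rightarrow> rvec) \<Rightarrow> nat \<Rightarrow> real" where
  "encode_cols n T X k = (let (s, i) = prod_decode k in if s \<in> {1..T} \<and> i \<in> {1..n} then X s i else 0)"

definition decode_cols :: "nat \<Rightarrow> nat \<Rightarrow> (nat \<Rightarrow> real) \<Rightarrow> (nat \<Rightarrow> rvec)" where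
  "decode_cols n T \<eta> = (\<lambda>s\<in>{1..T}. \<lambda>i\<in>{1..n}. \<eta> (prod_encode (s, i)))"

definition noise :: "nat \<Rightarrow> nat \<Rightarrow> (nat \<Rightarrow> real) measure" where
  "noise n T = distr (normal_cols n T) (\<Pi>\<^sub>M k\<in>UNIV. borel) (encode_cols n T)"

lemma encode_cols_measurable: "encode_cols n T \<in> normal_cols n T \<rightarrow>\<^sub>M (\<Pi>\<^sub>M k\<in>UNIV. borel)"
proof -
  have "(\<lambda>X. \<lambda>k\<in>UNIV. encode_cols n T X k) \<in> normal_cols n T \<rightarrow>\<^sub>M (\<Pi>\<^sub>M k\<in>UNIV. borel)"
  proof (rule measurable_restrict)
    fix k
    obtain s i where k: "prod_decode k = (s, i)" by (cases "prod_decode k")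
    show "(\<lambda>X. encode_cols n T X k) \<in> borel_measurable (normal_cols n T)"
    proof (cases "s \<in> {1..T} \<and> i \<in> {1..n}")
      case True
      then have "(\<lambda>X. encode_cols n T X k) = (\<lambda>X. X s i)" by (simp add: encode_cols_def k fun_eq_iff)
      then show ?thesis using True by (simp add: normal_cols_entry)
    next
      case False
      then have "(\<lambda>X. encode_cols n T X k) = (\<lambda>X. 0)" by (auto simp: encode_cols_def k fun_eq_iff)
      then show ?thesis by simp
    qed
  qed
  then show ?thesis by (simp add: restrict_UNIV)
qed

lemma decode_cols_measurable: "decode_cols n T \<in> (\<Pi>\<^sub>M k\<in>UNIV. borel) \<rightarrow>\<^sub>M normal_cols n T"
  unfolding measurable_cong_sets[OF refl sets_normal_cols] decode_cols_def[abs_def]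
  by (intro measurable_matricesI measurable_component_singleton) auto

lemma prob_space_noise: "prob_space (noise n T)"
  unfolding noise_def by (rule prob_space.prob_space_distr[OF prob_space_normal_cols encode_cols_measurable])

lemma decode_noise:
  shows "decode_cols n T \<in> noise n T \<rightarrow>\<^sub>M normal_cols n T" "distr (noise n T) (normal_cols n T) (decode_cols n T) = normal_cols n T"
proof -
  show "decode_cols n T \<in> noise n T \<rightarrow>\<^sub>M normal_cols n T"
    unfolding noise_def using decode_cols_measurable by simp
  have "distr (noise n T) (normal_cols n T) (decode_cols n T) = distr (normal_cols n T) (normal_cols n T) (decode_cols n T \<circ> encode_cols n T)"
    unfolding noise_def by (rule distr_distr[OF decode_cols_measurable encode_cols_measurable])
  also have "\<dots> = distr (normal_cols n T) (normal_cols n T) (\<lambda>X. X)"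
  proof (rule distr_cong[OF refl refl])
    fix X assume "X \<in> space (normal_cols n T)"
    then have "X \<in> space (matrices T n)" using sets_eq_imp_space_eq[OF sets_normal_cols] by blast
    then have "take_cols T n X = X" by (rule take_cols_id)
    moreover have "(decode_cols n T \<circ> encode_cols n T) X = take_cols T n X"
      by (simp add: decode_cols_def encode_cols_def take_cols_def cong: restrict_cong)
    ultimately show "(decode_cols n T \<circ> encode_cols n T) X = X" by simp
  qed
  finally show "distr (noise n T) (normal_cols n T) (decode_cols n T) = normal_cols n T" by (simp add: distr_id2)
qed

lemma distr_snd:
  assumes "prob_space M" "prob_space N"
  shows "distr (M \<Otimes>\<^sub>M N) N snd = N"
proof (rule measure_eqI)
  interpret M: prob_space M by fact
  interpret N: prob_space N by fact
  fix A assume "A \<in> sets (distr (M \<Otimes>\<^sub>M N) N snd)"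
  then have A: "A \<in> sets N" by simp
  have "emeasure (distr (M \<Otimes>\<^sub>M N) N snd) A = emeasure (M \<Otimes>\<^sub>M N) (space M \<times> A)"
    using A sets.sets_into_space[OF A]
    by (subst emeasure_distr) (auto intro!: arg_cong[where f="emeasure (M \<Otimes>\<^sub>M N)"] simp: space_pair_measure)
  also have "\<dots> = emeasure N A" using A by (simp add: N.emeasure_pair_measure_Times M.emeasure_space_1)
  finally show "emeasure (distr (M \<Otimes>\<^sub>M N) N snd) A = emeasure N A" .
qed simp

lemma GOE_entry_measurable:
  assumes "is_GOE M n W" "i \<in> {1..n}" "j \<in> {1..n}"
  shows "(\<lambda>\<omega>. W \<omega> i j) \<in> borel_measurable M"
proof -
  have upper: "(\<lambda>\<omega>. W \<omega> i j) \<in> borel_measurable M" if "i \<in> {1..n}" "j \<in> {1..n}" "i \<le> j" for i j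
  proof -
    have "distributed M lborel (\<lambda>\<omega>. W \<omega> i j) (normal_density 0 (sqrt ((if i = j then 2 else 1) / real n)))"
      using assms(1) that unfolding is_GOE_def by (cases "i = j") simp_all
    then show ?thesis by (auto simp: distributed_def)
  qed
  show ?thesis
  proof (cases "i \<le> j")
    case False
    then have "(\<lambda>\<omega>. W \<omega> j i) \<in> borel_measurable M" using assms by (intro upper) auto
    moreover have "W \<omega> j i = W \<omega> i j" if "\<omega> \<in> space M" for \<omega> using assms that by (auto simp: is_GOE_def)
    ultimately show ?thesis by (simp cong: measurable_cong)
  qed (rule upper[OF assms(2,3)])
qed

lemma GOE_goe_law:
  assumes P: "prob_space M" and W: "is_GOE M n W" and n: "n \<ge> 1"
  shows "(\<lambda>\<omega>. take_cols n n (W \<omega>)) \<in> M \<rightarrow>\<^sub>M matrices n n"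
    and "goe_law n (distr M (matrices n n) (\<lambda>\<omega>. take_cols n n (W \<omega>)))"
proof -
  show m: "(\<lambda>\<omega>. take_cols n n (W \<omega>)) \<in> M \<rightarrow>\<^sub>M matrices n n"
    by (intro take_cols_measurable GOE_entry_measurable[OF W])
  show "goe_law n (distr M (matrices n n) (\<lambda>\<omega>. take_cols n n (W \<omega>)))"
    unfolding goe_law_def
  proof (intro conjI allI)
    show "prob_space (distr M (matrices n n) (\<lambda>\<omega>. take_cols n n (W \<omega>)))" by (rule prob_space.prob_space_distr[OF P m])
    fix \<theta>
    have "(CLINT w|distr M (matrices n n) (\<lambda>\<omega>. take_cols n n (W \<omega>)). iexp (\<Sum>i=1..n. \<Sum>j=1..n. \<theta> i j * w i j))
      = (CLINT \<omega>|M. iexp (\<Sum>i=1..n. \<Sum>j=1..n. \<theta> i j * take_cols n n (W \<omega>) i j))"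
      by (rule integral_distr[OF m], rule measurable_compose[OF matrices_linear_measurable, of "\<lambda>y. iexp y"]) simp
    also have "\<dots> = (CLINT \<omega>|M. iexp (\<Sum>i=1..n. \<Sum>j=1..n. \<theta> i j * W \<omega> i j))"
    proof -
      have "(\<Sum>i=1..n. \<Sum>j=1..n. \<theta> i j * take_cols n n (W \<omega>) i j) = (\<Sum>i=1..n. \<Sum>j=1..n. \<theta> i j * W \<omega> i j)" for \<omega>
        by (intro sum.cong refl) (simp add: take_cols_def)
      then show ?thesis by (simp only:)
    qed
    also have "\<dots> = goe_char n \<theta>" by (rule GOE_char[OF P W n])
    finally show "(CLINT w|distr M (matrices n n) (\<lambda>\<omega>. take_cols n n (W \<omega>)). iexp (\<Sum>i=1..n. \<Sum>j=1..n. \<theta> i j * w i j)) = goe_char n \<theta>" .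
  qed simp
qed

lemma is_amp_run_take_cols:
  assumes "is_amp_run T n v f w z u"
  shows "is_amp_run T n v f (take_cols n n w) z u"
proof -
  have "(\<Sum>j=1..n. take_cols n n w i j * u j t) = (\<Sum>j=1..n. w i j * u j t)" if "i \<in> {1..n}" for i t
    using that by (intro sum.cong refl) (simp add: take_cols_def)
  then show ?thesis using assms unfolding is_amp_run_def by auto
qed

context amp_instance
begin

text \<open>
  The algorithm fixes its iterates on the index ranges only, and there they are built from W by
  measurable operations.
\<close>

lemma amp_run_measurable:
  assumes W: "is_GOE M n W" and run: "\<And>\<omega>. \<omega> \<in> space M \<Longrightarrow> is_amp_run T n v f (W \<omega>) (z \<omega>) (u \<omega>)"
    and t: "t \<in> {1..T}"
  shows "\<forall>i\<in>{1..n}. (\<lambda>\<omega>. u \<omega> i t) \<in> borel_measurable M \<and> (\<lambda>\<omega>. z \<omega> i t) \<in> borel_measurable M"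
  using t
proof (induction t rule: less_induct)
  case (less t)
  have u: "(\<lambda>\<omega>. u \<omega> i t) \<in> borel_measurable M" if i: "i \<in> {1..n}" for i
  proof (cases "t = 1")
    case True
    have "u \<omega> i t = v i" if "\<omega> \<in> space M" for \<omega> using run[OF that] i True by (simp add: is_amp_run_def)
    then show ?thesis by (simp cong: measurable_cong)
  next
    case False
    then have t1: "t - 1 \<in> {1..<T}" "t - 1 + 1 = t" using less.prems by auto
    have "(\<lambda>\<omega>. take_cols n (t - 1) (z \<omega>)) \<in> M \<rightarrow>\<^sub>M matrices n (t - 1)"
    proof (rule take_cols_measurable)
      fix j s assume "j \<in> {1..n}" "s \<in> {1..t - 1}"
      then show "(\<lambda>\<omega>. z \<omega> j s) \<in> borel_measurable M" using less.IH[of s] less.prems by auto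
    qed
    from measurable_compose[OF this f_measurable[OF t1(1) i]]
    have m: "(\<lambda>\<omega>. f (t - 1) (take_cols n (t - 1) (z \<omega>)) i) \<in> borel_measurable M" .
    have eq: "u \<omega> i t = f (t - 1) (take_cols n (t - 1) (z \<omega>)) i" if "\<omega> \<in> space M" for \<omega>
    proof -
      have "u \<omega> i (t - 1 + 1) = f (t - 1) (take_cols n (t - 1) (z \<omega>)) i"
        using run[OF that] t1(1) i unfolding is_amp_run_def by blast
      then show ?thesis unfolding t1(2) .
    qed
    show ?thesis by (rule iffD2[OF measurable_cong m]) (rule eq)
  qed
  have z: "(\<lambda>\<omega>. z \<omega> i t) \<in> borel_measurable M" if i: "i \<in> {1..n}" for i
  proof -
    have us: "(\<lambda>\<omega>. u \<omega> i s) \<in> borel_measurable M" if "s \<in> {1..<t}" for s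
      using less.IH[of s] that less.prems i by auto
    have m: "(\<lambda>\<omega>. (\<Sum>j=1..n. W \<omega> i j * u \<omega> j t) - (\<Sum>s=1..<t. onsager n v f t s * u \<omega> i s)) \<in> borel_measurable M"
      by (intro borel_measurable_diff borel_measurable_sum borel_measurable_times borel_measurable_const GOE_entry_measurable[OF W] i u us)
    have eq: "z \<omega> i t = (\<Sum>j=1..n. W \<omega> i j * u \<omega> j t) - (\<Sum>s=1..<t. onsager n v f t s * u \<omega> i s)" if "\<omega> \<in> space M" for \<omega>
      using run[OF that] less.prems i unfolding is_amp_run_def by blast
    show ?thesis by (rule iffD2[OF measurable_cong m]) (rule eq)
  qed
  show ?case using u z by blast
qed

text \<open>
  The exploration run on W itself, with the columns decoded from the auxiliary sequence: G is the
  Gaussian family from which the coupling is made.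
\<close>

lemma explored_columns_law:
  assumes P: "prob_space M" and W: "is_GOE M n W"
  defines "G \<equiv> (\<lambda>(\<omega>, \<eta>). snd (explored n v f T (take_cols n n (W \<omega>), decode_cols n T \<eta>)))"
  shows "G \<in> M \<Otimes>\<^sub>M noise n T \<rightarrow>\<^sub>M normal_cols n T"
    and "distr (M \<Otimes>\<^sub>M noise n T) (normal_cols n T) G = normal_cols n T"
proof -
  define \<mu> where "\<mu> = distr M (matrices n n) (\<lambda>\<omega>. take_cols n n (W \<omega>))"
  note gm = GOE_goe_law[OF P W n]
  have \<mu>: "goe_law n \<mu>" unfolding \<mu>_def by (rule gm(2))
  have p\<mu>: "prob_space \<mu>" using \<mu> by (simp add: goe_law_def)
  let ?K = "\<mu> \<Otimes>\<^sub>M normal_cols n T" and ?N = "M \<Otimes>\<^sub>M noise n T"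
  let ?s = "\<lambda>(\<omega>, \<eta>). (take_cols n n (W \<omega>), decode_cols n T \<eta>)"
  have wm: "(\<lambda>\<omega>. take_cols n n (W \<omega>)) \<in> M \<rightarrow>\<^sub>M \<mu>" unfolding \<mu>_def using gm(1) by simp
  have sm: "?s \<in> ?N \<rightarrow>\<^sub>M ?K"
    unfolding case_prod_unfold
    by (intro measurable_Pair measurable_compose[OF measurable_fst wm] measurable_compose[OF measurable_snd decode_noise(1)])
  have "distr M \<mu> (\<lambda>\<omega>. take_cols n n (W \<omega>)) = \<mu>"
    unfolding \<mu>_def by (intro distr_cong) auto
  moreover have "distr M \<mu> (\<lambda>\<omega>. take_cols n n (W \<omega>)) \<Otimes>\<^sub>M distr (noise n T) (normal_cols n T) (decode_cols n T)
     = distr ?N ?K ?s"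
    by (rule pair_measure_distr[OF wm decode_noise(1)])
       (simp add: decode_noise(2) prob_space_imp_sigma_finite prob_space_normal_cols)
  ultimately have slaw: "distr ?N ?K ?s = ?K" by (simp add: decode_noise(2))
  have ex: "explored n v f T \<in> ?K \<rightarrow>\<^sub>M ?K" "distr ?K ?K (explored n v f T) = ?K"
    using explored_law[OF \<mu> order_refl] by auto
  have G: "G = snd \<circ> (explored n v f T \<circ> ?s)" by (auto simp: G_def)
  have em: "explored n v f T \<circ> ?s \<in> ?N \<rightarrow>\<^sub>M ?K" by (rule measurable_comp[OF sm ex(1)])
  show "G \<in> ?N \<rightarrow>\<^sub>M normal_cols n T" unfolding G by (rule measurable_comp[OF em measurable_snd])
  have "distr ?N (normal_cols n T) G = distr (distr ?N ?K (explored n v f T \<circ> ?s)) (normal_cols n T) snd"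
    unfolding G by (rule distr_distr[OF measurable_snd em, symmetric])
  also have "distr ?N ?K (explored n v f T \<circ> ?s) = distr (distr ?N ?K ?s) ?K (explored n v f T)"
    by (rule distr_distr[OF ex(1) sm, symmetric])
  also have "\<dots> = ?K" unfolding slaw by (rule ex(2))
  also have "distr ?K (normal_cols n T) snd = normal_cols n T" by (rule distr_snd[OF p\<mu> prob_space_normal_cols])
  finally show "distr ?N (normal_cols n T) G = normal_cols n T" .
qed

end

theorem theorem4p3:
  fixes T :: nat
    and P :: "nat \<Rightarrow> 'w measure"
    and W z u :: "nat \<Rightarrow> 'w \<Rightarrow> nat \<Rightarrow> nat \<Rightarrow> real"
    and u1 :: "nat \<Rightarrow> nat \<Rightarrow> real"
    and f :: "nat \<Rightarrow> nat \<Rightarrow> (nat \<Rightarrow> nat \<Rightarrow> real) \<Rightarrow> nat \<Rightarrow> real"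
  assumes "T \<ge> 1"
    and "\<And>n. n \<ge> 1 \<Longrightarrow> prob_space (P n)"
    and "\<And>n. n \<ge> 1 \<Longrightarrow> is_GOE (P n) n (W n)"
    and "\<And>n t. n \<ge> 1 \<Longrightarrow> t \<in> {1..<T} \<Longrightarrow> weakly_differentiable n t (f n t)"
    and "\<And>n. n \<ge> 1 \<Longrightarrow> se_integrable T n (u1 n) (f n)"
    and "\<And>n \<omega>. n \<ge> 1 \<Longrightarrow> \<omega> \<in> space (P n) \<Longrightarrow>
           is_amp_run T n (u1 n) (f n) (W n \<omega>) (z n \<omega>) (u n \<omega>)"
    and "\<exists>C>0. \<exists>c>0. \<forall>n\<ge>1.
           (\<forall>t\<in>{1..T}. lambda_min (se_cov n (u1 n) (f n) t) > c \<and>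
                       op_norm (se_cov n (u1 n) (f n) t) < C) \<and>
           (\<forall>t\<in>{1..T}. \<forall>s\<in>{1..<t}. \<bar>onsager n (u1 n) (f n) t s\<bar> < C)"
    and "amp_stable T u1 f"
  shows "\<exists>(Q :: nat \<Rightarrow> (nat \<Rightarrow> real) measure)
           (Z :: nat \<Rightarrow> 'w \<times> (nat \<Rightarrow> real) \<Rightarrow> nat \<Rightarrow> nat \<Rightarrow> real)
           (E :: nat \<Rightarrow> 'w \<times> (nat \<Rightarrow> real) \<Rightarrow> nat \<Rightarrow> nat \<Rightarrow> real).
           (\<forall>n\<ge>1. prob_space (Q n) \<and>
              has_gauss_law (P n \<Otimes>\<^sub>M Q n) n T (Z n) (se_cov n (u1 n) (f n) T) \<and>
              E n \<in> measurable (P n \<Otimes>\<^sub>M Q n) (matrices n T) \<and>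
              (\<forall>\<omega>\<in>space (P n). \<forall>\<eta>\<in>space (Q n). \<forall>i\<in>{1..n}. \<forall>t\<in>{1..T}.
                 z n \<omega> i t = Z n (\<omega>, \<eta>) i t + E n (\<omega>, \<eta>) i t)) \<and>
           stoch_le (\<lambda>n. P n \<Otimes>\<^sub>M Q n) (\<lambda>n \<omega>. frob_norm n T (E n \<omega>)) 0"
proof -
  obtain C c where Cc: "C > 0" "c > 0"
    and lam: "\<And>n t. n \<ge> 1 \<Longrightarrow> t \<in> {1..T} \<Longrightarrow> lambda_min (se_cov n (u1 n) (f n) t) > c"
    and opn: "\<And>n t. n \<ge> 1 \<Longrightarrow> t \<in> {1..T} \<Longrightarrow> op_norm (se_cov n (u1 n) (f n) t) < C"
    and ons: "\<And>n t s. n \<ge> 1 \<Longrightarrow> t \<in> {1..T} \<Longrightarrow> s \<in> {1..<t} \<Longrightarrow> \<bar>onsager n (u1 n) (f n) t s\<bar> < C"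
    using assms(7) by blast
  have "\<forall>n. \<exists>LN. n \<ge> 1 \<longrightarrow> cholesky T c (entries (se_cov n (u1 n) (f n) T)) (fst LN) (snd LN)"
  proof
    fix n
    show "\<exists>LN. n \<ge> 1 \<longrightarrow> cholesky T c (entries (se_cov n (u1 n) (f n) T)) (fst LN) (snd LN)"
    proof (cases "n \<ge> 1")
      case True
      then have "lambda_min (se_cov n (u1 n) (f n) T) > c" using assms(1) by (intro lam) auto
      from cholesky_of_lambda_min[OF Cc(2) assms(1) this] show ?thesis by auto
    qed simp
  qed
  then obtain LN where LN: "\<And>n. n \<ge> 1 \<Longrightarrow> cholesky T c (entries (se_cov n (u1 n) (f n) T)) (fst (LN n)) (snd (LN n))"
    using choice by metis
  have ai: "amp_instance n T (u1 n) (f n) c C (fst (LN n)) (snd (LN n))" if n: "n \<ge> 1" for n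
    by (rule amp_instance.intro) (fact n assms(1) Cc(2) assms(4)[OF n] assms(5)[OF n] lam[OF n] opn[OF n] ons[OF n] LN[OF n])+
  interpret amp_sequence T u1 f c C "\<lambda>n. fst (LN n)" "\<lambda>n. snd (LN n)"
    by (rule amp_sequence.intro[OF ai assms(8)])
  let ?Q = "\<lambda>n. noise n T"
  let ?M = "\<lambda>n. P n \<Otimes>\<^sub>M noise n T"
  define G where "G n = (\<lambda>(\<omega>, \<eta>). snd (explored n (u1 n) (f n) T (take_cols n n (W n \<omega>), decode_cols n T \<eta>)))" for n
  have Gm: "G n \<in> ?M n \<rightarrow>\<^sub>M normal_cols n T" and Glaw: "distr (?M n) (normal_cols n T) (G n) = normal_cols n T" if n: "n \<ge> 1" for n
    unfolding G_def by (rule amp_instance.explored_columns_law[OF ai[OF n] assms(2)[OF n] assms(3)[OF n]])+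
  \<comment> \<open>the columns of G mixed by the Cholesky factor; G reads W and the noise\<close>
  define Z' where "Z' n p = Z n (G n p)" for n p
  define E where "E n p = (\<lambda>i\<in>{1..n}. \<lambda>t\<in>{1..T}. z n (fst p) i t - Z' n p i t)" for n p
  have pM: "prob_space (?M n)" if n: "n \<ge> 1" for n
  proof -
    interpret P: prob_space "P n" by (rule assms(2)[OF n])
    interpret Q: prob_space "noise n T" by (rule prob_space_noise)
    interpret PQ: pair_prob_space "P n" "noise n T" by standard
    show ?thesis by (rule PQ.prob_space_axioms)
  qed
  have Zm: "Z n \<in> normal_cols n T \<rightarrow>\<^sub>M matrices n T" for n unfolding Z_def by (rule mix_measurable)
  have Z'm: "Z' n \<in> ?M n \<rightarrow>\<^sub>M matrices n T" if "n \<ge> 1" for n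
    unfolding Z'_def[abs_def] by (rule measurable_compose[OF Gm[OF that] Zm])
  have law: "has_gauss_law (?M n) n T (Z' n) (se_cov n (u1 n) (f n) T)" if n: "n \<ge> 1" for n
  proof -
    have "distr (?M n) (matrices n T) (Z' n) = distr (?M n) (matrices n T) (Z n \<circ> G n)"
      by (intro distr_cong) (auto simp: Z'_def)
    also have "\<dots> = distr (distr (?M n) (normal_cols n T) (G n)) (matrices n T) (Z n)"
      by (rule distr_distr[OF Zm Gm[OF n], symmetric])
    also have "\<dots> = distr (normal_cols n T) (matrices n T) (Z n)" unfolding Glaw[OF n] ..
    also have "\<dots> = gauss_rows n (se_cov n (u1 n) (f n) T)"
      unfolding Z_def using mix_has_gauss_law[OF se_cov_carrier LN[OF n]] by (simp add: has_gauss_law_def)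
    finally show ?thesis using Z'm[OF n] by (simp add: has_gauss_law_def)
  qed
  have Em: "E n \<in> ?M n \<rightarrow>\<^sub>M matrices n T" if n: "n \<ge> 1" for n
    unfolding E_def[abs_def]
  proof (rule measurable_matricesI)
    fix i t assume it: "i \<in> {1..n}" "t \<in> {1..T}"
    have "(\<lambda>\<omega>. z n \<omega> i t) \<in> borel_measurable (P n)"
      using amp_instance.amp_run_measurable[OF ai[OF n] assms(3)[OF n] assms(6)[OF n] it(2)] it(1) by blast
    then show "(\<lambda>p. z n (fst p) i t - Z' n p i t) \<in> borel_measurable (?M n)"
      by (intro borel_measurable_diff measurable_compose[OF measurable_fst] measurable_compose[OF Z'm[OF n] matrices_entry[OF it]])
  qed
  have nz: "whp ?M (\<lambda>n p. \<forall>s\<in>{1..T}. \<rho> n (G n p) s \<noteq> 0)"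
    by (rule whp_pullback[OF gaussian_iterates_close(2) Gm Glaw])
  have err: "outer_le ?M (\<lambda>n p. err t n (G n p)) 0" if "t \<in> {1..T}" for t
    by (rule outer_le_pullback[OF gaussian_iterates_close(1)[OF that] Gm Glaw])
  have "outer_le ?M (\<lambda>n p. sqrt \<bar>\<Sum>t=1..T. err t n (G n p) * err t n (G n p)\<bar>) 0"
    by (intro outer_le_sqrt outer_le_sum outer_le_mult_rate[OF err err]) auto
  then have "outer_le ?M (\<lambda>n p. frob_norm n T (E n p)) 0"
  proof (rule outer_le_whp_mono[OF nz])
    show "\<forall>\<^sub>F n in sequentially. \<forall>p\<in>space (?M n). (\<forall>s\<in>{1..T}. \<rho> n (G n p) s \<noteq> 0) \<longrightarrow>
       \<bar>frob_norm n T (E n p)\<bar> \<le> \<bar>sqrt \<bar>\<Sum>t=1..T. err t n (G n p) * err t n (G n p)\<bar>\<bar>"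
      using eventually_ge_at_top[of 1]
    proof (eventually_elim, intro ballI impI)
      fix n p assume n: "1 \<le> (n::nat)" and p: "p \<in> space (?M n)" and r: "\<forall>s\<in>{1..T}. \<rho> n (G n p) s \<noteq> 0"
      have \<omega>: "fst p \<in> space (P n)" using p by (auto simp: space_pair_measure)
      \<comment> \<open>where no residual vanishes the matrix has been eliminated from the iterates\<close>
      have zz: "z n (fst p) i t = zh n (G n p) i t" if it: "i \<in> {1..n}" "t \<in> {1..T}" for i t
        unfolding zh_def
      proof (rule amp_run_eq_gauss_amp[OF n _ is_amp_run_take_cols[OF assms(6)[OF n \<omega>]] _ _ it(2,1)])
        show "symmetric_on n (take_cols n n (W n (fst p)))"
          using assms(3)[OF n] \<omega> by (auto simp: symmetric_on_def take_cols_def is_GOE_def)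
        show "G n p = snd (explored n (u1 n) (f n) T (take_cols n n (W n (fst p)), decode_cols n T (snd p)))"
          by (simp add: G_def case_prod_unfold)
        fix s assume "s \<in> {1..T}"
        then show "dot n (resid n (iter_u n (u1 n) (f n) (gauss_amp n (u1 n) (f n) T (G n p))) s)
             (resid n (iter_u n (u1 n) (f n) (gauss_amp n (u1 n) (f n) T (G n p))) s) \<noteq> 0"
          using r by (auto simp: \<rho>_def Uh_def zh_def)
      qed
      have "(\<Sum>i=1..n. \<Sum>t=1..T. (E n p i t)\<^sup>2) = (\<Sum>t=1..T. \<Sum>i=1..n. (E n p i t)\<^sup>2)" by (rule sum.swap)
      also have "\<dots> = (\<Sum>t=1..T. err t n (G n p) * err t n (G n p))"
      proof (intro sum.cong refl)
        fix t assume t: "t \<in> {1..T}"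
        have "(\<Sum>i=1..n. (E n p i t)\<^sup>2) = (\<Sum>i=1..n. (zh n (G n p) i t - Z n (G n p) i t)\<^sup>2)"
          using t by (intro sum.cong refl) (simp add: E_def Z'_def zz)
        then show "(\<Sum>i=1..n. (E n p i t)\<^sup>2) = err t n (G n p) * err t n (G n p)"
          by (simp add: err_def L2_set_def sum_nonneg)
      qed
      finally have "frob_norm n T (E n p) = sqrt (\<Sum>t=1..T. err t n (G n p) * err t n (G n p))"
        by (simp add: frob_norm_def)
      then show "\<bar>frob_norm n T (E n p)\<bar> \<le> \<bar>sqrt \<bar>\<Sum>t=1..T. err t n (G n p) * err t n (G n p)\<bar>\<bar>"
        by (simp add: sum_nonneg)
    qed
  qed
  then have stoch: "stoch_le ?M (\<lambda>n p. frob_norm n T (E n p)) 0" by (rule stoch_le_of_outer_le[OF _ pM])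
  show ?thesis
  proof (rule exI[of _ ?Q], rule exI[of _ Z'], rule exI[of _ E], intro conjI allI impI ballI)
    fix n :: nat assume n: "n \<ge> 1"
    show "prob_space (noise n T)" by (rule prob_space_noise)
    show "has_gauss_law (?M n) n T (Z' n) (se_cov n (u1 n) (f n) T)" by (rule law[OF n])
    show "E n \<in> ?M n \<rightarrow>\<^sub>M matrices n T" by (rule Em[OF n])
    show "z n \<omega> i t = Z' n (\<omega>, \<eta>) i t + E n (\<omega>, \<eta>) i t" if "i \<in> {1..n}" "t \<in> {1..T}" for \<omega> \<eta> i t
      using that by (simp add: E_def)
  qed (rule stoch)
qed

end
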